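(* Let $\Omega\subset\mathbb{R}^n$ ($n\ge 2$) be a bounded open set, let $p>1$, and let $p^*$ be as in the context. Let $f=f(x,u,\xi):\Omega\times\mathbb{R}\times\mathbb{R}^n\to[0,+\infty)$ be a Carathéodory function, convex with respect to $\xi\in\mathbb{R}^n$ for a.e. $x\in\Omega$ and all $u\in\mathbb{R}$, with $D_\xi f$ a Carathéodory map, such that: (1) there are constants $M\ge m>1$ with $m\,f(x,u,\xi)\le f(x,u,2\xi)\le M\,f(x,u,\xi)$ for all $(x,u,\xi)\in\Omega\times\mathbb{R}\times\mathbb{R}^n$; (2) there is a constant $c_5>0$ with $f(x,u,\xi)\ge c_5|\xi|^p$ for a.e. $x\in\Omega$ and every $(u,\xi)\in\mathbb{R}\times\mathbb{R}^n$; (3) there is a constant $c_6>0$ with $f(x,v,\xi)\le c_6 f(x,u,\xi)$ for all $u,v\in\mathbb{R}$ with $|v|\le|u|$, for a.e. $x\in\Omega$ and all $\xi\in\mathbb{R}^n$; (4) $x\mapsto f(x,0,0)$ belongs to $L^1(\Omega)$. Let $s_1,s_3>\frac{p^*}{p^*-p}$ (which for $p<n$ means $s_1,s_3>\frac np$), let $\varepsilon_1>0$ and $\varepsilon\in(0,1)$ be such that the exponents $p^*-\varepsilon_1$, $1-\frac1{p^*}-\varepsilon$, $p(1-\frac1{p^*})-\varepsilon$ and $p^*-1-\varepsilon$ are nonnegative. Let $a=a(x,u,\xi):\Omega\times\mathbb{R}\times\mathbb{R}^n\to\mathbb{R}^n$ be a Carathéodory vector field such that, for some constants $c_1,c_3>0$,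 $c_2,c_4\ge0$ and nonnegative functions $b_1\in L^{s_1}(\Omega)$ and $b_2\in L^1(\Omega)$, for a.e. $x\in\Omega$ and every $(u,\xi)\in\mathbb{R}\times\mathbb{R}^n$, $$(a(x,u,\xi),\xi)\ge c_1(D_\xi f(x,u,\xi),\xi)-c_2|u|^{p^*-\varepsilon_1}-b_1(x),$$ $$(a(x,u,\xi),\xi)\le c_3(D_\xi f(x,u,\xi),\xi)+c_4|u|^{p^*}+b_2(x).$$ Let $b=b(x,u,\xi):\Omega\times\mathbb{R}\times\mathbb{R}^n\to\mathbb{R}$ be a Carathéodory function satisfying, for a.e. $x\in\Omega$ and every $(u,\xi)\in\mathbb{R}\times\mathbb{R}^n$, either (A) the pair of inequalities $$\operatorname{sign}(u)\,b(x,u,\xi)\ge -c_7\big(f(x,u,\xi)^{1-\frac1{p^*}-\varepsilon}+|\xi|^{p(1-\frac1{p^*})-\varepsilon}+|u|^{p^*-1-\varepsilon}\big)-b_3(x),$$ $$u\,b(x,u,\xi)\le c_8\big(f(x,u,\xi)+|u|^{p^*}\big)+b_4(x)$$ for some positive constants $c_7,c_8$ and nonnegative functions $b_3\in L^{s_3}(\Omega)$ and $b_4\in L^1(\Omega)$, or (B) the inequality $$|b(x,u,\xi)|\le c_9\big(f(x,u,\xi)^{1-\frac1{p^*}-\varepsilon}+|u|^{p^*-1-\varepsilon}\big)+b_3(x)$$ for some constant $c_9\ge0$ and a nonnegative function $b_3\in L^{s_3}(\Omega)$. Let $u_0\in L^\infty(\Omega)\cap W^{1,F}(\Omega)$ and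 let $u\in W^{1,F}(\Omega)$, $u\in u_0+W^{1,F}_0(\Omega)$, be a weak solution to the Dirichlet problem $$\sum_{i=1}^n\frac{\partial}{\partial x_i}a^i(x,u,Du)=b(x,u,Du)\ \text{ in }\Omega,\qquad u=u_0\ \text{ on }\partial\Omega.$$ Then $u$ is globally bounded, i.e. $u\in L^\infty(\Omega)$, and there exists $\gamma\ge1$ such that $$\|u\|_{L^\infty(\Omega)}\le c\,\big(1+\|u_0\|_{L^\infty(\Omega)}\big)\cdot\big(1+\|u\|_{L^{p^*}(\Omega)}\big)^{\gamma},$$ where the constant $c$ depends on the data (and on $\varepsilon,\varepsilon_1$) but is independent of $u$.
   Context: $(\cdot,\cdot)$ is the scalar product in $\mathbb{R}^n$. A Carathéodory map on $\Omega\times\mathbb{R}\times\mathbb{R}^n$ is measurable in $x\in\Omega$ and continuous in $(u,\xi)\in\mathbb{R}\times\mathbb{R}^n$. $D_\xi f=(f_{\xi_1},\dots,f_{\xi_n})$ is the gradient of $f$ in $\xi$. Sobolev exponent: $p^*=\frac{np}{n-p}$ if $p<n$; if $p\ge n$, $p^*$ is a fixed real number greater than $p$, which may be taken arbitrarily large. (For $p<n$ one has $p(1-\frac1{p^*})=p+\frac pn-1$ and $\frac{p^*}{p^*-p}=\frac np$.) Finite-energy class: $W^{1,F}(\Omega):=\{u\in W^{1,1}(\Omega): F(u):=\int_\Omega f(x,u,Du)\,dx<+\infty\}$ and $W^{1,F}_0(\Omega):=W^{1,F}(\Omega)\cap W^{1,p}_0(\Omega)$. The notation $u\in u_0+W_0^{1,F}(\Omega)$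 means $u-u_0\in W_0^{1,F}(\Omega)$. Weak solution: $u$ is a weak solution of the Dirichlet problem if $$\int_\Omega\Big\{\sum_{i=1}^n a^i(x,u,Du)\varphi_{x_i}+b(x,u,Du)\varphi\Big\}dx=0\qquad\forall\,\varphi\in W^{1,F}_0(\Omega).$$ "The data" are $n$, $p$, $p^*$, $\Omega$, the constants $m,M$ and $c_i$ and the exponents appearing in the assumptions, and the norms $\|b_1\|_{L^{s_1}(\Omega)}$, $\|b_3\|_{L^{s_3}(\Omega)}$. *)

theory Defs
  imports "HOL-Analysis.Analysis" "HOL-Probability.Essential_Supremum"
begin

section \<open>Powers, Lebesgue norms\<close>

text \<open>In the growth conditions exponents may vanish, and then the power is the constant \<open>1\<close>,
  also at base \<open>0\<close>; the library has \<open>0 powr 0 = 0\<close>.\<close>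

definition rpow :: "real \<Rightarrow> real \<Rightarrow> real" where
  "rpow t a = (if a = 0 then 1 else t powr a)"

text \<open>Functions on \<open>\<Omega>\<close> are total functions whose values outside \<open>\<Omega>\<close> are irrelevant, and all the
  spaces below are invariant under changes on null sets.\<close>

definition Lp_space :: "real \<Rightarrow> (real^'n) set \<Rightarrow> (real^'n \<Rightarrow> 'b::euclidean_space) set" where
  "Lp_space p \<Omega> = {u. u \<in> borel_measurable (lebesgue_on \<Omega>) \<and>
     integrable (lebesgue_on \<Omega>) (\<lambda>x. norm (u x) powr p)}"

definition Lp_norm :: "real \<Rightarrow> (real^'n) set \<Rightarrow> (real^'n \<Rightarrow> 'b::euclidean_space) \<Rightarrow> real" where
  "Lp_norm p \<Omega> u = (\<integral>x. norm (u x) powr p \<partial>lebesgue_on \<Omega>) powr (1 / p)"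

definition Linf_space :: "(real^'n) set \<Rightarrow> (real^'n \<Rightarrow> real) set" where
  "Linf_space \<Omega> = {u. u \<in> borel_measurable (lebesgue_on \<Omega>) \<and>
     esssup (lebesgue_on \<Omega>) (\<lambda>x. ennreal \<bar>u x\<bar>) < \<infinity>}"

definition Linf_norm :: "(real^'n) set \<Rightarrow> (real^'n \<Rightarrow> real) \<Rightarrow> real" where
  "Linf_norm \<Omega> u = enn2real (esssup (lebesgue_on \<Omega>) (\<lambda>x. ennreal \<bar>u x\<bar>))"

section \<open>Partial derivatives, test functions\<close>

definition partial :: "'n \<Rightarrow> (real^'n \<Rightarrow> real) \<Rightarrow> real^'n \<Rightarrow> real" where
  "partial i g x = deriv (\<lambda>t. g (x + t *\<^sub>R axis i 1)) 0"

definition grad :: "(real^'n \<Rightarrow> real) \<Rightarrow> real^'n \<Rightarrow> real^'n" where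
  "grad g x = (\<chi> i. partial i g x)"

definition has_partials :: "(real^'n \<Rightarrow> real) \<Rightarrow> real^'n \<Rightarrow> bool" where
  "has_partials g x \<longleftrightarrow> (\<forall>i. (\<lambda>t. g (x + t *\<^sub>R axis i 1)) differentiable (at 0))"

text \<open>\<open>C\<^sup>\<infinity>\<close>: every iterated partial derivative is differentiable everywhere.\<close>

definition smooth :: "(real^'n \<Rightarrow> real) \<Rightarrow> bool" where
  "smooth \<phi> \<longleftrightarrow> (\<forall>is. foldr partial is \<phi> differentiable_on UNIV)"

definition test_functions :: "(real^'n) set \<Rightarrow> (real^'n \<Rightarrow> real) set" where
  "test_functions \<Omega> = {\<phi>. smooth \<phi> \<and> compact (closure {x. \<phi> x \<noteq> 0}) \<and> closure {x. \<phi> x \<noteq> 0} \<subseteq> \<Omega>}"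

section \<open>Sobolev spaces\<close>

definition is_weak_grad :: "(real^'n) set \<Rightarrow> (real^'n \<Rightarrow> real) \<Rightarrow> (real^'n \<Rightarrow> real^'n) \<Rightarrow> bool" where
  "is_weak_grad \<Omega> u v \<longleftrightarrow>
     (\<forall>K. compact K \<and> K \<subseteq> \<Omega> \<longrightarrow> u absolutely_integrable_on K \<and> v absolutely_integrable_on K) \<and>
     (\<forall>\<phi>\<in>test_functions \<Omega>. \<forall>i.
        (\<integral>x. u x * partial i \<phi> x \<partial>lebesgue_on \<Omega>) = - (\<integral>x. v x $ i * \<phi> x \<partial>lebesgue_on \<Omega>))"

text \<open>The weak gradient is unique up to null sets; one representative is chosen.\<close>

definition weak_grad :: "(real^'n) set \<Rightarrow> (real^'n \<Rightarrow> real) \<Rightarrow> real^'n \<Rightarrow> real^'n" where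
  "weak_grad \<Omega> u = (SOME v. is_weak_grad \<Omega> u v)"

definition W1p :: "real \<Rightarrow> (real^'n) set \<Rightarrow> (real^'n \<Rightarrow> real) set" where
  "W1p p \<Omega> = {u \<in> Lp_space p \<Omega>. \<exists>v \<in> Lp_space p \<Omega>. is_weak_grad \<Omega> u v}"

definition W1p_norm :: "real \<Rightarrow> (real^'n) set \<Rightarrow> (real^'n \<Rightarrow> real) \<Rightarrow> real" where
  "W1p_norm p \<Omega> u = Lp_norm p \<Omega> u + Lp_norm p \<Omega> (weak_grad \<Omega> u)"

text \<open>The closure of the test functions in \<open>W\<^sup>1\<^sup>,\<^sup>p\<close>.\<close>

definition W1p_0 :: "real \<Rightarrow> (real^'n) set \<Rightarrow> (real^'n \<Rightarrow> real) set" where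
  "W1p_0 p \<Omega> = {u \<in> W1p p \<Omega>. \<exists>\<phi>. (\<forall>k::nat. \<phi> k \<in> test_functions \<Omega>) \<and>
     (\<lambda>k. W1p_norm p \<Omega> (\<lambda>x. u x - \<phi> k x)) \<longlonglongrightarrow> 0}"

definition sobolev_exponent :: "nat \<Rightarrow> real \<Rightarrow> real \<Rightarrow> bool" where
  "sobolev_exponent n p ps \<longleftrightarrow>
     (if p < real n then ps = real n * p / (real n - p) else p < ps)"

section \<open>Energy functional and weak solutions\<close>

definition caratheodory ::
  "(real^'n) set \<Rightarrow> (real^'n \<Rightarrow> real \<Rightarrow> real^'n \<Rightarrow> 'b::euclidean_space) \<Rightarrow> bool" where
  "caratheodory \<Omega> g \<longleftrightarrow>
     (\<forall>u \<xi>. (\<lambda>x. g x u \<xi>) \<in> borel_measurable (lebesgue_on \<Omega>)) \<and>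
     (\<forall>x\<in>\<Omega>. continuous_on UNIV (\<lambda>(u, \<xi>). g x u \<xi>))"

definition D_xi :: "(real^'n \<Rightarrow> real \<Rightarrow> real^'n \<Rightarrow> real) \<Rightarrow> real^'n \<Rightarrow> real \<Rightarrow> real^'n \<Rightarrow> real^'n" where
  "D_xi f x u \<xi> = grad (f x u) \<xi>"

definition energy ::
  "(real^'n) set \<Rightarrow> (real^'n \<Rightarrow> real \<Rightarrow> real^'n \<Rightarrow> real) \<Rightarrow> (real^'n \<Rightarrow> real) \<Rightarrow> ennreal" where
  "energy \<Omega> f u = (\<integral>\<^sup>+x. ennreal (f x (u x) (weak_grad \<Omega> u x)) \<partial>lebesgue_on \<Omega>)"

definition W1F ::
  "(real^'n) set \<Rightarrow> (real^'n \<Rightarrow> real \<Rightarrow> real^'n \<Rightarrow> real) \<Rightarrow> (real^'n \<Rightarrow> real) set" where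
  "W1F \<Omega> f = {u \<in> W1p 1 \<Omega>. energy \<Omega> f u < \<infinity>}"

definition W1F_0 ::
  "real \<Rightarrow> (real^'n) set \<Rightarrow> (real^'n \<Rightarrow> real \<Rightarrow> real^'n \<Rightarrow> real) \<Rightarrow> (real^'n \<Rightarrow> real) set" where
  "W1F_0 p \<Omega> f = W1F \<Omega> f \<inter> W1p_0 p \<Omega>"

text \<open>Integrability is required explicitly because the Bochner integral of a non-integrable
  function is \<open>0\<close> by convention.\<close>

definition weak_solution ::
  "real \<Rightarrow> (real^'n) set \<Rightarrow> (real^'n \<Rightarrow> real \<Rightarrow> real^'n \<Rightarrow> real) \<Rightarrow>
   (real^'n \<Rightarrow> real \<Rightarrow> real^'n \<Rightarrow> real^'n) \<Rightarrow> (real^'n \<Rightarrow> real \<Rightarrow> real^'n \<Rightarrow> real) \<Rightarrow>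
   (real^'n \<Rightarrow> real) \<Rightarrow> bool" where
  "weak_solution p \<Omega> f a b u \<longleftrightarrow>
     (\<forall>\<phi>\<in>W1F_0 p \<Omega> f.
        let I = (\<lambda>x. (\<Sum>i\<in>UNIV. a x (u x) (weak_grad \<Omega> u x) $ i * weak_grad \<Omega> \<phi> x $ i)
                   + b x (u x) (weak_grad \<Omega> u x) * \<phi> x)
        in integrable (lebesgue_on \<Omega>) I \<and> (\<integral>x. I x \<partial>lebesgue_on \<Omega>) = 0)"

end

theory Submission
  imports Defs
begin

text \<open>The bound comes from a De Giorgi iteration on the level sets of \<open>u\<close> and of \<open>-u\<close>, carried out
  entirely with exponents strictly below \<open>p*\<close>.

  Fix \<open>\<sigma> \<in> {1, -1}\<close> and a level \<open>k \<ge> 1 + \<parallel>u0\<parallel>\<^sub>\<infinity>\<close>. The function \<open>\<psi> = \<sigma> max (\<sigma> u - k) 0\<close> is an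
  admissible test function (\<open>truncation_admissible\<close>): it has zero boundary values because
  \<open>\<sigma> u0 \<le> k\<close>, and finite energy because \<open>\<bar>\<psi>\<bar> \<le> \<bar>u\<bar>\<close> and \<open>f\<close> is almost monotone in \<open>\<bar>u\<bar>\<close>. The outer factor
  \<open>\<sigma>\<close> makes the gradient of \<open>\<psi>\<close> equal to \<open>Du\<close> on \<open>{\<sigma> u > k}\<close> for both signs; without it the
  energy of \<open>\<psi>\<close> would involve \<open>f\<close> at \<open>-Du\<close>, and \<open>f\<close> need not be even in \<open>\<xi>\<close>. Doubling at
  \<open>\<xi> = 0\<close> with \<open>m > 1\<close> forces \<open>f(x,u,0) = 0\<close>, so convexity gives \<open>D\<^sub>\<xi>f \<cdot> \<xi> \<ge> f\<close>
  (\<open>convex_grad_inner_ge\<close>). The lower bounds on \<open>a\<close> and on \<open>\<sigma> b\<close>, the latter a consequence of either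
  alternative for \<open>b\<close>, contain only subcritical powers, and Young's inequality absorbs the powers
  of \<open>f\<close> and of \<open>\<bar>Du\<bar>\<close> (\<open>pointwise_energy\<close>). Testing the equation with \<open>\<psi>\<close> therefore yields
  the Caccioppoli inequality
  \<open>\<integral>\<^bsub>{\<sigma>u>k}\<^esub> \<bar>Du\<bar>\<^sup>p \<le> C \<integral>\<^bsub>{\<sigma>u>k}\<^esub> (\<sigma>u)\<^sup>\<tau> + h \<sigma>u\<close> with \<open>h = \<bar>b1\<bar> + \<bar>b3\<bar> \<in> L\<^sup>s\<close>, \<open>s = min s1 s3\<close>
  and some \<open>\<tau> < p*\<close> (\<open>caccioppoli\<close>).

  The hypothesis \<open>s > p*/(p* - p)\<close> says \<open>p s/(s - 1) < p*\<close>, so there is a \<open>q < p*\<close> above both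
  \<open>\<tau>\<close> and \<open>p s/(s - 1)\<close>. By the Sobolev inequality with exponent \<open>q\<close> (\<open>sobolev_W1p_0\<close>) the
  integral of \<open>max (\<sigma>u - k) 0\<close> to the power \<open>q\<close> is at most a constant times the power \<open>q/p\<close> of the
  right-hand side above. Hoelder's inequality bounds that right-hand side by a power of the same
  integral at a lower level, and the choice of \<open>q\<close> makes the resulting exponent exceed \<open>1\<close>, so
  the integrals along the levels \<open>L (2 - 2\<^sup>-\<^sup>j)\<close> decay geometrically once \<open>L\<close> is a large enough
  multiple of \<open>(1 + \<parallel>u0\<parallel>\<^sub>\<infinity>) (1 + \<integral>\<bar>u\<bar>\<^sup>q)\<^sup>\<gamma>\<close>. Hence \<open>\<sigma>u \<le> 2L\<close> (\<open>de_giorgi\<close>).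

  Since \<open>u - u0\<close> lies in \<open>W1p_0\<close>, Sobolev's inequality gives \<open>\<integral>\<bar>u\<bar>\<^sup>q < \<infinity>\<close>, and so \<open>u\<close> is bounded.
  In particular \<open>u \<in> L\<^sup>p\<^sup>*\<close>, and now \<open>\<integral>\<bar>u\<bar>\<^sup>q\<close> is controlled by the norm in \<open>L\<^sup>p\<^sup>*\<close>, which turns
  the bound into the asserted one.

  The tools from Sobolev space theory are built from mollification: uniqueness of weak
  gradients, the chain rule, the gradient of a positive part, approximation in \<open>W1p_0\<close>. The
  Sobolev inequality with an exponent strictly below the critical one has a short proof by
  averaging the fundamental theorem of calculus over directions (\<open>sobolev_test_functions\<close>).\<close>

section \<open>Smooth functions and their gradients\<close>

text \<open>A coinduction principle: a family of differentiable functions that is closed under partial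
  derivatives consists of smooth functions.\<close>

lemma smoothI:
  assumes "\<phi> \<in> S" and "\<And>g. g \<in> S \<Longrightarrow> g differentiable_on UNIV"
    and "\<And>g i. g \<in> S \<Longrightarrow> partial i g \<in> S"
  shows "smooth \<phi>"
proof -
  have "foldr partial is \<phi> \<in> S" for "is"
    by (induction "is") (use assms in auto)
  then show ?thesis
    using assms(2) by (auto simp: smooth_def)
qed

lemma smooth_imp_differentiable: "smooth \<phi> \<Longrightarrow> \<phi> differentiable_on UNIV"
  unfolding smooth_def by (metis foldr.simps(1) id_apply)

lemma smooth_partial:
  assumes "smooth \<phi>" shows "smooth (partial i \<phi>)"
  unfolding smooth_def
proof
  fix "is"
  have "foldr partial (is @ [i]) \<phi> differentiable_on UNIV"
    using assms unfolding smooth_def by blast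
  then show "foldr partial is (partial i \<phi>) differentiable_on UNIV"
    by simp
qed

lemma smooth_continuous_on: "smooth \<phi> \<Longrightarrow> continuous_on S \<phi>"
  by (meson continuous_on_subset differentiable_imp_continuous_on smooth_imp_differentiable top_greatest)

lemma has_derivative_along_axis:
  fixes g :: "real^'n \<Rightarrow> real"
  assumes "(g has_derivative g') (at x)"
  shows "((\<lambda>t. g (x + t *\<^sub>R axis i 1)) has_real_derivative g' (axis i 1)) (at 0)"
proof -
  have "(g has_derivative g') (at (x + 0 *\<^sub>R axis i 1))"
    using assms by simp
  then have "((\<lambda>t::real. g (x + t *\<^sub>R axis i 1)) has_derivative (\<lambda>t. g' (t *\<^sub>R axis i 1))) (at 0)"
    by (rule has_derivative_compose[rotated]) (auto intro!: derivative_eq_intros)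
  moreover have "g' (t *\<^sub>R axis i 1) = g' (axis i 1) * t" for t
    using assms has_derivative_bounded_linear[THEN bounded_linear.linear] linear_scale
    by (metis mult.commute real_scaleR_def)
  ultimately show ?thesis
    by (simp add: has_field_derivative_def)
qed

lemma partial_eq_derivative:
  fixes g :: "real^'n \<Rightarrow> real"
  assumes "(g has_derivative g') (at x)"
  shows "partial i g x = g' (axis i 1)"
  unfolding partial_def using has_derivative_along_axis[OF assms] by (rule DERIV_imp_deriv)

lemma linear_eq_sum_axis:
  fixes f :: "real^'n \<Rightarrow> real"
  assumes "linear f" shows "f h = (\<Sum>i\<in>UNIV. h $ i * f (axis i 1))"
proof -
  have "f h = f (\<Sum>i\<in>UNIV. h $ i *\<^sub>R axis i 1)"
    by (simp add: basis_expansion flip: scalar_mult_eq_scaleR)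
  then show ?thesis
    using assms by (simp add: linear_sum linear_scale)
qed

text \<open>The gradient is defined through one-dimensional derivatives along the axes; for a
  differentiable function it represents the total derivative.\<close>

lemma differentiable_has_grad:
  fixes g :: "real^'n \<Rightarrow> real"
  assumes "g differentiable (at x)"
  shows "(g has_derivative (\<lambda>h. grad g x \<bullet> h)) (at x)"
proof -
  obtain g' where g': "(g has_derivative g') (at x)"
    using assms differentiable_def by blast
  then have "linear g'"
    using has_derivative_linear by blast
  then have "g' h = grad g x \<bullet> h" for h
    using linear_eq_sum_axis[of g' h] partial_eq_derivative[OF g']
    by (simp add: inner_vec_def grad_def mult.commute)
  then have "g' = (\<lambda>h. grad g x \<bullet> h)" by auto
  with g' show ?thesis by simp
qed

lemma smooth_has_grad:
  fixes g :: "real^'n \<Rightarrow> real"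
  shows "smooth g \<Longrightarrow> (g has_derivative (\<lambda>h. grad g x \<bullet> h)) (at x)"
  using smooth_imp_differentiable[of g] by (auto simp: differentiable_on_def intro: differentiable_has_grad)

lemma grad_nth [simp]: "grad g x $ i = partial i g x"
  by (simp add: grad_def)

lemma smooth_continuous_grad: "smooth g \<Longrightarrow> continuous_on S (grad g)"
  unfolding grad_def by (intro continuous_on_vec_lambda smooth_continuous_on smooth_partial)

lemma partial_zero_outside_support:
  assumes "open U" "\<And>y. y \<in> U \<Longrightarrow> g y = 0" "x \<in> U"
  shows "partial i g x = 0"
proof -
  have "(g has_derivative (\<lambda>h. 0)) (at x)"
    by (rule has_derivative_transform_within_open[OF _ assms(1,3)]) (auto simp: assms(2))
  from partial_eq_derivative[OF this] show ?thesis .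
qed

section \<open>A smooth bump\<close>

text \<open>The functions \<open>exp (-1/t) / t\<^sup>m\<close>, extended by \<open>0\<close> to \<open>t \<le> 0\<close>. The parameter \<open>m\<close> makes the
  family closed under derivatives up to linear combinations, so that smoothness of the bump
  needs no formula for higher derivatives.\<close>

definition flat_exp :: "nat \<Rightarrow> real \<Rightarrow> real" where
  "flat_exp m t = (if t > 0 then exp (- 1 / t) / t ^ m else 0)"

text \<open>One term of the exponential series, of order \<open>m + 2\<close>, beats \<open>1/t\<^sup>m\<close> and leaves a factor
  \<open>t\<^sup>2\<close>; this is what differentiability at \<open>0\<close> needs.\<close>

lemma flat_exp_le: "\<bar>flat_exp m t\<bar> \<le> fact (m + 2) * t\<^sup>2"
proof (cases "t > 0")
  case True
  have "(1 / t) ^ (m + 2) / fact (m + 2) \<le> exp (1 / t)"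
  proof -
    have "(\<Sum>k\<in>{m+2}. (1 / t) ^ k /\<^sub>R fact k) \<le> (\<Sum>k. (1 / t) ^ k /\<^sub>R fact k)"
      using True by (intro sum_le_suminf summable_exp_generic) auto
    then show ?thesis
      by (simp add: exp_def field_simps)
  qed
  then have "exp (- (1 / t)) \<le> fact (m + 2) * t ^ (m + 2)"
    using True by (simp add: exp_minus divide_simps del: fact_Suc power_Suc add_2_eq_Suc' power_add)
      (simp add: mult_ac del: fact_Suc power_Suc add_2_eq_Suc')
  then have "exp (- (1 / t)) / t ^ m \<le> fact (m + 2) * t ^ (m + 2) / t ^ m"
    using True by (intro divide_right_mono) auto
  then show ?thesis
    using True by (simp add: flat_exp_def power_add power2_eq_square)
qed (simp add: flat_exp_def)

lemma flat_exp_has_derivative: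
  "(flat_exp m has_real_derivative (flat_exp (m + 2) t - m * flat_exp (m + 1) t)) (at t)"
proof -
  consider "t > 0" | "t < 0" | "t = 0" by linarith
  then show ?thesis
  proof cases
    case 1
    have "((\<lambda>t. exp (- 1 / t) / t ^ m) has_real_derivative (flat_exp (m + 2) t - m * flat_exp (m + 1) t)) (at t)"
    proof -
      have E: "((\<lambda>t. exp (- 1 / t)) has_real_derivative exp (- 1 / t) / t\<^sup>2) (at t)"
        using 1 by (auto intro!: derivative_eq_intros simp: power2_eq_square)
      have "(exp (- 1 / t) / t\<^sup>2 * t ^ m - exp (- 1 / t) * (real m * t ^ (m - Suc 0))) / (t ^ m * t ^ m)
          = exp (- 1 / t) / t ^ (m + 2) - m * (exp (- 1 / t) / t ^ (m + 1))"
      proof (cases m)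
        case (Suc k)
        have *: "(E / (t * t) * (t * p) - E * (r * p)) / ((t * p) * (t * p)) = E / (t * t * t * p) - r * (E / (t * t * p))"
          if "t \<noteq> 0" "p \<noteq> 0" for E p r t :: real
        proof -
          have 1: "E / (t * t) * (t * p) / ((t * p) * (t * p)) = E / (t * t * t * p)"
            using that by (simp add: mult.assoc)
          have 2: "E * (r * p) / ((t * p) * (t * p)) = r * (E / (t * t * p))"
            using that by (simp add: mult.assoc mult.left_commute)
          show ?thesis unfolding diff_divide_distrib 1 2 ..
        qed
        have e: "t ^ m = t * t ^ k" "t ^ (m + 2) = t * t * t * t ^ k" "t ^ (m + 1) = t * t * t ^ k" "t ^ (m - Suc 0) = t ^ k"
          by (simp_all add: Suc)
        show ?thesis
          unfolding e power2_eq_square by (rule *) (use 1 in auto)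
      next
        case 0
        show ?thesis unfolding 0 power2_eq_square by simp
      qed
      then show ?thesis
        using DERIV_divide[OF E DERIV_pow[of m t]] 1 by (simp add: flat_exp_def)
    qed
    then show ?thesis
      by (rule has_field_derivative_transform_within_open[where S="{0<..}"])
         (use 1 in \<open>auto simp: flat_exp_def\<close>)
  next
    case 2
    have "((\<lambda>t. 0) has_real_derivative 0) (at t)" by simp
    then have "(flat_exp m has_real_derivative 0) (at t)"
      by (rule has_field_derivative_transform_within_open[where S="{..<0}"])
         (use 2 in \<open>auto simp: flat_exp_def\<close>)
    then show ?thesis
      using 2 by (simp add: flat_exp_def)
  next
    case 3
    have "((\<lambda>h. flat_exp m h / h) \<longlongrightarrow> 0) (at 0)"
    proof (rule tendsto_0_le[where f="\<lambda>h. h" and K="fact (m + 2)"])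
      show "\<forall>\<^sub>F h in at 0. norm (flat_exp m h / h) \<le> norm h * fact (m + 2)"
      proof (rule always_eventually, rule allI)
        fix h :: real
        have "\<bar>flat_exp m h\<bar> / \<bar>h\<bar> \<le> fact (m + 2) * \<bar>h\<bar>" if "h \<noteq> 0"
          using flat_exp_le[of m h] that
          by (simp add: pos_divide_le_eq mult.assoc power2_eq_square del: fact_Suc add_2_eq_Suc')
        then show "norm (flat_exp m h / h) \<le> norm h * fact (m + 2)"
          by (cases "h = 0") (auto simp: mult.commute)
      qed
    qed (rule tendsto_ident_at)
    then show ?thesis
      using 3 by (simp add: has_field_derivative_iff flat_exp_def)
  qed
qed

text \<open>The closure of the functions \<open>flat_exp m (r - \<bar>x\<bar>\<^sup>2)\<close> under the operations that
  differentiation produces.\<close>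

inductive_set bump_family :: "real \<Rightarrow> (real^'n \<Rightarrow> real) set" for r where
  base: "(\<lambda>x. flat_exp m (r - x \<bullet> x)) \<in> bump_family r"
| coord: "g \<in> bump_family r \<Longrightarrow> (\<lambda>x. x $ j * g x) \<in> bump_family r"
| add: "g \<in> bump_family r \<Longrightarrow> h \<in> bump_family r \<Longrightarrow> (\<lambda>x. g x + h x) \<in> bump_family r"
| scale: "g \<in> bump_family r \<Longrightarrow> (\<lambda>x. c * g x) \<in> bump_family r"

lemma bump_family_derivative:
  assumes "(g :: real^'n \<Rightarrow> real) \<in> bump_family r"
  shows "\<exists>G. (\<forall>x. (g has_derivative G x) (at x)) \<and> (\<forall>i. (\<lambda>x. G x (axis i 1)) \<in> bump_family r)"
  using assms
proof induction
  case (base m)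
  let ?D = "\<lambda>x::real^'n. flat_exp (m + 2) (r - x \<bullet> x) - m * flat_exp (m + 1) (r - x \<bullet> x)"
  have "((\<lambda>x::real^'n. flat_exp m (r - x \<bullet> x)) has_derivative (\<lambda>h. ?D x * (- 2 * (x \<bullet> h)))) (at x)" for x
  proof -
    have 1: "((\<lambda>x::real^'n. r - x \<bullet> x) has_derivative (\<lambda>h. - 2 * (x \<bullet> h))) (at x)"
      by (auto intro!: derivative_eq_intros simp: inner_commute)
    show ?thesis
      using has_derivative_compose[OF 1 flat_exp_has_derivative[of m "r - x \<bullet> x", unfolded has_field_derivative_def]]
      by simp
  qed
  moreover have "(\<lambda>x::real^'n. ?D x * (- 2 * (x \<bullet> axis i 1))) \<in> bump_family r" for i
  proof -
    have "(\<lambda>x::real^'n. x $ i * ((- 2) * (flat_exp (m + 2) (r - x \<bullet> x) + (- real m) * flat_exp (m + 1) (r - x \<bullet> x)))) \<in> bump_family r"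
      by (intro bump_family.intros)
    then show ?thesis
      by (simp add: inner_axis algebra_simps)
  qed
  ultimately show ?case by - (rule exI[of _ "\<lambda>x h. ?D x * (- 2 * (x \<bullet> h))"], blast)
next
  case (coord g j)
  then obtain G where G: "\<And>x. (g has_derivative G x) (at x)" "\<And>i. (\<lambda>x. G x (axis i 1)) \<in> bump_family r"
    by blast
  have "((\<lambda>x::real^'n. x $ j * g x) has_derivative (\<lambda>h. x $ j * G x h + h $ j * g x)) (at x)" for x
    by (rule derivative_eq_intros G bounded_linear_imp_has_derivative bounded_linear_vec_nth)+ auto
  moreover have "(\<lambda>x::real^'n. x $ j * G x (axis i 1) + axis i 1 $ j * g x) \<in> bump_family r" for i
    using G(2) coord(1) by (intro bump_family.intros)
  ultimately show ?case by (intro exI[of _ "\<lambda>x h. x $ j * G x h + h $ j * g x"]) auto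
next
  case (add g h)
  then obtain G H where G: "\<And>x. (g has_derivative G x) (at x)" "\<And>i. (\<lambda>x. G x (axis i 1)) \<in> bump_family r"
    and H: "\<And>x. (h has_derivative H x) (at x)" "\<And>i. (\<lambda>x. H x (axis i 1)) \<in> bump_family r"
    by blast
  show ?case
    by (rule exI[of _ "\<lambda>x k. G x k + H x k"])
       (auto intro!: has_derivative_add bump_family.intros G H)
next
  case (scale g c)
  then obtain G where G: "\<And>x. (g has_derivative G x) (at x)" "\<And>i. (\<lambda>x. G x (axis i 1)) \<in> bump_family r"
    by blast
  show ?case
    by (rule exI[of _ "\<lambda>x k. c * G x k"])
       (auto intro!: has_derivative_mult_right bump_family.intros G)
qed

lemma smooth_bump_family:
  assumes "(g :: real^'n \<Rightarrow> real) \<in> bump_family r" shows "smooth g"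
proof (rule smoothI[OF assms])
  fix g :: "real^'n \<Rightarrow> real" assume "g \<in> bump_family r"
  then obtain G where G: "\<And>x. (g has_derivative G x) (at x)" "\<And>i. (\<lambda>x. G x (axis i 1)) \<in> bump_family r"
    using bump_family_derivative by blast
  show "g differentiable_on UNIV"
    using G(1) by (auto simp: differentiable_on_def differentiable_def)
  show "partial i g \<in> bump_family r" for i
  proof -
    have "partial i g = (\<lambda>x. G x (axis i 1))"
      using partial_eq_derivative[OF G(1), of i] by auto
    then show ?thesis using G(2)[of i] by simp
  qed
qed

definition bump :: "real \<Rightarrow> real^'n \<Rightarrow> real" where
  "bump \<delta> x = flat_exp 0 (\<delta>\<^sup>2 - x \<bullet> x)"

text \<open>Here \<open>\<delta>\<close> is the radius of the support. The profile is not rescaled with \<open>\<delta>\<close>: only the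
  support, the sign and the total mass \<open>1\<close> matter.\<close>

definition mollifier :: "real \<Rightarrow> real^'n \<Rightarrow> real" where
  "mollifier \<delta> x = bump \<delta> x / (\<integral>y. bump \<delta> (y::real^'n) \<partial>lborel)"

lemma bump_nonneg: "0 \<le> bump \<delta> x"
  by (simp add: bump_def flat_exp_def)

lemma bump_zero:
  assumes "\<delta> > 0" "norm x \<ge> \<delta>" shows "bump \<delta> x = 0"
proof -
  have "\<delta>\<^sup>2 \<le> x \<bullet> x"
    using assms by (simp add: dot_square_norm power_mono)
  then show ?thesis by (simp add: bump_def flat_exp_def)
qed

lemma smooth_bump: "smooth (bump \<delta> :: real^'n \<Rightarrow> real)"
  using smooth_bump_family[OF bump_family.base[of 0 "\<delta>\<^sup>2"]] by (simp add: bump_def[abs_def])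

lemma integrable_continuous_bounded_support:
  fixes f :: "'a::euclidean_space \<Rightarrow> 'b::euclidean_space"
  assumes "continuous_on UNIV f" "\<And>x. norm x > R \<Longrightarrow> f x = 0"
  shows "integrable lborel f"
proof -
  have "integrable lborel (\<lambda>x. indicator (cball 0 R) x *\<^sub>R f x)"
    by (rule borel_integrable_compact) (auto intro: continuous_on_subset assms)
  moreover have "indicator (cball 0 R) x *\<^sub>R f x = f x" for x
    using assms(2)[of x] by (auto simp: indicator_def)
  ultimately show ?thesis by simp
qed

lemma integrable_bump: assumes "\<delta> > 0" shows "integrable lborel (bump \<delta> :: real^'n \<Rightarrow> real)"
  by (rule integrable_continuous_bounded_support[where R=\<delta>])
     (use assms in \<open>auto intro: smooth_continuous_on smooth_bump bump_zero\<close>)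

lemma integral_bump_pos:
  assumes "\<delta> > 0" shows "(\<integral>y. bump \<delta> (y::real^'n) \<partial>lborel) > 0"
proof -
  have "(\<integral>y. bump \<delta> (y::real^'n) \<partial>lborel) \<noteq> 0"
  proof
    assume "(\<integral>y. bump \<delta> (y::real^'n) \<partial>lborel) = 0"
    then have "AE x in lborel. bump \<delta> (x::real^'n) = 0"
      using integral_nonneg_eq_0_iff_AE[OF integrable_bump[OF assms]] bump_nonneg by auto
    moreover have "\<forall>x\<in>ball 0 \<delta>. bump \<delta> (x::real^'n) \<noteq> 0"
    proof
      fix x :: "real^'n" assume "x \<in> ball 0 \<delta>"
      then have "norm x < \<delta>" by simp
      then have "x \<bullet> x < \<delta>\<^sup>2"
        by (metis dot_square_norm norm_ge_zero power_strict_mono zero_less_numeral)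
      then show "bump \<delta> x \<noteq> 0" by (simp add: bump_def flat_exp_def)
    qed
    ultimately have "AE x in lborel. (x::real^'n) \<notin> ball 0 \<delta>"
      by (auto elim!: eventually_mono)
    then have "ball (0::real^'n) \<delta> \<in> null_sets lborel"
      by (subst AE_iff_null_sets) auto
    then have "negligible (ball (0::real^'n) \<delta>)"
      by (simp add: negligible_iff_null_sets null_sets_completionI)
    then show False
      using assms open_not_negligible[of "ball (0::real^'n) \<delta>"] by auto
  qed
  moreover have "(\<integral>y. bump \<delta> (y::real^'n) \<partial>lborel) \<ge> 0"
    by (simp add: bump_nonneg)
  ultimately show ?thesis by linarith
qed

lemma mollifier_nonneg: "0 \<le> mollifier \<delta> x"
  by (simp add: mollifier_def bump_nonneg)

lemma mollifier_zero: "\<delta> > 0 \<Longrightarrow> norm x \<ge> \<delta> \<Longrightarrow> mollifier \<delta> x = 0"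
  by (simp add: mollifier_def bump_zero)

lemma smooth_mollifier: "smooth (mollifier \<delta> :: real^'n \<Rightarrow> real)"
proof -
  let ?c = "1 / (\<integral>y. bump \<delta> (y::real^'n) \<partial>lborel)"
  have "(\<lambda>x::real^'n. ?c * flat_exp 0 (\<delta>\<^sup>2 - x \<bullet> x)) \<in> bump_family (\<delta>\<^sup>2)"
    by (intro bump_family.intros)
  from smooth_bump_family[OF this] show ?thesis
    by (simp add: mollifier_def[abs_def] bump_def[abs_def])
qed

lemma integrable_mollifier: "\<delta> > 0 \<Longrightarrow> integrable lborel (mollifier \<delta> :: real^'n \<Rightarrow> real)"
  unfolding mollifier_def[abs_def] by (intro integrable_divide_zero) (auto intro: integrable_bump)

lemma integral_mollifier: "\<delta> > 0 \<Longrightarrow> (\<integral>x. mollifier \<delta> (x::real^'n) \<partial>lborel) = 1"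
  unfolding mollifier_def[abs_def] using integral_bump_pos[of \<delta>, where 'n='n] by simp

section \<open>Convolution with a smooth kernel\<close>

lemma borel_measurable_lebesgueI: "f \<in> borel_measurable borel \<Longrightarrow> f \<in> borel_measurable lebesgue"
  by (simp add: measurable_completion)

lemma continuous_imp_measurable_lebesgue: "continuous_on UNIV f \<Longrightarrow> f \<in> borel_measurable lebesgue"
  by (intro borel_measurable_lebesgueI borel_measurable_continuous_onI)

lemma integrable_bounded_mult:
  fixes f g :: "'a \<Rightarrow> real"
  assumes "integrable M f" "g \<in> borel_measurable M" "\<And>x. \<bar>g x\<bar> \<le> B"
  shows "integrable M (\<lambda>x. g x * f x)"
proof (rule Bochner_Integration.integrable_bound)
  show "integrable M (\<lambda>x. B * f x)" using assms by simp
  show "AE x in M. norm (g x * f x) \<le> norm (B * f x)"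
    using assms(3) by (auto simp: abs_mult intro!: mult_right_mono AE_I2 order_trans[OF assms(3) abs_ge_self])
qed (use assms in auto)

lemma bounded_support_bounded:
  fixes g :: "'a::euclidean_space \<Rightarrow> 'b::real_normed_vector"
  assumes "continuous_on UNIV g" "\<And>x. norm x > R \<Longrightarrow> g x = 0"
  obtains B where "0 \<le> B" "\<And>x. norm (g x) \<le> B"
proof -
  have "compact (g ` cball 0 R)"
    by (intro compact_continuous_image continuous_on_subset[OF assms(1)]) auto
  then obtain B where B: "\<And>x. x \<in> cball 0 R \<Longrightarrow> norm (g x) \<le> B"
    using compact_imp_bounded[of "g ` cball 0 R"] unfolding bounded_iff by blast
  have "norm (g x) \<le> max 0 B" for x
    using B[of x] assms(2)[of x] by (cases "norm x > R") (auto simp: le_max_iff_disj)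
  then show ?thesis by (intro that[of "max 0 B"]) auto
qed

lemma bounded_support_uniformly_continuous:
  fixes g :: "'a::euclidean_space \<Rightarrow> 'b::real_normed_vector"
  assumes "continuous_on UNIV g" "\<And>x. norm x > R \<Longrightarrow> g x = 0"
  shows "uniformly_continuous_on UNIV g"
  unfolding uniformly_continuous_on_def
proof (intro allI impI)
  fix e :: real assume "e > 0"
  have "uniformly_continuous_on (cball 0 (R + 1)) g"
    by (intro compact_uniformly_continuous continuous_on_subset[OF assms(1)]) auto
  then obtain d where d: "d > 0" "\<And>x y. x \<in> cball 0 (R+1) \<Longrightarrow> y \<in> cball 0 (R+1) \<Longrightarrow> dist y x < d \<Longrightarrow> dist (g y) (g x) < e"
    using \<open>e > 0\<close> unfolding uniformly_continuous_on_def by metis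
  have "dist (g y) (g x) < e" if "dist y x < min d 1" for x y
  proof (cases "x \<in> cball 0 (R+1) \<and> y \<in> cball 0 (R+1)")
    case False
    have "norm y \<le> norm x + dist y x" "norm x \<le> norm y + dist y x"
      by (metis add.commute diff_add_cancel dist_norm norm_triangle_ineq)
         (metis add.commute diff_add_cancel dist_commute dist_norm norm_triangle_ineq)
    with False that have "norm x > R" "norm y > R" by auto
    then show ?thesis using assms(2) \<open>e > 0\<close> by simp
  qed (use d that in auto)
  then show "\<exists>d>0. \<forall>x\<in>UNIV. \<forall>x'\<in>UNIV. dist x' x < d \<longrightarrow> dist (g x') (g x) < e"
    using d(1) by (intro exI[of _ "min d 1"]) auto
qed

definition conv :: "(real^'n \<Rightarrow> real) \<Rightarrow> (real^'n \<Rightarrow> real) \<Rightarrow> real^'n \<Rightarrow> real" where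
  "conv k f x = (\<integral>y. k (x - y) * f y \<partial>lebesgue)"

lemma conv_integrable:
  fixes k f :: "real^'n \<Rightarrow> real"
  assumes "continuous_on UNIV k" "\<And>x. norm x > R \<Longrightarrow> k x = 0" "integrable lebesgue f"
  shows "integrable lebesgue (\<lambda>y. k (x - y) * f y)"
proof -
  obtain B where "\<And>x. norm (k x) \<le> B" using bounded_support_bounded[OF assms(1,2)] by metis
  then show ?thesis
    by (intro integrable_bounded_mult[OF assms(3)] continuous_imp_measurable_lebesgue continuous_on_compose2[OF assms(1)])
      (auto intro!: continuous_intros)
qed

lemma conv_cong_AE:
  fixes k f :: "real^'n \<Rightarrow> real"
  assumes "AE y in lebesgue. f y = g y" "f \<in> borel_measurable lebesgue" "g \<in> borel_measurable lebesgue" "continuous_on UNIV k"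
  shows "conv k f x = conv k g x"
  unfolding conv_def
proof (rule integral_cong_AE)
  have "(\<lambda>y. k (x - y)) \<in> borel_measurable lebesgue"
    by (intro continuous_imp_measurable_lebesgue continuous_on_compose2[OF assms(4)]) (auto intro!: continuous_intros)
  then show "(\<lambda>y. k (x - y) * f y) \<in> borel_measurable lebesgue" "(\<lambda>y. k (x - y) * g y) \<in> borel_measurable lebesgue"
    using assms by auto
qed (use assms(1) in auto)

lemma partial_zero_outside_ball:
  assumes "\<And>x. norm x > R \<Longrightarrow> k x = 0" "norm x > R"
  shows "partial i k x = 0" "grad k x = 0"
proof -
  have *: "partial i k x = 0" for i
    by (rule partial_zero_outside_support[where U="- cball 0 R"]) (use assms in auto)
  then show "partial i k x = 0" "grad k x = 0"
    by (auto simp: vec_eq_iff)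
qed

text \<open>The first-order Taylor remainder of \<open>k\<close> is \<open>o(\<bar>y - x\<bar>)\<close> uniformly in the base point, because
  \<open>grad k\<close> is uniformly continuous; integrating it against \<open>f\<close> keeps this rate.\<close>

lemma conv_has_derivative:
  fixes k f :: "real^'n \<Rightarrow> real"
  assumes k: "smooth k" "\<And>x. norm x > R \<Longrightarrow> k x = 0" and f: "integrable lebesgue f"
  shows "(conv k f has_derivative (\<lambda>h. (\<chi> i. conv (partial i k) f x) \<bullet> h)) (at x)"
  unfolding has_derivative_at_alt
proof (intro conjI allI impI bounded_linear_inner_right)
  fix e :: real assume "e > 0"
  define I where "I = (\<integral>y. \<bar>f y\<bar> \<partial>lebesgue)"
  have "I \<ge> 0" by (simp add: I_def)
  \<comment> \<open>the \<open>L\<^sup>1\<close> norm of \<open>f\<close> may vanish, hence \<open>1 + I\<close>\<close>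
  define e' where "e' = e / (1 + I)"
  have "e' > 0" using \<open>e > 0\<close> \<open>I \<ge> 0\<close> by (simp add: e'_def)
  have "uniformly_continuous_on UNIV (grad k)"
    by (rule bounded_support_uniformly_continuous[where R=R])
      (use k partial_zero_outside_ball(2)[OF k(2)] in \<open>auto intro: smooth_continuous_grad\<close>)
  then obtain d where d: "d > 0" "\<And>x y. dist y x < d \<Longrightarrow> dist (grad k y) (grad k x) < e'"
    using \<open>e' > 0\<close> unfolding uniformly_continuous_on_def by (metis UNIV_I)
  have lin: "\<bar>k b - k a - grad k a \<bullet> (b - a)\<bar> \<le> norm (b - a) * e'" if "dist b a < d" for a b
  proof -
    have "norm (k b - k a - (\<lambda>h. grad k a \<bullet> h) (b - a)) \<le> norm (b - a) * e'"
    proof (rule differentiable_bound_linearization[where S="ball a d" and f'="\<lambda>x h. grad k x \<bullet> h"])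
      show "a + t *\<^sub>R (b - a) \<in> ball a d" if "t \<in> {0..1}" for t
      proof -
        have "norm (t *\<^sub>R (b - a)) \<le> 1 * norm (b - a)"
          unfolding norm_scaleR using that by (intro mult_right_mono) auto
        then show ?thesis using \<open>dist b a < d\<close> by (simp add: dist_norm norm_minus_commute)
      qed
      show "(k has_derivative (\<lambda>h. grad k x \<bullet> h)) (at x within ball a d)" for x
        by (rule has_derivative_at_withinI[OF smooth_has_grad[OF k(1)]])
      show "onorm ((\<lambda>h. grad k x \<bullet> h) - (\<lambda>h. grad k a \<bullet> h)) \<le> e'" if "x \<in> ball a d" for x
      proof (rule onorm_le)
        fix h
        have "\<bar>(grad k x - grad k a) \<bullet> h\<bar> \<le> norm (grad k x - grad k a) * norm h"
          by (rule Cauchy_Schwarz_ineq2)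
        also have "\<dots> \<le> e' * norm h"
          using d(2)[of x a] that by (intro mult_right_mono) (auto simp: dist_norm norm_minus_commute)
        finally show "norm (((\<lambda>h. grad k x \<bullet> h) - (\<lambda>h. grad k a \<bullet> h)) h) \<le> e' * norm h"
          by (simp add: inner_diff_left)
      qed
    qed (use d(1) in auto)
    then show ?thesis by simp
  qed
  have cont: "continuous_on UNIV k" "\<And>i. continuous_on UNIV (partial i k)"
    using k smooth_continuous_on smooth_partial by blast+
  have int: "integrable lebesgue (\<lambda>z. k (y - z) * f z)" "\<And>i. integrable lebesgue (\<lambda>z. partial i k (y - z) * f z)" for y
    by (rule conv_integrable[where R=R]; use cont k f partial_zero_outside_ball(1)[OF k(2)] in auto)+
  show "\<exists>d>0. \<forall>y. norm (y - x) < d \<longrightarrow>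
      norm (conv k f y - conv k f x - (\<chi> i. conv (partial i k) f x) \<bullet> (y - x)) \<le> e * norm (y - x)"
  proof (intro exI[of _ d] conjI allI impI d(1))
    fix y assume y: "norm (y - x) < d"
    have "(\<chi> i. conv (partial i k) f x) \<bullet> (y - x) = (\<Sum>i\<in>UNIV. \<integral>z. (y - x) $ i * (partial i k (x - z) * f z) \<partial>lebesgue)"
      by (simp add: inner_vec_def conv_def mult.commute[of _ "_ - _"])
    also have "\<dots> = (\<integral>z. (\<Sum>i\<in>UNIV. (y - x) $ i * (partial i k (x - z) * f z)) \<partial>lebesgue)"
      by (rule Bochner_Integration.integral_sum[symmetric]) (use int in auto)
    also have "\<dots> = (\<integral>z. (grad k (x - z) \<bullet> (y - x)) * f z \<partial>lebesgue)"
      by (simp add: inner_vec_def sum_distrib_right sum_distrib_left mult_ac)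
    finally have eq: "(\<chi> i. conv (partial i k) f x) \<bullet> (y - x) = (\<integral>z. (grad k (x - z) \<bullet> (y - x)) * f z \<partial>lebesgue)" .
    have "(\<lambda>z. \<Sum>i\<in>UNIV. (y - x) $ i * (partial i k (x - z) * f z)) = (\<lambda>z. (grad k (x - z) \<bullet> (y - x)) * f z)"
      by (simp add: inner_vec_def sum_distrib_right sum_distrib_left mult_ac)
    moreover have "integrable lebesgue (\<lambda>z. \<Sum>i\<in>UNIV. (y - x) $ i * (partial i k (x - z) * f z))"
      using int by simp
    ultimately have intg: "integrable lebesgue (\<lambda>z. (grad k (x - z) \<bullet> (y - x)) * f z)"
      by simp
    have "conv k f y - conv k f x - (\<chi> i. conv (partial i k) f x) \<bullet> (y - x)
        = (\<integral>z. k (y - z) * f z - k (x - z) * f z - (grad k (x - z) \<bullet> (y - x)) * f z \<partial>lebesgue)"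
      unfolding eq using int intg by (simp add: conv_def)
    also have "\<bar>\<dots>\<bar> \<le> (\<integral>z. norm (y - x) * e' * \<bar>f z\<bar> \<partial>lebesgue)"
    proof (rule integral_abs_bound_integral)
      fix z
      have "\<bar>k (y - z) - k (x - z) - grad k (x - z) \<bullet> (y - x)\<bar> \<le> norm (y - x) * e'"
        using lin[of "y - z" "x - z"] y by (simp add: dist_norm)
      then have "\<bar>k (y - z) - k (x - z) - grad k (x - z) \<bullet> (y - x)\<bar> * \<bar>f z\<bar> \<le> norm (y - x) * e' * \<bar>f z\<bar>"
        by (rule mult_right_mono) simp
      then show "\<bar>k (y - z) * f z - k (x - z) * f z - (grad k (x - z) \<bullet> (y - x)) * f z\<bar> \<le> norm (y - x) * e' * \<bar>f z\<bar>"
        by (simp add: left_diff_distrib flip: abs_mult)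
    qed (use int intg f in auto)
    also have "\<dots> = norm (y - x) * (e' * I)" by (simp add: I_def)
    also have "\<dots> \<le> norm (y - x) * e"
      using \<open>e > 0\<close> \<open>I \<ge> 0\<close> by (intro mult_left_mono) (auto simp: e'_def field_simps)
    finally show "norm (conv k f y - conv k f x - (\<chi> i. conv (partial i k) f x) \<bullet> (y - x)) \<le> e * norm (y - x)"
      by (simp add: mult.commute)
  qed
qed

lemma partial_conv:
  fixes k f :: "real^'n \<Rightarrow> real"
  assumes "smooth k" "\<And>x. norm x > R \<Longrightarrow> k x = 0" "integrable lebesgue f"
  shows "partial i (conv k f) = conv (partial i k) f"
  using partial_eq_derivative[OF conv_has_derivative[OF assms]]
  by (auto simp: inner_axis)

text \<open>Derivatives fall on the kernel, so the convolutions of \<open>f\<close> with smooth kernels supported in a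
  fixed ball form a family closed under partial derivatives.\<close>

lemma smooth_conv:
  fixes k f :: "real^'n \<Rightarrow> real"
  assumes "smooth k" "\<And>x. norm x > R \<Longrightarrow> k x = 0" "integrable lebesgue f"
  shows "smooth (conv k f)"
proof (rule smoothI[where S="{conv k f | k. smooth k \<and> (\<forall>x. norm x > R \<longrightarrow> k x = 0)}"])
  show "conv k f \<in> {conv k f | k. smooth k \<and> (\<forall>x. norm x > R \<longrightarrow> k x = 0)}"
    using assms by blast
  fix g assume "g \<in> {conv k f | k. smooth k \<and> (\<forall>x. norm x > R \<longrightarrow> k x = 0)}"
  then obtain k where k: "smooth k" "\<And>x. norm x > R \<Longrightarrow> k x = 0" "g = conv k f" by blast
  show "g differentiable_on UNIV"
    unfolding k(3) differentiable_on_def differentiable_def using conv_has_derivative[OF k(1,2) assms(3)] by blast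
  show "partial i g \<in> {conv k f | k. smooth k \<and> (\<forall>x. norm x > R \<longrightarrow> k x = 0)}" for i
  proof -
    have "smooth (partial i k)" "\<forall>x. norm x > R \<longrightarrow> partial i k x = 0"
      using smooth_partial[OF k(1)] partial_zero_outside_ball(1)[OF k(2)] by auto
    then show ?thesis
      using partial_conv[OF k(1,2) assms(3), where i=i] k(3) by (intro CollectI exI[of _ "partial i k"]) auto
  qed
qed

section \<open>The inequalities of Hoelder and Jensen\<close>

lemma ennreal_powr_eq_0: "ennreal (t powr p) = 0 \<longleftrightarrow> t = 0"
  by (metis ennreal_eq_0_iff order_antisym order_refl powr_eq_0_iff powr_ge_zero)

text \<open>Young's inequality applied to the normalised functions \<open>f/a\<close> and \<open>g/b\<close>. The integrals are
  nonnegative extended ones with finite bounds, so that no integrability has to be supplied by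
  the user.\<close>

lemma nn_integral_Hoelder:
  fixes f g :: "'a \<Rightarrow> real"
  assumes [measurable]: "f \<in> borel_measurable M" "g \<in> borel_measurable M"
    and pos: "\<And>x. 0 \<le> f x" "\<And>x. 0 \<le> g x"
    and pq: "p > 1" "q > 1" "1/p + 1/q = 1" and AB: "A \<ge> 0" "B \<ge> 0"
    and f: "(\<integral>\<^sup>+x. ennreal (f x powr p) \<partial>M) \<le> ennreal A"
    and g: "(\<integral>\<^sup>+x. ennreal (g x powr q) \<partial>M) \<le> ennreal B"
  shows "(\<integral>\<^sup>+x. ennreal (f x * g x) \<partial>M) \<le> ennreal (A powr (1/p) * B powr (1/q))"
proof (cases "A = 0 \<or> B = 0")
  case True
  have "AE x in M. f x * g x = 0"
    using True
  proof
    assume "A = 0"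
    then have "(\<integral>\<^sup>+x. ennreal (f x powr p) \<partial>M) = 0" using f by simp
    then have "AE x in M. ennreal (f x powr p) = 0"
      by (subst (asm) nn_integral_0_iff_AE) auto
    then show ?thesis by eventually_elim (simp add: ennreal_powr_eq_0)
  next
    assume "B = 0"
    then have "(\<integral>\<^sup>+x. ennreal (g x powr q) \<partial>M) = 0" using g by simp
    then have "AE x in M. ennreal (g x powr q) = 0"
      by (subst (asm) nn_integral_0_iff_AE) auto
    then show ?thesis by eventually_elim (simp add: ennreal_powr_eq_0)
  qed
  then have "(\<integral>\<^sup>+x. ennreal (f x * g x) \<partial>M) = 0"
    by (subst nn_integral_0_iff_AE) auto
  then show ?thesis by simp
next
  case False
  then have "A > 0" "B > 0" using AB by auto
  define a where "a = A powr (1/p)"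
  define b where "b = B powr (1/q)"
  have ab: "a > 0" "b > 0" "a powr p = A" "b powr q = B"
    using \<open>A > 0\<close> \<open>B > 0\<close> pq by (auto simp: a_def b_def powr_powr)
  have "ennreal (f x * g x) \<le> ennreal (a * b / p / A) * ennreal (f x powr p) + ennreal (a * b / q / B) * ennreal (g x powr q)" for x
  proof -
    have "(f x / a) * (g x / b) \<le> (f x / a) powr p / p + (g x / b) powr q / q"
      by (rule Youngs_inequality) (use pq pos ab in auto)
    also have "\<dots> = f x powr p / A / p + g x powr q / B / q"
      using pos ab by (simp add: powr_divide)
    finally have "a * b * ((f x / a) * (g x / b)) \<le> a * b * (f x powr p / A / p + g x powr q / B / q)"
      using ab by (intro mult_left_mono) auto
    moreover have "a * b * ((f x / a) * (g x / b)) = f x * g x" using ab by simp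
    ultimately have "f x * g x \<le> (a * b / p / A) * (f x powr p) + (a * b / q / B) * (g x powr q)"
      by (simp add: field_simps)
    then have "ennreal (f x * g x) \<le> ennreal ((a * b / p / A) * (f x powr p) + (a * b / q / B) * (g x powr q))"
      by (rule ennreal_leI)
    also have "\<dots> = ennreal (a * b / p / A) * ennreal (f x powr p) + ennreal (a * b / q / B) * ennreal (g x powr q)"
    proof -
      have *: "0 \<le> a * b / p / A" "0 \<le> a * b / q / B" using ab(1,2) pq AB by auto
      show ?thesis
        unfolding ennreal_mult'[OF *(1), symmetric] ennreal_mult'[OF *(2), symmetric]
        by (rule ennreal_plus) (rule mult_nonneg_nonneg[OF *(1)], simp, rule mult_nonneg_nonneg[OF *(2)], simp)
    qed
    finally show ?thesis .
  qed
  then have "(\<integral>\<^sup>+x. ennreal (f x * g x) \<partial>M) \<le> (\<integral>\<^sup>+x. ennreal (a * b / p / A) * ennreal (f x powr p) + ennreal (a * b / q / B) * ennreal (g x powr q) \<partial>M)"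
    by (rule nn_integral_mono)
  also have "\<dots> = ennreal (a * b / p / A) * (\<integral>\<^sup>+x. ennreal (f x powr p) \<partial>M) + ennreal (a * b / q / B) * (\<integral>\<^sup>+x. ennreal (g x powr q) \<partial>M)"
    by (subst nn_integral_add) (auto simp: nn_integral_cmult)
  also have "\<dots> \<le> ennreal (a * b / p / A) * ennreal A + ennreal (a * b / q / B) * ennreal B"
    by (intro add_mono mult_left_mono f g) auto
  also have "\<dots> = ennreal (a * b / p + a * b / q)"
    using ab pq AB False by (subst ennreal_plus) (auto simp flip: ennreal_mult')
  also have "a * b / p + a * b / q = a * b * (1/p + 1/q)" by (simp add: field_simps)
  finally show ?thesis using pq by (simp add: a_def b_def)
qed

text \<open>Jensen's inequality for a kernel \<open>k\<close> of mass at most \<open>K\<close>, obtained from Hoelder's inequality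
  for the splitting \<open>k F = (k\<^sup>1\<^sup>/\<^sup>p F) k\<^sup>1\<^sup>-\<^sup>1\<^sup>/\<^sup>p\<close>.\<close>

lemma nn_integral_Jensen:
  fixes k F :: "'a \<Rightarrow> real"
  assumes [measurable]: "k \<in> borel_measurable M" "F \<in> borel_measurable M"
    and pos: "\<And>x. 0 \<le> k x" "\<And>x. 0 \<le> F x" and p: "p \<ge> 1" and K: "K \<ge> 0" "(\<integral>\<^sup>+x. ennreal (k x) \<partial>M) \<le> ennreal K"
    and A: "A \<ge> 0" "ennreal A \<le> (\<integral>\<^sup>+x. ennreal (k x * F x) \<partial>M)"
  shows "ennreal (A powr p) \<le> ennreal (K powr (p - 1)) * (\<integral>\<^sup>+x. ennreal (k x * F x powr p) \<partial>M)"
proof (cases "p = 1")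
  case True
  have "K = 0 \<Longrightarrow> A = 0"
  proof -
    assume "K = 0"
    then have "AE x in M. k x = 0"
      using K pos by (simp add: nn_integral_0_iff_AE ennreal_eq_0_iff) (auto elim!: eventually_mono intro: antisym)
    then have "(\<integral>\<^sup>+x. ennreal (k x * F x) \<partial>M) = 0"
      by (subst nn_integral_0_iff_AE) auto
    then show "A = 0" using A by (simp add: ennreal_eq_0_iff)
  qed
  then show ?thesis using A pos K True by (cases "K = 0") auto
next
  case False
  with p have "p > 1" by simp
  define q where "q = p / (p - 1)"
  have q: "q > 1" "1/p + 1/q = 1" using \<open>p > 1\<close> by (auto simp: q_def field_simps)
  show ?thesis
  proof (cases "(\<integral>\<^sup>+x. ennreal (k x * F x powr p) \<partial>M)")
    case (real B)
    have eq: "k x * F x = (k x powr (1/p) * F x) * k x powr (1/q)" for x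
    proof (cases "k x = 0")
      case False
      have "k x powr (1/p) * k x powr (1/q) = k x"
        using q pos(1)[of x] False by (simp flip: powr_add)
      then show ?thesis by (metis mult.commute mult.left_commute)
    qed simp
    have "(\<integral>\<^sup>+x. ennreal ((k x powr (1/p) * F x) * k x powr (1/q)) \<partial>M) \<le> ennreal (B powr (1/p) * K powr (1/q))"
    proof (rule nn_integral_Hoelder)
      have "(k x powr (1/p) * F x) powr p = k x * F x powr p" for x
        using pos[of x] \<open>p > 1\<close> by (simp add: powr_mult powr_powr)
      then show "(\<integral>\<^sup>+x. ennreal ((k x powr (1/p) * F x) powr p) \<partial>M) \<le> ennreal B"
        using real by simp
      have "(k x powr (1/q)) powr q = k x" for x
        using pos[of x] q by (simp add: powr_powr)
      then show "(\<integral>\<^sup>+x. ennreal ((k x powr (1/q)) powr q) \<partial>M) \<le> ennreal K"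
        using K by simp
    qed (use pos real \<open>p > 1\<close> q K in auto)
    then have "ennreal A \<le> ennreal (B powr (1/p) * K powr (1/q))"
      using A(2) unfolding eq by (rule order_trans[rotated])
    then have "A \<le> B powr (1/p) * K powr (1/q)"
      by (subst (asm) ennreal_le_iff) auto
    then have "A powr p \<le> (B powr (1/p) * K powr (1/q)) powr p"
      using \<open>p > 1\<close> A by (intro powr_mono2) auto
    also have "\<dots> = B * K powr (p - 1)"
      using real(1) K \<open>p > 1\<close> by (simp add: powr_mult powr_powr q_def)
    finally show ?thesis
      using real by (simp add: mult.commute flip: ennreal_mult')
  next
    case top
    show ?thesis
    proof (cases "K = 0")
      case True
      then have "AE x in M. k x = 0"
        using K pos by (simp add: nn_integral_0_iff_AE ennreal_eq_0_iff) (auto elim!: eventually_mono intro: antisym)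
      then have "(\<integral>\<^sup>+x. ennreal (k x * F x) \<partial>M) = 0"
        by (subst nn_integral_0_iff_AE) auto
      then have "A = 0" using A by (simp add: ennreal_eq_0_iff)
      then show ?thesis by simp
    next
      case False
      then show ?thesis using top K by (simp add: ennreal_mult_top)
    qed
  qed
qed

text \<open>The constant \<open>2 powr p\<close> is not optimal, but it serves for all \<open>p \<ge> 0\<close> at once.\<close>

lemma powr_add_le:
  fixes a b p :: real
  assumes "0 \<le> a" "0 \<le> b" "0 \<le> p"
  shows "(a + b) powr p \<le> 2 powr p * (a powr p + b powr p)"
proof -
  have "(a + b) powr p \<le> (2 * max a b) powr p"
    using assms by (intro powr_mono2) auto
  also have "\<dots> = 2 powr p * (max a b) powr p" using assms by (simp add: powr_mult)
  also have "\<dots> \<le> 2 powr p * (a powr p + b powr p)"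
    by (intro mult_left_mono) (auto simp: max_def)
  finally show ?thesis .
qed

section \<open>Density and mollification in \<open>L\<^sup>p\<close>\<close>

text \<open>Truncate \<open>f\<close> in value and in space (dominated convergence), then approximate the truncation
  almost everywhere by continuous functions; the same truncation applied to these gives them a
  common integrable bound and bounded support.\<close>

lemma Lp_approx_continuous:
  fixes f :: "real^'n \<Rightarrow> real"
  assumes [measurable]: "f \<in> borel_measurable lebesgue" and p: "p > 0"
    and fin: "(\<integral>\<^sup>+x. ennreal (\<bar>f x\<bar> powr p) \<partial>lebesgue) < \<infinity>" and e: "e > 0"
  shows "\<exists>g R. continuous_on UNIV g \<and> (\<forall>x. norm x > R \<longrightarrow> g x = 0) \<and>
    (\<integral>\<^sup>+x. ennreal (\<bar>f x - g x\<bar> powr p) \<partial>lebesgue) < ennreal e"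
proof -
  define e1 where "e1 = e / (2 * 2 powr p)"
  have "e1 > 0" using e by (simp add: e1_def)
  define cut where "cut N x = max 0 (min 1 (real N + 1 - norm x))" for N and x :: "real^'n"
  define clamp where "clamp N t = max (- real N) (min (real N) t)" for N t
  have cut: "0 \<le> cut N x" "cut N x \<le> 1" "norm x > N + 1 \<Longrightarrow> cut N x = 0" "norm x \<le> N \<Longrightarrow> cut N x = 1" for N x
    by (auto simp: cut_def)
  have clamp: "\<bar>clamp N t\<bar> \<le> N" "\<bar>t - clamp N t * c\<bar> \<le> \<bar>t\<bar>" "\<bar>t\<bar> \<le> N \<Longrightarrow> clamp N t = t" if "0 \<le> c" "c \<le> 1" for N t c
  proof -
    show "\<bar>clamp N t\<bar> \<le> N" "\<bar>t\<bar> \<le> N \<Longrightarrow> clamp N t = t" by (auto simp: clamp_def)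
    show "\<bar>t - clamp N t * c\<bar> \<le> \<bar>t\<bar>"
    proof (cases "t \<ge> 0")
      case True
      then have "0 \<le> clamp N t" "clamp N t \<le> t" by (auto simp: clamp_def)
      moreover have "0 \<le> clamp N t * c" "clamp N t * c \<le> clamp N t * 1"
        using that calculation by (intro mult_nonneg_nonneg mult_left_mono; simp)+
      ultimately show ?thesis using True by auto
    next
      case False
      then have "clamp N t \<le> 0" "clamp N t \<ge> t" by (auto simp: clamp_def)
      moreover have "0 \<ge> clamp N t * c" "clamp N t * c \<ge> clamp N t * 1"
        using that calculation by (intro mult_nonpos_nonneg mult_left_mono_neg; simp)+
      ultimately show ?thesis using False by auto
    qed
  qed
  have cont_cut: "continuous_on UNIV (cut N)" for N
    unfolding cut_def by (intro continuous_intros)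
  have [measurable]: "cut N \<in> borel_measurable lebesgue" for N
    by (rule continuous_imp_measurable_lebesgue[OF cont_cut])
  have [measurable]: "clamp N \<in> borel_measurable borel" for N
    unfolding clamp_def by measurable
  define F where "F N x = clamp N (f x) * cut N x" for N x
  have [measurable]: "F N \<in> borel_measurable lebesgue" for N
    unfolding F_def by measurable
  have "(\<lambda>N. \<integral>\<^sup>+x. ennreal (\<bar>f x - F N x\<bar> powr p) \<partial>lebesgue) \<longlonglongrightarrow> (\<integral>\<^sup>+x. 0 \<partial>(lebesgue :: (real^'n) measure))"
  proof (rule nn_integral_dominated_convergence[OF _ _ _ _ fin])
    show "AE x in lebesgue. ennreal (\<bar>f x - F N x\<bar> powr p) \<le> ennreal (\<bar>f x\<bar> powr p)" for N
      unfolding F_def using p clamp(2) cut by (auto intro!: AE_I2 ennreal_leI powr_mono2)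
    show "AE x in lebesgue. (\<lambda>N. ennreal (\<bar>f x - F N x\<bar> powr p)) \<longlonglongrightarrow> 0"
    proof (rule AE_I2, rule tendsto_eventually)
      fix x
      obtain N0 :: nat where N0: "real N0 \<ge> max \<bar>f x\<bar> (norm x)" using real_arch_simple by blast
      show "\<forall>\<^sub>F N in sequentially. ennreal (\<bar>f x - F N x\<bar> powr p) = 0"
        using eventually_ge_at_top[of N0]
      proof eventually_elim
        case (elim N)
        then have "F N x = f x" using N0 cut(4)[of x N] clamp(3)[of 0 "f x" N] by (auto simp: F_def)
        then show ?case by simp
      qed
    qed
  qed auto
  then have "\<forall>\<^sub>F N in sequentially. (\<integral>\<^sup>+x. ennreal (\<bar>f x - F N x\<bar> powr p) \<partial>lebesgue) < ennreal e1"
    using \<open>e1 > 0\<close> by (intro order_tendstoD) auto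
  then obtain N where N: "(\<integral>\<^sup>+x. ennreal (\<bar>f x - F N x\<bar> powr p) \<partial>lebesgue) < ennreal e1"
    by (auto simp: eventually_sequentially)
  have "f measurable_on UNIV"
    using measurable_on_iff_borel_measurable[of UNIV f] by simp
  then obtain Z g where Z: "negligible Z" and g: "\<And>n. continuous_on UNIV (g n)"
    and lim: "\<And>x. x \<notin> Z \<Longrightarrow> (\<lambda>n::nat. g n x) \<longlonglongrightarrow> f x"
    unfolding measurable_on_def by auto
  define h where "h n x = clamp N (g n x) * cut N x" for n x
  have cont_h: "continuous_on UNIV (h n)" for n
    unfolding h_def clamp_def by (intro continuous_intros g continuous_on_max continuous_on_min cont_cut)
  have [measurable]: "h n \<in> borel_measurable lebesgue" for n
    by (rule continuous_imp_measurable_lebesgue[OF cont_h])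
  have "(\<lambda>n. \<integral>\<^sup>+x. ennreal (\<bar>F N x - h n x\<bar> powr p) \<partial>lebesgue) \<longlonglongrightarrow> (\<integral>\<^sup>+x. 0 \<partial>(lebesgue :: (real^'n) measure))"
  proof (rule nn_integral_dominated_convergence[where w="\<lambda>x. ennreal ((2 * real N) powr p) * indicator (cball (0::real^'n) (N + 1)) x"])
    show "AE x in lebesgue. ennreal (\<bar>F N x - h n x\<bar> powr p) \<le> ennreal ((2 * real N) powr p) * indicator (cball (0::real^'n) (N + 1)) x" for n
    proof (rule AE_I2)
      fix x
      show "ennreal (\<bar>F N x - h n x\<bar> powr p) \<le> ennreal ((2 * real N) powr p) * indicator (cball (0::real^'n) (N + 1)) x"
      proof (cases "norm x \<le> N + 1")
        case True
        have "\<bar>F N x - h n x\<bar> = \<bar>clamp N (f x) - clamp N (g n x)\<bar> * cut N x"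
          using cut(1)[of N x] by (simp add: F_def h_def abs_mult flip: left_diff_distrib)
        also have "\<dots> \<le> (2 * real N) * 1"
          using clamp(1)[of 0 N "f x"] clamp(1)[of 0 N "g n x"] cut(1,2)[of N x] by (intro mult_mono) auto
        finally show ?thesis using True p by (auto intro!: ennreal_leI powr_mono2)
      next
        case False
        then show ?thesis using cut(3)[of N x] by (simp add: F_def h_def)
      qed
    qed
    have "emeasure lebesgue (cball (0::real^'n) (N + 1)) < \<infinity>"
      using emeasure_lborel_cball_finite[of "0::real^'n" "real (N + 1)"] by simp
    then show "(\<integral>\<^sup>+x. ennreal ((2 * real N) powr p) * indicator (cball (0::real^'n) (N + 1)) x \<partial>lebesgue) < \<infinity>"
      by (simp add: nn_integral_cmult_indicator ennreal_mult_less_top)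
    have "AE x in lebesgue. x \<notin> Z"
      using Z by (simp add: negligible_iff_null_sets AE_not_in)
    then show "AE x in lebesgue. (\<lambda>n. ennreal (\<bar>F N x - h n x\<bar> powr p)) \<longlonglongrightarrow> 0"
    proof eventually_elim
      case (elim x)
      have "(\<lambda>n. h n x) \<longlonglongrightarrow> F N x"
        unfolding h_def F_def clamp_def by (intro tendsto_intros lim elim tendsto_max tendsto_min)
      then have "(\<lambda>n. \<bar>F N x - h n x\<bar> powr p) \<longlonglongrightarrow> \<bar>F N x - F N x\<bar> powr p"
        using p by (intro tendsto_intros) auto
      then have "(\<lambda>n. ennreal (\<bar>F N x - h n x\<bar> powr p)) \<longlonglongrightarrow> ennreal (\<bar>F N x - F N x\<bar> powr p)"
        by (rule tendsto_ennrealI)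
      then show ?case using p by simp
    qed
    show "(\<lambda>x. ennreal ((2 * real N) powr p) * indicator (cball (0::real^'n) (N + 1)) x) \<in> borel_measurable lebesgue"
      by (intro borel_measurable_times_ennreal borel_measurable_const borel_measurable_indicator) (simp add: fmeasurableD)
    show "(\<lambda>x. ennreal (\<bar>F N x - h n x\<bar> powr p)) \<in> borel_measurable lebesgue" for n by measurable
  qed simp
  then have "\<forall>\<^sub>F n in sequentially. (\<integral>\<^sup>+x. ennreal (\<bar>F N x - h n x\<bar> powr p) \<partial>lebesgue) < ennreal e1"
    using \<open>e1 > 0\<close> by (intro order_tendstoD) auto
  then obtain n where n: "(\<integral>\<^sup>+x. ennreal (\<bar>F N x - h n x\<bar> powr p) \<partial>lebesgue) < ennreal e1"
    by (auto simp: eventually_sequentially)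
  have "(\<integral>\<^sup>+x. ennreal (\<bar>f x - h n x\<bar> powr p) \<partial>lebesgue)
      \<le> (\<integral>\<^sup>+x. ennreal (2 powr p) * (ennreal (\<bar>f x - F N x\<bar> powr p) + ennreal (\<bar>F N x - h n x\<bar> powr p)) \<partial>lebesgue)"
  proof (rule nn_integral_mono)
    fix x
    have "\<bar>f x - h n x\<bar> powr p \<le> (\<bar>f x - F N x\<bar> + \<bar>F N x - h n x\<bar>) powr p"
      using p by (intro powr_mono2) auto
    also have "\<dots> \<le> 2 powr p * (\<bar>f x - F N x\<bar> powr p + \<bar>F N x - h n x\<bar> powr p)"
      using p by (intro powr_add_le) auto
    finally show "ennreal (\<bar>f x - h n x\<bar> powr p) \<le> ennreal (2 powr p) * (ennreal (\<bar>f x - F N x\<bar> powr p) + ennreal (\<bar>F N x - h n x\<bar> powr p))"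
      by (simp add: ennreal_leI flip: ennreal_plus ennreal_mult')
  qed
  also have "\<dots> = ennreal (2 powr p) * ((\<integral>\<^sup>+x. ennreal (\<bar>f x - F N x\<bar> powr p) \<partial>lebesgue) + (\<integral>\<^sup>+x. ennreal (\<bar>F N x - h n x\<bar> powr p) \<partial>lebesgue))"
    by (simp add: nn_integral_cmult nn_integral_add)
  also have "\<dots> < ennreal (2 powr p) * (ennreal e1 + ennreal e1)"
    using N n by (intro ennreal_mult_strict_left_mono add_strict_mono) auto
  also have "\<dots> = ennreal e"
    using e by (simp add: e1_def flip: ennreal_plus ennreal_mult')
  finally have *: "(\<integral>\<^sup>+x. ennreal (\<bar>f x - h n x\<bar> powr p) \<partial>lebesgue) < ennreal e" .
  show ?thesis
    by (rule exI[of _ "h n"], rule exI[of _ "real N + 1"]) (use cont_h * cut(3) in \<open>auto simp: h_def\<close>)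
qed

lemma nn_integral_lborel_translate:
  fixes F :: "'a::euclidean_space \<Rightarrow> ennreal"
  assumes [measurable]: "F \<in> borel_measurable borel"
  shows "(\<integral>\<^sup>+x. F (x + c) \<partial>lborel) = (\<integral>\<^sup>+x. F x \<partial>lborel)"
proof -
  have "(\<integral>\<^sup>+x. F x \<partial>lborel) = (\<integral>\<^sup>+x. F x \<partial>(distr lborel borel ((+) c)))"
    by (simp add: lborel_distr_plus)
  also have "\<dots> = (\<integral>\<^sup>+x. F (c + x) \<partial>lborel)"
    by (rule nn_integral_distr) auto
  finally show ?thesis by (simp add: add.commute)
qed

text \<open>This is the change of variables \<open>y \<mapsto> x - y\<close> that puts the translate on the other factor of
  a convolution.\<close>

lemma lborel_distr_reflect: "distr lborel borel (\<lambda>y. x - y) = (lborel :: 'a::euclidean_space measure)"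
proof -
  have "(\<lambda>y::'a. x + (-1) *\<^sub>R y) = (\<lambda>y. x - y)" by auto
  then show ?thesis
    using lborel_affine[of "-1" x] by (simp add: density_1)
qed

lemma powr_add3_le:
  fixes a b c p :: real
  assumes "0 \<le> a" "0 \<le> b" "0 \<le> c" "0 \<le> p"
  shows "(a + b + c) powr p \<le> 4 powr p * (a powr p + b powr p + c powr p)"
proof -
  have "(a + b + c) powr p \<le> 2 powr p * ((a + b) powr p + c powr p)"
    using assms by (intro powr_add_le) auto
  also have "\<dots> \<le> 2 powr p * (2 powr p * (a powr p + b powr p) + 2 powr p * c powr p)"
    using assms by (intro mult_left_mono add_mono powr_add_le) (auto intro!: mult_right_mono[of 1 "2 powr p", simplified] ge_one_powr_ge_zero)
  also have "\<dots> = (2 powr p * 2 powr p) * (a powr p + b powr p + c powr p)" by (simp add: algebra_simps)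
  also have "2 powr p * 2 powr p = (2 * 2) powr p" by (subst powr_mult) auto
  finally show ?thesis by simp
qed

text \<open>For continuous functions of bounded support this is uniform continuity; the general case
  follows by density, since translations preserve the integral.\<close>

lemma Lp_translation_continuous:
  fixes f :: "real^'n \<Rightarrow> real"
  assumes [measurable]: "f \<in> borel_measurable borel" and p: "p > 0"
    and fin: "(\<integral>\<^sup>+x. ennreal (\<bar>f x\<bar> powr p) \<partial>lborel) < \<infinity>" and e: "e > 0"
  shows "\<exists>d>0. \<forall>h. norm h < d \<longrightarrow> (\<integral>\<^sup>+x. ennreal (\<bar>f (x - h) - f x\<bar> powr p) \<partial>lborel) \<le> ennreal e"
proof -
  \<comment> \<open>three errors, each with the factor \<open>4 powr p\<close> from the power of a sum\<close>
  define e1 where "e1 = e / (3 * 4 powr p)"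
  have "e1 > 0" using e by (simp add: e1_def)
  obtain g R where g: "continuous_on UNIV g" "\<And>x. norm x > R \<Longrightarrow> g x = 0"
    and fg: "(\<integral>\<^sup>+x. ennreal (\<bar>f x - g x\<bar> powr p) \<partial>lborel) < ennreal e1"
    using Lp_approx_continuous[of f p e1] p fin \<open>e1 > 0\<close>
    by (auto simp: nn_integral_completion borel_measurable_lebesgueI)
  have [measurable]: "g \<in> borel_measurable borel"
    using g(1) by (rule borel_measurable_continuous_onI)
  define V where "V = measure lborel (cball (0::real^'n) (R + 1))"
  have V: "V \<ge> 0" "emeasure lborel (cball (0::real^'n) (R + 1)) = ennreal V"
    unfolding V_def using emeasure_lborel_cball_finite[of "0::real^'n" "R+1"]
    by (simp, intro emeasure_eq_ennreal_measure, simp add: less_top)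
  \<comment> \<open>chosen so that a uniform error \<open>\<eta>\<close> on a ball of measure \<open>V\<close> contributes at most \<open>e1\<close>\<close>
  define \<eta> where "\<eta> = (e1 / (V + 1)) powr (1 / p)"
  have \<eta>: "\<eta> > 0" "\<eta> powr p = e1 / (V + 1)"
    using \<open>e1 > 0\<close> V p by (auto simp: \<eta>_def powr_powr)
  have "uniformly_continuous_on UNIV g"
    by (rule bounded_support_uniformly_continuous[OF g])
  then obtain d where d: "d > 0" "\<And>x y. dist y x < d \<Longrightarrow> dist (g y) (g x) < \<eta>"
    using \<eta>(1) unfolding uniformly_continuous_on_def by (metis UNIV_I)
  show ?thesis
  proof (intro exI[of _ "min d 1"] conjI allI impI)
    fix h :: "real^'n" assume h: "norm h < min d 1"
    have tr: "(\<integral>\<^sup>+x. ennreal (\<bar>f (x - h) - g (x - h)\<bar> powr p) \<partial>lborel) = (\<integral>\<^sup>+x. ennreal (\<bar>f x - g x\<bar> powr p) \<partial>lborel)"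
      using nn_integral_lborel_translate[of "\<lambda>x. ennreal (\<bar>f x - g x\<bar> powr p)" "- h"] by simp
    have "(\<integral>\<^sup>+x. ennreal (\<bar>g (x - h) - g x\<bar> powr p) \<partial>lborel) \<le> (\<integral>\<^sup>+x. ennreal (\<eta> powr p) * indicator (cball (0::real^'n) (R + 1)) x \<partial>lborel)"
    proof (rule nn_integral_mono)
      fix x
      show "ennreal (\<bar>g (x - h) - g x\<bar> powr p) \<le> ennreal (\<eta> powr p) * indicator (cball (0::real^'n) (R + 1)) x"
      proof (cases "norm x \<le> R + 1")
        case True
        then show ?thesis using d(2)[of "x - h" x] h p by (auto intro!: ennreal_leI powr_mono2 simp: dist_norm)
      next
        case False
        have "norm x \<le> norm (x - h) + norm h" by (metis diff_add_cancel norm_triangle_ineq)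
        with False h have "norm (x - h) > R" "norm x > R" by auto
        then show ?thesis using g(2) by simp
      qed
    qed
    also have "\<dots> = ennreal (\<eta> powr p * V)"
      using V by (simp add: nn_integral_cmult_indicator ennreal_mult)
    also have "\<dots> \<le> ennreal e1"
      using V \<open>e1 > 0\<close> by (intro ennreal_leI) (simp add: \<eta> field_simps)
    finally have mid: "(\<integral>\<^sup>+x. ennreal (\<bar>g (x - h) - g x\<bar> powr p) \<partial>lborel) \<le> ennreal e1" .
    have "(\<integral>\<^sup>+x. ennreal (\<bar>f (x - h) - f x\<bar> powr p) \<partial>lborel)
      \<le> (\<integral>\<^sup>+x. ennreal (4 powr p) * (ennreal (\<bar>f (x - h) - g (x - h)\<bar> powr p) + ennreal (\<bar>g (x - h) - g x\<bar> powr p) + ennreal (\<bar>f x - g x\<bar> powr p)) \<partial>lborel)"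
    proof (rule nn_integral_mono)
      fix x
      have "\<bar>f (x - h) - f x\<bar> powr p \<le> (\<bar>f (x - h) - g (x - h)\<bar> + \<bar>g (x - h) - g x\<bar> + \<bar>f x - g x\<bar>) powr p"
        using p by (intro powr_mono2) auto
      also have "\<dots> \<le> 4 powr p * (\<bar>f (x - h) - g (x - h)\<bar> powr p + \<bar>g (x - h) - g x\<bar> powr p + \<bar>f x - g x\<bar> powr p)"
        using p by (intro powr_add3_le) auto
      finally show "ennreal (\<bar>f (x - h) - f x\<bar> powr p) \<le> ennreal (4 powr p) * (ennreal (\<bar>f (x - h) - g (x - h)\<bar> powr p) + ennreal (\<bar>g (x - h) - g x\<bar> powr p) + ennreal (\<bar>f x - g x\<bar> powr p))"
        by (simp add: ennreal_leI flip: ennreal_plus ennreal_mult')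
    qed
    also have "\<dots> = ennreal (4 powr p) * ((\<integral>\<^sup>+x. ennreal (\<bar>f (x - h) - g (x - h)\<bar> powr p) \<partial>lborel) + (\<integral>\<^sup>+x. ennreal (\<bar>g (x - h) - g x\<bar> powr p) \<partial>lborel) + (\<integral>\<^sup>+x. ennreal (\<bar>f x - g x\<bar> powr p) \<partial>lborel))"
      by (simp add: nn_integral_cmult nn_integral_add)
    also have "\<dots> \<le> ennreal (4 powr p) * (ennreal e1 + ennreal e1 + ennreal e1)"
      unfolding tr using fg mid by (intro mult_left_mono add_mono) auto
    also have "\<dots> = ennreal e"
      using e by (simp add: e1_def flip: ennreal_plus ennreal_mult')
    finally show "(\<integral>\<^sup>+x. ennreal (\<bar>f (x - h) - f x\<bar> powr p) \<partial>lborel) \<le> ennreal e" .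
  qed (use d in auto)
qed

text \<open>The difference \<open>conv (mollifier \<delta>) f - f\<close> is an average of the translates \<open>f (x - y) - f x\<close>
  over \<open>\<bar>y\<bar> < \<delta>\<close>. Jensen's inequality and Tonelli's theorem reduce the claim to continuity of
  translations.\<close>

lemma mollify_Lp_borel:
  fixes f :: "real^'n \<Rightarrow> real"
  assumes [measurable]: "f \<in> borel_measurable borel" and p: "p \<ge> 1" and int: "integrable lborel f"
    and fin: "(\<integral>\<^sup>+x. ennreal (\<bar>f x\<bar> powr p) \<partial>lborel) < \<infinity>" and e: "e > 0"
  shows "\<exists>d>0. \<forall>\<delta>. 0 < \<delta> \<and> \<delta> < d \<longrightarrow> (\<integral>\<^sup>+x. ennreal (\<bar>conv (mollifier \<delta>) f x - f x\<bar> powr p) \<partial>lborel) \<le> ennreal e"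
proof -
  obtain d where d: "d > 0" "\<And>h. norm h < d \<Longrightarrow> (\<integral>\<^sup>+x. ennreal (\<bar>f (x - h) - f x\<bar> powr p) \<partial>lborel) \<le> ennreal e"
    using Lp_translation_continuous[of f p e] assms by auto
  show ?thesis
  proof (intro exI[of _ d] conjI allI impI d(1))
    fix \<delta> assume \<delta>: "0 < \<delta> \<and> \<delta> < d"
    let ?m = "mollifier \<delta> :: real^'n \<Rightarrow> real"
    have cont: "continuous_on UNIV ?m" by (rule smooth_continuous_on[OF smooth_mollifier])
    then have [measurable]: "?m \<in> borel_measurable borel" by (rule borel_measurable_continuous_onI)
    have m1: "(\<integral>\<^sup>+y. ennreal (?m y) \<partial>lborel) = 1"
      using \<delta> nn_integral_eq_integral[OF integrable_mollifier[where 'n='n, of \<delta>]] by (simp add: mollifier_nonneg integral_mollifier)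
    have conv: "conv ?m f x - f x = (\<integral>y. ?m y * (f (x - y) - f x) \<partial>lborel)"
      and intm: "integrable lborel (\<lambda>y. ?m y * (f (x - y) - f x))" for x
    proof -
      have eq: "(\<integral>y. ?m (x - y) * f y \<partial>lborel) = (\<integral>y. ?m y * f (x - y) \<partial>lborel)"
        by (subst (1) lborel_distr_reflect[of x, symmetric], subst integral_distr) auto
      have "integrable lebesgue (\<lambda>y. ?m (x - y) * f y)"
        by (rule conv_integrable[OF cont, of \<delta>]) (use \<delta> int in \<open>auto simp: mollifier_zero integrable_completion\<close>)
      then have "integrable lborel (\<lambda>y. ?m (x - y) * f y)"
        by (subst (asm) integrable_completion) auto
      then have i: "integrable lborel (\<lambda>y. ?m y * f (x - y))"
        by (subst (asm) (1) lborel_distr_reflect[of x, symmetric], subst (asm) integrable_distr_eq) auto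
      have c: "conv ?m f x = (\<integral>y. ?m y * f (x - y) \<partial>lborel)"
        unfolding conv_def eq[symmetric] by (rule integral_completion) auto
      have i2: "integrable lborel (\<lambda>y. ?m y * f x)"
        using integrable_mollifier \<delta> by auto
      show "integrable lborel (\<lambda>y. ?m y * (f (x - y) - f x))"
        unfolding right_diff_distrib by (intro Bochner_Integration.integrable_diff i i2)
      show "conv ?m f x - f x = (\<integral>y. ?m y * (f (x - y) - f x) \<partial>lborel)"
        unfolding right_diff_distrib using i i2 \<delta> integrable_mollifier
        by (simp add: c integral_mollifier)
    qed
    have pt: "ennreal (\<bar>conv ?m f x - f x\<bar> powr p) \<le> (\<integral>\<^sup>+y. ennreal (?m y * \<bar>f (x - y) - f x\<bar> powr p) \<partial>lborel)" for x
    proof -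
      have "ennreal \<bar>conv ?m f x - f x\<bar> \<le> (\<integral>\<^sup>+y. ennreal (?m y * \<bar>f (x - y) - f x\<bar>) \<partial>lborel)"
        unfolding conv using integral_norm_bound_ennreal[OF intm[of x]] by (simp add: abs_mult mollifier_nonneg)
      then have "ennreal (\<bar>conv ?m f x - f x\<bar> powr p) \<le> ennreal (1 powr (p - 1)) * (\<integral>\<^sup>+y. ennreal (?m y * \<bar>f (x - y) - f x\<bar> powr p) \<partial>lborel)"
        by (intro nn_integral_Jensen) (use p m1 in \<open>auto simp: mollifier_nonneg\<close>)
      then show ?thesis by simp
    qed
    have "(\<integral>\<^sup>+x. ennreal (\<bar>conv ?m f x - f x\<bar> powr p) \<partial>lborel)
      \<le> (\<integral>\<^sup>+x. (\<integral>\<^sup>+y. ennreal (?m y * \<bar>f (x - y) - f x\<bar> powr p) \<partial>lborel) \<partial>lborel)"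
      by (rule nn_integral_mono) (rule pt)
    also have "\<dots> = (\<integral>\<^sup>+y. (\<integral>\<^sup>+x. ennreal (?m y * \<bar>f (x - y) - f x\<bar> powr p) \<partial>lborel) \<partial>lborel)"
      by (rule lborel_pair.Fubini') measurable
    also have "\<dots> \<le> (\<integral>\<^sup>+y. ennreal (?m y) * ennreal e \<partial>lborel)"
    proof (rule nn_integral_mono)
      fix y
      have "(\<integral>\<^sup>+x. ennreal (?m y * \<bar>f (x - y) - f x\<bar> powr p) \<partial>lborel) = ennreal (?m y) * (\<integral>\<^sup>+x. ennreal (\<bar>f (x - y) - f x\<bar> powr p) \<partial>lborel)"
        by (simp add: ennreal_mult mollifier_nonneg nn_integral_cmult)
      also have "\<dots> \<le> ennreal (?m y) * ennreal e"
      proof (cases "norm y < d")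
        case True then show ?thesis by (intro mult_left_mono d) auto
      next
        case False then show ?thesis using \<delta> by (simp add: mollifier_zero)
      qed
      finally show "(\<integral>\<^sup>+x. ennreal (?m y * \<bar>f (x - y) - f x\<bar> powr p) \<partial>lborel) \<le> ennreal (?m y) * ennreal e" .
    qed
    also have "\<dots> = ennreal e" by (simp add: nn_integral_multc m1)
    finally show "(\<integral>\<^sup>+x. ennreal (\<bar>conv ?m f x - f x\<bar> powr p) \<partial>lborel) \<le> ennreal e" .
  qed
qed

text \<open>Joint measurability of \<open>f (x - y)\<close>, needed for Tonelli's theorem, is at hand for Borel functions
  only; here \<open>f\<close> is replaced by a Borel function equal to it almost everywhere, which does not
  change the convolution.\<close>

lemma mollify_Lp:
  fixes f :: "real^'n \<Rightarrow> real"
  assumes p: "p \<ge> 1" and int: "integrable lebesgue f"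
    and fin: "(\<integral>\<^sup>+x. ennreal (\<bar>f x\<bar> powr p) \<partial>lebesgue) < \<infinity>" and e: "e > 0"
  shows "\<exists>d>0. \<forall>\<delta>. 0 < \<delta> \<and> \<delta> < d \<longrightarrow> (\<integral>\<^sup>+x. ennreal (\<bar>conv (mollifier \<delta>) f x - f x\<bar> powr p) \<partial>lebesgue) \<le> ennreal e"
proof -
  have f[measurable]: "f \<in> borel_measurable lebesgue" using int by auto
  obtain F where F[measurable]: "F \<in> borel_measurable borel" and ae: "AE x in lborel. f x = F x"
    using completion_ex_borel_measurable_real[OF f] by auto
  have ae': "AE x in lebesgue. f x = F x" using ae by (rule AE_completion)
  have F'[measurable]: "F \<in> borel_measurable lebesgue" using F by (rule borel_measurable_lebesgueI)
  have 1: "integrable lebesgue F" using int integrable_cong_AE[OF f F' ae'] by simp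
  have 2: "(\<integral>\<^sup>+x. ennreal (\<bar>F x\<bar> powr p) \<partial>lebesgue) = (\<integral>\<^sup>+x. ennreal (\<bar>f x\<bar> powr p) \<partial>lebesgue)"
    by (rule nn_integral_cong_AE) (use ae' in auto)
  obtain d where d: "d > 0" "\<And>\<delta>. 0 < \<delta> \<and> \<delta> < d \<Longrightarrow> (\<integral>\<^sup>+x. ennreal (\<bar>conv (mollifier \<delta>) F x - F x\<bar> powr p) \<partial>lborel) \<le> ennreal e"
    using mollify_Lp_borel[OF F p _ _ e] 1 2 fin by (auto simp: integrable_completion nn_integral_completion)
  show ?thesis
  proof (intro exI[of _ d] conjI allI impI d(1))
    fix \<delta> assume \<delta>: "0 < \<delta> \<and> \<delta> < d"
    have "conv (mollifier \<delta>) f x = conv (mollifier \<delta>) F x" for x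
      by (rule conv_cong_AE[OF ae' f F']) (rule smooth_continuous_on[OF smooth_mollifier])
    then have "(\<integral>\<^sup>+x. ennreal (\<bar>conv (mollifier \<delta>) f x - f x\<bar> powr p) \<partial>lebesgue) = (\<integral>\<^sup>+x. ennreal (\<bar>conv (mollifier \<delta>) F x - F x\<bar> powr p) \<partial>lebesgue)"
      by (intro nn_integral_cong_AE) (use ae' in auto)
    then show "(\<integral>\<^sup>+x. ennreal (\<bar>conv (mollifier \<delta>) f x - f x\<bar> powr p) \<partial>lebesgue) \<le> ennreal e"
      using d(2)[OF \<delta>] by (simp add: nn_integral_completion)
  qed
qed

section \<open>Test functions and weak gradients\<close>

lemma test_function_support:
  assumes "\<phi> \<in> test_functions \<Omega>"
  obtains K where "compact K" "K \<subseteq> \<Omega>" "\<And>x. x \<notin> K \<Longrightarrow> \<phi> x = 0" "\<And>x i. x \<notin> K \<Longrightarrow> partial i \<phi> x = 0"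
proof -
  let ?K = "closure {x. \<phi> x \<noteq> 0}"
  have K: "compact ?K" "?K \<subseteq> \<Omega>"
    using assms unfolding test_functions_def mem_Collect_eq by (rule conjunct1[OF conjunct2], rule conjunct2[OF conjunct2])
  have z: "\<phi> x = 0" if "x \<notin> ?K" for x
  proof (rule ccontr)
    assume "\<phi> x \<noteq> 0"
    then have "x \<in> {x. \<phi> x \<noteq> 0}" by simp
    from subsetD[OF closure_subset this] that show False by contradiction
  qed
  have pz: "partial i \<phi> x = 0" if "x \<notin> ?K" for x i
  proof (rule partial_zero_outside_support)
    show "open (- ?K)" by (intro open_Compl closed_closure)
    show "\<phi> y = 0" if "y \<in> - ?K" for y by (rule z) (use that in \<open>rule ComplD\<close>)
    show "x \<in> - ?K" using that by simp
  qed
  show ?thesis by (rule that[OF K z pz])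
qed

lemma test_function_smooth: "\<phi> \<in> test_functions \<Omega> \<Longrightarrow> smooth \<phi>"
  by (simp add: test_functions_def)

lemma test_function_bounded_support:
  assumes "\<phi> \<in> test_functions \<Omega>"
  obtains R where "\<And>x. norm x > R \<Longrightarrow> \<phi> x = 0" "\<And>x i. norm x > R \<Longrightarrow> partial i \<phi> x = 0"
proof -
  obtain K where K: "compact K" "\<And>x. x \<notin> K \<Longrightarrow> \<phi> x = 0" "\<And>x i. x \<notin> K \<Longrightarrow> partial i \<phi> x = 0"
    by (rule test_function_support[OF assms]) (rule that)
  obtain R where "\<forall>x\<in>K. norm x \<le> R"
    using compact_imp_bounded[OF K(1)] bounded_iff by blast
  then show ?thesis using that[of R] K(2,3) by force
qed

lemma test_function_bounds:
  assumes "\<phi> \<in> test_functions \<Omega>"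
  obtains B where "0 \<le> B" "\<And>x. \<bar>\<phi> x\<bar> \<le> B" "\<And>x. \<bar>partial i \<phi> x\<bar> \<le> B"
proof -
  obtain R where R: "\<And>x. norm x > R \<Longrightarrow> \<phi> x = 0" "\<And>x i. norm x > R \<Longrightarrow> partial i \<phi> x = 0"
    by (rule test_function_bounded_support[OF assms]) (rule that)
  obtain B1 where B1: "0 \<le> B1" "\<And>x. norm (\<phi> x) \<le> B1"
    by (rule bounded_support_bounded[OF smooth_continuous_on[OF test_function_smooth[OF assms]], of R]) (use R that in auto)
  obtain B2 where B2: "0 \<le> B2" "\<And>x. norm (partial i \<phi> x) \<le> B2"
    by (rule bounded_support_bounded[OF smooth_continuous_on[OF smooth_partial[OF test_function_smooth[OF assms], of i]], of R]) (use R that in auto)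
  show ?thesis
    by (rule that[of "max B1 B2"]) (use B1 B2 in \<open>auto simp: le_max_iff_disj\<close>)
qed

lemma test_function_measurable:
  assumes "\<phi> \<in> test_functions \<Omega>"
  shows "\<phi> \<in> borel_measurable lebesgue" "partial i \<phi> \<in> borel_measurable lebesgue"
  by (rule continuous_imp_measurable_lebesgue[OF smooth_continuous_on[OF test_function_smooth[OF assms]]])
    (rule continuous_imp_measurable_lebesgue[OF smooth_continuous_on[OF smooth_partial[OF test_function_smooth[OF assms]]]])

text \<open>Multiplication by the indicator of a compact set containing the support turns the integrals
  over \<open>\<Omega>\<close> in the definition of a weak gradient into integrals over the whole space of
  integrable functions, to which convolution applies.\<close>

lemma lebesgue_on_integral_support:
  fixes f g :: "real^'n \<Rightarrow> real"
  assumes "open \<Omega>" "K \<subseteq> \<Omega>" "\<And>x. x \<notin> K \<Longrightarrow> g x = 0"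
  shows "(\<integral>x. f x * g x \<partial>lebesgue_on \<Omega>) = (\<integral>x. (indicator K x * f x) * g x \<partial>lebesgue)"
proof -
  have "(\<integral>x. f x * g x \<partial>lebesgue_on \<Omega>) = (\<integral>x. indicator \<Omega> x *\<^sub>R (f x * g x) \<partial>lebesgue)"
    by (rule integral_restrict_space) (use assms(1) in auto)
  also have "\<dots> = (\<integral>x. (indicator K x * f x) * g x \<partial>lebesgue)"
    by (rule Bochner_Integration.integral_cong) (use assms in \<open>auto simp: indicator_def\<close>)
  finally show ?thesis .
qed

lemma is_weak_gradD:
  fixes u :: "real^'n \<Rightarrow> real"
  assumes "is_weak_grad \<Omega> u v" "compact K" "K \<subseteq> \<Omega>"
  shows "integrable lebesgue (\<lambda>x. indicator K x * u x)" "integrable lebesgue (\<lambda>x. indicator K x * v x $ i)"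
proof -
  have *: "u absolutely_integrable_on K" "v absolutely_integrable_on K"
    using assms by (auto simp: is_weak_grad_def)
  show "integrable lebesgue (\<lambda>x. indicator K x * u x)"
    using *(1) by (simp add: set_integrable_def)
  have "integrable lebesgue (\<lambda>x. (indicator K x *\<^sub>R v x) $ i)"
    by (rule integrable_bounded_linear[OF bounded_linear_vec_nth]) (use *(2) in \<open>simp add: set_integrable_def\<close>)
  then show "integrable lebesgue (\<lambda>x. indicator K x * v x $ i)" by simp
qed

lemma is_weak_grad_integral:
  fixes u :: "real^'n \<Rightarrow> real"
  assumes "is_weak_grad \<Omega> u v" "open \<Omega>" "K \<subseteq> \<Omega>" "\<phi> \<in> test_functions \<Omega>"
    and "\<And>x. x \<notin> K \<Longrightarrow> \<phi> x = 0" "\<And>x. x \<notin> K \<Longrightarrow> partial i \<phi> x = 0"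
  shows "(\<integral>x. (indicator K x * u x) * partial i \<phi> x \<partial>lebesgue) = - (\<integral>x. (indicator K x * v x $ i) * \<phi> x \<partial>lebesgue)"
  using assms lebesgue_on_integral_support[of \<Omega> K "partial i \<phi>" u] lebesgue_on_integral_support[of \<Omega> K \<phi> "\<lambda>x. v x $ i"]
  by (simp add: is_weak_grad_def)

text \<open>The introduction rule that matches \<open>is_weak_gradD\<close> and \<open>is_weak_grad_integral\<close>: the set \<open>K\<close>
  may be chosen together with the test function.\<close>

lemma is_weak_gradI:
  fixes u :: "real^'n \<Rightarrow> real"
  assumes "open \<Omega>"
    and "\<And>K. compact K \<Longrightarrow> K \<subseteq> \<Omega> \<Longrightarrow> integrable lebesgue (\<lambda>x. indicator K x * u x)"
    and "\<And>K i. compact K \<Longrightarrow> K \<subseteq> \<Omega> \<Longrightarrow> integrable lebesgue (\<lambda>x. indicator K x * v x $ i)"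
    and "\<And>K \<phi> i. compact K \<Longrightarrow> K \<subseteq> \<Omega> \<Longrightarrow> \<phi> \<in> test_functions \<Omega> \<Longrightarrow> (\<And>x. x \<notin> K \<Longrightarrow> \<phi> x = 0) \<Longrightarrow> (\<And>x. x \<notin> K \<Longrightarrow> partial i \<phi> x = 0) \<Longrightarrow>
      (\<integral>x. (indicator K x * u x) * partial i \<phi> x \<partial>lebesgue) = - (\<integral>x. (indicator K x * v x $ i) * \<phi> x \<partial>lebesgue)"
  shows "is_weak_grad \<Omega> u v"
  unfolding is_weak_grad_def
proof (intro conjI allI impI ballI)
  fix K assume K: "compact K \<and> K \<subseteq> \<Omega>"
  show "u absolutely_integrable_on K" using assms(2) K by (simp add: set_integrable_def)
  have "(\<lambda>x. indicator K x *\<^sub>R v x) = (\<lambda>x. \<Sum>i\<in>UNIV. (indicator K x * v x $ i) *\<^sub>R axis i 1)"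
    by (auto simp: vec_eq_iff axis_def if_distrib cong: if_cong)
  moreover have "integrable lebesgue (\<lambda>x. \<Sum>i\<in>UNIV. (indicator K x * v x $ i) *\<^sub>R (axis i 1 :: real^'n))"
    using assms(3) K by (intro Bochner_Integration.integrable_sum integrable_scaleR_left) auto
  ultimately show "v absolutely_integrable_on K" by (simp add: set_integrable_def)
next
  fix \<phi> i assume \<phi>: "\<phi> \<in> test_functions \<Omega>"
  obtain K where K: "compact K" "K \<subseteq> \<Omega>" "\<And>x. x \<notin> K \<Longrightarrow> \<phi> x = 0" "\<And>x i. x \<notin> K \<Longrightarrow> partial i \<phi> x = 0"
    using test_function_support[OF \<phi>] by metis
  show "(\<integral>x. u x * partial i \<phi> x \<partial>lebesgue_on \<Omega>) = - (\<integral>x. v x $ i * \<phi> x \<partial>lebesgue_on \<Omega>)"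
    using assms(4)[OF K(1,2) \<phi> K(3) K(4)] lebesgue_on_integral_support[of \<Omega> K "partial i \<phi>" u]
      lebesgue_on_integral_support[of \<Omega> K \<phi> "\<lambda>x. v x $ i"] assms(1) K by simp
qed

lemma compact_neighbourhood:
  fixes K :: "'a::euclidean_space set"
  assumes "compact K" "open \<Omega>" "K \<subseteq> \<Omega>"
  obtains d K' where "d > 0" "compact K'" "K \<subseteq> K'" "K' \<subseteq> \<Omega>" "\<And>x \<delta>. x \<in> K \<Longrightarrow> \<delta> \<le> d \<Longrightarrow> cball x \<delta> \<subseteq> K'"
proof -
  obtain e where e: "e > 0" "(\<Union>x\<in>K. ball x e) \<subseteq> \<Omega>"
    using compact_subset_open_imp_ball_epsilon_subset[OF assms] by blast
  let ?K = "{x + y | x y. x \<in> K \<and> y \<in> cball 0 (e/2)}"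
  have "compact ?K" by (intro compact_sums[OF assms(1)]) auto
  moreover have "K \<subseteq> ?K" using e(1) by force
  moreover have "?K \<subseteq> \<Omega>"
  proof
    fix z assume "z \<in> ?K"
    then obtain x y where "z = x + y" "x \<in> K" "norm y \<le> e/2" by auto
    then have "z \<in> ball x e" using e(1) by (auto simp: dist_norm)
    then show "z \<in> \<Omega>" using e(2) \<open>x \<in> K\<close> by blast
  qed
  moreover have "cball x \<delta> \<subseteq> ?K" if "x \<in> K" "\<delta> \<le> e/2" for x \<delta>
  proof
    fix z assume "z \<in> cball x \<delta>"
    then have "z = x + (z - x)" "z - x \<in> cball 0 (e/2)" using that by (auto simp: dist_norm norm_minus_commute)
    then show "z \<in> ?K" using that(1) by blast
  qed
  ultimately show ?thesis using that[of "e/2" ?K] e(1) by auto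
qed

lemma partial_reflect:
  assumes "smooth g"
  shows "partial i (\<lambda>y. c * g (x - y)) = (\<lambda>y. (- c) * partial i g (x - y))"
    and "(\<lambda>y. c * g (x - y)) differentiable_on UNIV"
proof -
  have d: "((\<lambda>y. c * g (x - y)) has_derivative (\<lambda>h. c * (grad g (x - y) \<bullet> (- h)))) (at y)" for y
  proof -
    have "((\<lambda>y. x - y) has_derivative uminus) (at y)" by (auto intro!: derivative_eq_intros)
    from has_derivative_compose[OF this smooth_has_grad[OF assms]] show ?thesis
      by (intro has_derivative_mult_right) simp
  qed
  show "partial i (\<lambda>y. c * g (x - y)) = (\<lambda>y. (- c) * partial i g (x - y))"
    using partial_eq_derivative[OF d] by (auto simp: inner_axis)
  show "(\<lambda>y. c * g (x - y)) differentiable_on UNIV"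
    using d by (auto simp: differentiable_on_def differentiable_def)
qed

lemma smooth_reflect:
  assumes "smooth g" shows "smooth (\<lambda>y. g (x - y))"
proof (rule smoothI[where S="{(\<lambda>y. c * g (x - y)) | c g. smooth g}"])
  have "(\<lambda>y. g (x - y)) = (\<lambda>y. 1 * g (x - y))" by simp
  then show "(\<lambda>y. g (x - y)) \<in> {(\<lambda>y. c * g (x - y)) | c g. smooth g}" using assms by blast
  fix h assume "h \<in> {(\<lambda>y. c * g (x - y)) | c g. smooth g}"
  then obtain c g where h: "h = (\<lambda>y. c * g (x - y))" "smooth g" by blast
  show "h differentiable_on UNIV" using partial_reflect(2)[OF h(2)] h(1) by simp
  show "partial i h \<in> {(\<lambda>y. c * g (x - y)) | c g. smooth g}" for i
    using partial_reflect(1)[OF h(2)] smooth_partial[OF h(2)] h(1) by blast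
qed

text \<open>A reflected and translated mollifier is the test function behind every identity for mollified
  weak gradients.\<close>

lemma mollifier_test_function:
  fixes x :: "real^'n"
  assumes "\<delta> > 0" "cball x \<delta> \<subseteq> \<Omega>"
  shows "(\<lambda>y. mollifier \<delta> (x - y)) \<in> test_functions \<Omega>"
proof -
  have "{y. mollifier \<delta> (x - y) \<noteq> 0} \<subseteq> cball x \<delta>"
    using mollifier_zero[OF assms(1)] by (force simp: dist_norm)
  then have "closure {y. mollifier \<delta> (x - y) \<noteq> 0} \<subseteq> cball x \<delta>"
    by (intro closure_minimal) auto
  then show ?thesis
    unfolding test_functions_def using assms(2) smooth_reflect[OF smooth_mollifier]
    using \<open>{y. mollifier \<delta> (x - y) \<noteq> 0} \<subseteq> cball x \<delta>\<close> bounded_subset[OF bounded_cball]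
    by (auto simp: compact_closure)
qed

text \<open>Mollification commutes with weak derivatives at points whose \<open>\<delta>\<close>-ball stays in \<open>K\<close>: this is the definition of the weak gradient, tested with
  \<open>y \<mapsto> mollifier \<delta> (x - y)\<close>.\<close>

lemma conv_weak_grad:
  fixes u :: "real^'n \<Rightarrow> real"
  assumes wg: "is_weak_grad \<Omega> u v" "open \<Omega>" and K: "K \<subseteq> \<Omega>" and \<delta>: "\<delta> > 0" "cball x \<delta> \<subseteq> K"
  shows "conv (partial i (mollifier \<delta>)) (\<lambda>y. indicator K y * u y) x = conv (mollifier \<delta>) (\<lambda>y. indicator K y * v y $ i) x"
proof -
  let ?\<phi> = "\<lambda>y. mollifier \<delta> (x - y)"
  have p: "partial i ?\<phi> = (\<lambda>y. - partial i (mollifier \<delta>) (x - y))" for i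
    using partial_reflect(1)[OF smooth_mollifier[of \<delta>], where i=i and c=1 and x=x] by simp
  have z: "?\<phi> y = 0" "partial i ?\<phi> y = 0" if "y \<notin> K" for y
  proof -
    have "y \<notin> cball x \<delta>" using that \<delta> by blast
    then have y: "norm (x - y) > \<delta>" by (simp add: dist_norm)
    show "?\<phi> y = 0" using y \<delta> by (simp add: mollifier_zero)
    show "partial i ?\<phi> y = 0"
      unfolding p using partial_zero_outside_ball(1)[of \<delta> "mollifier \<delta>" "x - y" i] y \<delta> by (simp add: mollifier_zero)
  qed
  have "(\<integral>y. (indicator K y * u y) * partial i ?\<phi> y \<partial>lebesgue) = - (\<integral>y. (indicator K y * v y $ i) * ?\<phi> y \<partial>lebesgue)"
    by (rule is_weak_grad_integral[OF wg K mollifier_test_function]) (use \<delta> K z in auto)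
  then show ?thesis
    unfolding p conv_def by (simp add: mult.commute)
qed

text \<open>An open set is a countable union of compact sets.\<close>

lemma AE_on_open_from_compacts:
  fixes \<Omega> :: "(real^'n) set"
  assumes "open \<Omega>" "\<And>K. compact K \<Longrightarrow> K \<subseteq> \<Omega> \<Longrightarrow> AE x in lebesgue. x \<in> K \<longrightarrow> P x"
  shows "AE x in lebesgue_on \<Omega>. P x"
proof -
  obtain C where C: "\<And>n::nat. compact (C n)" "\<And>n. C n \<subseteq> \<Omega>" "\<Union>(range C) = \<Omega>"
    using open_Union_compact_subsets[OF assms(1)] by metis
  have "AE x in lebesgue. \<forall>n. x \<in> C n \<longrightarrow> P x"
    unfolding AE_all_countable using assms(2) C by blast
  then have "AE x in lebesgue. x \<in> \<Omega> \<longrightarrow> P x"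
    by eventually_elim (use C(3) in blast)
  then show ?thesis
    using assms(1) by (subst AE_restrict_space_iff) auto
qed

lemma conv_mollifier_measurable:
  fixes f :: "real^'n \<Rightarrow> real"
  assumes "\<delta> > 0" "integrable lebesgue f"
  shows "conv (mollifier \<delta>) f \<in> borel_measurable lebesgue"
proof -
  have "smooth (conv (mollifier \<delta>) f)"
    by (rule smooth_conv[where R=\<delta>]) (use assms in \<open>auto simp: smooth_mollifier mollifier_zero\<close>)
  then show ?thesis by (intro continuous_imp_measurable_lebesgue smooth_continuous_on)
qed

text \<open>Near a compact set the difference of two weak gradients has mollification \<open>0\<close>, and the
  mollifications converge to the difference in \<open>L\<^sup>1\<close>.\<close>

theorem weak_grad_unique:
  fixes u :: "real^'n \<Rightarrow> real"
  assumes wg: "is_weak_grad \<Omega> u v" "is_weak_grad \<Omega> u w" and "open \<Omega>"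
  shows "AE x in lebesgue_on \<Omega>. v x = w x"
proof (rule AE_on_open_from_compacts[OF \<open>open \<Omega>\<close>])
  fix K assume K: "compact K" "K \<subseteq> \<Omega>"
  obtain d K' where d: "d > 0" and K': "compact K'" "K \<subseteq> K'" "K' \<subseteq> \<Omega>" and ball: "\<And>x \<delta>. x \<in> K \<Longrightarrow> \<delta> \<le> d \<Longrightarrow> cball x \<delta> \<subseteq> K'"
    using compact_neighbourhood[OF K(1) \<open>open \<Omega>\<close> K(2)] by metis
  have "AE x in lebesgue. x \<in> K \<longrightarrow> v x $ i = w x $ i" for i
  proof -
    define z where "z x = indicator K' x * v x $ i - indicator K' x * w x $ i" for x
    have i: "integrable lebesgue (\<lambda>x. indicator K' x * v x $ i)" "integrable lebesgue (\<lambda>x. indicator K' x * w x $ i)"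
      using is_weak_gradD(2) wg K' by blast+
    then have z: "integrable lebesgue z" unfolding z_def by simp
    have [measurable]: "z \<in> borel_measurable lebesgue" "K \<in> sets lebesgue"
      using z fmeasurableD[OF lmeasurable_compact[OF K(1)]] by auto
    have cz: "conv (mollifier \<delta>) z x = 0" if "x \<in> K" "0 < \<delta>" "\<delta> \<le> d" for x \<delta>
    proof -
      have c: "continuous_on UNIV (mollifier \<delta> :: real^'n \<Rightarrow> real)" by (rule smooth_continuous_on[OF smooth_mollifier])
      have "conv (mollifier \<delta>) z x = conv (mollifier \<delta>) (\<lambda>x. indicator K' x * v x $ i) x - conv (mollifier \<delta>) (\<lambda>x. indicator K' x * w x $ i) x"
        unfolding conv_def z_def right_diff_distrib
        by (rule Bochner_Integration.integral_diff) (use i that in \<open>auto intro!: conv_integrable[OF c, where R=\<delta>] simp: mollifier_zero\<close>)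
      also have "\<dots> = 0"
        using conv_weak_grad[OF wg(1) \<open>open \<Omega>\<close> K'(3) that(2) ball[OF that(1,3)], of i]
          conv_weak_grad[OF wg(2) \<open>open \<Omega>\<close> K'(3) that(2) ball[OF that(1,3)], of i] by simp
      finally show ?thesis .
    qed
    have "(\<integral>\<^sup>+x. ennreal (\<bar>z x\<bar> * indicator K x) \<partial>lebesgue) \<le> ennreal e" if "e > 0" for e
    proof -
      have "(\<integral>\<^sup>+x. ennreal (\<bar>z x\<bar> powr 1) \<partial>lebesgue) < \<infinity>"
        using z by (simp add: integrable_iff_bounded)
      then obtain d' where d': "d' > 0" "\<And>\<delta>. 0 < \<delta> \<and> \<delta> < d' \<Longrightarrow> (\<integral>\<^sup>+x. ennreal (\<bar>conv (mollifier \<delta>) z x - z x\<bar> powr 1) \<partial>lebesgue) \<le> ennreal e"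
        using mollify_Lp[of 1 z e, OF order_refl z _ \<open>e > 0\<close>] by blast
      define \<delta> where "\<delta> = min d (d' / 2)"
      have \<delta>: "0 < \<delta>" "\<delta> < d'" "\<delta> \<le> d" using d d'(1) by (auto simp: \<delta>_def min_def)
      have "(\<integral>\<^sup>+x. ennreal (\<bar>z x\<bar> * indicator K x) \<partial>lebesgue) \<le> (\<integral>\<^sup>+x. ennreal (\<bar>conv (mollifier \<delta>) z x - z x\<bar> powr 1) \<partial>lebesgue)"
      proof (rule nn_integral_mono)
        fix x
        show "ennreal (\<bar>z x\<bar> * indicator K x) \<le> ennreal (\<bar>conv (mollifier \<delta>) z x - z x\<bar> powr 1)"
          using cz[of x, OF _ \<delta>(1,3)] by (cases "x \<in> K") simp_all
      qed
      also have "\<dots> \<le> ennreal e" by (rule d'(2)) (simp add: \<delta>)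
      finally show ?thesis .
    qed
    then have "(\<integral>\<^sup>+x. ennreal (\<bar>z x\<bar> * indicator K x) \<partial>lebesgue) \<le> 0"
      by - (rule ennreal_le_epsilon, simp)
    then have "(\<integral>\<^sup>+x. ennreal (\<bar>z x\<bar> * indicator K x) \<partial>lebesgue) = 0" by simp
    then have "AE x in lebesgue. ennreal (\<bar>z x\<bar> * indicator K x) = 0"
    proof (rule nn_integral_0_iff_AE[THEN iffD1, rotated])
      show "(\<lambda>x. ennreal (\<bar>z x\<bar> * indicator K x)) \<in> borel_measurable lebesgue"
        by (intro measurable_compose[OF _ measurable_ennreal] borel_measurable_times borel_measurable_abs borel_measurable_indicator) fact+
    qed
    then show ?thesis
    proof eventually_elim
      case (elim x)
      then show ?case using K'(2) by (auto simp: z_def indicator_def ennreal_eq_0_iff split: if_splits)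
    qed
  qed
  then have "AE x in lebesgue. \<forall>i. x \<in> K \<longrightarrow> v x $ i = w x $ i"
    by (subst AE_all_countable) auto
  then show "AE x in lebesgue. x \<in> K \<longrightarrow> v x = w x"
    by eventually_elim (auto simp: vec_eq_iff)
qed

section \<open>Integration by parts\<close>

lemma lborel_translate:
  fixes g :: "'a::euclidean_space \<Rightarrow> real"
  assumes [measurable]: "g \<in> borel_measurable borel"
  shows "(\<integral>x. g (c + x) \<partial>lborel) = (\<integral>x. g x \<partial>lborel)" (is ?A)
    and "integrable lborel (\<lambda>x. g (c + x)) \<longleftrightarrow> integrable lborel g" (is ?B)
proof -
  have "(\<integral>x. g x \<partial>(distr lborel borel ((+) c))) = (\<integral>x. g (c + x) \<partial>lborel)"
    by (rule integral_distr) auto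
  then show ?A by (simp add: lborel_distr_plus)
  have "integrable (distr lborel borel ((+) c)) g \<longleftrightarrow> integrable lborel (\<lambda>x. g (c + x))"
    by (rule integrable_distr_eq) auto
  then show ?B by (simp add: lborel_distr_plus)
qed

text \<open>The difference quotients of \<open>g\<close> along an axis have integral \<open>0\<close> by translation invariance,
  and they converge boundedly to \<open>g'\<close>.\<close>

lemma integral_derivative_zero:
  fixes g g' :: "real^'n \<Rightarrow> real"
  assumes g: "continuous_on UNIV g" "\<And>x. norm x > R \<Longrightarrow> g x = 0"
    and g': "continuous_on UNIV g'" "\<And>x. norm x > R \<Longrightarrow> g' x = 0"
    and D: "\<And>x. ((\<lambda>t. g (x + t *\<^sub>R axis i 1)) has_real_derivative g' x) (at 0)"
  shows "(\<integral>x. g' x \<partial>lebesgue) = 0"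
proof -
  have [measurable]: "g \<in> borel_measurable borel" "g' \<in> borel_measurable borel"
    using g(1) g'(1) by (auto intro: borel_measurable_continuous_onI)
  obtain B where B: "0 \<le> B" "\<And>x. norm (g' x) \<le> B" using bounded_support_bounded[OF g'] by metis
  define e where "e = (axis i 1 :: real^'n)"
  have e: "norm e = 1" by (simp add: e_def)
  have D': "((\<lambda>t. g (x + t *\<^sub>R e)) has_real_derivative g' (x + s *\<^sub>R e)) (at s)" for x s
  proof -
    have "((\<lambda>t. g (x + (t + s) *\<^sub>R e)) has_real_derivative g' (x + s *\<^sub>R e)) (at 0)"
      using D[of "x + s *\<^sub>R e"] unfolding e_def[symmetric] by (simp add: algebra_simps)
    then show ?thesis using DERIV_shift[of "\<lambda>t. g (x + t *\<^sub>R e)" _ 0 s] by simp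
  qed
  have lip: "\<bar>g (x + t *\<^sub>R e) - g x\<bar> \<le> B * t" if "t > 0" for x t
  proof -
    have "\<exists>z>0. z < t \<and> g (x + t *\<^sub>R e) - g (x + 0 *\<^sub>R e) = (t - 0) * g' (x + z *\<^sub>R e)"
      by (rule MVT2[OF that]) (use D' in auto)
    then obtain z where "g (x + t *\<^sub>R e) - g x = t * g' (x + z *\<^sub>R e)" by auto
    then show ?thesis using B(2)[of "x + z *\<^sub>R e"] that by (simp add: abs_mult mult.commute)
  qed
  define t where "t n = inverse (real (Suc n))" for n
  have t: "t n > 0" "t n \<le> 1" for n by (auto simp: t_def inverse_le_1_iff)
  have tlim: "t \<longlonglongrightarrow> 0" unfolding t_def by (rule LIMSEQ_inverse_real_of_nat)
  define q where "q n x = (g (x + t n *\<^sub>R e) - g x) / t n" for n x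
  have [measurable]: "q n \<in> borel_measurable borel" for n unfolding q_def by measurable
  have "(\<lambda>n. \<integral>x. q n x \<partial>lborel) \<longlonglongrightarrow> (\<integral>x. g' x \<partial>lborel)"
  proof (rule integral_dominated_convergence[where w="\<lambda>x. B * indicator (cball 0 (R + 1)) x"])
    show "integrable lborel (\<lambda>x::real^'n. B * indicator (cball 0 (R + 1)) x)"
      using emeasure_lborel_cball_finite[of "0::real^'n" "R+1"] by (intro integrable_mult_right integrable_real_indicator) simp_all
    show "AE x in lborel. (\<lambda>n. q n x) \<longlonglongrightarrow> g' x"
    proof (rule AE_I2)
      fix x
      have "((\<lambda>h. (g (x + (0 + h) *\<^sub>R e) - g (x + 0 *\<^sub>R e)) / h) \<longlongrightarrow> g' x) (at 0)"
        using D[of x] unfolding e_def DERIV_def .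
      then have "((\<lambda>h. (g (x + h *\<^sub>R e) - g x) / h) \<longlongrightarrow> g' x) (at 0)" by simp
      then show "(\<lambda>n. q n x) \<longlonglongrightarrow> g' x"
        unfolding q_def
      proof (rule filterlim_compose)
        show "filterlim t (at 0) sequentially"
          using t by (intro filterlim_atI tlim always_eventually) (metis less_irrefl)
      qed
    qed
    show "AE x in lborel. norm (q n x) \<le> B * indicator (cball 0 (R + 1)) x" for n
    proof (rule AE_I2)
      fix x
      show "norm (q n x) \<le> B * indicator (cball 0 (R + 1)) x"
      proof (cases "norm x \<le> R + 1")
        case True
        have "\<bar>g (x + t n *\<^sub>R e) - g x\<bar> / t n \<le> B" using lip[OF t(1), of x n] t(1)[of n] by (simp add: divide_le_eq)
        then show ?thesis using True t(1)[of n] by (simp add: q_def)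
      next
        case False
        have "norm x \<le> norm (x + t n *\<^sub>R e) + norm (t n *\<^sub>R e)"
          using norm_triangle_ineq4[of "x + t n *\<^sub>R e" "t n *\<^sub>R e"] by simp
        with False have "norm (x + t n *\<^sub>R e) > R" "norm x > R" using t[of n] e by auto
        then show ?thesis using False g(2) by (simp add: q_def)
      qed
    qed
    show "g' \<in> borel_measurable lborel" "q n \<in> borel_measurable lborel" for n
      by simp_all
  qed
  moreover have "(\<integral>x. q n x \<partial>lborel) = 0" for n
  proof -
    have i: "integrable lborel g" by (rule integrable_continuous_bounded_support[OF g])
    have "integrable lborel (\<lambda>x. g (t n *\<^sub>R e + x))" "(\<integral>x. g (t n *\<^sub>R e + x) \<partial>lborel) = (\<integral>x. g x \<partial>lborel)"
      using i lborel_translate[of g "t n *\<^sub>R e"] by simp_all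
    then show ?thesis
      using i by (simp add: q_def add.commute[of _ "t n *\<^sub>R e"])
  qed
  ultimately have "(\<integral>x. g' x \<partial>lborel) = 0"
    by (simp add: LIMSEQ_const_iff)
  then show ?thesis by (simp add: integral_completion)
qed

lemma integrable_lebesgue_continuous:
  fixes f :: "'a::euclidean_space \<Rightarrow> real"
  assumes "continuous_on UNIV f" "\<And>x. norm x > R \<Longrightarrow> f x = 0"
  shows "integrable lebesgue f"
  using integrable_continuous_bounded_support[OF assms] borel_measurable_continuous_onI[OF assms(1)]
  by (simp add: integrable_completion)

text \<open>The function \<open>h\<close> is only required to be continuously differentiable along one axis, so that the
  lemma applies to \<open>h = G o v\<close> with \<open>v\<close> smooth and \<open>G\<close> merely \<open>C\<^sup>1\<close>.\<close>

lemma integration_by_parts_test_function: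
  fixes h h' :: "real^'n \<Rightarrow> real"
  assumes h: "continuous_on UNIV h" "continuous_on UNIV h'"
    and D: "\<And>x. ((\<lambda>t. h (x + t *\<^sub>R axis i 1)) has_real_derivative h' x) (at 0)"
    and \<phi>: "\<phi> \<in> test_functions \<Omega>"
  shows "integrable lebesgue (\<lambda>x. h x * partial i \<phi> x)" "integrable lebesgue (\<lambda>x. h' x * \<phi> x)"
    "(\<integral>x. h x * partial i \<phi> x \<partial>lebesgue) = - (\<integral>x. h' x * \<phi> x \<partial>lebesgue)"
proof -
  obtain R where R: "\<And>x. norm x > R \<Longrightarrow> \<phi> x = 0" "\<And>x i. norm x > R \<Longrightarrow> partial i \<phi> x = 0"
    by (rule test_function_bounded_support[OF \<phi>]) (rule that)
  have c: "continuous_on UNIV \<phi>" "continuous_on UNIV (partial i \<phi>)"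
    using smooth_continuous_on[OF test_function_smooth[OF \<phi>]] smooth_continuous_on[OF smooth_partial[OF test_function_smooth[OF \<phi>]]] by auto
  show 1: "integrable lebesgue (\<lambda>x. h x * partial i \<phi> x)"
    by (rule integrable_lebesgue_continuous[of _ R]) (use c h R in \<open>auto intro!: continuous_intros\<close>)
  show 2: "integrable lebesgue (\<lambda>x. h' x * \<phi> x)"
    by (rule integrable_lebesgue_continuous[of _ R]) (use c h R in \<open>auto intro!: continuous_intros\<close>)
  have "(\<integral>x. h x * partial i \<phi> x + h' x * \<phi> x \<partial>lebesgue) = 0"
  proof (rule integral_derivative_zero[of "\<lambda>x. h x * \<phi> x" R])
    fix x
    have d: "((\<lambda>t. \<phi> (x + t *\<^sub>R axis i 1)) has_real_derivative partial i \<phi> x) (at 0)"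
      using has_derivative_along_axis[OF smooth_has_grad[OF test_function_smooth[OF \<phi>]], of x i] by (simp add: inner_axis)
    show "((\<lambda>t. h (x + t *\<^sub>R axis i 1) * \<phi> (x + t *\<^sub>R axis i 1)) has_real_derivative h x * partial i \<phi> x + h' x * \<phi> x) (at 0)"
      using DERIV_mult[OF D[of x] d] by (simp add: algebra_simps)
  qed (use c h R in \<open>auto intro!: continuous_intros\<close>)
  then show "(\<integral>x. h x * partial i \<phi> x \<partial>lebesgue) = - (\<integral>x. h' x * \<phi> x \<partial>lebesgue)"
    using 1 2 by simp
qed

lemma integrable_times_test:
  fixes f :: "real^'n \<Rightarrow> real"
  assumes "integrable lebesgue f" "\<phi> \<in> test_functions \<Omega>"
  shows "integrable lebesgue (\<lambda>x. f x * \<phi> x)" "integrable lebesgue (\<lambda>x. f x * partial i \<phi> x)"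
proof -
  obtain B where B: "0 \<le> B" "\<And>x. \<bar>\<phi> x\<bar> \<le> B" "\<And>x. \<bar>partial i \<phi> x\<bar> \<le> B"
    by (rule test_function_bounds[OF assms(2), of i]) (rule that)
  show "integrable lebesgue (\<lambda>x. f x * \<phi> x)" "integrable lebesgue (\<lambda>x. f x * partial i \<phi> x)"
    using integrable_bounded_mult[OF assms(1) test_function_measurable(1)[OF assms(2)] B(2)]
      integrable_bounded_mult[OF assms(1) test_function_measurable(2)[OF assms(2)] B(3)] by (simp_all add: mult.commute)
qed

section \<open>Examples and stability of weak gradients\<close>

lemma is_weak_grad_lincomb:
  fixes u w :: "real^'n \<Rightarrow> real"
  assumes u: "is_weak_grad \<Omega> u v" and w: "is_weak_grad \<Omega> w z" and "open \<Omega>"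
  shows "is_weak_grad \<Omega> (\<lambda>x. a * u x + b * w x) (\<lambda>x. a *\<^sub>R v x + b *\<^sub>R z x)"
proof (rule is_weak_gradI[OF \<open>open \<Omega>\<close>])
  fix K assume K: "compact K" "K \<subseteq> \<Omega>"
  note i = is_weak_gradD[OF u K] is_weak_gradD[OF w K]
  have "integrable lebesgue (\<lambda>x. a * (indicator K x * u x) + b * (indicator K x * w x))" using i by simp
  then show "integrable lebesgue (\<lambda>x. indicator K x * (a * u x + b * w x))" by (simp add: algebra_simps)
  have "integrable lebesgue (\<lambda>x. a * (indicator K x * v x $ i) + b * (indicator K x * z x $ i))" for i using i by simp
  then show "integrable lebesgue (\<lambda>x. indicator K x * (a *\<^sub>R v x + b *\<^sub>R z x) $ i)" for i by (simp add: algebra_simps)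
next
  fix K \<phi> i assume K: "compact K" "K \<subseteq> \<Omega>" and \<phi>: "\<phi> \<in> test_functions \<Omega>" and s: "\<And>x. x \<notin> K \<Longrightarrow> \<phi> x = 0" "\<And>x. x \<notin> K \<Longrightarrow> partial i \<phi> x = 0"
  note i = is_weak_gradD[OF u K] is_weak_gradD[OF w K]
  note ip = integrable_times_test[OF i(1) \<phi>] integrable_times_test[OF i(2) \<phi>] integrable_times_test[OF i(3) \<phi>] integrable_times_test[OF i(4) \<phi>]
  have e1: "(\<integral>x. (indicator K x * u x) * partial i \<phi> x \<partial>lebesgue) = - (\<integral>x. (indicator K x * v x $ i) * \<phi> x \<partial>lebesgue)"
    by (rule is_weak_grad_integral[OF u \<open>open \<Omega>\<close> K(2) \<phi> s])
  have e2: "(\<integral>x. (indicator K x * w x) * partial i \<phi> x \<partial>lebesgue) = - (\<integral>x. (indicator K x * z x $ i) * \<phi> x \<partial>lebesgue)"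
    by (rule is_weak_grad_integral[OF w \<open>open \<Omega>\<close> K(2) \<phi> s])
  have "(\<integral>x. (indicator K x * (a * u x + b * w x)) * partial i \<phi> x \<partial>lebesgue)
    = (\<integral>x. a * ((indicator K x * u x) * partial i \<phi> x) + b * ((indicator K x * w x) * partial i \<phi> x) \<partial>lebesgue)"
    by (simp add: algebra_simps)
  also have "\<dots> = a * (\<integral>x. (indicator K x * u x) * partial i \<phi> x \<partial>lebesgue) + b * (\<integral>x. (indicator K x * w x) * partial i \<phi> x \<partial>lebesgue)"
    using ip by simp
  also have "\<dots> = - (a * (\<integral>x. (indicator K x * v x $ i) * \<phi> x \<partial>lebesgue) + b * (\<integral>x. (indicator K x * z x $ i) * \<phi> x \<partial>lebesgue))"
    unfolding e1 e2 by simp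
  also have "\<dots> = - (\<integral>x. a * ((indicator K x * v x $ i) * \<phi> x) + b * ((indicator K x * z x $ i) * \<phi> x) \<partial>lebesgue)"
    using ip by simp
  also have "\<dots> = - (\<integral>x. (indicator K x * (a *\<^sub>R v x + b *\<^sub>R z x) $ i) * \<phi> x \<partial>lebesgue)"
    by (simp add: algebra_simps)
  finally show "(\<integral>x. (indicator K x * (a * u x + b * w x)) * partial i \<phi> x \<partial>lebesgue) = - (\<integral>x. (indicator K x * (a *\<^sub>R v x + b *\<^sub>R z x) $ i) * \<phi> x \<partial>lebesgue)" .
qed

lemma integrable_indicator_compact:
  fixes K :: "(real^'n) set"
  assumes "compact K" shows "integrable lebesgue (\<lambda>x. indicator K x * (c::real))"
proof -
  have "K \<in> fmeasurable lebesgue" using lmeasurable_compact[OF assms] .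
  then show ?thesis
    by (intro integrable_mult_left integrable_real_indicator) (auto simp: fmeasurable_def)
qed

lemma is_weak_grad_smooth:
  fixes h :: "real^'n \<Rightarrow> real"
  assumes "open \<Omega>" "smooth h"
  shows "is_weak_grad \<Omega> h (grad h)"
proof (rule is_weak_gradI[OF \<open>open \<Omega>\<close>])
  have c: "continuous_on UNIV h" "\<And>i. continuous_on UNIV (partial i h)"
    using assms(2) smooth_continuous_on smooth_partial by blast+
  fix K :: "(real^'n) set" assume K: "compact K" "K \<subseteq> \<Omega>"
  have *: "integrable lebesgue (\<lambda>x. indicator K x * f x)" if "continuous_on UNIV f" for f :: "real^'n \<Rightarrow> real"
  proof -
    have "integrable lborel (\<lambda>x. indicator K x *\<^sub>R f x)"
      by (rule borel_integrable_compact[OF K(1) continuous_on_subset[OF that]]) simp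
    moreover have "(\<lambda>x. indicator K x *\<^sub>R f x) \<in> borel_measurable lborel"
      using calculation by (rule borel_measurable_integrable)
    ultimately show ?thesis by (simp add: integrable_completion)
  qed
  show "integrable lebesgue (\<lambda>x. indicator K x * h x)" "\<And>i. integrable lebesgue (\<lambda>x. indicator K x * grad h x $ i)"
    using *[OF c(1)] *[OF c(2)] by simp_all
  fix \<phi> i assume \<phi>: "\<phi> \<in> test_functions \<Omega>" and s: "\<And>x. x \<notin> K \<Longrightarrow> \<phi> x = 0" "\<And>x. x \<notin> K \<Longrightarrow> partial i \<phi> x = 0"
  have e: "(\<lambda>x. (indicator K x * h x) * partial i \<phi> x) = (\<lambda>x. h x * partial i \<phi> x)"
    "(\<lambda>x. (indicator K x * grad h x $ i) * \<phi> x) = (\<lambda>x. partial i h x * \<phi> x)"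
    by (rule ext, use s in \<open>auto simp: indicator_def\<close>)+
  show "(\<integral>x. (indicator K x * h x) * partial i \<phi> x \<partial>lebesgue) = - (\<integral>x. (indicator K x * grad h x $ i) * \<phi> x \<partial>lebesgue)"
    unfolding e
  proof (rule integration_by_parts_test_function(3)[OF c(1) c(2) _ \<phi>])
    show "((\<lambda>t. h (x + t *\<^sub>R axis i 1)) has_real_derivative partial i h x) (at 0)" for x
      using has_derivative_along_axis[OF smooth_has_grad[OF assms(2)], of x i] by (simp add: inner_axis)
  qed
qed

lemma partial_const: "partial i (\<lambda>x::real^'n. c) = (\<lambda>x. 0)"
  using partial_eq_derivative[OF has_derivative_const] by auto

lemma is_weak_grad_const:
  assumes "open \<Omega>" shows "is_weak_grad \<Omega> (\<lambda>x::real^'n. c) (\<lambda>x. 0)"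
proof -
  have "smooth (\<lambda>x::real^'n. c)"
    by (rule smoothI[where S="range (\<lambda>c x. c)"]) (auto simp: partial_const)
  moreover have "grad (\<lambda>x::real^'n. c) = (\<lambda>x. 0)"
    by (auto simp: vec_eq_iff partial_const)
  ultimately show ?thesis using is_weak_grad_smooth[OF assms] by metis
qed

text \<open>Local integrability on the sets of a compact exhaustion gives measurability as a pointwise
  limit.\<close>

lemma is_weak_grad_measurable:
  fixes u :: "real^'n \<Rightarrow> real"
  assumes "is_weak_grad \<Omega> u v" "open \<Omega>"
  shows "u \<in> borel_measurable (lebesgue_on \<Omega>)" "v \<in> borel_measurable (lebesgue_on \<Omega>)"
proof -
  obtain C where C: "\<And>n::nat. compact (C n)" "\<And>n. C n \<subseteq> \<Omega>" "\<Union>(range C) = \<Omega>"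
    using open_Union_compact_subsets[OF assms(2)] by metis
  define D where "D n = (\<Union>k<n. C k)" for n
  have D: "compact (D n)" "D n \<subseteq> \<Omega>" for n
    unfolding D_def using C by (auto intro!: compact_UN)
  have gen: "f \<in> borel_measurable (lebesgue_on \<Omega>)" if i: "\<And>n. integrable lebesgue (\<lambda>x. indicator (D n) x * f x)" for f :: "real^'n \<Rightarrow> real"
  proof -
    have "(\<lambda>x. f x * indicator \<Omega> x) \<in> borel_measurable lebesgue"
    proof (rule borel_measurable_LIMSEQ_metric)
      show "(\<lambda>x. indicator (D n) x * f x) \<in> borel_measurable lebesgue" for n
        using i by (rule borel_measurable_integrable)
      fix x
      show "(\<lambda>n. indicator (D n) x * f x) \<longlonglongrightarrow> f x * indicator \<Omega> x"
      proof (cases "x \<in> \<Omega>")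
        case True
        then obtain k where "x \<in> C k" using C(3) by blast
        then have "\<forall>\<^sub>F n in sequentially. indicator (D n) x * f x = f x * indicator \<Omega> x"
          by (intro eventually_mono[OF eventually_gt_at_top[of k]]) (use True in \<open>auto simp: D_def indicator_def\<close>)
        then show ?thesis by (rule tendsto_eventually)
      next
        case False
        then have "x \<notin> D n" for n using D(2) by blast
        then show ?thesis using False by simp
      qed
    qed
    then show ?thesis
      using assms(2) by (subst borel_measurable_restrict_space_iff) (auto simp: mult.commute)
  qed
  show "u \<in> borel_measurable (lebesgue_on \<Omega>)"
    by (rule gen) (rule is_weak_gradD(1)[OF assms(1) D])
  have "(\<lambda>x. v x $ i) \<in> borel_measurable (lebesgue_on \<Omega>)" for i
    by (rule gen) (rule is_weak_gradD(2)[OF assms(1) D])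
  then show "v \<in> borel_measurable (lebesgue_on \<Omega>)"
    by (subst borel_measurable_euclidean_space) (auto simp: Basis_vec_def inner_axis)
qed

section \<open>Chain rule\<close>

lemma derivative_bound_lipschitz:
  fixes G :: "real \<Rightarrow> real"
  assumes "\<And>t. (G has_real_derivative G' t) (at t)" "\<And>t. \<bar>G' t\<bar> \<le> B"
  shows "\<bar>G s - G t\<bar> \<le> B * \<bar>s - t\<bar>"
  using field_differentiable_bound[of UNIV G G' B s t] assms by simp

text \<open>The identity holds for mollifications of \<open>u\<close> by integration by parts. In the limit the factor
  \<open>G' (u\<^sub>n)\<close> converges only almost everywhere along a subsequence, but it is bounded, and it
  multiplies functions that converge in \<open>L\<^sup>1\<close>.\<close>

lemma weak_grad_chain:
  fixes u :: "real^'n \<Rightarrow> real" and G :: "real \<Rightarrow> real"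
  assumes wg: "is_weak_grad \<Omega> u v" and \<Omega>: "open \<Omega>"
    and G: "\<And>t. (G has_real_derivative G' t) (at t)" and G': "continuous_on UNIV G'" and B: "\<And>t. \<bar>G' t\<bar> \<le> B"
  shows "is_weak_grad \<Omega> (\<lambda>x. G (u x)) (\<lambda>x. G' (u x) *\<^sub>R v x)"
proof (rule is_weak_gradI[OF \<Omega>])
  have lip: "\<bar>G s - G t\<bar> \<le> B * \<bar>s - t\<bar>" for s t by (rule derivative_bound_lipschitz[OF G B])
  have "B \<ge> 0" using B[of 0] by simp
  have cG: "continuous_on UNIV G" using G by (meson DERIV_continuous_on has_field_derivative_at_within)
  have [measurable]: "G \<in> borel_measurable borel" "G' \<in> borel_measurable borel"
    using cG G' by (auto intro: borel_measurable_continuous_onI)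
  have iG: "integrable lebesgue (\<lambda>x. G (U x) - G 0)" if "integrable lebesgue U" for U :: "real^'n \<Rightarrow> real"
  proof (rule Bochner_Integration.integrable_bound)
    have [measurable]: "U \<in> borel_measurable lebesgue" using that by auto
    show "integrable lebesgue (\<lambda>x. B * U x)" using that by simp
    show "(\<lambda>x. G (U x) - G 0) \<in> borel_measurable lebesgue" by measurable
    show "AE x in lebesgue. norm (G (U x) - G 0) \<le> norm (B * U x)"
      using lip[of _ 0] \<open>B \<ge> 0\<close> by (auto simp: abs_mult)
  qed
  fix K assume K: "compact K" "K \<subseteq> \<Omega>"
  note uK = is_weak_gradD[OF wg K]
  \<comment> \<open>\<open>G\<close> need not vanish at \<open>0\<close>, so \<open>G o U\<close> is integrable only after subtracting \<open>G 0\<close>\<close>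
  have Gsplit: "indicator K x * G (u x) = (G (indicator K x * u x) - G 0) + indicator K x * G 0" for x
    by (auto simp: indicator_def)
  show "integrable lebesgue (\<lambda>x. indicator K x * G (u x))"
    unfolding Gsplit by (intro Bochner_Integration.integrable_add iG uK integrable_indicator_compact K)
  show "integrable lebesgue (\<lambda>x. indicator K x * (G' (u x) *\<^sub>R v x) $ i)" for i
  proof -
    have "integrable lebesgue (\<lambda>x. G' (indicator K x * u x) * (indicator K x * v x $ i))"
      by (rule integrable_bounded_mult[OF uK(2) _ B]) (use uK(1) in measurable)
    moreover have "G' (indicator K x * u x) * (indicator K x * v x $ i) = indicator K x * (G' (u x) *\<^sub>R v x) $ i" for x
      by (auto simp: indicator_def)
    ultimately show ?thesis by simp
  qed
  fix \<phi> i assume \<phi>: "\<phi> \<in> test_functions \<Omega>" and s: "\<And>x. x \<notin> K \<Longrightarrow> \<phi> x = 0" "\<And>x. x \<notin> K \<Longrightarrow> partial i \<phi> x = 0"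
  obtain d K' where d: "d > 0" and K': "compact K'" "K \<subseteq> K'" "K' \<subseteq> \<Omega>" and ball: "\<And>x \<delta>. x \<in> K \<Longrightarrow> \<delta> \<le> d \<Longrightarrow> cball x \<delta> \<subseteq> K'"
    by (rule compact_neighbourhood[OF K(1) \<Omega> K(2)]) (rule that)
  obtain C where C: "0 \<le> C" "\<And>x. \<bar>\<phi> x\<bar> \<le> C" "\<And>x. \<bar>partial i \<phi> x\<bar> \<le> C"
    by (rule test_function_bounds[OF \<phi>, of i]) (rule that)
  note [measurable] = test_function_measurable[OF \<phi>]
  define U where "U x = indicator K' x * u x" for x
  define V where "V x = indicator K' x * v x $ i" for x
  have iU: "integrable lebesgue U" and iV: "integrable lebesgue V"
    unfolding U_def V_def by (rule is_weak_gradD[OF wg K'(1,3)])+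
  have [measurable]: "U \<in> borel_measurable lebesgue" "V \<in> borel_measurable lebesgue" using iU iV by auto
  define good where "good n \<delta> \<longleftrightarrow> 0 < \<delta> \<and> \<delta> \<le> d \<and> (\<integral>\<^sup>+x. ennreal \<bar>conv (mollifier \<delta>) U x - U x\<bar> \<partial>lebesgue) \<le> ennreal (inverse (real (Suc n)))
      \<and> (\<integral>\<^sup>+x. ennreal \<bar>conv (mollifier \<delta>) V x - V x\<bar> \<partial>lebesgue) \<le> ennreal (inverse (real (Suc n)))" for n \<delta>
  have "\<exists>\<delta>. good n \<delta>" for n
  proof -
    have f: "(\<integral>\<^sup>+x. ennreal (\<bar>U x\<bar> powr 1) \<partial>lebesgue) < \<infinity>" "(\<integral>\<^sup>+x. ennreal (\<bar>V x\<bar> powr 1) \<partial>lebesgue) < \<infinity>"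
      using iU iV by (simp_all add: integrable_iff_bounded)
    have e: "inverse (real (Suc n)) > 0" by simp
    obtain d1 where d1: "d1 > 0" "\<forall>\<delta>. 0 < \<delta> \<and> \<delta> < d1 \<longrightarrow> (\<integral>\<^sup>+x. ennreal (\<bar>conv (mollifier \<delta>) U x - U x\<bar> powr 1) \<partial>lebesgue) \<le> ennreal (inverse (real (Suc n)))"
      using mollify_Lp[OF order_refl iU f(1) e] by blast
    obtain d2 where d2: "d2 > 0" "\<forall>\<delta>. 0 < \<delta> \<and> \<delta> < d2 \<longrightarrow> (\<integral>\<^sup>+x. ennreal (\<bar>conv (mollifier \<delta>) V x - V x\<bar> powr 1) \<partial>lebesgue) \<le> ennreal (inverse (real (Suc n)))"
      using mollify_Lp[OF order_refl iV f(2) e] by blast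
    define \<delta> where "\<delta> = min d (min (d1/2) (d2/2))"
    have "0 < \<delta>" "\<delta> < d1" "\<delta> < d2" "\<delta> \<le> d" using d d1(1) d2(1) by (auto simp: \<delta>_def min_def)
    then have "good n \<delta>"
      using d1(2)[rule_format, of \<delta>] d2(2)[rule_format, of \<delta>] by (simp add: good_def)
    then show ?thesis by blast
  qed
  then obtain \<delta> where \<delta>: "\<And>n. good n (\<delta> n)" by metis
  define a where "a n = conv (mollifier (\<delta> n)) U" for n
  define w where "w n = conv (mollifier (\<delta> n)) V" for n
  have \<delta>0: "\<delta> n > 0" "\<delta> n \<le> d" for n using \<delta>[of n] by (auto simp: good_def)
  have [measurable]: "a n \<in> borel_measurable lebesgue" "w n \<in> borel_measurable lebesgue" for n
    unfolding a_def w_def using conv_mollifier_measurable \<delta>0 iU iV by blast+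
  have L1: "integrable lebesgue (\<lambda>x. a n x - U x)" "(\<integral>x. \<bar>a n x - U x\<bar> \<partial>lebesgue) \<le> inverse (real (Suc n))"
    "integrable lebesgue (\<lambda>x. w n x - V x)" "(\<integral>x. \<bar>w n x - V x\<bar> \<partial>lebesgue) \<le> inverse (real (Suc n))" for n
  proof -
    have *: "integrable lebesgue f \<and> (\<integral>x. \<bar>f x\<bar> \<partial>lebesgue) \<le> c"
      if f: "f \<in> borel_measurable lebesgue" "(\<integral>\<^sup>+x. ennreal \<bar>f x\<bar> \<partial>lebesgue) \<le> ennreal c" "c \<ge> 0" for f :: "real^'n \<Rightarrow> real" and c
    proof -
      have i: "integrable lebesgue f"
        using f by (intro integrableI_bounded) (auto intro: le_less_trans)
      have "ennreal (\<integral>x. \<bar>f x\<bar> \<partial>lebesgue) = (\<integral>\<^sup>+x. ennreal \<bar>f x\<bar> \<partial>lebesgue)"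
        by (rule nn_integral_eq_integral[symmetric]) (use i in auto)
      with f(2) have "ennreal (\<integral>x. \<bar>f x\<bar> \<partial>lebesgue) \<le> ennreal c" by simp
      then show ?thesis using i f(3) by (simp add: ennreal_le_iff)
    qed
    show "integrable lebesgue (\<lambda>x. a n x - U x)" "(\<integral>x. \<bar>a n x - U x\<bar> \<partial>lebesgue) \<le> inverse (real (Suc n))"
      using *[of "\<lambda>x. a n x - U x" "inverse (real (Suc n))"] \<delta>[of n] unfolding good_def a_def[symmetric] by simp_all
    show "integrable lebesgue (\<lambda>x. w n x - V x)" "(\<integral>x. \<bar>w n x - V x\<bar> \<partial>lebesgue) \<le> inverse (real (Suc n))"
      using *[of "\<lambda>x. w n x - V x" "inverse (real (Suc n))"] \<delta>[of n] unfolding good_def w_def[symmetric] by simp_all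
  qed
  have inv0: "(\<lambda>n. inverse (real (Suc n))) \<longlonglongrightarrow> 0" by (rule LIMSEQ_inverse_real_of_nat)
  have "(\<lambda>n. \<integral>x. norm (a n x - U x) \<partial>lebesgue) \<longlonglongrightarrow> 0"
    by (rule tendsto_sandwich[OF _ _ tendsto_const inv0]) (use L1 in \<open>simp_all add: always_eventually\<close>)
  then obtain r :: "nat \<Rightarrow> nat" where r: "strict_mono r" and ae: "AE x in lebesgue. (\<lambda>n. a (r n) x - U x) \<longlonglongrightarrow> 0"
    using tendsto_L1_AE_subseq[of lebesgue "\<lambda>n x. a n x - U x"] L1(1) by auto
  have inv0r: "(\<lambda>n. c * inverse (real (Suc (r n)))) \<longlonglongrightarrow> 0" for c
    using tendsto_mult_right_zero[OF LIMSEQ_subseq_LIMSEQ[OF inv0 r]] by (simp add: o_def)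
  have iGU: "integrable lebesgue (\<lambda>x. G (U x) * partial i \<phi> x)"
  proof -
    have "integrable lebesgue (\<lambda>x. G 0 * partial i \<phi> x)"
      by (rule integration_by_parts_test_function(1)[OF _ _ _ \<phi>, where h'="\<lambda>x. 0"]) auto
    then have "integrable lebesgue (\<lambda>x. (G (U x) - G 0) * partial i \<phi> x + G 0 * partial i \<phi> x)"
      by (intro Bochner_Integration.integrable_add integrable_times_test(2)[OF iG[OF iU] \<phi>])
    then show ?thesis by (simp add: algebra_simps)
  qed
  have iGV: "integrable lebesgue (\<lambda>x. G' (U x) * V x * \<phi> x)"
    by (rule integrable_times_test(1)[OF integrable_bounded_mult[OF iV _ B] \<phi>]) measurable
  have parts: "integrable lebesgue (\<lambda>x. G (a n x) * partial i \<phi> x)" "integrable lebesgue (\<lambda>x. G' (a n x) * w n x * \<phi> x)"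
    "(\<integral>x. G (a n x) * partial i \<phi> x \<partial>lebesgue) = - (\<integral>x. G' (a n x) * w n x * \<phi> x \<partial>lebesgue)" for n
  proof -
    have sm: "smooth (a n)" unfolding a_def
      by (rule smooth_conv[where R="\<delta> n"]) (use \<delta>0 iU in \<open>auto simp: smooth_mollifier mollifier_zero\<close>)
    have p: "partial i (a n) = conv (partial i (mollifier (\<delta> n))) U"
      unfolding a_def by (rule partial_conv[where R="\<delta> n"]) (use \<delta>0 iU in \<open>auto simp: smooth_mollifier mollifier_zero\<close>)
    \<comment> \<open>off \<open>K\<close> the two sides may differ, but there \<open>\<phi>\<close> vanishes\<close>
    have pw: "partial i (a n) x = w n x" if "x \<in> K" for x
      unfolding p w_def U_def[abs_def] V_def[abs_def]
      by (rule conv_weak_grad[OF wg \<Omega> K'(3) \<delta>0(1) ball[OF that \<delta>0(2)]])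
    have c: "continuous_on UNIV (a n)" "continuous_on UNIV (partial i (a n))"
      using sm by (auto intro: smooth_continuous_on smooth_partial)
    have D: "((\<lambda>t. G (a n (x + t *\<^sub>R axis i 1))) has_real_derivative G' (a n x) * partial i (a n) x) (at 0)" for x
    proof -
      have "((\<lambda>t. a n (x + t *\<^sub>R axis i 1)) has_real_derivative partial i (a n) x) (at 0)"
        using has_derivative_along_axis[OF smooth_has_grad[OF sm], of x i] by (simp add: inner_axis)
      from DERIV_chain2[OF _ this, of G "G' (a n x)"] G show ?thesis by simp
    qed
    have cc: "continuous_on UNIV (\<lambda>x. G (a n x))" "continuous_on UNIV (\<lambda>x. G' (a n x) * partial i (a n) x)"
      by (auto intro!: continuous_intros c continuous_on_compose2[OF cG c(1)] continuous_on_compose2[OF G' c(1)])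
    note ibp = integration_by_parts_test_function[OF cc D \<phi>]
    have e: "G' (a n x) * w n x * \<phi> x = G' (a n x) * partial i (a n) x * \<phi> x" for x
      using pw[of x] s(1)[of x] by (cases "x \<in> K") auto
    show "integrable lebesgue (\<lambda>x. G (a n x) * partial i \<phi> x)" "integrable lebesgue (\<lambda>x. G' (a n x) * w n x * \<phi> x)"
      "(\<integral>x. G (a n x) * partial i \<phi> x \<partial>lebesgue) = - (\<integral>x. G' (a n x) * w n x * \<phi> x \<partial>lebesgue)"
      unfolding e by (rule ibp)+
  qed
  have lim1: "(\<lambda>n. \<integral>x. G (a (r n) x) * partial i \<phi> x \<partial>lebesgue) \<longlonglongrightarrow> (\<integral>x. G (U x) * partial i \<phi> x \<partial>lebesgue)"
  proof (rule Lim_transform2[OF tendsto_const])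
    show "(\<lambda>n. (\<integral>x. G (U x) * partial i \<phi> x \<partial>lebesgue) - (\<integral>x. G (a (r n) x) * partial i \<phi> x \<partial>lebesgue)) \<longlonglongrightarrow> 0"
    proof (rule Lim_null_comparison[OF always_eventually inv0r[of "B * C"]], rule allI)
      fix n
      have "\<bar>(\<integral>x. G (U x) * partial i \<phi> x \<partial>lebesgue) - (\<integral>x. G (a (r n) x) * partial i \<phi> x \<partial>lebesgue)\<bar>
        = \<bar>\<integral>x. G (U x) * partial i \<phi> x - G (a (r n) x) * partial i \<phi> x \<partial>lebesgue\<bar>"
        using iGU parts(1) by simp
      also have "\<dots> \<le> (\<integral>x. (B * C) * \<bar>a (r n) x - U x\<bar> \<partial>lebesgue)"
      proof (rule integral_abs_bound_integral)
        fix x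
        have "\<bar>G (U x) - G (a (r n) x)\<bar> * \<bar>partial i \<phi> x\<bar> \<le> (B * \<bar>U x - a (r n) x\<bar>) * C"
          using lip C(1) C(3)[of x] \<open>B \<ge> 0\<close> by (intro mult_mono) auto
        moreover have "\<bar>G (U x) * partial i \<phi> x - G (a (r n) x) * partial i \<phi> x\<bar> = \<bar>G (U x) - G (a (r n) x)\<bar> * \<bar>partial i \<phi> x\<bar>"
          by (simp flip: abs_mult left_diff_distrib)
        moreover have "(B * C) * \<bar>a (r n) x - U x\<bar> = (B * \<bar>U x - a (r n) x\<bar>) * C" by (simp add: abs_minus_commute)
        ultimately show "\<bar>G (U x) * partial i \<phi> x - G (a (r n) x) * partial i \<phi> x\<bar> \<le> (B * C) * \<bar>a (r n) x - U x\<bar>" by linarith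
      qed (use iGU parts(1) L1(1) in auto)
      also have "\<dots> \<le> B * C * inverse (real (Suc (r n)))"
        using L1(2)[of "r n"] \<open>B \<ge> 0\<close> C(1) by (simp add: mult_left_mono)
      finally show "norm ((\<integral>x. G (U x) * partial i \<phi> x \<partial>lebesgue) - (\<integral>x. G (a (r n) x) * partial i \<phi> x \<partial>lebesgue)) \<le> B * C * inverse (real (Suc (r n)))" by simp
    qed
  qed
  have lim2: "(\<lambda>n. \<integral>x. G' (a (r n) x) * w (r n) x * \<phi> x \<partial>lebesgue) \<longlonglongrightarrow> (\<integral>x. G' (U x) * V x * \<phi> x \<partial>lebesgue)"
  proof -
    have iA: "integrable lebesgue (\<lambda>x. G' (a (r n) x) * (w (r n) x - V x) * \<phi> x)" for n
      by (rule integrable_times_test(1)[OF integrable_bounded_mult[OF L1(3) _ B] \<phi>]) measurable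
    have iB: "integrable lebesgue (\<lambda>x. G' (a (r n) x) * V x * \<phi> x)" for n
      by (rule integrable_times_test(1)[OF integrable_bounded_mult[OF iV _ B] \<phi>]) measurable
    have "(\<lambda>n. \<integral>x. G' (a (r n) x) * (w (r n) x - V x) * \<phi> x \<partial>lebesgue) \<longlonglongrightarrow> 0"
    proof (rule Lim_null_comparison[OF always_eventually inv0r[of "B * C"]], rule allI)
      fix n
      have "\<bar>\<integral>x. G' (a (r n) x) * (w (r n) x - V x) * \<phi> x \<partial>lebesgue\<bar> \<le> (\<integral>x. (B * C) * \<bar>w (r n) x - V x\<bar> \<partial>lebesgue)"
      proof (rule integral_abs_bound_integral)
        fix x
        have "(\<bar>G' (a (r n) x)\<bar> * \<bar>w (r n) x - V x\<bar>) * \<bar>\<phi> x\<bar> \<le> (B * \<bar>w (r n) x - V x\<bar>) * C"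
          using B C(1) C(2)[of x] \<open>B \<ge> 0\<close> by (intro mult_mono mult_right_mono) auto
        then show "\<bar>G' (a (r n) x) * (w (r n) x - V x) * \<phi> x\<bar> \<le> (B * C) * \<bar>w (r n) x - V x\<bar>"
          by (simp add: abs_mult mult_ac)
      qed (use iA L1(3) in auto)
      also have "\<dots> \<le> B * C * inverse (real (Suc (r n)))"
        using L1(4)[of "r n"] \<open>B \<ge> 0\<close> C(1) by (simp add: mult_left_mono)
      finally show "norm (\<integral>x. G' (a (r n) x) * (w (r n) x - V x) * \<phi> x \<partial>lebesgue) \<le> B * C * inverse (real (Suc (r n)))" by simp
    qed
    moreover have "(\<lambda>n. \<integral>x. G' (a (r n) x) * V x * \<phi> x \<partial>lebesgue) \<longlonglongrightarrow> (\<integral>x. G' (U x) * V x * \<phi> x \<partial>lebesgue)"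
    proof (rule integral_dominated_convergence[where w="\<lambda>x. (B * C) * \<bar>V x\<bar>"])
      show "AE x in lebesgue. (\<lambda>n. G' (a (r n) x) * V x * \<phi> x) \<longlonglongrightarrow> G' (U x) * V x * \<phi> x"
        using ae
      proof eventually_elim
        case (elim x)
        then have "(\<lambda>n. a (r n) x) \<longlonglongrightarrow> U x" using Lim_transform[OF tendsto_const elim] by simp
        then have "(\<lambda>n. G' (a (r n) x)) \<longlonglongrightarrow> G' (U x)"
          by (rule continuous_on_tendsto_compose[OF G']) auto
        then show ?case by (intro tendsto_intros)
      qed
      show "AE x in lebesgue. norm (G' (a (r n) x) * V x * \<phi> x) \<le> (B * C) * \<bar>V x\<bar>" for n
      proof (rule AE_I2)
        fix x
        have "(\<bar>G' (a (r n) x)\<bar> * \<bar>V x\<bar>) * \<bar>\<phi> x\<bar> \<le> (B * \<bar>V x\<bar>) * C"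
          using B C(1) C(2)[of x] \<open>B \<ge> 0\<close> by (intro mult_mono mult_right_mono) auto
        then show "norm (G' (a (r n) x) * V x * \<phi> x) \<le> (B * C) * \<bar>V x\<bar>" by (simp add: abs_mult mult_ac)
      qed
      show "integrable lebesgue (\<lambda>x. B * C * \<bar>V x\<bar>)" using iV by simp
    qed measurable
    ultimately have "(\<lambda>n. (\<integral>x. G' (a (r n) x) * (w (r n) x - V x) * \<phi> x \<partial>lebesgue) + (\<integral>x. G' (a (r n) x) * V x * \<phi> x \<partial>lebesgue)) \<longlonglongrightarrow> 0 + (\<integral>x. G' (U x) * V x * \<phi> x \<partial>lebesgue)"
      by (rule tendsto_add)
    moreover have "(\<integral>x. G' (a (r n) x) * (w (r n) x - V x) * \<phi> x \<partial>lebesgue) + (\<integral>x. G' (a (r n) x) * V x * \<phi> x \<partial>lebesgue) = (\<integral>x. G' (a (r n) x) * w (r n) x * \<phi> x \<partial>lebesgue)" for n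
      by (subst Bochner_Integration.integral_add[symmetric, OF iA iB]) (simp add: algebra_simps)
    ultimately show ?thesis by simp
  qed
  have "(\<lambda>n. \<integral>x. G (a (r n) x) * partial i \<phi> x \<partial>lebesgue) \<longlonglongrightarrow> - (\<integral>x. G' (U x) * V x * \<phi> x \<partial>lebesgue)"
    unfolding parts(3) by (rule tendsto_minus[OF lim2])
  from LIMSEQ_unique[OF lim1 this]
  have eq: "(\<integral>x. G (U x) * partial i \<phi> x \<partial>lebesgue) = - (\<integral>x. G' (U x) * V x * \<phi> x \<partial>lebesgue)" .
  have e1: "indicator K x * G (u x) * partial i \<phi> x = G (U x) * partial i \<phi> x" for x
    using s(2)[of x] K'(2) by (cases "x \<in> K") (auto simp: U_def indicator_def)
  have e2: "indicator K x * (G' (u x) *\<^sub>R v x) $ i * \<phi> x = G' (U x) * V x * \<phi> x" for x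
    using s(1)[of x] K'(2) by (cases "x \<in> K") (auto simp: U_def V_def indicator_def)
  show "(\<integral>x. indicator K x * G (u x) * partial i \<phi> x \<partial>lebesgue) = - (\<integral>x. indicator K x * (G' (u x) *\<^sub>R v x) $ i * \<phi> x \<partial>lebesgue)"
    unfolding e1 e2 by (rule eq)
qed

section \<open>The positive part\<close>

text \<open>The functions \<open>t \<mapsto> t\<^sub>+\<^sup>2 / (t\<^sub>+ + e)\<close> are \<open>C\<^sup>1\<close> approximations of the positive part from below,
  with derivatives in \<open>[0, 1]\<close> that vanish for \<open>t \<le> 0\<close> and tend to \<open>1\<close> for \<open>t > 0\<close>.\<close>

lemma smoothed_positive_part_derivative:
  fixes e :: real
  assumes "e > 0"
  shows "((\<lambda>t. (max t 0)\<^sup>2 / (max t 0 + e)) has_real_derivative 1 - e\<^sup>2 / (max t 0 + e)\<^sup>2) (at t)"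
proof -
  consider "t > 0" | "t < 0" | "t = 0" by linarith
  then show ?thesis
  proof cases
    case 1
    have "((\<lambda>t. t\<^sup>2 / (t + e)) has_real_derivative ((2 * t) * (t + e) - t\<^sup>2 * 1) / ((t + e) * (t + e))) (at t)"
      using 1 assms by (auto intro!: derivative_eq_intros)
    moreover have "((2 * t) * (t + e) - t\<^sup>2 * 1) / ((t + e) * (t + e)) = 1 - e\<^sup>2 / (t + e)\<^sup>2"
    proof -
      have p: "t + e \<noteq> 0" using 1 assms by simp
      have "(2 * t) * (t + e) - t\<^sup>2 * 1 = (t + e)\<^sup>2 - e\<^sup>2" by (simp add: power2_eq_square algebra_simps)
      then show ?thesis using p by (simp add: diff_divide_distrib power2_eq_square)
    qed
    ultimately have "((\<lambda>t. t\<^sup>2 / (t + e)) has_real_derivative 1 - e\<^sup>2 / (max t 0 + e)\<^sup>2) (at t)"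
      using 1 by simp
    then show ?thesis
      by (rule has_field_derivative_transform_within_open[where S="{0<..}"]) (use 1 in auto)
  next
    case 2
    have "((\<lambda>t. 0) has_real_derivative 1 - e\<^sup>2 / (max t 0 + e)\<^sup>2) (at t)"
      using 2 assms by simp
    then show ?thesis
      by (rule has_field_derivative_transform_within_open[where S="{..<0}"]) (use 2 in auto)
  next
    case 3
    have "((\<lambda>h. ((max h 0)\<^sup>2 / (max h 0 + e)) / h) \<longlongrightarrow> 0) (at 0)"
    proof (rule tendsto_0_le[where f="\<lambda>h. h" and K="1 / e"])
      show "\<forall>\<^sub>F h in at 0. norm (((max h 0)\<^sup>2 / (max h 0 + e)) / h) \<le> norm h * (1 / e)"
      proof (rule always_eventually, rule allI)
        fix h :: real
        show "norm (((max h 0)\<^sup>2 / (max h 0 + e)) / h) \<le> norm h * (1 / e)"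
        proof (cases "h > 0")
          case True
          have "h / (h + e) \<le> h / e" using True assms by (intro divide_left_mono) auto
          then show ?thesis using True assms by (simp add: power2_eq_square)
        qed (use assms in \<open>simp add: max_def divide_nonpos_pos\<close>)
      qed
    qed (rule tendsto_ident_at)
    then show ?thesis
      using 3 assms by (simp add: has_field_derivative_iff)
  qed
qed

text \<open>The chain rule for the smoothed positive parts, followed by dominated convergence. As their
  derivatives at \<open>0\<close> are \<open>0\<close>, the limit is the strict indicator \<open>of_bool (u x > 0)\<close>.\<close>

theorem weak_grad_positive_part:
  fixes u :: "real^'n \<Rightarrow> real"
  assumes wg: "is_weak_grad \<Omega> u v" and \<Omega>: "open \<Omega>"
  shows "is_weak_grad \<Omega> (\<lambda>x. max (u x) 0) (\<lambda>x. of_bool (u x > 0) *\<^sub>R v x)"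
proof (rule is_weak_gradI[OF \<Omega>])
  fix K assume K: "compact K" "K \<subseteq> \<Omega>"
  define U where "U x = indicator K x * u x" for x
  define V where "V i x = indicator K x * v x $ i" for i x
  have iU: "integrable lebesgue U" and iV: "integrable lebesgue (V i)" for i
    unfolding U_def[abs_def] V_def[abs_def] by (rule is_weak_gradD[OF wg K])+
  have [measurable]: "U \<in> borel_measurable lebesgue" "V i \<in> borel_measurable lebesgue" for i using iU iV by auto
  have eU: "indicator K x * max (u x) 0 = max (U x) 0" for x by (auto simp: U_def indicator_def)
  have eV: "indicator K x * (of_bool (u x > 0) *\<^sub>R v x) $ i = of_bool (U x > 0) * V i x" for x i by (auto simp: U_def V_def indicator_def)
  show i1: "integrable lebesgue (\<lambda>x. indicator K x * max (u x) 0)"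
    unfolding eU by (rule Bochner_Integration.integrable_bound[OF iU]) (auto intro!: AE_I2)
  show i2: "integrable lebesgue (\<lambda>x. indicator K x * (of_bool (u x > 0) *\<^sub>R v x) $ i)" for i
    unfolding eV by (rule Bochner_Integration.integrable_bound[OF iV[of i]]) (auto intro!: AE_I2)
  fix \<phi> i assume \<phi>: "\<phi> \<in> test_functions \<Omega>" and s: "\<And>x. x \<notin> K \<Longrightarrow> \<phi> x = 0" "\<And>x. x \<notin> K \<Longrightarrow> partial i \<phi> x = 0"
  note [measurable] = test_function_measurable[OF \<phi>]
  define e where "e n = inverse (real (Suc n))" for n
  have e: "e n > 0" for n by (simp add: e_def)
  have e0: "e \<longlonglongrightarrow> 0" unfolding e_def by (rule LIMSEQ_inverse_real_of_nat)
  define G where "G n t = (max t 0)\<^sup>2 / (max t 0 + e n)" for n t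
  define G' where "G' n t = 1 - (e n)\<^sup>2 / (max t 0 + e n)\<^sup>2" for n t
  have nz: "max t 0 + e n \<noteq> 0" "max t 0 + e n > 0" for t n using e[of n] by (auto simp: max_def)
  have cG': "continuous_on UNIV (G' n)" for n
    unfolding G'_def using nz(1) by (intro continuous_intros) auto
  have cG: "continuous_on UNIV (G n)" for n
    unfolding G_def using nz(1) by (intro continuous_intros) auto
  have [measurable]: "G n \<in> borel_measurable borel" "G' n \<in> borel_measurable borel" for n
    using cG cG' by (auto intro: borel_measurable_continuous_onI)
  have G'b: "\<bar>G' n t\<bar> \<le> 1" for n t
  proof -
    have "(e n)\<^sup>2 / (max t 0 + e n)\<^sup>2 \<le> 1"
      using e[of n] by (subst divide_le_eq_1_pos) (auto intro!: power_mono simp: nz)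
    moreover have "0 \<le> (e n)\<^sup>2 / (max t 0 + e n)\<^sup>2" by simp
    ultimately show ?thesis unfolding G'_def by linarith
  qed
  have Gb: "0 \<le> G n t" "G n t \<le> max t 0" for n t
  proof -
    show "0 \<le> G n t" unfolding G_def using nz(2)[of t n] by simp
    have "(max t 0)\<^sup>2 \<le> max t 0 * (max t 0 + e n)" using e[of n] by (simp add: power2_eq_square max_def)
    then show "G n t \<le> max t 0" unfolding G_def using nz(2)[of t n] by (simp add: divide_le_eq)
  qed
  have Glim: "(\<lambda>n. G n t) \<longlonglongrightarrow> max t 0" for t
  proof (cases "t > 0")
    case True
    have "(\<lambda>n. (max t 0)\<^sup>2 / (max t 0 + e n)) \<longlonglongrightarrow> (max t 0)\<^sup>2 / (max t 0 + 0)"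
      using True by (intro tendsto_intros e0) auto
    then show ?thesis using True by (simp add: G_def power2_eq_square)
  qed (simp add: G_def max_def)
  have G'lim: "(\<lambda>n. G' n t) \<longlonglongrightarrow> of_bool (t > 0)" for t
  proof (cases "t > 0")
    case True
    have "(\<lambda>n. 1 - (e n)\<^sup>2 / (max t 0 + e n)\<^sup>2) \<longlonglongrightarrow> 1 - 0\<^sup>2 / (max t 0 + 0)\<^sup>2"
      using True by (intro tendsto_intros e0) auto
    then show ?thesis using True by (simp add: G'_def)
  next
    case False
    have "e n \<noteq> 0" for n using e[of n] by simp
    then show ?thesis using False by (simp add: G'_def max_def)
  qed
  have id: "(\<integral>x. G n (U x) * partial i \<phi> x \<partial>lebesgue) = - (\<integral>x. G' n (U x) * V i x * \<phi> x \<partial>lebesgue)" for n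
  proof -
    have "is_weak_grad \<Omega> (\<lambda>x. G n (u x)) (\<lambda>x. G' n (u x) *\<^sub>R v x)"
      by (rule weak_grad_chain[OF wg \<Omega> _ cG' G'b])
        (unfold G_def G'_def, rule smoothed_positive_part_derivative[OF e])
    from is_weak_grad_integral[OF this \<Omega> K(2) \<phi> s]
    have "(\<integral>x. (indicator K x * G n (u x)) * partial i \<phi> x \<partial>lebesgue) = - (\<integral>x. (indicator K x * (G' n (u x) *\<^sub>R v x) $ i) * \<phi> x \<partial>lebesgue)" .
    moreover have "(\<lambda>x. (indicator K x * G n (u x)) * partial i \<phi> x) = (\<lambda>x. G n (U x) * partial i \<phi> x)"
    proof
      fix x show "(indicator K x * G n (u x)) * partial i \<phi> x = G n (U x) * partial i \<phi> x"
        using s(2)[of x] by (cases "x \<in> K") (auto simp: U_def)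
    qed
    moreover have "(\<lambda>x. (indicator K x * (G' n (u x) *\<^sub>R v x) $ i) * \<phi> x) = (\<lambda>x. G' n (U x) * V i x * \<phi> x)"
    proof
      fix x show "(indicator K x * (G' n (u x) *\<^sub>R v x) $ i) * \<phi> x = G' n (U x) * V i x * \<phi> x"
        using s(1)[of x] by (cases "x \<in> K") (auto simp: U_def V_def)
    qed
    ultimately show ?thesis by metis
  qed
  have l1: "(\<lambda>n. \<integral>x. G n (U x) * partial i \<phi> x \<partial>lebesgue) \<longlonglongrightarrow> (\<integral>x. max (U x) 0 * partial i \<phi> x \<partial>lebesgue)"
  proof (rule integral_dominated_convergence[where w="\<lambda>x. \<bar>U x * partial i \<phi> x\<bar>"])
    show "integrable lebesgue (\<lambda>x. \<bar>U x * partial i \<phi> x\<bar>)" using integrable_times_test(2)[OF iU \<phi>] by (rule integrable_abs)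
    show "AE x in lebesgue. (\<lambda>n. G n (U x) * partial i \<phi> x) \<longlonglongrightarrow> max (U x) 0 * partial i \<phi> x"
      by (intro AE_I2 tendsto_intros Glim)
    show "AE x in lebesgue. norm (G n (U x) * partial i \<phi> x) \<le> \<bar>U x * partial i \<phi> x\<bar>" for n
    proof (rule AE_I2)
      fix x
      have "\<bar>G n (U x)\<bar> \<le> \<bar>U x\<bar>" using Gb[of n "U x"] by (auto simp: max_def split: if_splits)
      then show "norm (G n (U x) * partial i \<phi> x) \<le> \<bar>U x * partial i \<phi> x\<bar>" by (simp add: abs_mult mult_right_mono)
    qed
  qed measurable
  have l2: "(\<lambda>n. \<integral>x. G' n (U x) * V i x * \<phi> x \<partial>lebesgue) \<longlonglongrightarrow> (\<integral>x. of_bool (U x > 0) * V i x * \<phi> x \<partial>lebesgue)"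
  proof (rule integral_dominated_convergence[where w="\<lambda>x. \<bar>V i x * \<phi> x\<bar>"])
    show "integrable lebesgue (\<lambda>x. \<bar>V i x * \<phi> x\<bar>)" using integrable_times_test(1)[OF iV \<phi>] by (rule integrable_abs)
    show "AE x in lebesgue. (\<lambda>n. G' n (U x) * V i x * \<phi> x) \<longlonglongrightarrow> of_bool (U x > 0) * V i x * \<phi> x"
      by (intro AE_I2 tendsto_intros G'lim)
    show "AE x in lebesgue. norm (G' n (U x) * V i x * \<phi> x) \<le> \<bar>V i x * \<phi> x\<bar>" for n
    proof (rule AE_I2)
      fix x
      have "\<bar>G' n (U x)\<bar> * \<bar>V i x * \<phi> x\<bar> \<le> 1 * \<bar>V i x * \<phi> x\<bar>" by (intro mult_right_mono G'b) auto
      then show "norm (G' n (U x) * V i x * \<phi> x) \<le> \<bar>V i x * \<phi> x\<bar>" by (simp add: abs_mult mult.assoc)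
    qed
  qed measurable
  have "(\<integral>x. max (U x) 0 * partial i \<phi> x \<partial>lebesgue) = - (\<integral>x. of_bool (U x > 0) * V i x * \<phi> x \<partial>lebesgue)"
    using LIMSEQ_unique[OF l1[unfolded id] tendsto_minus[OF l2]] .
  then show "(\<integral>x. indicator K x * max (u x) 0 * partial i \<phi> x \<partial>lebesgue) = - (\<integral>x. indicator K x * (of_bool (u x > 0) *\<^sub>R v x) $ i * \<phi> x \<partial>lebesgue)"
    unfolding eU eV .
qed

text \<open>Writing \<open>u\<close> as the difference of the positive parts of \<open>u\<close> and \<open>-u\<close> gives a second weak gradient
  that vanishes on \<open>{u = 0}\<close>; uniqueness does the rest.\<close>

theorem weak_grad_zero_set:
  fixes u :: "real^'n \<Rightarrow> real"
  assumes wg: "is_weak_grad \<Omega> u v" and \<Omega>: "open \<Omega>"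
  shows "AE x in lebesgue_on \<Omega>. u x = 0 \<longrightarrow> v x = 0"
proof -
  have m: "is_weak_grad \<Omega> (\<lambda>x. - u x) (\<lambda>x. - v x)"
    using is_weak_grad_lincomb[OF wg wg \<Omega>, of "-1" 0] by simp
  have "is_weak_grad \<Omega> (\<lambda>x. 1 * max (u x) 0 + (-1) * max (- u x) 0)
      (\<lambda>x. 1 *\<^sub>R (of_bool (u x > 0) *\<^sub>R v x) + (-1) *\<^sub>R (of_bool (- u x > 0) *\<^sub>R (- v x)))"
    by (rule is_weak_grad_lincomb[OF weak_grad_positive_part[OF wg \<Omega>] weak_grad_positive_part[OF m \<Omega>] \<Omega>])
  moreover have "(\<lambda>x. 1 * max (u x) 0 + (-1) * max (- u x) 0) = u" by (auto simp: max_def)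
  ultimately have "is_weak_grad \<Omega> u (\<lambda>x. 1 *\<^sub>R (of_bool (u x > 0) *\<^sub>R v x) + (-1) *\<^sub>R (of_bool (- u x > 0) *\<^sub>R (- v x)))" by simp
  from weak_grad_unique[OF wg this \<Omega>] show ?thesis
    by (rule eventually_mono) auto
qed

section \<open>A Sobolev inequality below the critical exponent\<close>

lemma nn_integral_lborel_scale:
  fixes h :: "'a::euclidean_space \<Rightarrow> ennreal"
  assumes [measurable]: "h \<in> borel_measurable borel" and "t > 0"
  shows "ennreal (t ^ DIM('a)) * (\<integral>\<^sup>+z. h (x + t *\<^sub>R z) \<partial>lborel) = (\<integral>\<^sup>+z. h z \<partial>lborel)"
proof -
  have "(\<integral>\<^sup>+z. h z \<partial>lborel) = (\<integral>\<^sup>+z. h z \<partial>(density (distr lborel borel (\<lambda>z. x + t *\<^sub>R z)) (\<lambda>_. ennreal (\<bar>t\<bar> ^ DIM('a)))))"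
    using lborel_affine[of t x] assms(2) by simp
  also have "\<dots> = (\<integral>\<^sup>+z. ennreal (\<bar>t\<bar> ^ DIM('a)) * h z \<partial>(distr lborel borel (\<lambda>z. x + t *\<^sub>R z)))"
    by (rule nn_integral_density) auto
  also have "\<dots> = (\<integral>\<^sup>+z. ennreal (\<bar>t\<bar> ^ DIM('a)) * h (x + t *\<^sub>R z) \<partial>lborel)"
    by (rule nn_integral_distr) auto
  also have "\<dots> = ennreal (\<bar>t\<bar> ^ DIM('a)) * (\<integral>\<^sup>+z. h (x + t *\<^sub>R z) \<partial>lborel)"
    by (rule nn_integral_cmult) auto
  finally show ?thesis using assms(2) by simp
qed

text \<open>The segment from \<open>x\<close> in direction \<open>z\<close> has left the support of \<open>\<phi>\<close> at time \<open>2 R\<close>, since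
  \<open>\<bar>z\<bar> \<ge> 1\<close>; the factor \<open>2\<close> in the integrand is the upper bound for \<open>\<bar>z\<bar>\<close>.\<close>

lemma radial_bound:
  fixes \<phi> :: "real^'n \<Rightarrow> real"
  assumes \<phi>: "smooth \<phi>" and supp: "\<And>x. norm x \<ge> R \<Longrightarrow> \<phi> x = 0" and R: "R > 0"
    and z: "1 \<le> norm z" "norm z \<le> 2" and x: "norm x < R"
  shows "ennreal \<bar>\<phi> x\<bar> \<le> (\<integral>\<^sup>+t. ennreal (2 * norm (grad \<phi> (x + t *\<^sub>R z))) * indicator {0..2*R} t \<partial>lborel)"
proof -
  have D: "((\<lambda>t. \<phi> (x + t *\<^sub>R z)) has_vector_derivative grad \<phi> (x + t *\<^sub>R z) \<bullet> z) (at t within {0..2*R})" for t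
  proof -
    have "((\<lambda>t. x + t *\<^sub>R z) has_derivative (\<lambda>h. h *\<^sub>R z)) (at t within {0..2*R})"
      by (auto intro!: derivative_eq_intros)
    from has_derivative_compose[OF this smooth_has_grad[OF \<phi>]]
    show ?thesis by (simp add: has_vector_derivative_def mult.commute)
  qed
  have "norm (x + (2*R) *\<^sub>R z) \<ge> R"
  proof -
    have "norm ((2*R) *\<^sub>R z) \<le> norm (x + (2*R) *\<^sub>R z) + norm x"
      using norm_triangle_ineq4[of "x + (2*R) *\<^sub>R z" x] by simp
    moreover have "norm ((2*R) *\<^sub>R z) \<ge> 2 * R" using z R by simp
    ultimately show ?thesis using x by linarith
  qed
  then have z0: "\<phi> (x + (2*R) *\<^sub>R z) = 0" by (rule supp)
  have "((\<lambda>t. grad \<phi> (x + t *\<^sub>R z) \<bullet> z) has_integral (\<phi> (x + (2*R) *\<^sub>R z) - \<phi> (x + 0 *\<^sub>R z))) {0..2*R}"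
    by (rule fundamental_theorem_of_calculus[OF _ D]) (use R in auto)
  then have I: "((\<lambda>t. grad \<phi> (x + t *\<^sub>R z) \<bullet> z) has_integral (- \<phi> x)) {0..2*R}" using z0 by simp
  have c: "continuous_on {0..2*R} (\<lambda>t. 2 * norm (grad \<phi> (x + t *\<^sub>R z)))"
    by (intro continuous_intros continuous_on_compose2[OF smooth_continuous_grad[OF \<phi>, of UNIV]]) auto
  then have J: "((\<lambda>t. 2 * norm (grad \<phi> (x + t *\<^sub>R z))) has_integral integral {0..2*R} (\<lambda>t. 2 * norm (grad \<phi> (x + t *\<^sub>R z)))) {0..2*R}"
    using integrable_continuous_interval integrable_integral by blast
  have "norm (- \<phi> x) \<le> integral {0..2*R} (\<lambda>t. 2 * norm (grad \<phi> (x + t *\<^sub>R z)))"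
    unfolding integral_unique[OF I, symmetric]
  proof (rule integral_norm_bound_integral)
    show "norm (grad \<phi> (x + t *\<^sub>R z) \<bullet> z) \<le> 2 * norm (grad \<phi> (x + t *\<^sub>R z))" for t
      using Cauchy_Schwarz_ineq2[of "grad \<phi> (x + t *\<^sub>R z)" z] mult_left_mono[OF z(2), of "norm (grad \<phi> (x + t *\<^sub>R z))"] by simp
  qed (use I J in \<open>auto simp: has_integral_integrable\<close>)
  then have "ennreal \<bar>\<phi> x\<bar> \<le> ennreal (integral {0..2*R} (\<lambda>t. 2 * norm (grad \<phi> (x + t *\<^sub>R z))))"
    by (intro ennreal_leI) simp
  also have "\<dots> = (\<integral>\<^sup>+t. ennreal (2 * norm (grad \<phi> (x + t *\<^sub>R z))) * indicator {0..2*R} t \<partial>lborel)"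
    by (rule nn_integral_has_integral_lebesgue'[OF _ J, symmetric]) simp
  finally show ?thesis .
qed

text \<open>Write \<open>g = \<bar>grad \<phi>\<bar>\<close>, let \<open>A\<close> be the annulus \<open>1 \<le> \<bar>z\<bar> \<le> 2\<close>, and put
  \<open>k t x = \<integral>\<^bsub>A\<^esub> g (x + t z) dz\<close>. Averaging \<open>radial_bound\<close> over \<open>z \<in> A\<close> gives
  \<open>\<bar>A\<bar> \<bar>\<phi> x\<bar> / 2 \<le> \<integral>\<^sub>0\<^sup>2\<^sup>R k t x dt\<close>. By Jensen's inequality \<open>(k t x)\<^sup>p\<close> is at most a constant times
  \<open>H t x = \<integral>\<^bsub>A\<^esub> g (x + t z)\<^sup>p dz\<close>. This has two bounds: \<open>H t x \<le> G\<^sup>p / t\<^sup>n\<close> for each \<open>x\<close>, by the substitution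
  \<open>x + t z\<close>, and \<open>\<integral> H t x dx \<le> \<bar>A\<bar> G\<^sup>p\<close>. Interpolating, the \<open>q\<close>-th power of \<open>k t\<close> has integral at most
  a constant times \<open>t\<^sup>-\<^sup>n\<^sup>(\<^sup>q\<^sup>-\<^sup>p\<^sup>)\<^sup>/\<^sup>p G\<^sup>q\<close>. Its \<open>q\<close>-th root is integrable at \<open>t = 0\<close> exactly if
  \<open>n (1/p - 1/q) < 1\<close>.\<close>

theorem sobolev_test_functions:
  fixes \<Omega> :: "(real^'n) set" and p q :: real
  assumes \<Omega>: "bounded \<Omega>" and pq: "1 \<le> p" "p < q" and sub: "real CARD('n) * (1 / p - 1 / q) < 1"
  shows "\<exists>C>0. \<forall>\<phi>\<in>test_functions \<Omega>. \<forall>G\<ge>0. (\<integral>\<^sup>+x. ennreal (norm (grad \<phi> x) powr p) \<partial>lborel) \<le> ennreal (G powr p) \<longrightarrow>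
    (\<integral>\<^sup>+x. ennreal (\<bar>\<phi> x\<bar> powr q) \<partial>lborel) \<le> ennreal (C * G powr q)"
proof -
  define n where "n = real CARD('n)"
  obtain R where R: "R > 0" "\<And>x. x \<in> \<Omega> \<Longrightarrow> norm x < R"
    using bounded_pos_less[THEN iffD1, OF \<Omega>] by blast
  define A where "A = {z::real^'n. 1 \<le> norm z \<and> norm z \<le> 2}"
  have Aeq: "A = cball 0 2 - ball 0 1" by (auto simp: A_def)
  then have Ab: "A \<in> sets borel" by simp
  have "emeasure lborel A \<le> emeasure lborel (cball (0::real^'n) 2)" using Aeq by (intro emeasure_mono) auto
  then have Afin: "emeasure lborel A < \<infinity>" using emeasure_lborel_cball_finite[of "0::real^'n" 2] by (rule le_less_trans)
  define a where "a = measure lborel A"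
  have ea: "emeasure lborel A = ennreal a"
    unfolding a_def using Afin by (intro emeasure_eq_ennreal_measure) auto
  have "a > 0"
  proof (rule ccontr)
    assume "\<not> a > 0"
    then have "emeasure lborel A = 0" using ea by (simp add: a_def ennreal_neg)
    then have "A \<in> null_sets lborel" using Ab by auto
    then have "negligible A" by (simp add: negligible_iff_null_sets null_sets_completionI)
    \<comment> \<open>any coordinate direction serves; \<open>undefined\<close> picks one index\<close>
    moreover have "ball ((3/2) *\<^sub>R axis undefined 1) (1/2) \<subseteq> A"
    proof
      fix y :: "real^'n" assume "y \<in> ball ((3/2) *\<^sub>R axis undefined 1) (1/2)"
      then have d: "norm ((3/2) *\<^sub>R axis undefined 1 - y) < 1/2" by (simp add: dist_norm)
      have e: "norm ((3/2) *\<^sub>R axis undefined 1 :: real^'n) = 3/2" by simp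
      show "y \<in> A" unfolding A_def
        using d e norm_triangle_ineq2[of "(3/2) *\<^sub>R axis undefined 1" y] norm_triangle_ineq2[of y "(3/2) *\<^sub>R axis undefined 1"]
        by (auto simp: norm_minus_commute)
    qed
    ultimately have "negligible (ball ((3/2) *\<^sub>R axis undefined 1 :: real^'n) (1/2))" by (rule negligible_subset)
    then show False using open_not_negligible[of "ball ((3/2) *\<^sub>R axis undefined 1 :: real^'n) (1/2)"] by auto
  qed
  define \<beta> where "\<beta> = n * (1 / p - 1 / q)"
  have \<beta>: "\<beta> < 1" using sub by (simp add: \<beta>_def n_def)
  have qb: "n * (q - p) / p = q * \<beta>" using pq by (simp add: \<beta>_def field_simps)
  have q: "q > 1" using pq by simp
  \<comment> \<open>the weight \<open>t powr (- \<alpha>)\<close> must be integrable at \<open>0\<close>, that is \<open>\<alpha> < 1\<close>, and so must be the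
    power \<open>\<gamma>\<close> below, that is \<open>\<alpha> > (q \<beta> - 1) / (q - 1)\<close>; this is the midpoint between \<open>1\<close> and the larger lower bound\<close>
  define \<alpha> where "\<alpha> = (max 0 ((q * \<beta> - 1) / (q - 1)) + 1) / 2"
  have \<alpha>1: "\<alpha> < 1" "0 < \<alpha>"
  proof -
    have "(q * \<beta> - 1) / (q - 1) < 1" using \<beta> q by (simp add: divide_less_eq)
    then show "\<alpha> < 1" by (simp add: \<alpha>_def)
    show "0 < \<alpha>" by (simp add: \<alpha>_def)
  qed
  have \<alpha>2: "\<alpha> * (q - 1) - n * (q - p) / p > - 1"
  proof -
    have "(q * \<beta> - 1) / (q - 1) < 1" using \<beta> q by (simp add: divide_less_eq)
    moreover have "x < (max 0 x + 1) / 2" if "x < 1" for x :: real using that by (auto simp: max_def)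
    ultimately have "(q * \<beta> - 1) / (q - 1) < \<alpha>" unfolding \<alpha>_def by blast
    then show ?thesis using q unfolding qb by (simp add: divide_less_eq)
  qed
  define \<gamma> where "\<gamma> = \<alpha> * (q - 1) - n * (q - p) / p"
  define K1 where "K1 = (2*R) powr (1 - \<alpha>) / (1 - \<alpha>)"
  define K2 where "K2 = (2*R) powr (\<gamma> + 1) / (\<gamma> + 1)"
  have K: "K1 > 0" "K2 > 0" using R \<alpha>1 \<alpha>2 by (auto simp: K1_def K2_def \<gamma>_def)
  have pow_int: "(\<integral>\<^sup>+t. ennreal (t powr e) * indicator {0..2*R} t \<partial>lborel) = ennreal ((2*R) powr (e + 1) / (e + 1))" if "e > -1" for e :: real
    by (rule nn_integral_has_integral_lebesgue'[OF _ has_integral_powr_from_0[OF that]]) (use R in auto)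
  have i1: "(\<integral>\<^sup>+t. ennreal (indicator {0..2*R} t * t powr (- \<alpha>)) \<partial>lborel) = ennreal K1"
    using pow_int[of "- \<alpha>"] \<alpha>1 by (simp add: K1_def ennreal_mult' mult.commute ennreal_indicator)
  have i2: "(\<integral>\<^sup>+t. ennreal (t powr \<gamma>) * indicator {0..2*R} t \<partial>lborel) = ennreal K2"
    using pow_int[of \<gamma>] \<alpha>2 by (simp add: K2_def \<gamma>_def)
  define C where "C = (2 / a) powr q * (K1 powr (q - 1) * (a powr (p - 1) * (a powr (p - 1)) powr ((q - p) / p) * a * K2))"
  have "C > 0" using \<open>a > 0\<close> K unfolding C_def by simp
  show ?thesis
  proof (intro exI[of _ C] conjI ballI allI impI \<open>C > 0\<close>)
    fix \<phi> and G :: real assume \<phi>: "\<phi> \<in> test_functions \<Omega>" and "G \<ge> 0"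
      and G: "(\<integral>\<^sup>+x. ennreal (norm (grad \<phi> x) powr p) \<partial>lborel) \<le> ennreal (G powr p)"
    have sm: "smooth \<phi>" by (rule test_function_smooth[OF \<phi>])
    have supp: "\<phi> x = 0" if "norm x \<ge> R" for x
    proof -
      obtain K where K: "K \<subseteq> \<Omega>" "\<And>x. x \<notin> K \<Longrightarrow> \<phi> x = 0" by (rule test_function_support[OF \<phi>]) (rule that)
      show ?thesis using K R(2)[of x] that by (intro K(2)) auto
    qed
    define g where "g x = norm (grad \<phi> x)" for x
    have cg: "continuous_on UNIV g" unfolding g_def by (intro continuous_intros smooth_continuous_grad sm)
    then have [measurable]: "g \<in> borel_measurable borel" by (rule borel_measurable_continuous_onI)
    have [measurable]: "\<phi> \<in> borel_measurable borel" by (intro borel_measurable_continuous_onI smooth_continuous_on sm)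
    have g0: "g x \<ge> 0" for x by (simp add: g_def)
    have Gg: "(\<integral>\<^sup>+x. ennreal (g x powr p) \<partial>lborel) \<le> ennreal (G powr p)" using G by (simp add: g_def)
    note Ab[measurable]
    define k where "k t x = (\<integral>z. indicator A z * g (x + t *\<^sub>R z) \<partial>lborel)" for t x
    have [measurable]: "(\<lambda>t. k t x) \<in> borel_measurable borel" for x
      unfolding k_def by measurable
    have k0: "k t x \<ge> 0" for t x unfolding k_def by (simp add: g0)
    have ki: "integrable lborel (\<lambda>z. indicator A z * g (x + t *\<^sub>R z))" for t x
    proof -
      have "compact A" using Aeq by (simp add: compact_diff)
      then have "integrable lborel (\<lambda>z. indicator A z *\<^sub>R g (x + t *\<^sub>R z))"
        by (intro borel_integrable_compact continuous_on_compose2[OF cg]) (auto intro!: continuous_intros)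
      then show ?thesis by simp
    qed
    have kn: "ennreal (k t x) = (\<integral>\<^sup>+z. ennreal (indicator A z * g (x + t *\<^sub>R z)) \<partial>lborel)" for t x
      unfolding k_def using nn_integral_eq_integral[OF ki[of x t]] g0 by simp
    define H where "H t x = (\<integral>\<^sup>+z. ennreal (indicator A z * g (x + t *\<^sub>R z) powr p) \<partial>lborel)" for t x
    have [measurable]: "(\<lambda>(t, x). H t x) \<in> borel_measurable (borel \<Otimes>\<^sub>M borel)" unfolding H_def by measurable
    have kp: "ennreal (k t x powr p) \<le> ennreal (a powr (p - 1)) * H t x" for t x
      unfolding H_def
    proof (rule nn_integral_Jensen)
      show "(\<integral>\<^sup>+z. ennreal (indicator A z) \<partial>lborel) \<le> ennreal a"
        using ea Ab by (simp add: ennreal_indicator)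
    qed (use pq g0 k0 \<open>a > 0\<close> kn in auto)
    have Hb: "H t x \<le> ennreal (G powr p / t powr n)" if "t > 0" for t x
    proof -
      have "H t x \<le> (\<integral>\<^sup>+z. ennreal (g (x + t *\<^sub>R z) powr p) \<partial>lborel)"
        unfolding H_def by (rule nn_integral_mono) (auto simp: indicator_def)
      also have "\<dots> = ennreal (1 / t ^ CARD('n)) * (ennreal (t ^ CARD('n)) * (\<integral>\<^sup>+z. ennreal (g (x + t *\<^sub>R z) powr p) \<partial>lborel))"
        using that by (simp add: mult.assoc[symmetric] ennreal_mult'[symmetric])
      also have "\<dots> = ennreal (1 / t ^ CARD('n)) * (\<integral>\<^sup>+z. ennreal (g z powr p) \<partial>lborel)"
        using nn_integral_lborel_scale[of "\<lambda>z. ennreal (g z powr p)" t x] that by simp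
      also have "\<dots> \<le> ennreal (1 / t ^ CARD('n)) * ennreal (G powr p)"
        by (intro mult_left_mono Gg) simp
      also have "\<dots> = ennreal (G powr p / t powr n)"
        using that by (simp add: ennreal_mult'[symmetric] n_def powr_realpow)
      finally show ?thesis .
    qed
    have kq: "ennreal (k t x powr q) \<le> ennreal ((a powr (p - 1) * G powr p / t powr n) powr ((q - p) / p)) * (ennreal (a powr (p - 1)) * H t x)" if "t > 0" for t x
    proof -
      have "ennreal (k t x powr p) \<le> ennreal (a powr (p - 1)) * ennreal (G powr p / t powr n)"
        using kp[of t x] mult_left_mono[OF Hb[OF that, of x], of "ennreal (a powr (p - 1))"] by (rule order_trans) simp
      then have "ennreal (k t x powr p) \<le> ennreal (a powr (p - 1) * G powr p / t powr n)"
        by (simp add: ennreal_mult'[symmetric])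
      then have "k t x powr p \<le> a powr (p - 1) * G powr p / t powr n"
        by (subst (asm) ennreal_le_iff) auto
      then have "(k t x powr p) powr ((q - p) / p) \<le> (a powr (p - 1) * G powr p / t powr n) powr ((q - p) / p)"
        using pq by (intro powr_mono2) auto
      moreover have "(k t x powr p) powr ((q - p) / p) = k t x powr (q - p)" using pq by (simp add: powr_powr)
      ultimately have "ennreal (k t x powr (q - p)) \<le> ennreal ((a powr (p - 1) * G powr p / t powr n) powr ((q - p) / p))"
        by (simp add: ennreal_leI)
      then have "ennreal (k t x powr (q - p)) * ennreal (k t x powr p) \<le> ennreal ((a powr (p - 1) * G powr p / t powr n) powr ((q - p) / p)) * (ennreal (a powr (p - 1)) * H t x)"
        by (intro mult_mono kp) auto
      moreover have "k t x powr (q - p) * k t x powr p = k t x powr q" by (simp flip: powr_add)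
      ultimately show ?thesis by (simp add: ennreal_mult'[symmetric])
    qed
    define E where "E = a powr (p - 1) * (a powr (p - 1)) powr ((q - p) / p) * G powr (q - p)"
    have E0: "E \<ge> 0" by (simp add: E_def)
    have pt: "ennreal ((a * \<bar>\<phi> x\<bar> / 2) powr q) \<le> ennreal (K1 powr (q - 1)) * (\<integral>\<^sup>+t. ennreal E * (ennreal (t powr \<gamma>) * indicator {0..2*R} t) * H t x \<partial>lborel)" if x: "norm x < R" for x
    proof -
      have half: "ennreal (1/2) * (ennreal a * ennreal \<bar>\<phi> x\<bar>) = ennreal (a * \<bar>\<phi> x\<bar> / 2)"
        using \<open>a > 0\<close> by (subst ennreal_mult'[symmetric], simp, subst ennreal_mult'[symmetric], simp, simp)
      have "ennreal a * ennreal \<bar>\<phi> x\<bar> = (\<integral>\<^sup>+z. ennreal \<bar>\<phi> x\<bar> * indicator A z \<partial>lborel)"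
        by (subst nn_integral_cmult_indicator) (use ea Ab in \<open>simp_all add: mult.commute\<close>)
      also have "\<dots> \<le> (\<integral>\<^sup>+z. (\<integral>\<^sup>+t. ennreal (2 * g (x + t *\<^sub>R z)) * indicator {0..2*R} t \<partial>lborel) * indicator A z \<partial>lborel)"
      proof (rule nn_integral_mono)
        fix z
        show "ennreal \<bar>\<phi> x\<bar> * indicator A z \<le> (\<integral>\<^sup>+t. ennreal (2 * g (x + t *\<^sub>R z)) * indicator {0..2*R} t \<partial>lborel) * indicator A z"
          using radial_bound[OF sm supp R(1), of z x] x by (auto simp: A_def g_def indicator_def)
      qed
      also have "\<dots> = (\<integral>\<^sup>+z. (\<integral>\<^sup>+t. ennreal (2 * g (x + t *\<^sub>R z)) * indicator {0..2*R} t * indicator A z \<partial>lborel) \<partial>lborel)"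
        by (simp add: nn_integral_multc)
      also have "\<dots> = (\<integral>\<^sup>+t. (\<integral>\<^sup>+z. ennreal (2 * g (x + t *\<^sub>R z)) * indicator {0..2*R} t * indicator A z \<partial>lborel) \<partial>lborel)"
        by (rule lborel_pair.Fubini') measurable
      also have "\<dots> = (\<integral>\<^sup>+t. (\<integral>\<^sup>+z. (ennreal 2 * indicator {0..2*R} t) * ennreal (indicator A z * g (x + t *\<^sub>R z)) \<partial>lborel) \<partial>lborel)"
        by (intro nn_integral_cong) (auto simp: indicator_def ennreal_mult')
      also have "\<dots> = (\<integral>\<^sup>+t. (ennreal 2 * indicator {0..2*R} t) * ennreal (k t x) \<partial>lborel)"
        by (simp add: nn_integral_cmult kn)
      also have "\<dots> = (\<integral>\<^sup>+t. ennreal 2 * (indicator {0..2*R} t * ennreal (k t x)) \<partial>lborel)" by (simp add: mult.assoc)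
      also have "\<dots> = ennreal 2 * (\<integral>\<^sup>+t. indicator {0..2*R} t * ennreal (k t x) \<partial>lborel)"
        by (rule nn_integral_cmult) measurable
      finally have "ennreal (1/2) * (ennreal a * ennreal \<bar>\<phi> x\<bar>) \<le> ennreal (1/2) * (ennreal 2 * (\<integral>\<^sup>+t. indicator {0..2*R} t * ennreal (k t x) \<partial>lborel))"
        by (rule mult_left_mono) simp
      also have "\<dots> = (\<integral>\<^sup>+t. indicator {0..2*R} t * ennreal (k t x) \<partial>lborel)"
        by (simp only: mult.assoc[symmetric] ennreal_mult'[symmetric]) simp
      \<comment> \<open>insert the weight, to which Jensen's inequality in \<open>t\<close> is then applied\<close>
      also have "\<dots> = (\<integral>\<^sup>+t. ennreal ((indicator {0..2*R} t * t powr (- \<alpha>)) * (k t x * t powr \<alpha>)) \<partial>lborel)"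
      proof (rule nn_integral_cong_AE)
        have "AE t::real in lborel. t \<noteq> 0" by (rule AE_lborel_singleton)
        then show "AE t in lborel. indicator {0..2*R} t * ennreal (k t x) = ennreal ((indicator {0..2*R} t * t powr (- \<alpha>)) * (k t x * t powr \<alpha>))"
        proof eventually_elim
          case (elim t)
          show ?case
          proof (cases "t \<in> {0..2*R}")
            case True
            then have "t powr (- \<alpha>) * t powr \<alpha> = 1" using elim by (simp flip: powr_add)
            then have "t powr (- \<alpha>) * (k t x * t powr \<alpha>) = k t x"
              by (metis mult.commute mult.left_commute mult.right_neutral)
            then have "(indicator {0..2*R} t * t powr (- \<alpha>)) * (k t x * t powr \<alpha>) = k t x"
              using True by (simp only: indicator_simps mult_1)
            then show ?thesis using True by (simp only: indicator_simps mult_1)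
          qed simp
        qed
      qed
      finally have *: "ennreal (a * \<bar>\<phi> x\<bar> / 2) \<le> (\<integral>\<^sup>+t. ennreal ((indicator {0..2*R} t * t powr (- \<alpha>)) * (k t x * t powr \<alpha>)) \<partial>lborel)"
        unfolding half .
      have "ennreal ((a * \<bar>\<phi> x\<bar> / 2) powr q) \<le> ennreal (K1 powr (q - 1)) * (\<integral>\<^sup>+t. ennreal ((indicator {0..2*R} t * t powr (- \<alpha>)) * (k t x * t powr \<alpha>) powr q) \<partial>lborel)"
        by (rule nn_integral_Jensen) (use * i1 q K \<open>a > 0\<close> k0 in auto)
      also have "(\<integral>\<^sup>+t. ennreal ((indicator {0..2*R} t * t powr (- \<alpha>)) * (k t x * t powr \<alpha>) powr q) \<partial>lborel)
          \<le> (\<integral>\<^sup>+t. ennreal E * (ennreal (t powr \<gamma>) * indicator {0..2*R} t) * H t x \<partial>lborel)"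
      proof (rule nn_integral_mono)
        fix t
        show "ennreal ((indicator {0..2*R} t * t powr (- \<alpha>)) * (k t x * t powr \<alpha>) powr q) \<le> ennreal E * (ennreal (t powr \<gamma>) * indicator {0..2*R} t) * H t x"
        proof (cases "t > 0 \<and> t \<le> 2*R")
          case True
          then have t: "t > 0" by simp
          have "t powr (- \<alpha>) * (k t x * t powr \<alpha>) powr q = t powr (\<alpha> * (q - 1)) * k t x powr q"
          proof -
            have "t powr (- \<alpha>) * t powr (\<alpha> * q) = t powr (\<alpha> * (q - 1))" using t by (simp add: algebra_simps flip: powr_add)
            then show ?thesis using k0[of t x] t by (simp add: powr_mult powr_powr)
          qed
          then have "ennreal ((indicator {0..2*R} t * t powr (- \<alpha>)) * (k t x * t powr \<alpha>) powr q) = ennreal (t powr (\<alpha> * (q - 1))) * ennreal (k t x powr q)"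
            using True by (simp add: ennreal_mult')
          also have "\<dots> \<le> ennreal (t powr (\<alpha> * (q - 1))) * (ennreal ((a powr (p - 1) * G powr p / t powr n) powr ((q - p) / p)) * (ennreal (a powr (p - 1)) * H t x))"
            by (intro mult_left_mono kq[OF t]) simp
          also have "\<dots> = ennreal (t powr (\<alpha> * (q - 1)) * (a powr (p - 1) * G powr p / t powr n) powr ((q - p) / p) * a powr (p - 1)) * H t x"
            by (simp add: ennreal_mult' mult.assoc)
          also have "t powr (\<alpha> * (q - 1)) * (a powr (p - 1) * G powr p / t powr n) powr ((q - p) / p) * a powr (p - 1) = E * t powr \<gamma>"
          proof -
            have e1: "(G powr p) powr ((q - p) / p) = G powr (q - p)" "(t powr n) powr ((q - p) / p) = t powr (n * (q - p) / p)"
              using pq by (simp_all add: powr_powr)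
            have e2: "t powr (\<alpha> * (q - 1)) / t powr (n * (q - p) / p) = t powr \<gamma>"
              using t by (simp add: \<gamma>_def powr_diff)
            have "(a powr (p - 1) * G powr p / t powr n) powr ((q - p) / p) = (a powr (p - 1)) powr ((q - p) / p) * G powr (q - p) / t powr (n * (q - p) / p)"
              unfolding e1[symmetric] by (simp add: powr_mult powr_divide)
            then show ?thesis unfolding e2[symmetric] E_def by simp
          qed
          finally show ?thesis using True by (simp add: ennreal_mult' E0)
        next
          case False
          then have "t \<notin> {0..2*R} \<or> t = 0" by auto
          then show ?thesis by auto
        qed
      qed
      finally show ?thesis by (simp add: mult_left_mono)
    qed
    have "(\<integral>\<^sup>+x. ennreal ((a * \<bar>\<phi> x\<bar> / 2) powr q) \<partial>lborel) \<le> (\<integral>\<^sup>+x. ennreal (K1 powr (q - 1)) * (\<integral>\<^sup>+t. ennreal E * (ennreal (t powr \<gamma>) * indicator {0..2*R} t) * H t x \<partial>lborel) \<partial>lborel)"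
    proof (rule nn_integral_mono)
      fix x
      show "ennreal ((a * \<bar>\<phi> x\<bar> / 2) powr q) \<le> ennreal (K1 powr (q - 1)) * (\<integral>\<^sup>+t. ennreal E * (ennreal (t powr \<gamma>) * indicator {0..2*R} t) * H t x \<partial>lborel)"
        using pt[of x] supp[of x] by (cases "norm x < R") auto
    qed
    also have "\<dots> = ennreal (K1 powr (q - 1)) * (\<integral>\<^sup>+x. (\<integral>\<^sup>+t. ennreal E * (ennreal (t powr \<gamma>) * indicator {0..2*R} t) * H t x \<partial>lborel) \<partial>lborel)"
      by (rule nn_integral_cmult) measurable
    also have "(\<integral>\<^sup>+x. (\<integral>\<^sup>+t. ennreal E * (ennreal (t powr \<gamma>) * indicator {0..2*R} t) * H t x \<partial>lborel) \<partial>lborel)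
       = (\<integral>\<^sup>+t. (\<integral>\<^sup>+x. ennreal E * (ennreal (t powr \<gamma>) * indicator {0..2*R} t) * H t x \<partial>lborel) \<partial>lborel)"
      by (rule lborel_pair.Fubini') measurable
    also have "\<dots> = (\<integral>\<^sup>+t. ennreal E * (ennreal (t powr \<gamma>) * indicator {0..2*R} t) * (\<integral>\<^sup>+x. H t x \<partial>lborel) \<partial>lborel)"
      by (intro nn_integral_cong nn_integral_cmult) measurable
    finally have i3: "(\<integral>\<^sup>+x. ennreal ((a * \<bar>\<phi> x\<bar> / 2) powr q) \<partial>lborel) \<le> ennreal (K1 powr (q - 1)) * (\<integral>\<^sup>+t. ennreal E * (ennreal (t powr \<gamma>) * indicator {0..2*R} t) * (\<integral>\<^sup>+x. H t x \<partial>lborel) \<partial>lborel)" .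
    have HH: "(\<integral>\<^sup>+x. H t x \<partial>lborel) \<le> ennreal (a * G powr p)" for t
    proof -
      have "(\<integral>\<^sup>+x. H t x \<partial>lborel) = (\<integral>\<^sup>+z. (\<integral>\<^sup>+x. ennreal (indicator A z * g (x + t *\<^sub>R z) powr p) \<partial>lborel) \<partial>lborel)"
        unfolding H_def by (rule lborel_pair.Fubini') measurable
      also have "\<dots> = (\<integral>\<^sup>+z. indicator A z * (\<integral>\<^sup>+x. ennreal (g (x + t *\<^sub>R z) powr p) \<partial>lborel) \<partial>lborel)"
        by (intro nn_integral_cong) (auto simp: indicator_def)
      also have "\<dots> \<le> (\<integral>\<^sup>+z. indicator A z * ennreal (G powr p) \<partial>lborel)"
      proof (intro nn_integral_mono mult_left_mono)
        fix z
        show "(\<integral>\<^sup>+x. ennreal (g (x + t *\<^sub>R z) powr p) \<partial>lborel) \<le> ennreal (G powr p)"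
          using nn_integral_lborel_translate[of "\<lambda>x. ennreal (g x powr p)" "t *\<^sub>R z"] Gg by simp
      qed simp
      also have "\<dots> = ennreal (a * G powr p)"
        using ea Ab \<open>a > 0\<close> by (simp add: nn_integral_multc ennreal_mult')
      finally show ?thesis .
    qed
    have "(\<integral>\<^sup>+t. ennreal E * (ennreal (t powr \<gamma>) * indicator {0..2*R} t) * (\<integral>\<^sup>+x. H t x \<partial>lborel) \<partial>lborel)
       \<le> (\<integral>\<^sup>+t. ennreal E * (ennreal (t powr \<gamma>) * indicator {0..2*R} t) * ennreal (a * G powr p) \<partial>lborel)"
      by (intro nn_integral_mono mult_left_mono HH) simp
    also have "\<dots> = ennreal E * ennreal K2 * ennreal (a * G powr p)"
      using i2 by (simp add: nn_integral_multc nn_integral_cmult)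
    also have "\<dots> = ennreal (E * K2 * (a * G powr p))"
      using E0 K \<open>a > 0\<close> by (simp add: ennreal_mult')
    finally have i4: "(\<integral>\<^sup>+t. ennreal E * (ennreal (t powr \<gamma>) * indicator {0..2*R} t) * (\<integral>\<^sup>+x. H t x \<partial>lborel) \<partial>lborel) \<le> ennreal (E * K2 * (a * G powr p))" .
    have "(\<integral>\<^sup>+x. ennreal (\<bar>\<phi> x\<bar> powr q) \<partial>lborel) = (\<integral>\<^sup>+x. ennreal ((2 / a) powr q) * ennreal ((a * \<bar>\<phi> x\<bar> / 2) powr q) \<partial>lborel)"
    proof (rule nn_integral_cong)
      fix x
      have "(2 / a) powr q * (a * \<bar>\<phi> x\<bar> / 2) powr q = ((2 / a) * (a * \<bar>\<phi> x\<bar> / 2)) powr q"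
        using \<open>a > 0\<close> by (subst powr_mult) auto
      also have "(2 / a) * (a * \<bar>\<phi> x\<bar> / 2) = \<bar>\<phi> x\<bar>" using \<open>a > 0\<close> by simp
      finally show "ennreal (\<bar>\<phi> x\<bar> powr q) = ennreal ((2 / a) powr q) * ennreal ((a * \<bar>\<phi> x\<bar> / 2) powr q)"
        by (simp add: ennreal_mult'[symmetric])
    qed
    also have "\<dots> = ennreal ((2 / a) powr q) * (\<integral>\<^sup>+x. ennreal ((a * \<bar>\<phi> x\<bar> / 2) powr q) \<partial>lborel)"
      by (rule nn_integral_cmult) measurable
    also have "\<dots> \<le> ennreal ((2 / a) powr q) * (ennreal (K1 powr (q - 1)) * ennreal (E * K2 * (a * G powr p)))"
      by (rule mult_left_mono[OF order_trans[OF i3 mult_left_mono[OF i4]]]) simp_all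
    also have "\<dots> = ennreal ((2 / a) powr q * (K1 powr (q - 1) * (E * K2 * (a * G powr p))))"
      by (simp add: ennreal_mult')
    also have "(2 / a) powr q * (K1 powr (q - 1) * (E * K2 * (a * G powr p))) = C * G powr q"
    proof -
      have "G powr q = G powr (q - p) * G powr p" by (simp flip: powr_add)
      then show ?thesis unfolding C_def E_def by (simp only: mult_ac)
    qed
    finally show "(\<integral>\<^sup>+x. ennreal (\<bar>\<phi> x\<bar> powr q) \<partial>lborel) \<le> ennreal (C * G powr q)" .
  qed
qed

section \<open>Integrals of powers over a domain\<close>

text \<open>With values in the extended nonnegative reals, these integrals can be estimated before any
  integrability is known; \<open>Lp_norm\<close> has the value \<open>0\<close> for functions outside \<open>Lp_space\<close>.\<close>

definition Lp_int :: "real \<Rightarrow> (real^'n) set \<Rightarrow> (real^'n \<Rightarrow> 'b::euclidean_space) \<Rightarrow> ennreal" where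
  "Lp_int p \<Omega> f = (\<integral>\<^sup>+x. ennreal (norm (f x) powr p) \<partial>lebesgue_on \<Omega>)"

lemma Lp_int_cong: "AE x in lebesgue_on \<Omega>. f x = g x \<Longrightarrow> Lp_int p \<Omega> f = Lp_int p \<Omega> g"
  unfolding Lp_int_def by (rule nn_integral_cong_AE) auto

lemma Lp_int_mono: "p \<ge> 0 \<Longrightarrow> AE x in lebesgue_on \<Omega>. norm (f x) \<le> norm (g x) \<Longrightarrow> Lp_int p \<Omega> f \<le> Lp_int p \<Omega> g"
  unfolding Lp_int_def by (rule nn_integral_mono_AE) (auto intro!: ennreal_leI powr_mono2 elim: eventually_mono)

lemma Lp_int_add:
  fixes f g :: "real^'n \<Rightarrow> 'b::euclidean_space"
  assumes [measurable]: "f \<in> borel_measurable (lebesgue_on \<Omega>)" "g \<in> borel_measurable (lebesgue_on \<Omega>)" and p: "p \<ge> 0"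
  shows "Lp_int p \<Omega> (\<lambda>x. f x + g x) \<le> ennreal (2 powr p) * (Lp_int p \<Omega> f + Lp_int p \<Omega> g)"
proof -
  have "Lp_int p \<Omega> (\<lambda>x. f x + g x) \<le> (\<integral>\<^sup>+x. ennreal (2 powr p) * (ennreal (norm (f x) powr p) + ennreal (norm (g x) powr p)) \<partial>lebesgue_on \<Omega>)"
    unfolding Lp_int_def
  proof (rule nn_integral_mono)
    fix x
    have "norm (f x + g x) powr p \<le> (norm (f x) + norm (g x)) powr p"
      using p by (intro powr_mono2 norm_triangle_ineq) auto
    also have "\<dots> \<le> 2 powr p * (norm (f x) powr p + norm (g x) powr p)"
      using p by (intro powr_add_le) auto
    finally show "ennreal (norm (f x + g x) powr p) \<le> ennreal (2 powr p) * (ennreal (norm (f x) powr p) + ennreal (norm (g x) powr p))"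
      by (simp add: ennreal_leI flip: ennreal_plus ennreal_mult')
  qed
  also have "\<dots> = ennreal (2 powr p) * (Lp_int p \<Omega> f + Lp_int p \<Omega> g)"
    unfolding Lp_int_def by (simp add: nn_integral_cmult nn_integral_add)
  finally show ?thesis .
qed

lemma Lp_int_add_le:
  fixes f g :: "real^'n \<Rightarrow> 'b::euclidean_space"
  assumes "f \<in> borel_measurable (lebesgue_on \<Omega>)" "g \<in> borel_measurable (lebesgue_on \<Omega>)" and p: "p \<ge> 0"
    and "Lp_int p \<Omega> f \<le> ennreal a" "Lp_int p \<Omega> g \<le> ennreal b" "a \<ge> 0" "b \<ge> 0"
  shows "Lp_int p \<Omega> (\<lambda>x. f x + g x) \<le> ennreal (2 powr p * (a + b))"
proof -
  have "Lp_int p \<Omega> (\<lambda>x. f x + g x) \<le> ennreal (2 powr p) * (ennreal a + ennreal b)"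
    using assms by (intro order_trans[OF Lp_int_add[OF assms(1-3)] mult_left_mono] add_mono) auto
  also have "\<dots> = ennreal (2 powr p * (a + b))"
    using assms(6,7) by (simp add: ennreal_mult'[symmetric] ennreal_plus[symmetric] del: ennreal_plus)
  finally show ?thesis .
qed

lemma Lp_int_minus: "Lp_int p \<Omega> (\<lambda>x. - f x) = Lp_int p \<Omega> f"
  by (simp add: Lp_int_def)

lemma Lp_int_diff_commute: "Lp_int p \<Omega> (\<lambda>x. f x - g x) = Lp_int p \<Omega> (\<lambda>x. g x - f x)"
  by (simp add: Lp_int_def norm_minus_commute)

lemma Lp_space_iff: "f \<in> Lp_space p \<Omega> \<longleftrightarrow> f \<in> borel_measurable (lebesgue_on \<Omega>) \<and> Lp_int p \<Omega> f < \<infinity>"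
proof -
  have "integrable (lebesgue_on \<Omega>) (\<lambda>x. norm (f x) powr p) \<longleftrightarrow> Lp_int p \<Omega> f < \<infinity>" if [measurable]: "f \<in> borel_measurable (lebesgue_on \<Omega>)"
    unfolding Lp_int_def integrable_iff_bounded by simp
  then show ?thesis unfolding Lp_space_def by blast
qed

lemma Lp_norm_nonneg: "0 \<le> Lp_norm p \<Omega> f"
  by (simp add: Lp_norm_def)

lemma Lp_int_eq_norm:
  assumes "f \<in> Lp_space p \<Omega>" "p > 0"
  shows "Lp_int p \<Omega> f = ennreal (Lp_norm p \<Omega> f powr p)"
proof -
  have i: "integrable (lebesgue_on \<Omega>) (\<lambda>x. norm (f x) powr p)" using assms by (simp add: Lp_space_def)
  have "Lp_norm p \<Omega> f powr p = (\<integral>x. norm (f x) powr p \<partial>lebesgue_on \<Omega>)"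
    unfolding Lp_norm_def using assms(2) by (simp add: powr_powr)
  then show ?thesis
    unfolding Lp_int_def using nn_integral_eq_integral[OF i] by simp
qed

lemma Lp_space_add:
  fixes f g :: "real^'n \<Rightarrow> 'b::euclidean_space"
  assumes "f \<in> Lp_space p \<Omega>" "g \<in> Lp_space p \<Omega>" "p \<ge> 0"
  shows "(\<lambda>x. f x + g x) \<in> Lp_space p \<Omega>"
proof -
  have m: "f \<in> borel_measurable (lebesgue_on \<Omega>)" "g \<in> borel_measurable (lebesgue_on \<Omega>)" using assms by (auto simp: Lp_space_iff)
  have "ennreal (2 powr p) * (Lp_int p \<Omega> f + Lp_int p \<Omega> g) < \<infinity>" using assms by (simp add: Lp_space_iff ennreal_mult_less_top)
  then show ?thesis
    using le_less_trans[OF Lp_int_add[OF m assms(3)]] m by (auto simp: Lp_space_iff)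
qed

lemma Lp_space_scaleR:
  fixes f :: "real^'n \<Rightarrow> 'b::euclidean_space"
  assumes "f \<in> Lp_space p \<Omega>" shows "(\<lambda>x. c *\<^sub>R f x) \<in> Lp_space p \<Omega>"
proof -
  have [measurable]: "f \<in> borel_measurable (lebesgue_on \<Omega>)" using assms by (auto simp: Lp_space_iff)
  have "Lp_int p \<Omega> (\<lambda>x. c *\<^sub>R f x) = ennreal (\<bar>c\<bar> powr p) * Lp_int p \<Omega> f"
    unfolding Lp_int_def by (subst nn_integral_cmult[symmetric]) (auto simp: powr_mult ennreal_mult')
  then show ?thesis using assms by (simp add: Lp_space_iff ennreal_mult_less_top)
qed

lemma Lp_space_diff:
  fixes f g :: "real^'n \<Rightarrow> 'b::euclidean_space"
  assumes "f \<in> Lp_space p \<Omega>" "g \<in> Lp_space p \<Omega>" "p \<ge> 0"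
  shows "(\<lambda>x. f x - g x) \<in> Lp_space p \<Omega>"
  using Lp_space_add[OF assms(1) Lp_space_scaleR[OF assms(2), of "-1"] assms(3)] by simp

lemma Lp_space_mono:
  assumes "g \<in> Lp_space p \<Omega>" "f \<in> borel_measurable (lebesgue_on \<Omega>)" "AE x in lebesgue_on \<Omega>. norm (f x) \<le> norm (g x)" "p \<ge> 0"
  shows "f \<in> Lp_space p \<Omega>"
  using assms Lp_int_mono[OF assms(4,3)] by (auto simp: Lp_space_iff)

lemma finite_measure_lebesgue_on_bounded_open:
  fixes \<Omega> :: "(real^'n) set"
  assumes "open \<Omega>" "bounded \<Omega>"
  shows "emeasure (lebesgue_on \<Omega>) \<Omega> < \<infinity>" "finite_measure (lebesgue_on \<Omega>)" "space (lebesgue_on \<Omega>) = \<Omega>"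
proof -
  have l: "\<Omega> \<in> lmeasurable" using assms by (rule lmeasurable_open[rotated])
  show "finite_measure (lebesgue_on \<Omega>)" by (rule finite_measure_lebesgue_on[OF l])
  then show "emeasure (lebesgue_on \<Omega>) \<Omega> < \<infinity>" using finite_measure.emeasure_finite[of "lebesgue_on \<Omega>" \<Omega>] by (simp add: less_top)
  show "space (lebesgue_on \<Omega>) = \<Omega>" by (simp add: space_restrict_space)
qed

lemma Lp_space_bounded:
  fixes f :: "real^'n \<Rightarrow> 'b::euclidean_space"
  assumes "open \<Omega>" "bounded \<Omega>" "f \<in> borel_measurable (lebesgue_on \<Omega>)" "AE x in lebesgue_on \<Omega>. norm (f x) \<le> B" "p \<ge> 0"
  shows "f \<in> Lp_space p \<Omega>"
proof -
  have "Lp_int p \<Omega> f \<le> (\<integral>\<^sup>+x. ennreal (B powr p) \<partial>lebesgue_on \<Omega>)"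
    unfolding Lp_int_def by (rule nn_integral_mono_AE) (use assms(4,5) in \<open>auto intro!: ennreal_leI powr_mono2 elim: eventually_mono\<close>)
  also have "\<dots> = ennreal (B powr p) * emeasure (lebesgue_on \<Omega>) \<Omega>"
    using finite_measure_lebesgue_on_bounded_open(3)[OF assms(1,2)] by simp
  also have "\<dots> < \<infinity>"
    using finite_measure_lebesgue_on_bounded_open(1)[OF assms(1,2)] by (simp add: ennreal_mult_less_top)
  finally show ?thesis using assms(3) by (simp add: Lp_space_iff)
qed

lemma measurable_lebesgue_onI: "f \<in> borel_measurable lebesgue \<Longrightarrow> f \<in> borel_measurable (lebesgue_on \<Omega>)"
  by (rule measurable_restrict_space1)

lemma continuous_measurable_lebesgue_on:
  fixes f :: "real^'n \<Rightarrow> 'b::euclidean_space"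
  shows "continuous_on UNIV f \<Longrightarrow> f \<in> borel_measurable (lebesgue_on \<Omega>)"
  by (intro measurable_lebesgue_onI continuous_imp_measurable_lebesgue)

lemma test_function_Lp:
  assumes "open \<Omega>" "bounded \<Omega>" "\<phi> \<in> test_functions \<Omega>" "p \<ge> 0"
  shows "\<phi> \<in> Lp_space p \<Omega>" "grad \<phi> \<in> Lp_space p \<Omega>"
proof -
  obtain R where R: "\<And>x. norm x > R \<Longrightarrow> \<phi> x = 0" "\<And>x i. norm x > R \<Longrightarrow> partial i \<phi> x = 0"
    by (rule test_function_bounded_support[OF assms(3)]) (rule that)
  have c: "continuous_on UNIV \<phi>" "continuous_on UNIV (grad \<phi>)"
    using smooth_continuous_on smooth_continuous_grad test_function_smooth[OF assms(3)] by blast+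
  have z: "grad \<phi> x = 0" if "norm x > R" for x using R(2)[OF that] by (simp add: vec_eq_iff)
  obtain B1 where B1: "\<And>x. norm (\<phi> x) \<le> B1" by (rule bounded_support_bounded[OF c(1) R(1)]) (use that in auto)
  obtain B2 where B2: "\<And>x. norm (grad \<phi> x) \<le> B2" by (rule bounded_support_bounded[OF c(2) z]) (use that in auto)
  show "\<phi> \<in> Lp_space p \<Omega>"
    by (rule Lp_space_bounded[OF assms(1,2) continuous_measurable_lebesgue_on[OF c(1)] _ assms(4), of B1]) (use B1 in simp)
  show "grad \<phi> \<in> Lp_space p \<Omega>"
    by (rule Lp_space_bounded[OF assms(1,2) continuous_measurable_lebesgue_on[OF c(2)] _ assms(4), of B2]) (use B2 in simp)
qed

lemma test_function_scale:
  assumes "\<phi> \<in> test_functions \<Omega>"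
  shows "(\<lambda>x. c * \<phi> x) \<in> test_functions \<Omega>" "grad (\<lambda>x. c * \<phi> x) x = c *\<^sub>R grad \<phi> x"
proof -
  have d: "((\<lambda>x. c * g x) has_derivative (\<lambda>h. c * (grad g x \<bullet> h))) (at x)" if "smooth g" for g :: "real^'n \<Rightarrow> real" and x c
    by (rule has_derivative_mult_right[OF smooth_has_grad[OF that]])
  have p: "partial i (\<lambda>x. c * g x) = (\<lambda>x. c * partial i g x)" if "smooth g" for g :: "real^'n \<Rightarrow> real" and i c
    using partial_eq_derivative[OF d[OF that]] by (auto simp: inner_axis)
  have "smooth (\<lambda>x. c * \<phi> x)"
  proof (rule smoothI[where S="{(\<lambda>x. c * g x) | g. smooth g}"])
    show "(\<lambda>x. c * \<phi> x) \<in> {(\<lambda>x. c * g x) | g. smooth g}" using test_function_smooth[OF assms] by blast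
    fix h assume "h \<in> {(\<lambda>x. c * g x) | g. smooth g}"
    then obtain g where g: "h = (\<lambda>x. c * g x)" "smooth g" by blast
    show "h differentiable_on UNIV" using d[OF g(2)] unfolding g(1) differentiable_on_def differentiable_def by blast
    show "partial i h \<in> {(\<lambda>x. c * g x) | g. smooth g}" for i using p[OF g(2)] smooth_partial[OF g(2)] g(1) by blast
  qed
  moreover have "closure {x. c * \<phi> x \<noteq> 0} \<subseteq> closure {x. \<phi> x \<noteq> 0}" by (intro closure_mono) auto
  moreover have "compact (closure {x. \<phi> x \<noteq> 0})" "closure {x. \<phi> x \<noteq> 0} \<subseteq> \<Omega>"
    using assms unfolding test_functions_def by blast+
  moreover have "compact (closure {x. c * \<phi> x \<noteq> 0})"
    using compact_Int_closed[OF calculation(3) closed_closure[of "{x. c * \<phi> x \<noteq> 0}"]] calculation(2) by (simp add: Int_absorb1)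
  ultimately show "(\<lambda>x. c * \<phi> x) \<in> test_functions \<Omega>" unfolding test_functions_def by blast
  show "grad (\<lambda>x. c * \<phi> x) x = c *\<^sub>R grad \<phi> x"
    using p[OF test_function_smooth[OF assms]] by (simp add: vec_eq_iff)
qed

section \<open>The space \<open>W1p_0\<close>\<close>

lemma weak_grad_is_weak_grad:
  fixes u :: "real^'n \<Rightarrow> real"
  assumes "is_weak_grad \<Omega> u v" "open \<Omega>"
  shows "is_weak_grad \<Omega> u (weak_grad \<Omega> u)" "AE x in lebesgue_on \<Omega>. weak_grad \<Omega> u x = v x"
proof -
  show "is_weak_grad \<Omega> u (weak_grad \<Omega> u)" unfolding weak_grad_def by (rule someI[where P="is_weak_grad \<Omega> u", OF assms(1)])
  from weak_grad_unique[OF this assms] show "AE x in lebesgue_on \<Omega>. weak_grad \<Omega> u x = v x" .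
qed

lemma W1p_weak_grad:
  fixes u :: "real^'n \<Rightarrow> real"
  assumes "u \<in> W1p p \<Omega>" "open \<Omega>"
  shows "is_weak_grad \<Omega> u (weak_grad \<Omega> u)" "weak_grad \<Omega> u \<in> Lp_space p \<Omega>" "u \<in> Lp_space p \<Omega>"
proof -
  obtain v where v: "v \<in> Lp_space p \<Omega>" "is_weak_grad \<Omega> u v" and u: "u \<in> Lp_space p \<Omega>"
    using assms(1) by (auto simp: W1p_def)
  show 1: "is_weak_grad \<Omega> u (weak_grad \<Omega> u)" by (rule weak_grad_is_weak_grad[OF v(2) assms(2)])
  show "u \<in> Lp_space p \<Omega>" by (rule u)
  show "weak_grad \<Omega> u \<in> Lp_space p \<Omega>"
    using Lp_int_cong[OF weak_grad_is_weak_grad(2)[OF v(2) assms(2)], of p] v(1) is_weak_grad_measurable(2)[OF 1 assms(2)]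
    by (simp add: Lp_space_iff)
qed

lemma W1pI:
  assumes "u \<in> Lp_space p \<Omega>" "v \<in> Lp_space p \<Omega>" "is_weak_grad \<Omega> u v"
  shows "u \<in> W1p p \<Omega>"
  using assms by (auto simp: W1p_def)

lemma is_weak_grad_diff_test:
  fixes u :: "real^'n \<Rightarrow> real"
  assumes "is_weak_grad \<Omega> u v" "open \<Omega>" "\<phi> \<in> test_functions \<Omega>"
  shows "is_weak_grad \<Omega> (\<lambda>x. u x - \<phi> x) (\<lambda>x. v x - grad \<phi> x)"
  using is_weak_grad_lincomb[OF assms(1) is_weak_grad_smooth[OF assms(2) test_function_smooth[OF assms(3)]] assms(2), of 1 "-1"] by simp

text \<open>The norm in the definition of \<open>W1p_0\<close> involves the chosen representative of the weak gradient
  of \<open>u - \<phi>\<close>; this rule and the next trade it for any weak gradient \<open>v\<close> of \<open>u\<close>.\<close>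

lemma W1p_0_approx:
  fixes u :: "real^'n \<Rightarrow> real"
  assumes u: "u \<in> W1p_0 p \<Omega>" and wg: "is_weak_grad \<Omega> u v" and \<Omega>: "open \<Omega>" "bounded \<Omega>" and p: "p \<ge> 1" and e: "e > 0"
  shows "\<exists>\<phi>\<in>test_functions \<Omega>. Lp_int p \<Omega> (\<lambda>x. u x - \<phi> x) \<le> ennreal e \<and> Lp_int p \<Omega> (\<lambda>x. v x - grad \<phi> x) \<le> ennreal e"
proof -
  obtain \<phi> where \<phi>: "\<And>k::nat. \<phi> k \<in> test_functions \<Omega>" and lim: "(\<lambda>k. W1p_norm p \<Omega> (\<lambda>x. u x - \<phi> k x)) \<longlonglongrightarrow> 0"
    using u by (auto simp: W1p_0_def)
  have uW: "u \<in> W1p p \<Omega>" using u by (simp add: W1p_0_def)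
  have "e powr (1/p) > 0" using e by simp
  then have "\<forall>\<^sub>F k in sequentially. W1p_norm p \<Omega> (\<lambda>x. u x - \<phi> k x) < e powr (1/p)"
    using order_tendstoD(2)[OF lim] by blast
  then obtain k where k: "W1p_norm p \<Omega> (\<lambda>x. u x - \<phi> k x) < e powr (1/p)" by (auto simp: eventually_sequentially)
  have D: "is_weak_grad \<Omega> (\<lambda>x. u x - \<phi> k x) (\<lambda>x. v x - grad (\<phi> k) x)"
    by (rule is_weak_grad_diff_test[OF wg \<Omega>(1) \<phi>])
  have ae: "AE x in lebesgue_on \<Omega>. weak_grad \<Omega> (\<lambda>x. u x - \<phi> k x) x = v x - grad (\<phi> k) x"
    by (rule weak_grad_is_weak_grad(2)[OF D \<Omega>(1)])
  have v: "v \<in> Lp_space p \<Omega>"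
    using Lp_int_cong[OF weak_grad_is_weak_grad(2)[OF wg \<Omega>(1)], of p] W1p_weak_grad(2)[OF uW \<Omega>(1)] is_weak_grad_measurable(2)[OF wg \<Omega>(1)]
    by (simp add: Lp_space_iff)
  have L: "(\<lambda>x. u x - \<phi> k x) \<in> Lp_space p \<Omega>" "(\<lambda>x. v x - grad (\<phi> k) x) \<in> Lp_space p \<Omega>"
    using Lp_space_diff[OF W1p_weak_grad(3)[OF uW \<Omega>(1)] test_function_Lp(1)[OF \<Omega> \<phi>]]
      Lp_space_diff[OF v test_function_Lp(2)[OF \<Omega> \<phi>]] p by auto
  have W: "(\<lambda>x. u x - \<phi> k x) \<in> W1p p \<Omega>" by (rule W1pI[OF L D])
  have small: "ennreal (c powr p) \<le> ennreal e" if "0 \<le> c" "c < e powr (1/p)" for c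
  proof -
    have "c powr p \<le> (e powr (1/p)) powr p" using that p by (intro powr_mono2) auto
    then show ?thesis using e p by (intro ennreal_leI) (simp add: powr_powr)
  qed
  have "Lp_int p \<Omega> (\<lambda>x. u x - \<phi> k x) \<le> ennreal e"
    unfolding Lp_int_eq_norm[OF L(1) less_le_trans[OF zero_less_one p]]
    by (rule small[OF Lp_norm_nonneg])
      (use k Lp_norm_nonneg[of p \<Omega> "\<lambda>x. u x - \<phi> k x"] Lp_norm_nonneg[of p \<Omega> "weak_grad \<Omega> (\<lambda>x. u x - \<phi> k x)"] in \<open>simp add: W1p_norm_def\<close>)
  moreover have "Lp_int p \<Omega> (\<lambda>x. v x - grad (\<phi> k) x) \<le> ennreal e"
    unfolding Lp_int_cong[OF ae, symmetric] Lp_int_eq_norm[OF W1p_weak_grad(2)[OF W \<Omega>(1)] less_le_trans[OF zero_less_one p]]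
    by (rule small[OF Lp_norm_nonneg])
      (use k Lp_norm_nonneg[of p \<Omega> "\<lambda>x. u x - \<phi> k x"] Lp_norm_nonneg[of p \<Omega> "weak_grad \<Omega> (\<lambda>x. u x - \<phi> k x)"] in \<open>simp add: W1p_norm_def\<close>)
  ultimately show ?thesis using \<phi> by blast
qed

lemma W1p_0I:
  fixes u :: "real^'n \<Rightarrow> real"
  assumes wg: "is_weak_grad \<Omega> u v" and u: "u \<in> Lp_space p \<Omega>" "v \<in> Lp_space p \<Omega>" and \<Omega>: "open \<Omega>" "bounded \<Omega>" and p: "p \<ge> 1"
    and approx: "\<And>e. e > 0 \<Longrightarrow> \<exists>\<phi>\<in>test_functions \<Omega>. Lp_int p \<Omega> (\<lambda>x. u x - \<phi> x) \<le> ennreal e \<and> Lp_int p \<Omega> (\<lambda>x. v x - grad \<phi> x) \<le> ennreal e"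
  shows "u \<in> W1p_0 p \<Omega>"
proof -
  have "inverse (real (Suc k)) powr p > 0" for k by simp
  then have "\<forall>k. \<exists>\<phi>. \<phi> \<in> test_functions \<Omega> \<and> Lp_int p \<Omega> (\<lambda>x. u x - \<phi> x) \<le> ennreal (inverse (real (Suc k)) powr p) \<and> Lp_int p \<Omega> (\<lambda>x. v x - grad \<phi> x) \<le> ennreal (inverse (real (Suc k)) powr p)"
    using approx by blast
  from choice[OF this] obtain \<phi> where "\<forall>k. \<phi> k \<in> test_functions \<Omega> \<and> Lp_int p \<Omega> (\<lambda>x. u x - \<phi> k x) \<le> ennreal (inverse (real (Suc k)) powr p) \<and> Lp_int p \<Omega> (\<lambda>x. v x - grad (\<phi> k) x) \<le> ennreal (inverse (real (Suc k)) powr p)"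
    by (elim exE)
  then have \<phi>: "\<And>k. \<phi> k \<in> test_functions \<Omega>"
    and s: "\<And>k. Lp_int p \<Omega> (\<lambda>x. u x - \<phi> k x) \<le> ennreal (inverse (real (Suc k)) powr p)" "\<And>k. Lp_int p \<Omega> (\<lambda>x. v x - grad (\<phi> k) x) \<le> ennreal (inverse (real (Suc k)) powr p)"
    by simp_all
  have p0: "p > 0" using p by simp
  have small: "c \<le> inverse (real (Suc k))" if "ennreal (c powr p) \<le> ennreal (inverse (real (Suc k)) powr p)" "c \<ge> 0" for c k
  proof (rule ccontr)
    assume "\<not> c \<le> inverse (real (Suc k))"
    then have "inverse (real (Suc k)) powr p < c powr p" using p0 by (intro powr_less_mono2) auto
    then show False using that(1) by (simp add: ennreal_le_iff)
  qed
  have "W1p_norm p \<Omega> (\<lambda>x. u x - \<phi> k x) \<le> 2 * inverse (real (Suc k))" for k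
  proof -
    have D: "is_weak_grad \<Omega> (\<lambda>x. u x - \<phi> k x) (\<lambda>x. v x - grad (\<phi> k) x)"
      by (rule is_weak_grad_diff_test[OF wg \<Omega>(1) \<phi>])
    have ae: "AE x in lebesgue_on \<Omega>. weak_grad \<Omega> (\<lambda>x. u x - \<phi> k x) x = v x - grad (\<phi> k) x"
      by (rule weak_grad_is_weak_grad(2)[OF D \<Omega>(1)])
    have L: "(\<lambda>x. u x - \<phi> k x) \<in> Lp_space p \<Omega>" "(\<lambda>x. v x - grad (\<phi> k) x) \<in> Lp_space p \<Omega>"
      using Lp_space_diff[OF u(1) test_function_Lp(1)[OF \<Omega> \<phi>]] Lp_space_diff[OF u(2) test_function_Lp(2)[OF \<Omega> \<phi>]] p by auto
    have W: "(\<lambda>x. u x - \<phi> k x) \<in> W1p p \<Omega>" by (rule W1pI[OF L D])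
    have "Lp_norm p \<Omega> (\<lambda>x. u x - \<phi> k x) \<le> inverse (real (Suc k))"
      using s(1)[of k] unfolding Lp_int_eq_norm[OF L(1) p0] by (rule small) (rule Lp_norm_nonneg)
    moreover have "Lp_norm p \<Omega> (weak_grad \<Omega> (\<lambda>x. u x - \<phi> k x)) \<le> inverse (real (Suc k))"
      using s(2)[of k] unfolding Lp_int_cong[OF ae, symmetric] Lp_int_eq_norm[OF W1p_weak_grad(2)[OF W \<Omega>(1)] p0] by (rule small) (rule Lp_norm_nonneg)
    ultimately show ?thesis by (simp add: W1p_norm_def)
  qed
  moreover have "W1p_norm p \<Omega> (\<lambda>x. u x - \<phi> k x) \<ge> 0" for k by (simp add: W1p_norm_def Lp_norm_nonneg)
  moreover have "(\<lambda>k. 2 * inverse (real (Suc k))) \<longlonglongrightarrow> 0" by (rule tendsto_mult_right_zero[OF LIMSEQ_inverse_real_of_nat])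
  ultimately have "(\<lambda>k. W1p_norm p \<Omega> (\<lambda>x. u x - \<phi> k x)) \<longlonglongrightarrow> 0"
    by - (rule tendsto_sandwich[OF always_eventually always_eventually tendsto_const, of _ _ "\<lambda>k. 2 * inverse (real (Suc k))"], blast+)
  then show ?thesis
    unfolding W1p_0_def using W1pI[OF u wg] \<phi> by blast
qed

text \<open>Convergence in \<open>L\<^sup>1\<close> of the \<open>p\<close>-th powers gives almost everywhere convergence along a
  subsequence.\<close>

lemma Lp_int_AE_subseq:
  fixes f :: "nat \<Rightarrow> real^'n \<Rightarrow> real"
  assumes m[measurable]: "\<And>k. f k \<in> borel_measurable (lebesgue_on \<Omega>)" and p: "p > 0"
    and b: "\<And>k. Lp_int p \<Omega> (f k) \<le> ennreal (c k)" and c: "c \<longlonglongrightarrow> 0" "\<And>k. c k \<ge> 0"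
  shows "\<exists>r::nat\<Rightarrow>nat. strict_mono r \<and> (AE x in lebesgue_on \<Omega>. (\<lambda>k. f (r k) x) \<longlonglongrightarrow> 0)"
proof -
  have i: "integrable (lebesgue_on \<Omega>) (\<lambda>x. \<bar>f k x\<bar> powr p)" for k
    using b[of k] by (intro integrableI_bounded) (auto simp: Lp_int_def intro: le_less_trans)
  have le: "(\<integral>x. \<bar>f k x\<bar> powr p \<partial>lebesgue_on \<Omega>) \<le> c k" for k
    using nn_integral_eq_integral[OF i[of k]] b[of k] c(2)[of k] by (simp add: Lp_int_def ennreal_le_iff)
  have "(\<lambda>k. \<integral>x. norm (\<bar>f k x\<bar> powr p) \<partial>lebesgue_on \<Omega>) \<longlonglongrightarrow> 0"
    by (rule tendsto_sandwich[OF always_eventually always_eventually tendsto_const c(1)]) (use le in auto)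
  then obtain r :: "nat \<Rightarrow> nat" where r: "strict_mono r" and ae: "AE x in lebesgue_on \<Omega>. (\<lambda>k. \<bar>f (r k) x\<bar> powr p) \<longlonglongrightarrow> 0"
    using tendsto_L1_AE_subseq[of "lebesgue_on \<Omega>" "\<lambda>k x. \<bar>f k x\<bar> powr p"] i by auto
  have "AE x in lebesgue_on \<Omega>. (\<lambda>k. f (r k) x) \<longlonglongrightarrow> 0"
    using ae
  proof eventually_elim
    case (elim x)
    have "(\<lambda>k. (\<bar>f (r k) x\<bar> powr p) powr (1/p)) \<longlonglongrightarrow> 0 powr (1/p)"
      by (rule tendsto_powr'[OF elim tendsto_const]) (use p in auto)
    then have "(\<lambda>k. \<bar>f (r k) x\<bar>) \<longlonglongrightarrow> 0" using p by (simp add: powr_powr)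
    then show ?case by (simp add: tendsto_rabs_zero_iff)
  qed
  with r show ?thesis by blast
qed

lemma nn_integral_lborel_eq_lebesgue_on:
  assumes "open \<Omega>" "\<And>x. x \<notin> \<Omega> \<Longrightarrow> h x = 0"
  shows "(\<integral>\<^sup>+x. h x \<partial>lborel) = (\<integral>\<^sup>+x. h x \<partial>lebesgue_on (\<Omega> :: (real^'n) set))"
proof -
  have "(\<integral>\<^sup>+x. h x \<partial>lebesgue_on \<Omega>) = (\<integral>\<^sup>+x. h x * indicator \<Omega> x \<partial>lebesgue)"
    by (rule nn_integral_restrict_space) (use assms(1) in auto)
  also have "\<dots> = (\<integral>\<^sup>+x. h x \<partial>lebesgue)" by (rule nn_integral_cong) (use assms(2) in \<open>auto simp: indicator_def\<close>)
  finally show ?thesis by (simp add: nn_integral_completion)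
qed

text \<open>The inequality passes from test functions to the limit by Fatou's lemma along an almost
  everywhere convergent subsequence. The approximation error is kept below \<open>X\<close> itself, so the
  gradients of the approximants have \<open>p\<close>-th power integral at most a constant times \<open>X\<close>. This
  needs \<open>X > 0\<close>; the case \<open>X = 0\<close> is the limit of that one.\<close>

theorem sobolev_W1p_0:
  fixes \<Omega> :: "(real^'n) set" and p q :: real
  assumes \<Omega>: "open \<Omega>" "bounded \<Omega>" and pq: "1 \<le> p" "p < q" and sub: "real CARD('n) * (1 / p - 1 / q) < 1"
  shows "\<exists>C>0. \<forall>u\<in>W1p_0 p \<Omega>. \<forall>v X. is_weak_grad \<Omega> u v \<longrightarrow> X \<ge> 0 \<longrightarrow> Lp_int p \<Omega> v \<le> ennreal X \<longrightarrow>
    Lp_int q \<Omega> u \<le> ennreal (C * X powr (q / p))"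
proof -
  obtain C where C: "C > 0" and sob: "\<And>\<phi> G. \<phi> \<in> test_functions \<Omega> \<Longrightarrow> G \<ge> 0 \<Longrightarrow> (\<integral>\<^sup>+x. ennreal (norm (grad \<phi> x) powr p) \<partial>lborel) \<le> ennreal (G powr p) \<Longrightarrow>
    (\<integral>\<^sup>+x. ennreal (\<bar>\<phi> x\<bar> powr q) \<partial>lborel) \<le> ennreal (C * G powr q)"
    using sobolev_test_functions[OF \<Omega>(2) pq sub] by blast
  define C' where "C' = C * 4 powr q"
  have "C' > 0" using C by (simp add: C'_def)
  have main: "Lp_int q \<Omega> u \<le> ennreal (C' * X powr (q / p))"
    if u: "u \<in> W1p_0 p \<Omega>" and wg: "is_weak_grad \<Omega> u v" and X: "X > 0" and b: "Lp_int p \<Omega> v \<le> ennreal X" for u v X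
  proof -
    \<comment> \<open>the error is at most \<open>X\<close>, which keeps the gradients of the approximants of size \<open>X\<close>\<close>
    define e where "e k = min X (inverse (real (Suc k)))" for k
    have e: "e k > 0" "e k \<le> X" for k using X by (auto simp: e_def)
    have e0: "e \<longlonglongrightarrow> 0"
      by (rule tendsto_sandwich[OF always_eventually always_eventually tendsto_const LIMSEQ_inverse_real_of_nat]) (use e in \<open>auto simp: e_def intro: less_imp_le\<close>)
    have "\<forall>k. \<exists>\<phi>. \<phi> \<in> test_functions \<Omega> \<and> Lp_int p \<Omega> (\<lambda>x. u x - \<phi> x) \<le> ennreal (e k) \<and> Lp_int p \<Omega> (\<lambda>x. v x - grad \<phi> x) \<le> ennreal (e k)"
      using W1p_0_approx[OF u wg \<Omega> pq(1) e(1)] by blast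
    from choice[OF this] obtain \<phi> where "\<forall>k. \<phi> k \<in> test_functions \<Omega> \<and> Lp_int p \<Omega> (\<lambda>x. u x - \<phi> k x) \<le> ennreal (e k) \<and> Lp_int p \<Omega> (\<lambda>x. v x - grad (\<phi> k) x) \<le> ennreal (e k)"
      by (elim exE)
    then have \<phi>: "\<And>k. \<phi> k \<in> test_functions \<Omega>" and a1: "\<And>k. Lp_int p \<Omega> (\<lambda>x. u x - \<phi> k x) \<le> ennreal (e k)"
      and a2: "\<And>k. Lp_int p \<Omega> (\<lambda>x. v x - grad (\<phi> k) x) \<le> ennreal (e k)"
      by simp_all
    have m: "u \<in> borel_measurable (lebesgue_on \<Omega>)" "v \<in> borel_measurable (lebesgue_on \<Omega>)"
      by (rule is_weak_grad_measurable[OF wg \<Omega>(1)])+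
    have m\<phi>: "\<phi> k \<in> borel_measurable (lebesgue_on \<Omega>)" "grad (\<phi> k) \<in> borel_measurable (lebesgue_on \<Omega>)" for k
      by (intro continuous_measurable_lebesgue_on smooth_continuous_on smooth_continuous_grad test_function_smooth[OF \<phi>])+
    note [measurable] = m m\<phi>
    have bound: "Lp_int q \<Omega> (\<phi> k) \<le> ennreal (C' * X powr (q / p))" for k
    proof -
      have "Lp_int p \<Omega> (\<lambda>x. v x + (grad (\<phi> k) x - v x)) \<le> ennreal (2 powr p * (X + X))"
        by (rule Lp_int_add_le) (use X b a2[of k] e(2)[of k] pq m m\<phi> in \<open>auto simp: Lp_int_diff_commute[of p \<Omega> "grad (\<phi> k)"] intro: order_trans ennreal_leI\<close>)
      then have "Lp_int p \<Omega> (grad (\<phi> k)) \<le> ennreal (2 powr p * (X + X))" by simp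
      also have "2 powr p * (X + X) \<le> (4 * X powr (1/p)) powr p"
      proof -
        have "2 \<le> 2 powr p" using pq(1) powr_mono[of 1 p 2] by simp
        then have "2 powr p * (2 * X) \<le> 2 powr p * (2 powr p * X)" using X by (intro mult_left_mono mult_right_mono) auto
        also have "\<dots> = (2 * 2) powr p * X" by (subst powr_mult) auto
        finally show ?thesis using X pq by (simp add: powr_mult powr_powr)
      qed
      finally have "Lp_int p \<Omega> (grad (\<phi> k)) \<le> ennreal ((4 * X powr (1/p)) powr p)" by (simp add: ennreal_leI)
      moreover have "(\<integral>\<^sup>+x. ennreal (norm (grad (\<phi> k) x) powr p) \<partial>lborel) = Lp_int p \<Omega> (grad (\<phi> k))"
        "(\<integral>\<^sup>+x. ennreal (\<bar>\<phi> k x\<bar> powr q) \<partial>lborel) = Lp_int q \<Omega> (\<phi> k)"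
      proof -
        obtain K where K: "K \<subseteq> \<Omega>" "\<And>x. x \<notin> K \<Longrightarrow> \<phi> k x = 0" "\<And>x i. x \<notin> K \<Longrightarrow> partial i (\<phi> k) x = 0"
          by (rule test_function_support[OF \<phi>[of k]]) (rule that)
        have z: "\<phi> k x = 0" "grad (\<phi> k) x = 0" if "x \<notin> \<Omega>" for x
          using K that by (auto simp: vec_eq_iff)
        show "(\<integral>\<^sup>+x. ennreal (norm (grad (\<phi> k) x) powr p) \<partial>lborel) = Lp_int p \<Omega> (grad (\<phi> k))"
          unfolding Lp_int_def by (rule nn_integral_lborel_eq_lebesgue_on[OF \<Omega>(1)]) (simp add: z)
        show "(\<integral>\<^sup>+x. ennreal (\<bar>\<phi> k x\<bar> powr q) \<partial>lborel) = Lp_int q \<Omega> (\<phi> k)"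
          unfolding Lp_int_def real_norm_def by (rule nn_integral_lborel_eq_lebesgue_on[OF \<Omega>(1)]) (simp add: z)
      qed
      ultimately have "Lp_int q \<Omega> (\<phi> k) \<le> ennreal (C * (4 * X powr (1/p)) powr q)"
        using sob[OF \<phi>[of k], of "4 * X powr (1/p)"] by simp
      also have "C * (4 * X powr (1/p)) powr q = C' * X powr (q / p)"
        by (simp add: C'_def powr_mult powr_powr)
      finally show ?thesis .
    qed
    obtain r :: "nat \<Rightarrow> nat" where r: "strict_mono r" and ae: "AE x in lebesgue_on \<Omega>. (\<lambda>k. u x - \<phi> (r k) x) \<longlonglongrightarrow> 0"
      using Lp_int_AE_subseq[of "\<lambda>k x. u x - \<phi> k x" \<Omega> p e] a1 e0 e(1) pq by (auto intro: less_imp_le)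
    have "Lp_int q \<Omega> u = (\<integral>\<^sup>+x. liminf (\<lambda>k. ennreal (\<bar>\<phi> (r k) x\<bar> powr q)) \<partial>lebesgue_on \<Omega>)"
      unfolding Lp_int_def
    proof (rule nn_integral_cong_AE)
      show "AE x in lebesgue_on \<Omega>. ennreal (norm (u x) powr q) = liminf (\<lambda>k. ennreal (\<bar>\<phi> (r k) x\<bar> powr q))"
        using ae
      proof eventually_elim
        case (elim x)
        have "(\<lambda>k. u x - (u x - \<phi> (r k) x)) \<longlonglongrightarrow> u x - 0" by (intro tendsto_intros elim)
        then have "(\<lambda>k. \<bar>\<phi> (r k) x\<bar> powr q) \<longlonglongrightarrow> \<bar>u x\<bar> powr q"
          using pq by (intro tendsto_powr' tendsto_rabs tendsto_const) auto
        then have "(\<lambda>k. ennreal (\<bar>\<phi> (r k) x\<bar> powr q)) \<longlonglongrightarrow> ennreal (\<bar>u x\<bar> powr q)" by (rule tendsto_ennrealI)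
        then show ?case by (simp only: real_norm_def lim_imp_Liminf[OF sequentially_bot])
      qed
    qed
    also have "\<dots> \<le> liminf (\<lambda>k. \<integral>\<^sup>+x. ennreal (\<bar>\<phi> (r k) x\<bar> powr q) \<partial>lebesgue_on \<Omega>)"
      by (rule nn_integral_liminf) measurable
    also have "\<dots> \<le> liminf (\<lambda>k. ennreal (C' * X powr (q / p)))"
      by (rule Liminf_mono) (use bound in \<open>auto simp: Lp_int_def\<close>)
    also have "\<dots> = ennreal (C' * X powr (q / p))" by (simp add: Liminf_const)
    finally show ?thesis .
  qed
  show ?thesis
  proof (intro exI[of _ C'] conjI ballI allI impI \<open>C' > 0\<close>)
    fix u v X assume u: "u \<in> W1p_0 p \<Omega>" and wg: "is_weak_grad \<Omega> u v" and X: "X \<ge> 0" and b: "Lp_int p \<Omega> v \<le> ennreal X"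
    show "Lp_int q \<Omega> u \<le> ennreal (C' * X powr (q / p))"
    proof (cases "X = 0")
      case False
      then show ?thesis using main[OF u wg _ b] X by simp
    next
      case True
      have "Lp_int q \<Omega> u \<le> 0 + ennreal e" if "e > 0" for e
      proof -
        define X' where "X' = (e / C') powr (p / q)"
        have "X' > 0" "C' * X' powr (q / p) = e" using that \<open>C' > 0\<close> pq by (auto simp: X'_def powr_powr)
        then show ?thesis using main[OF u wg, of X'] b True by simp
      qed
      then have "Lp_int q \<Omega> u \<le> 0" by - (rule ennreal_le_epsilon, simp)
      then show ?thesis by simp
    qed
  qed
qed

section \<open>Positive parts in \<open>W1p_0\<close>\<close>

lemma sum_powr_le:
  fixes a :: "'i \<Rightarrow> real"
  assumes "finite A" "A \<noteq> {}" "\<And>i. i \<in> A \<Longrightarrow> 0 \<le> a i" "p \<ge> 0"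
  shows "(\<Sum>i\<in>A. a i) powr p \<le> real (card A) powr p * (\<Sum>i\<in>A. a i powr p)"
proof -
  obtain j where j: "j \<in> A" "\<And>i. i \<in> A \<Longrightarrow> a i \<le> a j"
  proof -
    have "Max (a ` A) \<in> a ` A" using assms by (intro Max_in) auto
    then obtain j where "j \<in> A" "a j = Max (a ` A)" by auto
    then show ?thesis using that assms(1) by (metis Max_ge finite_imageI imageI)
  qed
  have "(\<Sum>i\<in>A. a i) \<le> real (card A) * a j" using sum_bounded_above[of A a "a j"] j by simp
  then have "(\<Sum>i\<in>A. a i) powr p \<le> (real (card A) * a j) powr p"
    using assms by (intro powr_mono2 sum_nonneg) auto
  also have "\<dots> = real (card A) powr p * a j powr p" using assms j by (simp add: powr_mult)
  also have "\<dots> \<le> real (card A) powr p * (\<Sum>i\<in>A. a i powr p)"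
    using assms j by (intro mult_left_mono member_le_sum) auto
  finally show ?thesis .
qed

lemma Lp_int_le_lebesgue:
  fixes f :: "real^'n \<Rightarrow> 'b::euclidean_space"
  assumes "open \<Omega>"
  shows "Lp_int p \<Omega> f \<le> (\<integral>\<^sup>+x. ennreal (norm (f x) powr p) \<partial>lebesgue)"
proof -
  have "Lp_int p \<Omega> f = (\<integral>\<^sup>+x. ennreal (norm (f x) powr p) * indicator \<Omega> x \<partial>lebesgue)"
    unfolding Lp_int_def by (rule nn_integral_restrict_space) (use assms in auto)
  also have "\<dots> \<le> (\<integral>\<^sup>+x. ennreal (norm (f x) powr p) \<partial>lebesgue)"
    by (rule nn_integral_mono) (auto simp: indicator_def)
  finally show ?thesis .
qed

lemma lebesgue_indicator_le_Lp_int: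
  fixes f :: "real^'n \<Rightarrow> 'b::euclidean_space" and g :: "real^'n \<Rightarrow> real"
  assumes "open \<Omega>" "K \<subseteq> \<Omega>" "\<And>x. \<bar>g x\<bar> \<le> norm (f x)" "p \<ge> 0"
  shows "(\<integral>\<^sup>+x. ennreal (\<bar>indicator K x * g x\<bar> powr p) \<partial>lebesgue) \<le> Lp_int p \<Omega> f"
proof -
  have "(\<integral>\<^sup>+x. ennreal (\<bar>indicator K x * g x\<bar> powr p) \<partial>lebesgue) \<le> (\<integral>\<^sup>+x. ennreal (norm (f x) powr p) * indicator \<Omega> x \<partial>lebesgue)"
  proof (rule nn_integral_mono)
    fix x
    show "ennreal (\<bar>indicator K x * g x\<bar> powr p) \<le> ennreal (norm (f x) powr p) * indicator \<Omega> x"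
      using assms(2) assms(3)[of x] assms(4) by (auto simp: indicator_def intro!: ennreal_leI powr_mono2)
  qed
  also have "\<dots> = Lp_int p \<Omega> f"
    unfolding Lp_int_def by (rule nn_integral_restrict_space[symmetric]) (use assms in auto)
  finally show ?thesis .
qed

text \<open>Mollify componentwise. For small \<open>\<delta>\<close> the mollification of \<open>f\<close> is a test function on \<open>\<Omega>\<close>, and its
  gradient is the mollification of \<open>h\<close>: near \<open>K\<close> by \<open>conv_weak_grad\<close>, and far from \<open>K\<close> because both
  sides vanish.\<close>

theorem mollify_compact_support:
  fixes f :: "real^'n \<Rightarrow> real"
  assumes wg: "is_weak_grad \<Omega> f h" and \<Omega>: "open \<Omega>" and p: "p \<ge> 1" and L: "f \<in> Lp_space p \<Omega>" "h \<in> Lp_space p \<Omega>"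
    and K: "compact K" "K \<subseteq> \<Omega>" and supp: "AE x in lebesgue_on \<Omega>. x \<notin> K \<longrightarrow> f x = 0 \<and> h x = 0" and e: "e > 0"
  shows "\<exists>\<psi>\<in>test_functions \<Omega>. Lp_int p \<Omega> (\<lambda>x. f x - \<psi> x) \<le> ennreal e \<and> Lp_int p \<Omega> (\<lambda>x. h x - grad \<psi> x) \<le> ennreal e"
proof -
  obtain d K' where d: "d > 0" and K': "compact K'" "K \<subseteq> K'" "K' \<subseteq> \<Omega>" and ball: "\<And>x \<delta>. x \<in> K \<Longrightarrow> \<delta> \<le> d \<Longrightarrow> cball x \<delta> \<subseteq> K'"
    by (rule compact_neighbourhood[OF K(1) \<Omega> K(2)]) (rule that)
  define N where "N = real CARD('n)"
  have N: "N \<ge> 1" unfolding N_def by (simp add: Suc_leI)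
  have N': "N powr p * N \<ge> 1"
    using mult_mono[of 1 "N powr p" 1 N] N p by (simp add: ge_one_powr_ge_zero)
  \<comment> \<open>the gradient has \<open>N\<close> components, and the power of their sum costs \<open>N powr p\<close>\<close>
  define e2 where "e2 = e / (N powr p * N)"
  have e2: "e2 > 0" "e2 \<le> e" "N powr p * (N * e2) = e"
    using e N N' by (auto simp: e2_def divide_le_eq)
  define F where "F x = indicator K x * f x" for x
  define H where "H i x = indicator K x * h x $ i" for i x
  have iF: "integrable lebesgue F" unfolding F_def[abs_def] by (rule is_weak_gradD(1)[OF wg K])
  have iH: "integrable lebesgue (H i)" for i unfolding H_def[abs_def] by (rule is_weak_gradD(2)[OF wg K])
  have fF: "(\<integral>\<^sup>+x. ennreal (\<bar>F x\<bar> powr p) \<partial>lebesgue) < \<infinity>"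
    unfolding F_def by (rule le_less_trans[OF lebesgue_indicator_le_Lp_int[OF \<Omega> K(2), of f f p]]) (use L p in \<open>auto simp: Lp_space_iff\<close>)
  have fH: "(\<integral>\<^sup>+x. ennreal (\<bar>H i x\<bar> powr p) \<partial>lebesgue) < \<infinity>" for i
    unfolding H_def by (rule le_less_trans[OF lebesgue_indicator_le_Lp_int[OF \<Omega> K(2), of "\<lambda>x. h x $ i" h p]])
      (use L p component_le_norm_cart in \<open>auto simp: Lp_space_iff\<close>)
  obtain dF where dF: "dF > 0" "\<And>\<delta>. 0 < \<delta> \<and> \<delta> < dF \<Longrightarrow> (\<integral>\<^sup>+x. ennreal (\<bar>conv (mollifier \<delta>) F x - F x\<bar> powr p) \<partial>lebesgue) \<le> ennreal e2"
    using mollify_Lp[OF p iF fF e2(1)] by blast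
  have "\<forall>i. \<exists>d>0. \<forall>\<delta>. 0 < \<delta> \<and> \<delta> < d \<longrightarrow> (\<integral>\<^sup>+x. ennreal (\<bar>conv (mollifier \<delta>) (H i) x - H i x\<bar> powr p) \<partial>lebesgue) \<le> ennreal e2"
    using mollify_Lp[OF p iH fH e2(1)] by blast
  from choice[OF this] obtain dH where dH: "\<And>i. dH i > 0" "\<And>i \<delta>. 0 < \<delta> \<and> \<delta> < dH i \<Longrightarrow> (\<integral>\<^sup>+x. ennreal (\<bar>conv (mollifier \<delta>) (H i) x - H i x\<bar> powr p) \<partial>lebesgue) \<le> ennreal e2"
    by blast
  define D where "D = Min (range dH)"
  have D: "D > 0" "D \<le> dH i" for i unfolding D_def using dH(1) by auto
  \<comment> \<open>\<open>d/2\<close> rather than \<open>d\<close>: a ball of radius \<open>\<delta>\<close> that meets \<open>K\<close> lies in a ball of radius \<open>2 \<delta>\<close> about a point of \<open>K\<close>\<close>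
  define \<delta> where "\<delta> = min (d/2) (min (dF/2) (D/2))"
  have \<delta>: "\<delta> > 0" "\<delta> \<le> d/2" "\<delta> < dF" "\<delta> < dH i" for i
    using d dF(1) D(1) D(2)[of i] by (auto simp: \<delta>_def min_def)
  define \<psi> where "\<psi> = conv (mollifier \<delta>) F"
  have mz: "mollifier \<delta> x = 0" if "norm x > \<delta>" for x :: "real^'n" using that \<delta>(1) by (simp add: mollifier_zero)
  have sm: "smooth \<psi>" unfolding \<psi>_def by (rule smooth_conv[OF smooth_mollifier mz iF])
  have far: "conv k (\<lambda>y. indicator K y * g y) x = 0" if "cball x \<delta> \<inter> K = {}" "\<And>x. norm x > \<delta> \<Longrightarrow> k x = 0" for k :: "real^'n \<Rightarrow> real" and g x
  proof -
    have z0: "k (x - y) * (indicator K y * g y) = 0" for y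
    proof (cases "y \<in> K")
      case True
      then have "y \<notin> cball x \<delta>" using that(1) by blast
      then show ?thesis using that(2)[of "x - y"] by (simp add: dist_norm)
    qed simp
    show ?thesis unfolding conv_def by (simp only: z0 Bochner_Integration.integral_zero)
  qed
  have aeF: "AE x in lebesgue. indicator K' x * f x = F x" and aeH: "AE x in lebesgue. indicator K' x * h x $ i = H i x" for i
  proof -
    have ae: "AE x in lebesgue. x \<in> \<Omega> \<longrightarrow> x \<notin> K \<longrightarrow> f x = 0 \<and> h x = 0"
      using supp \<Omega> by (subst (asm) AE_restrict_space_iff) auto
    show "AE x in lebesgue. indicator K' x * f x = F x"
      using ae by eventually_elim (use K' in \<open>auto simp: F_def indicator_def\<close>)
    show "AE x in lebesgue. indicator K' x * h x $ i = H i x" for i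
      using ae by eventually_elim (use K' in \<open>auto simp: H_def indicator_def\<close>)
  qed
  have p\<psi>: "partial i \<psi> x = conv (mollifier \<delta>) (H i) x" for i x
  proof -
    have pz: "partial i (mollifier \<delta>) x = 0" if "norm x > \<delta>" for x :: "real^'n" by (rule partial_zero_outside_ball(1)[OF mz that])
    have "partial i \<psi> x = conv (partial i (mollifier \<delta>)) F x"
      unfolding \<psi>_def by (rule fun_cong[OF partial_conv[OF smooth_mollifier mz iF]])
    also have "\<dots> = conv (mollifier \<delta>) (H i) x"
    proof (cases "cball x \<delta> \<inter> K = {}")
      case True
      then show ?thesis unfolding F_def[abs_def] H_def[abs_def] using far[OF True pz] far[OF True mz] by simp
    next
      case False
      then obtain y where y: "y \<in> K" "dist x y \<le> \<delta>" by auto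
      have "cball x \<delta> \<subseteq> cball y (2 * \<delta>)"
      proof
        fix z assume "z \<in> cball x \<delta>"
        then show "z \<in> cball y (2 * \<delta>)" using y(2) dist_triangle[of y z x] by (simp add: dist_commute)
      qed
      also have "\<dots> \<subseteq> K'" using ball[OF y(1), of "2 * \<delta>"] \<delta>(2) by simp
      finally have sub: "cball x \<delta> \<subseteq> K'" .
      have "conv (partial i (mollifier \<delta>)) F x = conv (partial i (mollifier \<delta>)) (\<lambda>y. indicator K' y * f y) x"
        by (rule conv_cong_AE[symmetric, OF aeF]) (use iF is_weak_gradD(1)[OF wg K'(1,3)] in \<open>auto intro: smooth_continuous_on smooth_partial smooth_mollifier\<close>)
      also have "\<dots> = conv (mollifier \<delta>) (\<lambda>y. indicator K' y * h y $ i) x"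
        by (rule conv_weak_grad[OF wg \<Omega> K'(3) \<delta>(1) sub])
      also have "\<dots> = conv (mollifier \<delta>) (H i) x"
        by (rule conv_cong_AE[OF aeH]) (use iH is_weak_gradD(2)[OF wg K'(1,3)] in \<open>auto intro: smooth_continuous_on smooth_mollifier\<close>)
      finally show ?thesis .
    qed
    finally show ?thesis .
  qed
  have "\<psi> \<in> test_functions \<Omega>"
  proof -
    have "{x. \<psi> x \<noteq> 0} \<subseteq> K'"
    proof
      fix x assume "x \<in> {x. \<psi> x \<noteq> 0}"
      then have "conv (mollifier \<delta>) (\<lambda>y. indicator K y * f y) x \<noteq> 0" by (simp add: \<psi>_def F_def[abs_def])
      moreover have "conv (mollifier \<delta>) (\<lambda>y. indicator K y * f y) x = 0" if "cball x \<delta> \<inter> K = {}"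
        by (rule far[OF that mz])
      ultimately have "cball x \<delta> \<inter> K \<noteq> {}" by (rule contrapos_nn)
      then obtain y where y: "y \<in> K" "dist x y \<le> \<delta>" by auto
      then show "x \<in> K'" using ball[OF y(1), of \<delta>] \<delta>(1,2) d by (auto simp: dist_commute)
    qed
    then have c: "closure {x. \<psi> x \<noteq> 0} \<subseteq> K'" using K'(1) by (intro closure_minimal compact_imp_closed)
    then have "compact (closure {x. \<psi> x \<noteq> 0})" using compact_Int_closed[OF K'(1) closed_closure[of "{x. \<psi> x \<noteq> 0}"]] by (simp add: Int_absorb1)
    then show ?thesis using sm c K'(3) by (simp add: test_functions_def)
  qed
  moreover have "Lp_int p \<Omega> (\<lambda>x. f x - \<psi> x) \<le> ennreal e"
  proof -
    have "Lp_int p \<Omega> (\<lambda>x. f x - \<psi> x) = Lp_int p \<Omega> (\<lambda>x. F x - \<psi> x)"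
      by (rule Lp_int_cong) (use supp in \<open>eventually_elim, auto simp: F_def indicator_def\<close>)
    also have "\<dots> = Lp_int p \<Omega> (\<lambda>x. \<psi> x - F x)" by (rule Lp_int_diff_commute)
    also have "\<dots> \<le> (\<integral>\<^sup>+x. ennreal (norm (\<psi> x - F x) powr p) \<partial>lebesgue)" by (rule Lp_int_le_lebesgue[OF \<Omega>])
    also have "\<dots> \<le> ennreal e2" using dF(2)[of \<delta>] \<delta> by (simp add: \<psi>_def)
    also have "\<dots> \<le> ennreal e" using e2 by (intro ennreal_leI)
    finally show ?thesis .
  qed
  moreover have "Lp_int p \<Omega> (\<lambda>x. h x - grad \<psi> x) \<le> ennreal e"
  proof -
    have mH: "H i \<in> borel_measurable lebesgue" for i using iH by auto
    have mc: "conv (mollifier \<delta>) (H i) \<in> borel_measurable lebesgue" for i by (rule conv_mollifier_measurable[OF \<delta>(1) iH])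
    define HH where "HH x = (\<chi> i. H i x)" for x
    have "Lp_int p \<Omega> (\<lambda>x. h x - grad \<psi> x) = Lp_int p \<Omega> (\<lambda>x. HH x - grad \<psi> x)"
      by (rule Lp_int_cong) (use supp in \<open>eventually_elim, auto simp: HH_def H_def indicator_def vec_eq_iff\<close>)
    also have "\<dots> \<le> (\<integral>\<^sup>+x. ennreal (norm (HH x - grad \<psi> x) powr p) \<partial>lebesgue)" by (rule Lp_int_le_lebesgue[OF \<Omega>])
    also have "\<dots> \<le> (\<integral>\<^sup>+x. ennreal (N powr p) * (\<Sum>i\<in>UNIV. ennreal (\<bar>conv (mollifier \<delta>) (H i) x - H i x\<bar> powr p)) \<partial>lebesgue)"
    proof (rule nn_integral_mono)
      fix x
      have "norm (HH x - grad \<psi> x) powr p \<le> (\<Sum>i\<in>UNIV. \<bar>(HH x - grad \<psi> x) $ i\<bar>) powr p"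
        using p by (intro powr_mono2 norm_le_l1_cart) auto
      also have "\<dots> \<le> N powr p * (\<Sum>i\<in>UNIV. \<bar>(HH x - grad \<psi> x) $ i\<bar> powr p)"
        unfolding N_def by (rule sum_powr_le) (use p in auto)
      also have "(\<Sum>i\<in>UNIV. \<bar>(HH x - grad \<psi> x) $ i\<bar> powr p) = (\<Sum>i\<in>UNIV. \<bar>conv (mollifier \<delta>) (H i) x - H i x\<bar> powr p)"
        by (simp add: HH_def p\<psi> abs_minus_commute)
      finally have "ennreal (norm (HH x - grad \<psi> x) powr p) \<le> ennreal (N powr p * (\<Sum>i\<in>UNIV. \<bar>conv (mollifier \<delta>) (H i) x - H i x\<bar> powr p))"
        by (rule ennreal_leI)
      then show "ennreal (norm (HH x - grad \<psi> x) powr p) \<le> ennreal (N powr p) * (\<Sum>i\<in>UNIV. ennreal (\<bar>conv (mollifier \<delta>) (H i) x - H i x\<bar> powr p))"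
        by (simp add: ennreal_mult')
    qed
    also have "\<dots> = ennreal (N powr p) * (\<Sum>i\<in>UNIV. (\<integral>\<^sup>+x. ennreal (\<bar>conv (mollifier \<delta>) (H i) x - H i x\<bar> powr p) \<partial>lebesgue))"
    proof -
      have m: "(\<lambda>x. ennreal (\<bar>conv (mollifier \<delta>) (H i) x - H i x\<bar> powr p)) \<in> borel_measurable lebesgue" for i
        using mH[of i] mc[of i] by measurable
      show ?thesis
        by (subst nn_integral_cmult, intro borel_measurable_sum m, subst nn_integral_sum, rule m, rule refl)
    qed
    also have "\<dots> \<le> ennreal (N powr p) * (\<Sum>i\<in>(UNIV::'n set). ennreal e2)"
      using dH(2) \<delta> by (intro mult_left_mono sum_mono) auto
    also have "\<dots> = ennreal (N powr p * (N * e2))"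
      using e2(1) N by (simp add: N_def ennreal_mult' ennreal_of_nat_eq_real_of_nat)
    finally show ?thesis using e2(3) by simp
  qed
  ultimately show ?thesis by blast
qed

text \<open>Let \<open>\<phi>\<^sub>k\<close> be test functions approximating \<open>W - W0\<close>. Where \<open>\<phi>\<^sub>k\<close> vanishes, \<open>W0 + \<phi>\<^sub>k = W0 \<le> 0\<close>; so the
  positive part of \<open>W0 + \<phi>\<^sub>k\<close> has compact support in \<open>\<Omega>\<close> and is a limit of test functions by
  \<open>mollify_compact_support\<close>. The gradients of these positive parts converge because the
  indicators of \<open>{W0 + \<phi>\<^sub>k > 0}\<close> converge almost everywhere off \<open>{W = 0}\<close>, and \<open>V\<close> vanishes almost
  everywhere on \<open>{W = 0}\<close>.\<close>

theorem positive_part_W1p_0: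
  fixes W W0 :: "real^'n \<Rightarrow> real"
  assumes \<Omega>: "open \<Omega>" "bounded \<Omega>" and p: "p \<ge> 1"
    and wgW: "is_weak_grad \<Omega> W V" and wg0: "is_weak_grad \<Omega> W0 V0"
    and L: "W \<in> Lp_space p \<Omega>" "V \<in> Lp_space p \<Omega>" "W0 \<in> Lp_space p \<Omega>" "V0 \<in> Lp_space p \<Omega>"
    and neg: "AE x in lebesgue_on \<Omega>. W0 x \<le> 0"
    and approx: "\<And>e. e > 0 \<Longrightarrow> \<exists>\<phi>\<in>test_functions \<Omega>. Lp_int p \<Omega> (\<lambda>x. W x - W0 x - \<phi> x) \<le> ennreal e \<and> Lp_int p \<Omega> (\<lambda>x. V x - V0 x - grad \<phi> x) \<le> ennreal e"
  shows "(\<lambda>x. max (W x) 0) \<in> W1p_0 p \<Omega>"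
proof (rule W1p_0I[OF weak_grad_positive_part[OF wgW \<Omega>(1)] _ _ \<Omega> p])
  have p0: "p > 0" "p \<ge> 0" using p by auto
  have mW: "W \<in> borel_measurable (lebesgue_on \<Omega>)" "V \<in> borel_measurable (lebesgue_on \<Omega>)"
    and m0: "W0 \<in> borel_measurable (lebesgue_on \<Omega>)" "V0 \<in> borel_measurable (lebesgue_on \<Omega>)"
    using L by (auto simp: Lp_space_iff)
  note [measurable] = mW m0
  show "(\<lambda>x. max (W x) 0) \<in> Lp_space p \<Omega>" by (rule Lp_space_mono[OF L(1) _ _ p0(2)]) auto
  show "(\<lambda>x. of_bool (W x > 0) *\<^sub>R V x) \<in> Lp_space p \<Omega>" by (rule Lp_space_mono[OF L(2) _ _ p0(2)]) auto
  fix e :: real assume e: "e > 0"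
  define e1 where "e1 = e / (2 * 2 powr p)"
  have e1: "e1 > 0" "2 powr p * (e1 + e1) = e" using e by (auto simp: e1_def)
  define s where "s k = inverse (real (Suc k))" for k
  have s: "s k > 0" for k by (simp add: s_def)
  have s0: "s \<longlonglongrightarrow> 0" unfolding s_def by (rule LIMSEQ_inverse_real_of_nat)
  have "\<forall>k. \<exists>\<phi>. \<phi> \<in> test_functions \<Omega> \<and> Lp_int p \<Omega> (\<lambda>x. W x - W0 x - \<phi> x) \<le> ennreal (s k) \<and> Lp_int p \<Omega> (\<lambda>x. V x - V0 x - grad \<phi> x) \<le> ennreal (s k)"
    using approx[OF s] by blast
  from choice[OF this] obtain \<phi> where "\<forall>k. \<phi> k \<in> test_functions \<Omega> \<and> Lp_int p \<Omega> (\<lambda>x. W x - W0 x - \<phi> k x) \<le> ennreal (s k) \<and> Lp_int p \<Omega> (\<lambda>x. V x - V0 x - grad (\<phi> k) x) \<le> ennreal (s k)"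
    by (elim exE)
  then have \<phi>: "\<And>k. \<phi> k \<in> test_functions \<Omega>" and a1: "\<And>k. Lp_int p \<Omega> (\<lambda>x. W x - W0 x - \<phi> k x) \<le> ennreal (s k)"
    and a2: "\<And>k. Lp_int p \<Omega> (\<lambda>x. V x - V0 x - grad (\<phi> k) x) \<le> ennreal (s k)"
    by simp_all
  define Wk where "Wk k x = W0 x + \<phi> k x" for k x
  define Vk where "Vk k x = V0 x + grad (\<phi> k) x" for k x
  have wgk: "is_weak_grad \<Omega> (Wk k) (Vk k)" for k
    using is_weak_grad_lincomb[OF wg0 is_weak_grad_smooth[OF \<Omega>(1) test_function_smooth[OF \<phi>[of k]]] \<Omega>(1), of 1 1]
    by (simp add: Wk_def[abs_def] Vk_def[abs_def])
  have Lk: "Wk k \<in> Lp_space p \<Omega>" "Vk k \<in> Lp_space p \<Omega>" for k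
    unfolding Wk_def[abs_def] Vk_def[abs_def]
    by (intro Lp_space_add L test_function_Lp \<Omega> \<phi> p0)+
  have mk[measurable]: "Wk k \<in> borel_measurable (lebesgue_on \<Omega>)" "Vk k \<in> borel_measurable (lebesgue_on \<Omega>)" for k
    using Lk[of k] by (auto simp: Lp_space_iff)
  have b1: "Lp_int p \<Omega> (\<lambda>x. W x - Wk k x) \<le> ennreal (s k)" and b2: "Lp_int p \<Omega> (\<lambda>x. V x - Vk k x) \<le> ennreal (s k)" for k
    using a1[of k] a2[of k] by (simp_all add: Wk_def Vk_def diff_diff_eq)
  obtain r :: "nat \<Rightarrow> nat" where r: "strict_mono r" and ae: "AE x in lebesgue_on \<Omega>. (\<lambda>k. W x - Wk (r k) x) \<longlonglongrightarrow> 0"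
    using Lp_int_AE_subseq[of "\<lambda>k x. W x - Wk k x" \<Omega> p s, OF _ p0(1) b1 s0 less_imp_le[OF s]] by auto
  \<comment> \<open>the part of the gradient error that comes from the change of the indicator\<close>
  define T where "T k x = (of_bool (Wk (r k) x > 0) - of_bool (W x > 0)) *\<^sub>R V x" for k x
  have [measurable]: "T k \<in> borel_measurable (lebesgue_on \<Omega>)" for k unfolding T_def by measurable
  have "(\<lambda>k. Lp_int p \<Omega> (T k)) \<longlonglongrightarrow> (\<integral>\<^sup>+x. 0 \<partial>lebesgue_on \<Omega>)"
    unfolding Lp_int_def
  proof (rule nn_integral_dominated_convergence[where w="\<lambda>x. ennreal (norm (V x) powr p)"])
    show "AE x in lebesgue_on \<Omega>. ennreal (norm (T k x) powr p) \<le> ennreal (norm (V x) powr p)" for k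
      using p0 by (intro AE_I2 ennreal_leI powr_mono2) (auto simp: T_def)
    show "(\<integral>\<^sup>+x. ennreal (norm (V x) powr p) \<partial>lebesgue_on \<Omega>) < \<infinity>"
      using L(2) by (simp add: Lp_space_iff Lp_int_def)
    show "AE x in lebesgue_on \<Omega>. (\<lambda>k. ennreal (norm (T k x) powr p)) \<longlonglongrightarrow> 0"
      using ae weak_grad_zero_set[OF wgW \<Omega>(1)]
    proof eventually_elim
      case (elim x)
      have "(\<lambda>k. W x - (W x - Wk (r k) x)) \<longlonglongrightarrow> W x - 0" by (intro tendsto_intros elim)
      then have lim: "(\<lambda>k. Wk (r k) x) \<longlonglongrightarrow> W x" by simp
      have "\<forall>\<^sub>F k in sequentially. T k x = 0"
      proof -
        consider "W x > 0" | "W x < 0" | "W x = 0" by linarith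
        then show ?thesis
        proof cases
          case 1
          show ?thesis using order_tendstoD(1)[OF lim 1] by (rule eventually_mono) (use 1 in \<open>simp add: T_def\<close>)
        next
          case 2
          show ?thesis using order_tendstoD(2)[OF lim 2] by (rule eventually_mono) (use 2 in \<open>simp add: T_def\<close>)
        next
          case 3
          then show ?thesis using elim by (simp add: T_def)
        qed
      qed
      then have "\<forall>\<^sub>F k in sequentially. ennreal (norm (T k x) powr p) = 0" by (rule eventually_mono) simp
      then show ?case by (rule tendsto_eventually)
    qed
  qed measurable
  then have "(\<lambda>k. Lp_int p \<Omega> (T k)) \<longlonglongrightarrow> 0" by simp
  then have ev1: "\<forall>\<^sub>F k in sequentially. Lp_int p \<Omega> (T k) < ennreal (e1 / (2 * 2 powr p))"
    using e1 by (intro order_tendstoD(2)) auto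
  have "(\<lambda>k. s (r k)) \<longlonglongrightarrow> 0" using LIMSEQ_subseq_LIMSEQ[OF s0 r] by (simp add: o_def)
  then have ev2: "\<forall>\<^sub>F k in sequentially. s (r k) < min e1 (e1 / (2 * 2 powr p))"
    using e1 by (intro order_tendstoD(2)) auto
  obtain k where k1: "Lp_int p \<Omega> (T k) < ennreal (e1 / (2 * 2 powr p))" and k2: "s (r k) < min e1 (e1 / (2 * 2 powr p))"
    using eventually_conj[OF ev1 ev2] by (auto simp: eventually_sequentially)
  define f where "f x = max (Wk (r k) x) 0" for x
  define h where "h x = of_bool (Wk (r k) x > 0) *\<^sub>R Vk (r k) x" for x
  have wgf: "is_weak_grad \<Omega> f h" unfolding f_def[abs_def] h_def[abs_def] by (rule weak_grad_positive_part[OF wgk \<Omega>(1)])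
  have [measurable]: "f \<in> borel_measurable (lebesgue_on \<Omega>)" "h \<in> borel_measurable (lebesgue_on \<Omega>)"
    unfolding f_def h_def by measurable
  have Lf: "f \<in> Lp_space p \<Omega>" "h \<in> Lp_space p \<Omega>"
    by (rule Lp_space_mono[OF Lk(1)[of "r k"] _ _ p0(2)], auto simp: f_def)
       (rule Lp_space_mono[OF Lk(2)[of "r k"] _ _ p0(2)], auto simp: h_def)
  have d1: "Lp_int p \<Omega> (\<lambda>x. max (W x) 0 - f x) \<le> ennreal e1"
  proof -
    have "Lp_int p \<Omega> (\<lambda>x. max (W x) 0 - f x) \<le> Lp_int p \<Omega> (\<lambda>x. W x - Wk (r k) x)"
      by (rule Lp_int_mono[OF p0(2)]) (auto simp: f_def max_def)
    also have "\<dots> \<le> ennreal e1" by (rule order_trans[OF b1]) (use k2 in \<open>auto intro: ennreal_leI\<close>)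
    finally show ?thesis .
  qed
  have d2: "Lp_int p \<Omega> (\<lambda>x. of_bool (W x > 0) *\<^sub>R V x - h x) \<le> ennreal e1"
  proof -
    have "Lp_int p \<Omega> (\<lambda>x. - T k x + of_bool (Wk (r k) x > 0) *\<^sub>R (V x - Vk (r k) x)) \<le> ennreal (2 powr p * (e1 / (2 * 2 powr p) + e1 / (2 * 2 powr p)))"
    proof (rule Lp_int_add_le[OF _ _ p0(2)])
      show "Lp_int p \<Omega> (\<lambda>x. - T k x) \<le> ennreal (e1 / (2 * 2 powr p))" using k1 by (simp add: Lp_int_minus)
      have "Lp_int p \<Omega> (\<lambda>x. of_bool (Wk (r k) x > 0) *\<^sub>R (V x - Vk (r k) x)) \<le> Lp_int p \<Omega> (\<lambda>x. V x - Vk (r k) x)"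
        by (rule Lp_int_mono[OF p0(2)]) auto
      also have "\<dots> \<le> ennreal (e1 / (2 * 2 powr p))" by (rule order_trans[OF b2]) (use k2 in \<open>auto intro: ennreal_leI\<close>)
      finally show "Lp_int p \<Omega> (\<lambda>x. of_bool (Wk (r k) x > 0) *\<^sub>R (V x - Vk (r k) x)) \<le> ennreal (e1 / (2 * 2 powr p))" .
      show "(\<lambda>x. - T k x) \<in> borel_measurable (lebesgue_on \<Omega>)" by measurable
      show "(\<lambda>x. of_bool (Wk (r k) x > 0) *\<^sub>R (V x - Vk (r k) x)) \<in> borel_measurable (lebesgue_on \<Omega>)" by measurable
    qed (use e1 in auto)
    also have "2 powr p * (e1 / (2 * 2 powr p) + e1 / (2 * 2 powr p)) = e1" by simp
    finally have *: "Lp_int p \<Omega> (\<lambda>x. - T k x + of_bool (Wk (r k) x > 0) *\<^sub>R (V x - Vk (r k) x)) \<le> ennreal e1" .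
    have "(\<lambda>x. - T k x + of_bool (Wk (r k) x > 0) *\<^sub>R (V x - Vk (r k) x)) = (\<lambda>x. of_bool (W x > 0) *\<^sub>R V x - h x)"
      by (auto simp: T_def h_def algebra_simps)
    then show ?thesis using * by simp
  qed
  obtain K where K: "compact K" "K \<subseteq> \<Omega>" "\<And>x. x \<notin> K \<Longrightarrow> \<phi> (r k) x = 0" "\<And>x i. x \<notin> K \<Longrightarrow> partial i (\<phi> (r k)) x = 0"
    by (rule test_function_support[OF \<phi>[of "r k"]]) (rule that)
  have "AE x in lebesgue_on \<Omega>. x \<notin> K \<longrightarrow> f x = 0 \<and> h x = 0"
    using neg by (rule eventually_mono) (use K(3) in \<open>auto simp: f_def h_def Wk_def\<close>)
  from mollify_compact_support[OF wgf \<Omega>(1) p Lf K(1,2) this e1(1)]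
  obtain \<psi> where \<psi>: "\<psi> \<in> test_functions \<Omega>" "Lp_int p \<Omega> (\<lambda>x. f x - \<psi> x) \<le> ennreal e1" "Lp_int p \<Omega> (\<lambda>x. h x - grad \<psi> x) \<le> ennreal e1"
    by blast
  have m\<psi>: "\<psi> \<in> borel_measurable (lebesgue_on \<Omega>)" "grad \<psi> \<in> borel_measurable (lebesgue_on \<Omega>)"
    by (intro continuous_measurable_lebesgue_on smooth_continuous_on smooth_continuous_grad test_function_smooth[OF \<psi>(1)])+
  note [measurable] = m\<psi>
  have "Lp_int p \<Omega> (\<lambda>x. (max (W x) 0 - f x) + (f x - \<psi> x)) \<le> ennreal (2 powr p * (e1 + e1))"
    by (rule Lp_int_add_le[OF _ _ p0(2) d1 \<psi>(2)]) (use e1 in \<open>simp_all\<close>)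
  moreover have "Lp_int p \<Omega> (\<lambda>x. (of_bool (W x > 0) *\<^sub>R V x - h x) + (h x - grad \<psi> x)) \<le> ennreal (2 powr p * (e1 + e1))"
    by (rule Lp_int_add_le[OF _ _ p0(2) d2 \<psi>(3)]) (use e1 in \<open>simp_all\<close>)
  ultimately show "\<exists>\<phi>\<in>test_functions \<Omega>. Lp_int p \<Omega> (\<lambda>x. max (W x) 0 - \<phi> x) \<le> ennreal e \<and> Lp_int p \<Omega> (\<lambda>x. of_bool (0 < W x) *\<^sub>R V x - grad \<phi> x) \<le> ennreal e"
    using \<psi>(1) unfolding e1(2) by (intro bexI[of _ \<psi>]) simp_all
qed

section \<open>Caratheodory functions and convexity\<close>

text \<open>Insert simple functions converging to \<open>(u, v)\<close>: for these the composition is a countable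
  gluing of functions \<open>x \<mapsto> g x c d\<close>, and continuity in \<open>(u, \<xi>)\<close> gives the limit.\<close>

lemma caratheodory_measurable:
  fixes g :: "real^'n \<Rightarrow> real \<Rightarrow> real^'n \<Rightarrow> 'b::euclidean_space"
  assumes g: "caratheodory \<Omega> g" and m[measurable]: "u \<in> borel_measurable (lebesgue_on \<Omega>)" "v \<in> borel_measurable (lebesgue_on \<Omega>)"
  shows "(\<lambda>x. g x (u x) (v x)) \<in> borel_measurable (lebesgue_on \<Omega>)"
proof -
  let ?M = "lebesgue_on \<Omega>"
  have "(\<lambda>x. (u x, v x)) \<in> borel_measurable ?M" by measurable
  from borel_measurable_implies_sequence_metric[OF this]
  obtain F where F: "\<And>i. simple_function ?M (F i)" and lim: "\<And>x. x \<in> space ?M \<Longrightarrow> (\<lambda>i. F i x) \<longlonglongrightarrow> (u x, v x)"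
    by blast
  show ?thesis
  proof (rule borel_measurable_LIMSEQ_metric)
    fix i
    let ?I = "F i ` space ?M"
    show "(\<lambda>x. g x (fst (F i x)) (snd (F i x))) \<in> borel_measurable ?M"
    proof (rule measurable_compose_countable'[where f="\<lambda>y x. g x (fst y) (snd y)" and I="?I"])
      show "(\<lambda>x. g x (fst y) (snd y)) \<in> borel_measurable ?M" for y
        using g by (simp add: caratheodory_def)
      have fin: "finite ?I" by (rule simple_functionD(1)[OF F])
      show "countable ?I" using fin by (rule countable_finite)
      show "F i \<in> measurable ?M (count_space ?I)"
        unfolding measurable_count_space_eq2[OF fin] using simple_functionD(2)[OF F[of i]] by auto
    qed
  next
    fix x assume x: "x \<in> space ?M"
    then have "x \<in> \<Omega>" by (simp add: space_restrict_space)
    then have "continuous_on UNIV (\<lambda>(u, \<xi>). g x u \<xi>)" using g by (simp add: caratheodory_def)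
    from continuous_on_tendsto_compose[OF this lim[OF x]]
    show "(\<lambda>i. g x (fst (F i x)) (snd (F i x))) \<longlonglongrightarrow> g x (u x) (v x)"
      by (simp add: case_prod_unfold)
  qed
qed

text \<open>The tangent inequality at \<open>\<xi>\<close>, evaluated at \<open>0\<close>. Only partial derivatives are assumed to exist, so
  the derivative in direction \<open>\<xi>\<close> is bounded through convexity: \<open>(1 + t) \<xi>\<close> is the average of the \<open>N\<close>
  points \<open>\<xi> + N t \<xi>\<^sub>i e\<^sub>i\<close>, each of which moves along one axis.\<close>

lemma convex_grad_inner_ge:
  fixes h :: "real^'n \<Rightarrow> real"
  assumes conv: "convex_on UNIV h" and pd: "has_partials h \<xi>"
  shows "grad h \<xi> \<bullet> \<xi> \<ge> h \<xi> - h 0"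
proof -
  define N where "N = real CARD('n)"
  have N: "N > 0" by (simp add: N_def)
  have D: "((\<lambda>s. h (\<xi> + s *\<^sub>R axis i 1)) has_real_derivative partial i h \<xi>) (at 0)" for i
    using pd unfolding has_partials_def partial_def by (simp add: DERIV_deriv_iff_real_differentiable)
  \<comment> \<open>the sum of the difference quotients along the axes, with steps \<open>N \<xi>\<^sub>i t\<close>\<close>
  define Q where "Q t = (\<Sum>i\<in>UNIV. (h (\<xi> + (N * \<xi> $ i * t) *\<^sub>R axis i 1) - h \<xi>) / t)" for t
  have lim: "(Q \<longlongrightarrow> (\<Sum>i\<in>UNIV. N * \<xi> $ i * partial i h \<xi>)) (at_right 0)"
    unfolding Q_def
  proof (rule tendsto_sum)
    fix i
    have "((\<lambda>t. (N * \<xi> $ i) * t) has_real_derivative N * \<xi> $ i) (at 0)" by (auto intro!: derivative_eq_intros)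
    from DERIV_chain2[OF _ this, of "\<lambda>s. h (\<xi> + s *\<^sub>R axis i 1)"] D[of i]
    have "((\<lambda>t. h (\<xi> + (N * \<xi> $ i * t) *\<^sub>R axis i 1)) has_real_derivative partial i h \<xi> * (N * \<xi> $ i)) (at 0)" by simp
    then have "((\<lambda>t. (h (\<xi> + (N * \<xi> $ i * t) *\<^sub>R axis i 1) - h \<xi>) / t) \<longlongrightarrow> partial i h \<xi> * (N * \<xi> $ i)) (at 0)"
      by (simp add: has_field_derivative_iff)
    then show "((\<lambda>t. (h (\<xi> + (N * \<xi> $ i * t) *\<^sub>R axis i 1) - h \<xi>) / t) \<longlongrightarrow> N * \<xi> $ i * partial i h \<xi>) (at_right 0)"
      by (simp add: mult.commute filterlim_at_split)
  qed
  have "\<forall>\<^sub>F t in at_right 0. N * (h \<xi> - h 0) \<le> Q t"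
  proof (rule eventually_at_right_less[THEN eventually_mono])
    fix t :: real assume t: "0 < t"
    have "h ((1 / (1 + t)) *\<^sub>R ((1 + t) *\<^sub>R \<xi>) + (t / (1 + t)) *\<^sub>R 0) \<le> (1 / (1 + t)) * h ((1 + t) *\<^sub>R \<xi>) + (t / (1 + t)) * h 0"
    proof -
      have "1 - t / (1 + t) = 1 / (1 + t)" using t by (simp add: field_simps)
      then show ?thesis
        using convex_onD[OF conv, of "t / (1 + t)" "(1 + t) *\<^sub>R \<xi>" 0] t by simp
    qed
    then have "h \<xi> \<le> (h ((1 + t) *\<^sub>R \<xi>) + t * h 0) / (1 + t)" using t by (simp add: add_divide_distrib)
    then have lo: "t * (h \<xi> - h 0) \<le> h ((1 + t) *\<^sub>R \<xi>) - h \<xi>" using t by (simp add: pos_le_divide_eq algebra_simps)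
    have "(1 + t) *\<^sub>R \<xi> = (\<Sum>i\<in>UNIV. (1 / N) *\<^sub>R (\<xi> + (N * \<xi> $ i * t) *\<^sub>R axis i 1))"
    proof -
      have "(\<Sum>i\<in>UNIV. (1 / N) *\<^sub>R (\<xi> + (N * \<xi> $ i * t) *\<^sub>R axis i 1)) = (\<Sum>i\<in>(UNIV::'n set). (1 / N) *\<^sub>R \<xi>) + t *\<^sub>R (\<Sum>i\<in>UNIV. (\<xi> $ i) *\<^sub>R axis i 1)"
        using N by (simp add: scaleR_add_right sum.distrib scaleR_sum_right mult.commute)
      moreover have "(\<Sum>i\<in>UNIV. (\<xi> $ i) *\<^sub>R axis i 1) = \<xi>"
        using basis_expansion[of \<xi>] by (simp add: scalar_mult_eq_scaleR)
      moreover have "(\<Sum>i\<in>(UNIV::'n set). (1 / N) *\<^sub>R \<xi>) = \<xi>" using N unfolding sum_constant_scaleR by (simp add: N_def)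
      ultimately show ?thesis by (simp add: scaleR_add_left)
    qed
    also have "h \<dots> \<le> (\<Sum>i\<in>UNIV. (1 / N) * h (\<xi> + (N * \<xi> $ i * t) *\<^sub>R axis i 1))"
      by (rule convex_on_sum[OF _ _ conv]) (use N in \<open>auto simp: N_def\<close>)
    finally have "h ((1 + t) *\<^sub>R \<xi>) - h \<xi> \<le> (\<Sum>i\<in>UNIV. (1 / N) * h (\<xi> + (N * \<xi> $ i * t) *\<^sub>R axis i 1)) - h \<xi>" by simp
    also have "\<dots> = (\<Sum>i\<in>UNIV. (1 / N) * (h (\<xi> + (N * \<xi> $ i * t) *\<^sub>R axis i 1) - h \<xi>))"
      using N by (simp add: right_diff_distrib sum_subtractf N_def)
    also have "\<dots> = (t / N) * Q t" using t by (simp add: Q_def sum_distrib_left)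
    finally have "t * (h \<xi> - h 0) \<le> (t / N) * Q t" using lo by simp
    then have "t * (N * (h \<xi> - h 0)) \<le> t * Q t" using N by (simp add: field_simps)
    then show "N * (h \<xi> - h 0) \<le> Q t" using t by simp
  qed
  from tendsto_lowerbound[OF lim this] have "N * (h \<xi> - h 0) \<le> (\<Sum>i\<in>UNIV. N * \<xi> $ i * partial i h \<xi>)" by simp
  also have "\<dots> = N * (grad h \<xi> \<bullet> \<xi>)" by (simp add: inner_vec_def sum_distrib_left mult_ac)
  finally show ?thesis using N by simp
qed

section \<open>Pointwise estimate\<close>

lemma rpow_pos: "w > 0 \<Longrightarrow> rpow w a = w powr a"
  by (simp add: rpow_def)

lemma rpow_nonneg: "rpow t a \<ge> 0"
  by (simp add: rpow_def)

text \<open>Young's inequality with exponents \<open>1/\<theta>\<close> and \<open>1/(1 - \<theta>)\<close>. For \<open>\<theta> = 0\<close> the first exponent is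
  infinite, but \<open>rpow t 0 = 1\<close> and the claim is trivial.\<close>

lemma young_rpow:
  assumes "0 \<le> \<theta>" "\<theta> < 1" "\<delta> > 0"
  shows "\<exists>C\<ge>0. \<forall>t\<ge>0. \<forall>y\<ge>0. rpow t \<theta> * y \<le> \<delta> * t + C * y powr (1 / (1 - \<theta>))"
proof (cases "\<theta> = 0")
  case True
  then show ?thesis using assms(3) by (intro exI[of _ 1]) (auto simp: rpow_def)
next
  case False
  define C where "C = (\<delta> powr (- \<theta>)) powr (1 / (1 - \<theta>))"
  have "rpow t \<theta> * y \<le> \<delta> * t + C * y powr (1 / (1 - \<theta>))" if t: "t \<ge> 0" and y: "y \<ge> 0" for t y
  proof -
    have e: "1 / (1 / \<theta>) + 1 / (1 / (1 - \<theta>)) = 1" by simp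
    have "((\<delta> * t) powr \<theta>) * (\<delta> powr (- \<theta>) * y) \<le> ((\<delta> * t) powr \<theta>) powr (1 / \<theta>) / (1 / \<theta>) + (\<delta> powr (- \<theta>) * y) powr (1 / (1 - \<theta>)) / (1 / (1 - \<theta>))"
      by (rule Youngs_inequality) (use assms False t y in auto)
    also have "((\<delta> * t) powr \<theta>) powr (1 / \<theta>) = \<delta> * t" using assms False t by (simp add: powr_powr)
    also have "(\<delta> * t) / (1 / \<theta>) \<le> \<delta> * t" using assms t by (simp add: mult_left_le)
    also have "(\<delta> powr (- \<theta>) * y) powr (1 / (1 - \<theta>)) / (1 / (1 - \<theta>)) = (1 - \<theta>) * (C * y powr (1 / (1 - \<theta>)))"
      using y by (simp add: powr_mult C_def)
    also have "\<dots> \<le> 1 * (C * y powr (1 / (1 - \<theta>)))" using assms by (intro mult_right_mono) (auto simp: C_def)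
    finally have "((\<delta> * t) powr \<theta>) * (\<delta> powr (- \<theta>) * y) \<le> \<delta> * t + C * y powr (1 / (1 - \<theta>))" by simp
    moreover have "((\<delta> * t) powr \<theta>) * (\<delta> powr (- \<theta>) * y) = rpow t \<theta> * y"
      using assms t False by (simp add: powr_mult powr_minus rpow_def field_simps)
    ultimately show ?thesis by simp
  qed
  then show ?thesis by (intro exI[of _ C]) (auto simp: C_def)
qed

text \<open>The pointwise inequality behind the energy estimate. It is applied on \<open>{\<sigma>u > k}\<close> with \<open>t\<close> the
  integrand \<open>f\<close>, \<open>\<xi> = \<bar>Du\<bar>\<close>, \<open>w = \<sigma>u\<close>, \<open>y = \<sigma>u - k\<close>, \<open>A\<close> the product of \<open>a\<close> with \<open>Du\<close>, and \<open>B = \<sigma> b\<close>. Young's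
  inequality absorbs the products \<open>t\<^sup>\<theta> y\<close> into \<open>t\<close> at the price of \<open>y\<close> to the power \<open>1/(1 - \<theta>)\<close>, and since
  \<open>w \<ge> 1\<close> all powers that occur are dominated by \<open>w powr \<tau>\<close>. The exponent of \<open>\<xi>\<close> is written as \<open>p \<theta>2\<close>,
  so that coercivity turns it into \<open>t\<close> to the power \<open>\<theta>2\<close>.\<close>

lemma pointwise_energy:
  fixes c1 c2 c5 \<kappa> p \<theta>1 \<theta>2 r e3 \<tau> :: real
  assumes "0 < c1" "0 \<le> c2" "0 < c5" "0 < \<kappa>" "1 < p" and \<theta>: "0 \<le> \<theta>1" "\<theta>1 < 1" "0 \<le> \<theta>2" "\<theta>2 < 1"
    and \<tau>: "r \<le> \<tau>" "1 / (1 - \<theta>1) \<le> \<tau>" "1 / (1 - \<theta>2) \<le> \<tau>" "e3 + 1 \<le> \<tau>"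
  shows "\<exists>C>0. \<forall>t \<xi> w y A B \<beta>1 \<beta>3. 0 \<le> t \<longrightarrow> 0 \<le> \<xi> \<longrightarrow> c5 * \<xi> powr p \<le> t \<longrightarrow> 1 \<le> w \<longrightarrow> 0 \<le> y \<longrightarrow> y \<le> w \<longrightarrow> 0 \<le> \<beta>1 \<longrightarrow> 0 \<le> \<beta>3 \<longrightarrow>
     c1 * t - c2 * w powr r - \<beta>1 \<le> A \<longrightarrow> - \<kappa> * (rpow t \<theta>1 + rpow \<xi> (p * \<theta>2) + w powr e3) - \<beta>3 \<le> B \<longrightarrow>
     (c1 / 2) * t - C * (w powr \<tau> + (\<beta>1 + \<beta>3) * w) \<le> A + B * y"
proof -
  \<comment> \<open>each of the two absorbed terms may use \<open>c1/4\<close> of the energy, after multiplication by \<open>\<kappa>\<close>\<close>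
  define \<delta>1 where "\<delta>1 = c1 / (4 * \<kappa>)"
  define m where "m = rpow (1 / c5) \<theta>2"
  have m: "m > 0" using assms by (simp add: m_def rpow_def)
  define \<delta>2 where "\<delta>2 = c1 / (4 * \<kappa> * m)"
  have \<delta>: "\<delta>1 > 0" "\<delta>2 > 0" using assms m by (auto simp: \<delta>1_def \<delta>2_def)
  obtain C1 where C1: "C1 \<ge> 0" "\<And>t y. t \<ge> 0 \<Longrightarrow> y \<ge> 0 \<Longrightarrow> rpow t \<theta>1 * y \<le> \<delta>1 * t + C1 * y powr (1 / (1 - \<theta>1))"
    using young_rpow[OF \<theta>(1,2) \<delta>(1)] by blast
  obtain C2 where C2: "C2 \<ge> 0" "\<And>t y. t \<ge> 0 \<Longrightarrow> y \<ge> 0 \<Longrightarrow> rpow t \<theta>2 * y \<le> \<delta>2 * t + C2 * y powr (1 / (1 - \<theta>2))"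
    using young_rpow[OF \<theta>(3,4) \<delta>(2)] by blast
  define C where "C = c2 + \<kappa> * (C1 + m * C2 + 1) + 1"
  have "C > 0" using assms C1(1) C2(1) m by (simp add: C_def add_nonneg_pos)
  show ?thesis
  proof (intro exI[of _ C] conjI allI impI \<open>C > 0\<close>)
    fix t \<xi> w y A B \<beta>1 \<beta>3 :: real
    assume t: "0 \<le> t" and \<xi>: "0 \<le> \<xi>" "c5 * \<xi> powr p \<le> t" and w: "1 \<le> w" and y: "0 \<le> y" "y \<le> w" and \<beta>: "0 \<le> \<beta>1" "0 \<le> \<beta>3"
      and A: "c1 * t - c2 * w powr r - \<beta>1 \<le> A" and B: "- \<kappa> * (rpow t \<theta>1 + rpow \<xi> (p * \<theta>2) + w powr e3) - \<beta>3 \<le> B"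
    have wp: "w powr e \<le> w powr \<tau>" if "e \<le> \<tau>" for e using w that by (intro powr_mono) auto
    have yp: "y powr e \<le> w powr \<tau>" if "e \<le> \<tau>" "0 \<le> e" for e
      using powr_mono2[OF that(2) y] wp[OF that(1)] by linarith
    have X: "rpow \<xi> (p * \<theta>2) \<le> m * rpow t \<theta>2"
    proof (cases "\<theta>2 = 0")
      case False
      then have "\<theta>2 > 0" using \<theta> by simp
      have "rpow \<xi> (p * \<theta>2) = (\<xi> powr p) powr \<theta>2" using False assms by (simp add: rpow_def powr_powr)
      also have "\<dots> \<le> ((1 / c5) * t) powr \<theta>2" using \<xi> assms \<theta> by (intro powr_mono2) (auto simp: field_simps)
      also have "\<dots> = m * rpow t \<theta>2" using False assms t by (simp add: m_def rpow_def powr_mult powr_divide)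
      finally show ?thesis .
    qed (simp add: m_def rpow_def)
    have 1: "rpow t \<theta>1 * y \<le> \<delta>1 * t + C1 * w powr \<tau>"
      using C1(2)[OF t y(1)] mult_left_mono[OF yp[OF \<tau>(2)] C1(1)] \<theta> by simp
    have "rpow \<xi> (p * \<theta>2) * y \<le> m * (rpow t \<theta>2 * y)" using mult_right_mono[OF X y(1)] by simp
    also have "\<dots> \<le> m * (\<delta>2 * t + C2 * w powr \<tau>)"
      using C2(2)[OF t y(1)] mult_left_mono[OF yp[OF \<tau>(3)] C2(1)] \<theta> m by (intro mult_left_mono) auto
    finally have 2: "rpow \<xi> (p * \<theta>2) * y \<le> m * (\<delta>2 * t + C2 * w powr \<tau>)" .
    have "w powr e3 * y \<le> w powr e3 * w" using y by (intro mult_left_mono) auto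
    also have "\<dots> = w powr (e3 + 1)" using w by (simp add: powr_add)
    finally have 3: "w powr e3 * y \<le> w powr \<tau>" using wp[OF \<tau>(4)] by linarith
    have "(- \<kappa> * (rpow t \<theta>1 + rpow \<xi> (p * \<theta>2) + w powr e3) - \<beta>3) * y \<le> B * y"
      using B y(1) by (rule mult_right_mono)
    moreover have "(- \<kappa> * (rpow t \<theta>1 + rpow \<xi> (p * \<theta>2) + w powr e3) - \<beta>3) * y
      = - (\<kappa> * (rpow t \<theta>1 * y + rpow \<xi> (p * \<theta>2) * y + w powr e3 * y)) - \<beta>3 * y" by (simp add: algebra_simps)
    moreover have "\<kappa> * (rpow t \<theta>1 * y + rpow \<xi> (p * \<theta>2) * y + w powr e3 * y) \<le> \<kappa> * ((\<delta>1 * t + C1 * w powr \<tau>) + m * (\<delta>2 * t + C2 * w powr \<tau>) + w powr \<tau>)"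
      using 1 2 3 assms by (intro mult_left_mono) auto
    moreover have "\<kappa> * ((\<delta>1 * t + C1 * w powr \<tau>) + m * (\<delta>2 * t + C2 * w powr \<tau>) + w powr \<tau>) = (c1 / 2) * t + \<kappa> * (C1 + m * C2 + 1) * w powr \<tau>"
    proof -
      have "\<kappa> * \<delta>1 = c1 / 4" "\<kappa> * (m * \<delta>2) = c1 / 4" using assms m by (auto simp: \<delta>1_def \<delta>2_def)
      then have "\<kappa> * \<delta>1 * t + \<kappa> * (m * \<delta>2) * t = (c1 / 4) * t + (c1 / 4) * t" by (simp only:)
      then have "\<kappa> * \<delta>1 * t + \<kappa> * (m * \<delta>2) * t = (c1 / 2) * t" by simp
      then show ?thesis by (simp add: algebra_simps)
    qed
    moreover have "\<beta>3 * y \<le> \<beta>3 * w" using \<beta> y by (intro mult_left_mono) auto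
    moreover have "c2 * w powr r \<le> c2 * w powr \<tau>" using wp[OF \<tau>(1)] assms by (intro mult_left_mono) auto
    moreover have "\<beta>1 \<le> \<beta>1 * w" using mult_left_mono[OF w \<beta>(1)] by simp
    moreover have "C * (w powr \<tau> + (\<beta>1 + \<beta>3) * w) \<ge> (c2 + \<kappa> * (C1 + m * C2 + 1)) * w powr \<tau> + (\<beta>1 * w + \<beta>3 * w)"
    proof -
      have "C \<ge> 1" "C \<ge> c2 + \<kappa> * (C1 + m * C2 + 1)" using assms C1(1) C2(1) m by (auto simp: C_def)
      then have "C * w powr \<tau> \<ge> (c2 + \<kappa> * (C1 + m * C2 + 1)) * w powr \<tau>" "C * ((\<beta>1 + \<beta>3) * w) \<ge> 1 * ((\<beta>1 + \<beta>3) * w)"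
        using mult_right_mono[of "c2 + \<kappa> * (C1 + m * C2 + 1)" C "w powr \<tau>"] mult_right_mono[of 1 C "(\<beta>1 + \<beta>3) * w"] \<beta> w by auto
      then show ?thesis by (simp add: algebra_simps)
    qed
    moreover have "(c2 + \<kappa> * (C1 + m * C2 + 1)) * w powr \<tau> = c2 * w powr \<tau> + \<kappa> * (C1 + m * C2 + 1) * w powr \<tau>" by (simp add: algebra_simps)
    moreover have "(c1 / 2) * t + (c1 / 2) * t = c1 * t" by simp
    ultimately show "(c1 / 2) * t - C * (w powr \<tau> + (\<beta>1 + \<beta>3) * w) \<le> A + B * y" using A by linarith
  qed
qed

section \<open>De Giorgi iteration\<close>

text \<open>Above the level \<open>k\<^sub>j\<^sub>+\<^sub>1 = L (2 - 2\<^sup>-\<^sup>j\<^sup>-\<^sup>1)\<close> the excess over \<open>k\<^sub>j\<close> is at least \<open>L 2\<^sup>-\<^sup>j\<^sup>-\<^sup>1\<close>, and hence comparable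
  with \<open>w\<close> up to the factor \<open>2\<^sup>j\<^sup>+\<^sup>3\<close>. So a power of \<open>w\<close> below \<open>q\<close> costs only a geometric factor and gains
  a negative power of \<open>L\<close>.\<close>

lemma level_step:
  fixes w L q e :: real and j :: nat
  assumes "L \<ge> 1" "0 \<le> e" "e \<le> q" and w: "w > L * (2 - (1/2) ^ Suc j)"
  shows "w powr e \<le> 2 powr (q * (real j + 3)) * L powr (- (q - e)) * (max (w - L * (2 - (1/2) ^ j)) 0) powr q"
proof -
  define y where "y = w - L * (2 - (1/2) ^ j)"
  have "y > L * ((1/2) ^ j - (1/2) ^ Suc j)" using w unfolding y_def by (simp add: algebra_simps)
  then have y: "y > L * (1/2) ^ Suc j" by simp
  then have y0: "y > 0" using assms(1) by (smt (verit) zero_less_power mult_pos_pos zero_less_divide_1_iff)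
  have p2: "(1/2 :: real) ^ n = 2 powr (- real n)" for n by (simp add: powr_minus powr_realpow power_one_over inverse_eq_divide)
  have yl: "L * 2 powr (- (real j + 1)) \<le> y" using y p2[of "Suc j"] by (simp add: add.commute del: power_Suc)
  have "L * (2 - (1/2) ^ j) \<le> 2 powr (real j + 2) * y"
  proof -
    have "2 powr (real j + 2) * (L * 2 powr (- (real j + 1))) \<le> 2 powr (real j + 2) * y" using yl by (intro mult_left_mono) auto
    moreover have "2 powr (real j + 2) * (L * 2 powr (- (real j + 1))) = L * 2"
    proof -
      have "2 powr (real j + 2) * 2 powr (- (real j + 1)) = (2::real)" by (simp flip: powr_add)
      then show ?thesis by (metis mult.left_commute)
    qed
    moreover have "L * (2 - (1/2) ^ j) \<le> L * 2" using assms(1) by (intro mult_left_mono) auto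
    ultimately show ?thesis by linarith
  qed
  then have "w \<le> 2 powr (real j + 2) * y + y" by (simp add: y_def)
  also have "\<dots> \<le> 2 powr (real j + 3) * y"
  proof -
    have "1 \<le> 2 powr (real j + 2)" by (rule ge_one_powr_ge_zero) auto
    then have "(2 powr (real j + 2) + 1) * y \<le> (2 powr (real j + 2) * 2) * y" using y0 by (intro mult_right_mono) auto
    also have "2 powr (real j + 2) * 2 = 2 powr (real j + 3)" using powr_add[of 2 "real j + 2" 1] by (simp add: add.commute)
    finally show ?thesis by (simp add: algebra_simps)
  qed
  finally have wy: "w \<le> 2 powr (real j + 3) * y" .
  have "w > 0"
  proof -
    have "(1/2::real) ^ Suc j \<le> 1" by (rule power_le_one) auto
    then have "L * (2 - (1/2) ^ Suc j) \<ge> 0" using assms(1) by (intro mult_nonneg_nonneg) auto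
    then show ?thesis using w by linarith
  qed
  have "w powr e \<le> (2 powr (real j + 3) * y) powr e" using wy \<open>w > 0\<close> assms(2) by (intro powr_mono2) auto
  also have "\<dots> = 2 powr (e * (real j + 3)) * y powr e" using y0 by (simp add: powr_mult powr_powr mult.commute)
  also have "y powr e = y powr (- (q - e)) * y powr q" by (simp flip: powr_add)
  also have "y powr (- (q - e)) \<le> (L * 2 powr (- (real j + 1))) powr (- (q - e))"
    by (rule powr_mono2') (use assms yl in auto)
  also have "(L * 2 powr (- (real j + 1))) powr (- (q - e)) = L powr (- (q - e)) * 2 powr ((q - e) * (real j + 1))"
    using assms(1) by (simp add: powr_mult powr_powr algebra_simps)
  finally have "w powr e \<le> 2 powr (e * (real j + 3)) * ((L powr (- (q - e)) * 2 powr ((q - e) * (real j + 1))) * y powr q)"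
    by (simp add: mult_left_mono mult_right_mono)
  also have "\<dots> = (2 powr (e * (real j + 3)) * 2 powr ((q - e) * (real j + 1))) * (L powr (- (q - e)) * y powr q)" by simp
  also have "2 powr (e * (real j + 3)) * 2 powr ((q - e) * (real j + 1)) \<le> 2 powr (q * (real j + 3))"
  proof -
    have "e * (real j + 3) + (q - e) * (real j + 1) \<le> e * (real j + 3) + (q - e) * (real j + 3)"
      using assms by (intro add_left_mono mult_left_mono) auto
    also have "\<dots> = q * (real j + 3)" by (simp add: algebra_simps)
    finally show ?thesis unfolding powr_add[symmetric] by (intro powr_mono) auto
  qed
  finally have "w powr e \<le> 2 powr (q * (real j + 3)) * (L powr (- (q - e)) * y powr q)"
    by (simp add: mult_right_mono)
  moreover have "max y 0 = y" using y0 by simp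
  ultimately show ?thesis unfolding y_def[symmetric] by (simp add: mult.assoc)
qed

text \<open>Let \<open>Z\<^sub>j\<close> be the integral of the \<open>q\<close>-th power of the excess over \<open>k\<^sub>j = L (2 - 2\<^sup>-\<^sup>j)\<close>. By \<open>level_step\<close> the
  integral of \<open>w powr \<tau>\<close> above level \<open>k\<^sub>j\<^sub>+\<^sub>1\<close> is bounded by \<open>Z\<^sub>j\<close>, and by Hoelder's inequality with
  \<open>t = s/(s - 1)\<close> that of \<open>h w\<close> by \<open>Z\<^sub>j\<close> to the power \<open>1/t\<close>. Feeding this into the hypothesis gives
  \<open>Z\<^sub>j\<^sub>+\<^sub>1\<close> at most a constant times \<open>B\<^sup>j L\<^sup>-\<^sup>\<sigma>\<^sup>q\<^sup>/\<^sup>p\<close> times \<open>Z\<^sub>j\<close> to the power \<open>1 + \<alpha>\<close>, where \<open>1 + \<alpha> = q/(p t) > 1\<close>. For \<open>L\<close>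
  large this recursion preserves the bound \<open>Z\<^sub>j \<le> \<Lambda> B\<^sup>-\<^sup>j\<^sup>/\<^sup>\<alpha>\<close>, so \<open>Z\<^sub>j \<rightarrow> 0\<close> and \<open>w \<le> 2 L\<close>. The
  statement is uniform in the measure, in \<open>w\<close> and in \<open>h\<close>, so the constants depend only on the data.\<close>

lemma de_giorgi:
  fixes p q s \<tau> C3 Hs :: real
  assumes pq: "1 \<le> p" "0 \<le> \<tau>" "\<tau> < q" "1 < s" and s': "p * (s / (s - 1)) < q" and C3: "C3 > 0" and Hs: "Hs \<ge> 0"
  shows "\<exists>c \<gamma>. c > 0 \<and> \<gamma> > 0 \<and> (\<forall>(M :: 'a measure) w h K0 Y.
     w \<in> borel_measurable M \<longrightarrow> h \<in> borel_measurable M \<longrightarrow> (\<forall>x. 0 \<le> h x) \<longrightarrow> 1 \<le> K0 \<longrightarrow> 0 \<le> Y \<longrightarrow>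
     (\<integral>\<^sup>+x. ennreal (h x powr s) \<partial>M) \<le> ennreal Hs \<longrightarrow> (\<integral>\<^sup>+x. ennreal (\<bar>w x\<bar> powr q) \<partial>M) \<le> ennreal Y \<longrightarrow>
     (\<forall>k X. K0 \<le> k \<longrightarrow> 0 \<le> X \<longrightarrow> (\<integral>\<^sup>+x. ennreal (of_bool (w x > k) * (w x powr \<tau> + h x * w x)) \<partial>M) \<le> ennreal X \<longrightarrow>
        (\<integral>\<^sup>+x. ennreal ((max (w x - k) 0) powr q) \<partial>M) \<le> ennreal (C3 * X powr (q / p))) \<longrightarrow>
     (AE x in M. w x \<le> c * K0 * (1 + Y) powr \<gamma>))"
proof -
  define t where "t = s / (s - 1)"
  have t1: "t > 1" using pq by (simp add: t_def less_divide_eq)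
  have st: "1 / s + 1 / t = 1" using pq by (simp add: t_def field_simps)
  have tq: "t < q / p" using s' pq by (simp add: t_def less_divide_eq mult.commute)
  have p0: "p > 0" using pq by simp
  have q0: "q > 1" using tq t1 pq by (smt (verit) divide_le_eq_1_pos divide_right_mono le_divide_eq_1 p0 less_divide_eq mult_le_cancel_left1)
  have qp: "q / p \<le> q" using pq q0 by (simp add: divide_le_eq)
  have tq': "t < q" using tq qp by linarith
  \<comment> \<open>the smaller of the two powers of \<open>1/L\<close> gained from \<open>w powr \<tau>\<close> and, after Hoelder's inequality, from \<open>h w\<close>\<close>
  define \<sigma> where "\<sigma> = min (q - \<tau>) ((q - t) / t)"
  have \<sigma>: "\<sigma> > 0" "\<sigma> \<le> q - \<tau>" "\<sigma> \<le> (q - t) / t" using pq tq' t1 by (auto simp: \<sigma>_def)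
  define \<alpha> where "\<alpha> = q / (p * t) - 1"
  have \<alpha>: "\<alpha> > 0" using tq t1 p0 by (simp add: \<alpha>_def field_simps)
  define H1 where "H1 = Hs powr (1 / s)"
  have H1: "H1 \<ge> 0" by (simp add: H1_def)
  define B where "B = 2 powr (q * (q / p))"
  have B: "B > 1" unfolding B_def using q0 p0 by (intro gr_one_powr) auto
  \<comment> \<open>\<open>L\<close> below is chosen so that \<open>L powr (- \<sigma>) \<le> 1 / (c0 \<Lambda>)\<close>; this \<open>c0\<close> cancels all constants and
    leaves the factor \<open>B powr (- 1 / \<alpha>)\<close> that the next step of the induction requires\<close>
  define c0 where "c0 = max 1 ((C3 * 2 powr (3 * q * (q / p)) * (1 + H1) powr (q / p) * B powr (1 / \<alpha>)) powr (p / q))"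
  have c0: "c0 \<ge> 1" by (simp add: c0_def)
  define c where "c = 2 * c0 powr (1 / \<sigma>)"
  have "c > 0" using c0 by (simp add: c_def)
  have "1 / \<sigma> > 0" using \<sigma> by simp
  show ?thesis
  proof (rule exI[of _ c], rule exI[of _ "1 / \<sigma>"], intro conjI allI impI \<open>c > 0\<close> \<open>1 / \<sigma> > 0\<close>)
    fix M :: "'a measure" and w h K0 Y
    assume w[measurable]: "w \<in> borel_measurable M" and h[measurable]: "h \<in> borel_measurable M" and h0: "\<forall>x. 0 \<le> h x" and K0: "1 \<le> K0" and Y: "0 \<le> Y"
      and hs: "(\<integral>\<^sup>+x. ennreal (h x powr s) \<partial>M) \<le> ennreal Hs" and wY: "(\<integral>\<^sup>+x. ennreal (\<bar>w x\<bar> powr q) \<partial>M) \<le> ennreal Y"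
      and cac: "\<forall>k X. K0 \<le> k \<longrightarrow> 0 \<le> X \<longrightarrow> (\<integral>\<^sup>+x. ennreal (of_bool (w x > k) * (w x powr \<tau> + h x * w x)) \<partial>M) \<le> ennreal X \<longrightarrow>
        (\<integral>\<^sup>+x. ennreal ((max (w x - k) 0) powr q) \<partial>M) \<le> ennreal (C3 * X powr (q / p))"
    define \<Lambda> where "\<Lambda> = 1 + Y"
    have \<Lambda>: "\<Lambda> \<ge> 1" using Y by (simp add: \<Lambda>_def)
    define L where "L = K0 * (c0 * \<Lambda>) powr (1 / \<sigma>)"
    have cl1: "(c0 * \<Lambda>) powr (1 / \<sigma>) \<ge> 1"
      using c0 \<Lambda> \<sigma> mult_mono[of 1 c0 1 \<Lambda>] by (intro ge_one_powr_ge_zero) auto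
    have "L \<ge> K0" using mult_left_mono[OF cl1, of K0] K0 by (simp add: L_def)
    then have L: "L \<ge> K0" "L \<ge> 1" using K0 by linarith+
    have L\<sigma>: "L powr (- \<sigma>) \<le> 1 / (c0 * \<Lambda>)"
    proof -
      have "L powr (- \<sigma>) \<le> ((c0 * \<Lambda>) powr (1 / \<sigma>)) powr (- \<sigma>)"
        using mult_right_mono[OF K0, of "(c0 * \<Lambda>) powr (1 / \<sigma>)"] cl1 \<sigma> by (intro powr_mono2') (auto simp: L_def)
      also have "\<dots> = 1 / (c0 * \<Lambda>)" using \<sigma> c0 \<Lambda> by (simp add: powr_powr powr_minus divide_inverse)
      finally show ?thesis .
    qed
    define k where "k j = L * (2 - (1/2) ^ j)" for j :: nat
    have kL: "k j \<ge> L" "k j \<le> 2 * L" for j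
    proof -
      have "(1/2::real) ^ j \<le> 1" "(1/2::real) ^ j \<ge> 0" by (auto intro: power_le_one)
      then have "L * 1 \<le> L * (2 - (1/2) ^ j)" "L * (2 - (1/2) ^ j) \<le> L * 2" using L by (intro mult_left_mono; simp)+
      then show "k j \<ge> L" "k j \<le> 2 * L" by (auto simp: k_def)
    qed
    define Z where "Z j = (\<integral>\<^sup>+x. ennreal ((max (w x - k j) 0) powr q) \<partial>M)" for j
    have low: "(\<integral>\<^sup>+x. ennreal (of_bool (w x > k (Suc j)) * w x powr e) \<partial>M) \<le> ennreal (2 powr (q * (real j + 3)) * L powr (- (q - e)) * \<zeta>)"
      if e: "0 \<le> e" "e \<le> q" and \<zeta>: "Z j \<le> ennreal \<zeta>" for e \<zeta> j
    proof -
      have "(\<integral>\<^sup>+x. ennreal (of_bool (w x > k (Suc j)) * w x powr e) \<partial>M) \<le> (\<integral>\<^sup>+x. ennreal (2 powr (q * (real j + 3)) * L powr (- (q - e))) * ennreal ((max (w x - k j) 0) powr q) \<partial>M)"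
      proof (rule nn_integral_mono)
        fix x
        have "of_bool (w x > k (Suc j)) * w x powr e \<le> 2 powr (q * (real j + 3)) * L powr (- (q - e)) * (max (w x - k j) 0) powr q"
          using level_step[OF L(2) e, of j "w x"] unfolding k_def by (cases "w x > L * (2 - (1/2) ^ Suc j)") auto
        then show "ennreal (of_bool (w x > k (Suc j)) * w x powr e) \<le> ennreal (2 powr (q * (real j + 3)) * L powr (- (q - e))) * ennreal ((max (w x - k j) 0) powr q)"
          by (simp add: ennreal_leI flip: ennreal_mult')
      qed
      also have "\<dots> = ennreal (2 powr (q * (real j + 3)) * L powr (- (q - e))) * Z j"
        unfolding Z_def by (rule nn_integral_cmult) measurable
      also have "\<dots> \<le> ennreal (2 powr (q * (real j + 3)) * L powr (- (q - e))) * ennreal \<zeta>" by (intro mult_left_mono \<zeta>) auto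
      finally show ?thesis by (simp flip: ennreal_mult')
    qed
    have step: "Z (Suc j) \<le> ennreal (\<Lambda> * (B powr (- 1 / \<alpha>)) ^ Suc j)" if Zj: "Z j \<le> ennreal (\<Lambda> * (B powr (- 1 / \<alpha>)) ^ j)" for j
    proof -
      define y where "y = (B powr (- 1 / \<alpha>)) ^ j"
      have yy: "y = B powr (- real j / \<alpha>)" using B by (simp add: y_def powr_powr flip: powr_realpow)
      have y: "0 < y" "y \<le> 1"
      proof -
        show "0 < y" using B by (simp add: y_def)
        have "B powr (- 1 / \<alpha>) \<le> 1" using powr_mono[of "- 1 / \<alpha>" 0 B] B \<alpha> by simp
        then show "y \<le> 1" unfolding y_def by (intro power_le_one) auto
      qed
      have Zj': "Z j \<le> ennreal (\<Lambda> * y)" using Zj by (simp add: y_def)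
      define P where "P = 2 powr (q * (real j + 3))"
      have P: "P \<ge> 1" unfolding P_def using q0 by (intro ge_one_powr_ge_zero) auto
      have I1: "(\<integral>\<^sup>+x. ennreal (of_bool (w x > k (Suc j)) * w x powr \<tau>) \<partial>M) \<le> ennreal (P * L powr (- (q - \<tau>)) * (\<Lambda> * y))"
        unfolding P_def by (rule low) (use pq Zj' in auto)
      have I2: "(\<integral>\<^sup>+x. ennreal (of_bool (w x > k (Suc j)) * w x powr t) \<partial>M) \<le> ennreal (P * L powr (- (q - t)) * (\<Lambda> * y))"
        unfolding P_def by (rule low) (use t1 tq' Zj' in auto)
      have kpos: "w x > 0" if "w x > k (Suc j)" for x using that kL(1)[of "Suc j"] L by linarith
      have I3: "(\<integral>\<^sup>+x. ennreal (h x * (of_bool (w x > k (Suc j)) * w x)) \<partial>M) \<le> ennreal (Hs powr (1 / s) * (P * L powr (- (q - t)) * (\<Lambda> * y)) powr (1 / t))"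
      proof (rule nn_integral_Hoelder)
        have "(of_bool (w x > k (Suc j)) * w x) powr t = of_bool (w x > k (Suc j)) * w x powr t" for x by (cases "w x > k (Suc j)") auto
        then show "(\<integral>\<^sup>+x. ennreal ((of_bool (w x > k (Suc j)) * w x) powr t) \<partial>M) \<le> ennreal (P * L powr (- (q - t)) * (\<Lambda> * y))"
          using I2 by simp
        show "0 \<le> of_bool (w x > k (Suc j)) * w x" for x using kpos[of x] by (cases "w x > k (Suc j)") auto
        show "(\<lambda>x. of_bool (w x > k (Suc j)) * w x) \<in> borel_measurable M" by measurable
      qed (use pq t1 st Hs hs h0 P \<Lambda> y in auto)
      define X where "X = P * L powr (- \<sigma>) * (1 + H1) * \<Lambda> * y powr (1 / t)"
      have X0: "X \<ge> 0" using P H1 \<Lambda> by (simp add: X_def)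
      have yt: "y \<le> y powr (1 / t)" using powr_mono'[of "1 / t" 1 y] y t1 by simp
      have X1: "P * L powr (- (q - \<tau>)) * (\<Lambda> * y) \<le> P * L powr (- \<sigma>) * (\<Lambda> * y powr (1 / t))"
      proof (intro mult_mono)
        show "L powr (- (q - \<tau>)) \<le> L powr (- \<sigma>)" using L \<sigma> by (intro powr_mono) auto
      qed (use P \<Lambda> y yt in auto)
      have X2: "(P * L powr (- (q - t)) * (\<Lambda> * y)) powr (1 / t) \<le> P * L powr (- \<sigma>) * (\<Lambda> * y powr (1 / t))"
      proof -
        have "(P * L powr (- (q - t)) * (\<Lambda> * y)) powr (1 / t) = P powr (1 / t) * L powr (- ((q - t) / t)) * (\<Lambda> powr (1 / t) * y powr (1 / t))"
          using P \<Lambda> y by (simp add: powr_mult powr_powr minus_divide_left)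
        also have "\<dots> \<le> P * L powr (- \<sigma>) * (\<Lambda> * y powr (1 / t))"
        proof (intro mult_mono)
          show "L powr (- ((q - t) / t)) \<le> L powr (- \<sigma>)" using L \<sigma> by (intro powr_mono) auto
          show "P powr (1 / t) \<le> P" using powr_mono[of "1 / t" 1 P] P t1 by simp
          show "\<Lambda> powr (1 / t) \<le> \<Lambda>" using powr_mono[of "1 / t" 1 \<Lambda>] \<Lambda> t1 by simp
        qed (use P \<Lambda> y in auto)
        finally show ?thesis .
      qed
      have "(\<integral>\<^sup>+x. ennreal (of_bool (w x > k (Suc j)) * (w x powr \<tau> + h x * w x)) \<partial>M)
        = (\<integral>\<^sup>+x. ennreal (of_bool (w x > k (Suc j)) * w x powr \<tau>) + ennreal (h x * (of_bool (w x > k (Suc j)) * w x)) \<partial>M)"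
      proof (rule nn_integral_cong)
        fix x
        show "ennreal (of_bool (w x > k (Suc j)) * (w x powr \<tau> + h x * w x)) = ennreal (of_bool (w x > k (Suc j)) * w x powr \<tau>) + ennreal (h x * (of_bool (w x > k (Suc j)) * w x))"
          using kpos[of x] h0 by (cases "w x > k (Suc j)") auto
      qed
      also have "\<dots> = (\<integral>\<^sup>+x. ennreal (of_bool (w x > k (Suc j)) * w x powr \<tau>) \<partial>M) + (\<integral>\<^sup>+x. ennreal (h x * (of_bool (w x > k (Suc j)) * w x)) \<partial>M)"
        by (rule nn_integral_add) measurable
      also have "\<dots> \<le> ennreal (P * L powr (- (q - \<tau>)) * (\<Lambda> * y)) + ennreal (H1 * (P * L powr (- (q - t)) * (\<Lambda> * y)) powr (1 / t))"
        unfolding H1_def by (intro add_mono I1 I3)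
      also have "\<dots> = ennreal (P * L powr (- (q - \<tau>)) * (\<Lambda> * y) + H1 * (P * L powr (- (q - t)) * (\<Lambda> * y)) powr (1 / t))"
        using P \<Lambda> y H1 by (intro ennreal_plus[symmetric]) auto
      also have "\<dots> \<le> ennreal X"
      proof (rule ennreal_leI)
        have "H1 * (P * L powr (- (q - t)) * (\<Lambda> * y)) powr (1 / t) \<le> H1 * (P * L powr (- \<sigma>) * (\<Lambda> * y powr (1 / t)))"
          by (rule mult_left_mono[OF X2 H1])
        then have "P * L powr (- (q - \<tau>)) * (\<Lambda> * y) + H1 * (P * L powr (- (q - t)) * (\<Lambda> * y)) powr (1 / t) \<le> (1 + H1) * (P * L powr (- \<sigma>) * (\<Lambda> * y powr (1 / t)))"
          using X1 by (simp add: algebra_simps)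
        also have "\<dots> = X" by (simp add: X_def mult_ac)
        finally show "P * L powr (- (q - \<tau>)) * (\<Lambda> * y) + H1 * (P * L powr (- (q - t)) * (\<Lambda> * y)) powr (1 / t) \<le> X" .
      qed
      finally have "Z (Suc j) \<le> ennreal (C3 * X powr (q / p))"
        unfolding Z_def using cac[rule_format, of "k (Suc j)" X] X0 kL(1)[of "Suc j"] L by auto
      also have "C3 * X powr (q / p) \<le> \<Lambda> * (B powr (- 1 / \<alpha>)) ^ Suc j"
      proof -
        have "X \<le> P * (1 / (c0 * \<Lambda>)) * (1 + H1) * \<Lambda> * y powr (1 / t)"
          unfolding X_def using P H1 \<Lambda> L\<sigma> by (intro mult_right_mono mult_left_mono) auto
        also have "\<dots> = (P * (1 + H1) * y powr (1 / t)) / c0" using \<Lambda> by simp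
        finally have "X powr (q / p) \<le> ((P * (1 + H1) * y powr (1 / t)) / c0) powr (q / p)"
          using X0 q0 p0 by (intro powr_mono2) auto
        also have "\<dots> = (P powr (q / p) * (1 + H1) powr (q / p) * y powr (1 + \<alpha>)) / c0 powr (q / p)"
          using P H1 y c0 p0 by (simp add: powr_mult powr_divide powr_powr \<alpha>_def mult.commute)
        finally have "C3 * X powr (q / p) \<le> C3 * ((P powr (q / p) * (1 + H1) powr (q / p) * y powr (1 + \<alpha>)) / c0 powr (q / p))"
          using C3 by (intro mult_left_mono) auto
        also have "P powr (q / p) = 2 powr (3 * q * (q / p)) * B powr (real j)"
        proof -
          have "q * (real j + 3) * (q / p) = 3 * q * (q / p) + q * (q / p) * real j" by (simp add: algebra_simps add_divide_distrib)
          then show ?thesis unfolding P_def B_def powr_powr powr_add[symmetric] by simp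
        qed
        also have "y powr (1 + \<alpha>) = B powr (- real j / \<alpha>) * B powr (- real j)"
        proof -
          have "- real j / \<alpha> * (1 + \<alpha>) = - real j / \<alpha> + - real j" using \<alpha> by (simp add: field_simps)
          then show ?thesis unfolding yy powr_powr powr_add[symmetric] by simp
        qed
        also have "C3 * (2 powr (3 * q * (q / p)) * B powr (real j) * (1 + H1) powr (q / p) * (B powr (- real j / \<alpha>) * B powr (- real j)) / c0 powr (q / p))
           = (C3 * 2 powr (3 * q * (q / p)) * (1 + H1) powr (q / p) / c0 powr (q / p)) * B powr (- real j / \<alpha>)"
          using B by (simp add: powr_minus field_simps)
        also have "\<dots> \<le> B powr (- 1 / \<alpha>) * B powr (- real j / \<alpha>)"
        proof (rule mult_right_mono)
          define V where "V = C3 * 2 powr (3 * q * (q / p)) * (1 + H1) powr (q / p)"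
          have V: "V > 0" using C3 H1 by (simp add: V_def)
          have "V * B powr (1 / \<alpha>) = ((V * B powr (1 / \<alpha>)) powr (p / q)) powr (q / p)"
            using V B p0 q0 by (simp add: powr_powr)
          also have "\<dots> \<le> c0 powr (q / p)" using p0 q0 by (intro powr_mono2) (auto simp: c0_def V_def)
          finally have "V / c0 powr (q / p) \<le> 1 / B powr (1 / \<alpha>)" using c0 B by (simp add: field_simps)
          then show "C3 * 2 powr (3 * q * (q / p)) * (1 + H1) powr (q / p) / c0 powr (q / p) \<le> B powr (- 1 / \<alpha>)"
            unfolding V_def by (simp add: powr_minus_divide)
        qed simp
        also have "\<dots> = (B powr (- 1 / \<alpha>)) ^ Suc j" using yy by (simp add: y_def)
        also have "\<dots> \<le> \<Lambda> * (B powr (- 1 / \<alpha>)) ^ Suc j" using \<Lambda> B mult_right_mono[OF \<Lambda>, of "(B powr (- 1 / \<alpha>)) ^ Suc j"] by simp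
        finally show ?thesis .
      qed
      finally show ?thesis by (simp add: ennreal_leI)
    qed
    have all: "Z j \<le> ennreal (\<Lambda> * (B powr (- 1 / \<alpha>)) ^ j)" for j
    proof (induction j)
      case 0
      have "Z 0 \<le> (\<integral>\<^sup>+x. ennreal (\<bar>w x\<bar> powr q) \<partial>M)"
        unfolding Z_def using q0 kL(1)[of 0] L by (intro nn_integral_mono ennreal_leI powr_mono2) auto
      also have "\<dots> \<le> ennreal Y" by (rule wY)
      also have "\<dots> \<le> ennreal \<Lambda>" by (rule ennreal_leI) (simp add: \<Lambda>_def)
      finally show ?case by simp
    qed (rule step)
    have "(\<lambda>j. \<Lambda> * (B powr (- 1 / \<alpha>)) ^ j) \<longlonglongrightarrow> \<Lambda> * 0"
    proof (intro tendsto_mult tendsto_const LIMSEQ_realpow_zero)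
      show "B powr (- 1 / \<alpha>) < 1" using B \<alpha> by (simp add: powr_less_one)
    qed simp
    then have "(\<lambda>j. ennreal (\<Lambda> * (B powr (- 1 / \<alpha>)) ^ j)) \<longlonglongrightarrow> ennreal 0" using tendsto_ennrealI by fastforce
    moreover have "(\<integral>\<^sup>+x. ennreal ((max (w x - 2 * L) 0) powr q) \<partial>M) \<le> ennreal (\<Lambda> * (B powr (- 1 / \<alpha>)) ^ j)" for j
    proof -
      have "(\<integral>\<^sup>+x. ennreal ((max (w x - 2 * L) 0) powr q) \<partial>M) \<le> Z j"
        unfolding Z_def using kL(2)[of j] q0 by (intro nn_integral_mono ennreal_leI powr_mono2) auto
      then show ?thesis using all[of j] by (rule order_trans)
    qed
    ultimately have "(\<integral>\<^sup>+x. ennreal ((max (w x - 2 * L) 0) powr q) \<partial>M) \<le> ennreal 0"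
      by (intro LIMSEQ_le_const) auto
    then have "(\<integral>\<^sup>+x. ennreal ((max (w x - 2 * L) 0) powr q) \<partial>M) = 0" by simp
    then have "AE x in M. ennreal ((max (w x - 2 * L) 0) powr q) = 0"
      by (subst (asm) nn_integral_0_iff_AE) measurable
    then have "AE x in M. w x \<le> 2 * L"
      by eventually_elim (auto simp: ennreal_powr_eq_0 max_def split: if_splits)
    moreover have "2 * L = c * K0 * (1 + Y) powr (1 / \<sigma>)"
      using c0 \<Lambda> by (simp add: L_def c_def powr_mult \<Lambda>_def[symmetric] mult_ac)
    ultimately show "AE x in M. w x \<le> c * K0 * (1 + Y) powr (1 / \<sigma>)" by simp
  qed
qed

section \<open>Truncations as test functions\<close>

lemma Lp_int_sign: "\<bar>\<sigma>\<bar> = 1 \<Longrightarrow> Lp_int p \<Omega> (\<lambda>x. \<sigma> *\<^sub>R f x) = Lp_int p \<Omega> f"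
  by (simp add: Lp_int_def)

text \<open>Restricting to \<open>\<bar>\<sigma>\<bar> = 1\<close> leaves all approximation errors unchanged.\<close>

lemma W1p_0_sign:
  fixes u :: "real^'n \<Rightarrow> real"
  assumes u: "u \<in> W1p_0 p \<Omega>" and wg: "is_weak_grad \<Omega> u v" and \<Omega>: "open \<Omega>" "bounded \<Omega>" and p: "p \<ge> 1" and \<sigma>: "\<bar>\<sigma>\<bar> = 1"
  shows "(\<lambda>x. \<sigma> * u x) \<in> W1p_0 p \<Omega>" "is_weak_grad \<Omega> (\<lambda>x. \<sigma> * u x) (\<lambda>x. \<sigma> *\<^sub>R v x)"
proof -
  show w: "is_weak_grad \<Omega> (\<lambda>x. \<sigma> * u x) (\<lambda>x. \<sigma> *\<^sub>R v x)"
    using is_weak_grad_lincomb[OF wg wg \<Omega>(1), of \<sigma> 0] by simp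
  have uW: "u \<in> W1p p \<Omega>" using u by (simp add: W1p_0_def)
  have Lu: "u \<in> Lp_space p \<Omega>" by (rule W1p_weak_grad(3)[OF uW \<Omega>(1)])
  have Lv: "v \<in> Lp_space p \<Omega>"
    using Lp_int_cong[OF weak_grad_is_weak_grad(2)[OF wg \<Omega>(1)], of p] W1p_weak_grad(2)[OF uW \<Omega>(1)] is_weak_grad_measurable(2)[OF wg \<Omega>(1)]
    by (simp add: Lp_space_iff)
  show "(\<lambda>x. \<sigma> * u x) \<in> W1p_0 p \<Omega>"
  proof (rule W1p_0I[OF w _ _ \<Omega> p])
    show "(\<lambda>x. \<sigma> * u x) \<in> Lp_space p \<Omega>" using Lp_space_scaleR[OF Lu, of \<sigma>] by simp
    show "(\<lambda>x. \<sigma> *\<^sub>R v x) \<in> Lp_space p \<Omega>" by (rule Lp_space_scaleR[OF Lv])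
    fix e :: real assume "e > 0"
    then obtain \<phi> where \<phi>: "\<phi> \<in> test_functions \<Omega>" "Lp_int p \<Omega> (\<lambda>x. u x - \<phi> x) \<le> ennreal e" "Lp_int p \<Omega> (\<lambda>x. v x - grad \<phi> x) \<le> ennreal e"
      using W1p_0_approx[OF u wg \<Omega> p] by blast
    have "Lp_int p \<Omega> (\<lambda>x. \<sigma> * u x - \<sigma> * \<phi> x) \<le> ennreal e"
      using \<phi>(2) Lp_int_sign[OF \<sigma>, of p \<Omega> "\<lambda>x. u x - \<phi> x"] by (simp add: right_diff_distrib)
    moreover have "Lp_int p \<Omega> (\<lambda>x. \<sigma> *\<^sub>R v x - grad (\<lambda>x. \<sigma> * \<phi> x) x) \<le> ennreal e"
      using \<phi>(3) Lp_int_sign[OF \<sigma>, of p \<Omega> "\<lambda>x. v x - grad \<phi> x"] by (simp add: scaleR_diff_right test_function_scale(2)[OF \<phi>(1)])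
    ultimately show "\<exists>\<phi>\<in>test_functions \<Omega>. Lp_int p \<Omega> (\<lambda>x. \<sigma> * u x - \<phi> x) \<le> ennreal e \<and> Lp_int p \<Omega> (\<lambda>x. \<sigma> *\<^sub>R v x - grad \<phi> x) \<le> ennreal e"
      using test_function_scale(1)[OF \<phi>(1), of \<sigma>] by (intro bexI[of _ "\<lambda>x. \<sigma> * \<phi> x"] conjI)
  qed
qed

text \<open>Membership in \<open>W1F\<close> only provides a gradient in \<open>L\<^sup>1\<close>; coercivity of \<open>f\<close> raises it to \<open>L\<^sup>p\<close>.\<close>

lemma energy_grad_Lp:
  fixes u :: "real^'n \<Rightarrow> real"
  assumes \<Omega>: "open \<Omega>" and u: "u \<in> W1F \<Omega> f" and c5: "c5 > 0" and grow: "AE x in lebesgue_on \<Omega>. \<forall>v \<xi>. c5 * norm \<xi> powr p \<le> f x v \<xi>"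
  shows "weak_grad \<Omega> u \<in> Lp_space p \<Omega>"
proof -
  have uW: "u \<in> W1p 1 \<Omega>" and en: "energy \<Omega> f u < \<infinity>" using u by (auto simp: W1F_def)
  have wg: "is_weak_grad \<Omega> u (weak_grad \<Omega> u)" by (rule W1p_weak_grad(1)[OF uW \<Omega>])
  have m[measurable]: "weak_grad \<Omega> u \<in> borel_measurable (lebesgue_on \<Omega>)" by (rule is_weak_grad_measurable(2)[OF wg \<Omega>])
  have "ennreal c5 * Lp_int p \<Omega> (weak_grad \<Omega> u) = (\<integral>\<^sup>+x. ennreal (c5 * norm (weak_grad \<Omega> u x) powr p) \<partial>lebesgue_on \<Omega>)"
    unfolding Lp_int_def using c5 by (subst nn_integral_cmult[symmetric]) (auto simp: ennreal_mult')
  also have "\<dots> \<le> energy \<Omega> f u"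
    unfolding energy_def by (rule nn_integral_mono_AE) (use grow in \<open>eventually_elim, simp add: ennreal_leI\<close>)
  finally have "ennreal c5 * Lp_int p \<Omega> (weak_grad \<Omega> u) < \<infinity>" using en by (rule le_less_trans)
  then have "Lp_int p \<Omega> (weak_grad \<Omega> u) < \<infinity>" using c5 by (auto simp: ennreal_mult_less_top)
  then show ?thesis using m by (simp add: Lp_space_iff)
qed

text \<open>Apply \<open>positive_part_W1p_0\<close> to \<open>\<sigma>u - k\<close> and \<open>\<sigma>u0 - k \<le> 0\<close>. The energy of the truncation is at most
  \<open>c6\<close> times the energy of \<open>u\<close> where \<open>\<sigma>u > k\<close>, because its gradient there is that of \<open>u\<close>, and it is the
  integral of \<open>f(x,0,0)\<close> elsewhere.\<close>

theorem truncation_admissible: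
  fixes u u0 :: "real^'n \<Rightarrow> real"
  assumes \<Omega>: "open \<Omega>" "bounded \<Omega>" and p: "p > 1" and fnn: "\<forall>x\<in>\<Omega>. \<forall>v \<xi>. 0 \<le> f x v \<xi>" and cf: "caratheodory \<Omega> f"
    and c5: "c5 > 0" and grow: "AE x in lebesgue_on \<Omega>. \<forall>v \<xi>. c5 * norm \<xi> powr p \<le> f x v \<xi>"
    and c6: "c6 > 0" and mono: "AE x in lebesgue_on \<Omega>. \<forall>v w \<xi>. \<bar>v\<bar> \<le> \<bar>w\<bar> \<longrightarrow> f x v \<xi> \<le> c6 * f x w \<xi>"
    and f0: "(\<lambda>x. f x 0 0) \<in> Lp_space 1 \<Omega>"
    and u0: "u0 \<in> W1F \<Omega> f" "u0 \<in> borel_measurable (lebesgue_on \<Omega>)" "AE x in lebesgue_on \<Omega>. \<bar>u0 x\<bar> \<le> K"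
    and u: "u \<in> W1F \<Omega> f" and uu0: "(\<lambda>x. u x - u0 x) \<in> W1F_0 p \<Omega> f"
    and \<sigma>: "\<sigma> = 1 \<or> \<sigma> = -1" and k: "0 \<le> k" "K \<le> k"
  shows "(\<lambda>x. \<sigma> * max (\<sigma> * u x - k) 0) \<in> W1F_0 p \<Omega> f"
    and "is_weak_grad \<Omega> (\<lambda>x. \<sigma> * max (\<sigma> * u x - k) 0) (\<lambda>x. of_bool (\<sigma> * u x > k) *\<^sub>R weak_grad \<Omega> u x)"
proof -
  let ?\<psi> = "\<lambda>x. \<sigma> * max (\<sigma> * u x - k) 0"
  let ?D = "weak_grad \<Omega> u" and ?E = "weak_grad \<Omega> u0"
  have p1: "p \<ge> 1" and p0: "p \<ge> 0" using p by auto
  have \<sigma>1: "\<bar>\<sigma>\<bar> = 1" "\<sigma> * \<sigma> = 1" using \<sigma> by auto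
  have uW: "u \<in> W1p 1 \<Omega>" and u0W: "u0 \<in> W1p 1 \<Omega>" and en: "energy \<Omega> f u < \<infinity>" using u u0 by (auto simp: W1F_def)
  have wg: "is_weak_grad \<Omega> u ?D" and wg0: "is_weak_grad \<Omega> u0 ?E"
    by (rule W1p_weak_grad(1)[OF uW \<Omega>(1)], rule W1p_weak_grad(1)[OF u0W \<Omega>(1)])
  have m: "u \<in> borel_measurable (lebesgue_on \<Omega>)" "?D \<in> borel_measurable (lebesgue_on \<Omega>)" by (rule is_weak_grad_measurable[OF wg \<Omega>(1)])+
  note [measurable] = m
  have LD: "?D \<in> Lp_space p \<Omega>" "?E \<in> Lp_space p \<Omega>" by (rule energy_grad_Lp[OF \<Omega>(1) u c5 grow], rule energy_grad_Lp[OF \<Omega>(1) u0(1) c5 grow])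
  have Lu0: "u0 \<in> Lp_space p \<Omega>" by (rule Lp_space_bounded[OF \<Omega> u0(2) _ p0, of K]) (use u0(3) in simp)
  have duW: "(\<lambda>x. u x - u0 x) \<in> W1p_0 p \<Omega>" using uu0 by (simp add: W1F_0_def)
  then have "(\<lambda>x. u x - u0 x) \<in> W1p p \<Omega>" by (simp add: W1p_0_def)
  from W1p_weak_grad(3)[OF this \<Omega>(1)] have "(\<lambda>x. u x - u0 x) \<in> Lp_space p \<Omega>" .
  from Lp_space_add[OF this Lu0 p0] have Lu: "u \<in> Lp_space p \<Omega>" by simp
  have Lc: "(\<lambda>x::real^'n. c::real) \<in> Lp_space r \<Omega>" if "r \<ge> 0" for c r
    by (rule Lp_space_bounded[OF \<Omega> _ _ that, of _ "\<bar>c\<bar>"]) auto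
  have lin: "is_weak_grad \<Omega> (\<lambda>x. \<sigma> * w x - k) (\<lambda>x. \<sigma> *\<^sub>R v x)" if "is_weak_grad \<Omega> w v" for w v
    using is_weak_grad_lincomb[OF that is_weak_grad_const[OF \<Omega>(1), of 1] \<Omega>(1), of \<sigma> "- k"] by simp
  have Llin: "(\<lambda>x. \<sigma> * w x - k) \<in> Lp_space r \<Omega>" if "w \<in> Lp_space r \<Omega>" "r \<ge> 0" for w r
    using Lp_space_diff[OF Lp_space_scaleR[OF that(1), of \<sigma>] Lc[OF that(2), of k] that(2)] by simp
  have wgd: "is_weak_grad \<Omega> (\<lambda>x. u x - u0 x) (\<lambda>x. ?D x - ?E x)"
    using is_weak_grad_lincomb[OF wg wg0 \<Omega>(1), of 1 "-1"] by simp
  have sg: "(\<lambda>x. \<sigma> * (u x - u0 x)) \<in> W1p_0 p \<Omega>" "is_weak_grad \<Omega> (\<lambda>x. \<sigma> * (u x - u0 x)) (\<lambda>x. \<sigma> *\<^sub>R (?D x - ?E x))"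
    by (rule W1p_0_sign[OF duW wgd \<Omega> p1 \<sigma>1(1)])+
  have P: "(\<lambda>x. max (\<sigma> * u x - k) 0) \<in> W1p_0 p \<Omega>"
  proof (rule positive_part_W1p_0[OF \<Omega> p1 lin[OF wg] lin[OF wg0] Llin[OF Lu p0] Lp_space_scaleR[OF LD(1)] Llin[OF Lu0 p0] Lp_space_scaleR[OF LD(2)]])
    show "AE x in lebesgue_on \<Omega>. \<sigma> * u0 x - k \<le> 0"
      using u0(3) by (rule eventually_mono) (use \<sigma> k in auto)
    fix e :: real assume "e > 0"
    then show "\<exists>\<phi>\<in>test_functions \<Omega>. Lp_int p \<Omega> (\<lambda>x. \<sigma> * u x - k - (\<sigma> * u0 x - k) - \<phi> x) \<le> ennreal e \<and> Lp_int p \<Omega> (\<lambda>x. \<sigma> *\<^sub>R ?D x - \<sigma> *\<^sub>R ?E x - grad \<phi> x) \<le> ennreal e"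
      using W1p_0_approx[OF sg \<Omega> p1 \<open>e > 0\<close>] by (simp add: right_diff_distrib scaleR_diff_right)
  qed
  have wgP: "is_weak_grad \<Omega> (\<lambda>x. max (\<sigma> * u x - k) 0) (\<lambda>x. of_bool (\<sigma> * u x - k > 0) *\<^sub>R (\<sigma> *\<^sub>R ?D x))"
    by (rule weak_grad_positive_part[OF lin[OF wg] \<Omega>(1)])
  have \<psi>0: "?\<psi> \<in> W1p_0 p \<Omega>" by (rule W1p_0_sign(1)[OF P wgP \<Omega> p1 \<sigma>1(1)])
  have "is_weak_grad \<Omega> ?\<psi> (\<lambda>x. \<sigma> *\<^sub>R (of_bool (\<sigma> * u x - k > 0) *\<^sub>R (\<sigma> *\<^sub>R ?D x)))"
    by (rule W1p_0_sign(2)[OF P wgP \<Omega> p1 \<sigma>1(1)])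
  moreover have "(\<lambda>x. \<sigma> *\<^sub>R (of_bool (\<sigma> * u x - k > 0) *\<^sub>R (\<sigma> *\<^sub>R ?D x))) = (\<lambda>x. of_bool (\<sigma> * u x > k) *\<^sub>R ?D x)"
    using \<sigma> by auto
  ultimately show wg\<psi>: "is_weak_grad \<Omega> ?\<psi> (\<lambda>x. of_bool (\<sigma> * u x > k) *\<^sub>R ?D x)" by simp
  have m\<psi>[measurable]: "?\<psi> \<in> borel_measurable (lebesgue_on \<Omega>)" by measurable
  have "?\<psi> \<in> W1p 1 \<Omega>"
  proof (rule W1pI[OF _ _ wg\<psi>])
    show "?\<psi> \<in> Lp_space 1 \<Omega>"
      by (rule Lp_space_mono[OF Llin[OF W1p_weak_grad(3)[OF uW \<Omega>(1)]] m\<psi>]) (use \<sigma> in \<open>auto simp: abs_mult max_def\<close>)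
    show "(\<lambda>x. of_bool (\<sigma> * u x > k) *\<^sub>R ?D x) \<in> Lp_space 1 \<Omega>"
      by (rule Lp_space_mono[OF W1p_weak_grad(2)[OF uW \<Omega>(1)]]) auto
  qed
  moreover have "energy \<Omega> f ?\<psi> < \<infinity>"
  proof -
    have mf: "(\<lambda>x. f x (u x) (?D x)) \<in> borel_measurable (lebesgue_on \<Omega>)" by (rule caratheodory_measurable[OF cf m])
    have mf0: "(\<lambda>x. f x 0 0) \<in> borel_measurable (lebesgue_on \<Omega>)" using f0 by (simp add: Lp_space_iff)
    note [measurable] = mf mf0
    have "energy \<Omega> f ?\<psi> \<le> (\<integral>\<^sup>+x. ennreal c6 * ennreal (f x (u x) (?D x)) + ennreal (norm (f x 0 0) powr 1) \<partial>lebesgue_on \<Omega>)"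
      unfolding energy_def
    proof (rule nn_integral_mono_AE)
      have sp: "AE x in lebesgue_on \<Omega>. x \<in> \<Omega>" by (rule AE_I2) (simp add: space_restrict_space)
      show "AE x in lebesgue_on \<Omega>. ennreal (f x (?\<psi> x) (weak_grad \<Omega> ?\<psi> x)) \<le> ennreal c6 * ennreal (f x (u x) (?D x)) + ennreal (norm (f x 0 0) powr 1)"
        using weak_grad_is_weak_grad(2)[OF wg\<psi> \<Omega>(1)] mono sp
      proof eventually_elim
        case (elim x)
        show ?case
        proof (cases "\<sigma> * u x > k")
          case True
          then have "\<bar>?\<psi> x\<bar> \<le> \<bar>u x\<bar>" using \<sigma> k by (auto simp: max_def abs_mult)
          then have "f x (?\<psi> x) (?D x) \<le> c6 * f x (u x) (?D x)" using elim(2) by blast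
          then have "ennreal (f x (?\<psi> x) (weak_grad \<Omega> ?\<psi> x)) \<le> ennreal (c6 * f x (u x) (?D x))"
            using elim(1) True by (simp add: ennreal_leI)
          also have "\<dots> = ennreal c6 * ennreal (f x (u x) (?D x))" using c6 by (simp add: ennreal_mult')
          finally show ?thesis by (simp add: add_increasing2)
        next
          case False
          then have "?\<psi> x = 0" "weak_grad \<Omega> ?\<psi> x = 0" using elim(1) by auto
          then have e: "f x (?\<psi> x) (weak_grad \<Omega> ?\<psi> x) = f x 0 0" by (simp only:)
          have "0 \<le> f x 0 0" using elim(3) fnn by blast
          then show ?thesis unfolding e by (simp add: add_increasing)
        qed
      qed
    qed
    also have "\<dots> = ennreal c6 * energy \<Omega> f u + Lp_int 1 \<Omega> (\<lambda>x. f x 0 0)"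
      unfolding energy_def Lp_int_def by (simp add: nn_integral_add nn_integral_cmult)
    also have "\<dots> < \<infinity>" using en f0 by (simp add: Lp_space_iff ennreal_mult_less_top)
    finally show ?thesis .
  qed
  ultimately show "?\<psi> \<in> W1F_0 p \<Omega> f" using \<psi>0 by (simp add: W1F_0_def W1F_def)
qed

text \<open>Test the equation with \<open>\<sigma> max (\<sigma>u - k) 0\<close>. The energy term is integrable since \<open>u\<close> has finite
  energy, and the remainder \<open>R\<close> is integrable by assumption, so the pointwise inequality may be
  integrated; coercivity then replaces the energy by \<open>\<bar>Du\<bar>\<^sup>p\<close>.\<close>

theorem caccioppoli:
  fixes u :: "real^'n \<Rightarrow> real"
  assumes \<Omega>: "open \<Omega>" and fnn: "\<forall>x\<in>\<Omega>. \<forall>v \<xi>. 0 \<le> f x v \<xi>" and cf: "caratheodory \<Omega> f"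
    and u: "u \<in> W1F \<Omega> f" and ws: "weak_solution p \<Omega> f a b u" and \<sigma>: "\<sigma> = 1 \<or> \<sigma> = -1"
    and \<psi>: "(\<lambda>x. \<sigma> * max (\<sigma> * u x - k) 0) \<in> W1F_0 p \<Omega> f"
    and wg\<psi>: "is_weak_grad \<Omega> (\<lambda>x. \<sigma> * max (\<sigma> * u x - k) 0) (\<lambda>x. of_bool (\<sigma> * u x > k) *\<^sub>R weak_grad \<Omega> u x)"
    and c: "c1 > 0" "C > 0" and R: "R \<in> borel_measurable (lebesgue_on \<Omega>)" "\<And>x. \<sigma> * u x > k \<Longrightarrow> 0 \<le> R x"
    and PT: "AE x in lebesgue_on \<Omega>. \<sigma> * u x > k \<longrightarrow> (c1 / 2) * f x (u x) (weak_grad \<Omega> u x) - C * R x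
       \<le> a x (u x) (weak_grad \<Omega> u x) \<bullet> weak_grad \<Omega> u x + (\<sigma> * b x (u x) (weak_grad \<Omega> u x)) * (\<sigma> * u x - k)"
    and c5: "c5 > 0" and grow: "AE x in lebesgue_on \<Omega>. \<forall>v \<xi>. c5 * norm \<xi> powr p \<le> f x v \<xi>"
    and X: "X \<ge> 0" "(\<integral>\<^sup>+x. ennreal (of_bool (\<sigma> * u x > k) * R x) \<partial>lebesgue_on \<Omega>) \<le> ennreal X"
  shows "Lp_int p \<Omega> (\<lambda>x. of_bool (\<sigma> * u x > k) *\<^sub>R weak_grad \<Omega> u x) \<le> ennreal (2 * C / (c1 * c5) * X)"
proof -
  let ?M = "lebesgue_on \<Omega>"
  let ?D = "weak_grad \<Omega> u"
  let ?\<psi> = "\<lambda>x. \<sigma> * max (\<sigma> * u x - k) 0"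
  have uW: "u \<in> W1p 1 \<Omega>" and en: "energy \<Omega> f u < \<infinity>" using u by (auto simp: W1F_def)
  have wg: "is_weak_grad \<Omega> u ?D" by (rule W1p_weak_grad(1)[OF uW \<Omega>])
  have m: "u \<in> borel_measurable ?M" "?D \<in> borel_measurable ?M" by (rule is_weak_grad_measurable[OF wg \<Omega>])+
  have mf: "(\<lambda>x. f x (u x) (?D x)) \<in> borel_measurable ?M" by (rule caratheodory_measurable[OF cf m])
  note [measurable] = m mf R(1)
  have sp: "AE x in ?M. x \<in> \<Omega>" by (rule AE_I2) (simp add: space_restrict_space)
  define I where "I x = (\<Sum>i\<in>UNIV. a x (u x) (?D x) $ i * weak_grad \<Omega> ?\<psi> x $ i) + b x (u x) (?D x) * ?\<psi> x" for x
  have I: "integrable ?M I" "(\<integral>x. I x \<partial>?M) = 0"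
    using ws \<psi> unfolding weak_solution_def I_def[abs_def] Let_def by blast+
  define g where "g x = of_bool (\<sigma> * u x > k) * f x (u x) (?D x)" for x
  define r where "r x = of_bool (\<sigma> * u x > k) * R x" for x
  have [measurable]: "g \<in> borel_measurable ?M" "r \<in> borel_measurable ?M" unfolding g_def r_def by measurable
  have r0: "0 \<le> r x" for x using R(2)[of x] by (simp add: r_def)
  have g0: "AE x in ?M. 0 \<le> g x" using sp by (rule eventually_mono) (use fnn in \<open>auto simp: g_def\<close>)
  have ir: "integrable ?M r"
    using X r0 by (intro integrableI_bounded) (auto simp: r_def[symmetric] intro: le_less_trans)
  have ig: "integrable ?M g"
  proof (rule integrableI_bounded)
    have "(\<integral>\<^sup>+x. ennreal (norm (g x)) \<partial>?M) \<le> energy \<Omega> f u"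
      unfolding energy_def by (rule nn_integral_mono_AE, use sp in eventually_elim) (use fnn in \<open>auto simp: g_def intro: ennreal_leI\<close>)
    then show "(\<integral>\<^sup>+x. ennreal (norm (g x)) \<partial>?M) < \<infinity>" using en by (rule le_less_trans)
  qed measurable
  have "(\<integral>x. (c1 / 2) * g x - C * r x \<partial>?M) \<le> (\<integral>x. I x \<partial>?M)"
  proof (rule integral_mono_AE)
    show "integrable ?M (\<lambda>x. (c1 / 2) * g x - C * r x)" using ig ir by simp
    show "integrable ?M I" by (rule I(1))
    show "AE x in ?M. (c1 / 2) * g x - C * r x \<le> I x"
      using PT weak_grad_is_weak_grad(2)[OF wg\<psi> \<Omega>]
    proof eventually_elim
      case (elim x)
      show ?case
      proof (cases "\<sigma> * u x > k")
        case True
        have "I x = a x (u x) (?D x) \<bullet> ?D x + b x (u x) (?D x) * ?\<psi> x"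
          using elim(2) True by (simp add: I_def inner_vec_def)
        moreover have "b x (u x) (?D x) * ?\<psi> x = (\<sigma> * b x (u x) (?D x)) * (\<sigma> * u x - k)" using True by simp
        ultimately have "I x = a x (u x) (?D x) \<bullet> ?D x + (\<sigma> * b x (u x) (?D x)) * (\<sigma> * u x - k)" by (simp only:)
        then show ?thesis using elim(1) True by (simp add: g_def r_def)
      next
        case False
        then have "I x = 0" using elim(2) by (simp add: I_def)
        then show ?thesis using False by (simp add: g_def r_def)
      qed
    qed
  qed
  then have "(c1 / 2) * (\<integral>x. g x \<partial>?M) \<le> C * (\<integral>x. r x \<partial>?M)" using I(2) ig ir by simp
  moreover have "(\<integral>x. r x \<partial>?M) \<le> X"
  proof -
    have "(\<integral>\<^sup>+x. ennreal (r x) \<partial>?M) \<le> ennreal X" using X(2) unfolding r_def .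
    then have "ennreal (\<integral>x. r x \<partial>?M) \<le> ennreal X" using nn_integral_eq_integral[OF ir] r0 by simp
    then show ?thesis using X(1) by (simp add: ennreal_le_iff)
  qed
  ultimately have "(c1 / 2) * (\<integral>x. g x \<partial>?M) \<le> C * X" using c mult_left_mono[of "\<integral>x. r x \<partial>?M" X C] by linarith
  then have gX: "(\<integral>x. g x \<partial>?M) \<le> 2 * C / c1 * X" using c by (simp add: field_simps)
  have "Lp_int p \<Omega> (\<lambda>x. of_bool (\<sigma> * u x > k) *\<^sub>R ?D x) \<le> (\<integral>\<^sup>+x. ennreal (1 / c5) * ennreal (g x) \<partial>?M)"
    unfolding Lp_int_def
  proof (rule nn_integral_mono_AE)
    show "AE x in ?M. ennreal (norm (of_bool (\<sigma> * u x > k) *\<^sub>R ?D x) powr p) \<le> ennreal (1 / c5) * ennreal (g x)"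
      using grow
    proof eventually_elim
      case (elim x)
      show ?case
      proof (cases "\<sigma> * u x > k")
        case True
        have "norm (?D x) powr p \<le> 1 / c5 * f x (u x) (?D x)" using elim c5 by (simp add: field_simps)
        then show ?thesis using True c5 by (simp add: g_def ennreal_leI flip: ennreal_mult')
      qed simp
    qed
  qed
  also have "\<dots> = ennreal (1 / c5) * ennreal (\<integral>x. g x \<partial>?M)"
    using nn_integral_eq_integral[OF ig g0] by (simp add: nn_integral_cmult)
  also have "\<dots> \<le> ennreal (1 / c5) * ennreal (2 * C / c1 * X)" by (intro mult_left_mono ennreal_leI gX) simp
  also have "\<dots> = ennreal (2 * C / (c1 * c5) * X)" using c5 by (simp add: mult.commute flip: ennreal_mult')
  finally show ?thesis .
qed

section \<open>Global boundedness\<close>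

lemma Linf_space_bound:
  assumes "u \<in> Linf_space \<Omega>"
  shows "AE x in lebesgue_on \<Omega>. \<bar>u x\<bar> \<le> Linf_norm \<Omega> u" "0 \<le> Linf_norm \<Omega> u" "u \<in> borel_measurable (lebesgue_on \<Omega>)"
proof -
  have "esssup (lebesgue_on \<Omega>) (\<lambda>x. ennreal \<bar>u x\<bar>) = ennreal (Linf_norm \<Omega> u)"
    using assms unfolding Linf_norm_def by (intro ennreal_enn2real[symmetric]) (auto simp: Linf_space_def)
  then have "AE x in lebesgue_on \<Omega>. ennreal \<bar>u x\<bar> \<le> ennreal (Linf_norm \<Omega> u)"
    using esssup_AE[where M="lebesgue_on \<Omega>" and f="\<lambda>x. ennreal \<bar>u x\<bar>"] by simp
  then show "AE x in lebesgue_on \<Omega>. \<bar>u x\<bar> \<le> Linf_norm \<Omega> u"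
    by (rule eventually_mono) (simp add: ennreal_le_iff Linf_norm_def)
  show "0 \<le> Linf_norm \<Omega> u" by (simp add: Linf_norm_def)
  show "u \<in> borel_measurable (lebesgue_on \<Omega>)" using assms by (simp add: Linf_space_def)
qed

lemma Linf_spaceI:
  assumes "u \<in> borel_measurable (lebesgue_on \<Omega>)" "AE x in lebesgue_on \<Omega>. \<bar>u x\<bar> \<le> B" "0 \<le> B"
  shows "u \<in> Linf_space \<Omega>" "Linf_norm \<Omega> u \<le> B"
proof -
  have m: "(\<lambda>x. ennreal \<bar>u x\<bar>) \<in> borel_measurable (lebesgue_on \<Omega>)" using assms(1) by measurable
  have le: "esssup (lebesgue_on \<Omega>) (\<lambda>x. ennreal \<bar>u x\<bar>) \<le> ennreal B"
    by (rule esssup_I[OF m]) (use assms(2) in eventually_elim, rule ennreal_leI)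
  then show "u \<in> Linf_space \<Omega>" using assms(1) by (auto simp: Linf_space_def intro: le_less_trans)
  have "enn2real (esssup (lebesgue_on \<Omega>) (\<lambda>x. ennreal \<bar>u x\<bar>)) \<le> enn2real (ennreal B)"
    using le by (intro enn2real_mono) auto
  then show "Linf_norm \<Omega> u \<le> B" using assms(3) by (simp add: Linf_norm_def)
qed

lemma powr_le_one_plus_powr:
  fixes x s r :: real
  assumes "0 \<le> x" "0 \<le> s" "s \<le> r" shows "x powr s \<le> 1 + x powr r"
proof (cases "x \<le> 1")
  case True
  then have "x powr s \<le> 1" using assms powr_mono2[of s x 1] by simp
  then show ?thesis by (simp add: add_increasing2)
next
  case False
  then have "x powr s \<le> x powr r" using assms by (intro powr_mono) auto
  then show ?thesis by simp
qed

lemma Lp_int_le_of_larger_exponent: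
  fixes f :: "real^'n \<Rightarrow> 'b::euclidean_space"
  assumes \<Omega>: "open \<Omega>" "bounded \<Omega>" and f: "f \<in> Lp_space r \<Omega>" and s: "0 \<le> s" "s \<le> r" "0 < r"
  shows "Lp_int s \<Omega> f \<le> ennreal (measure (lebesgue_on \<Omega>) \<Omega> + Lp_norm r \<Omega> f powr r)"
proof -
  have [measurable]: "f \<in> borel_measurable (lebesgue_on \<Omega>)" using f by (simp add: Lp_space_iff)
  interpret finite_measure "lebesgue_on \<Omega>" by (rule finite_measure_lebesgue_on_bounded_open(2)[OF \<Omega>])
  have "Lp_int s \<Omega> f \<le> (\<integral>\<^sup>+x. 1 + ennreal (norm (f x) powr r) \<partial>lebesgue_on \<Omega>)"
    unfolding Lp_int_def
  proof (rule nn_integral_mono)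
    fix x
    have "ennreal (norm (f x) powr s) \<le> ennreal (1 + norm (f x) powr r)"
      by (intro ennreal_leI powr_le_one_plus_powr s) auto
    then show "ennreal (norm (f x) powr s) \<le> 1 + ennreal (norm (f x) powr r)" by (simp add: ennreal_plus)
  qed
  also have "\<dots> = emeasure (lebesgue_on \<Omega>) \<Omega> + Lp_int r \<Omega> f"
    unfolding Lp_int_def by (subst nn_integral_add) (auto simp: finite_measure_lebesgue_on_bounded_open(3)[OF \<Omega>])
  also have "\<dots> = ennreal (measure (lebesgue_on \<Omega>) \<Omega> + Lp_norm r \<Omega> f powr r)"
    unfolding Lp_int_eq_norm[OF f s(3)] by (simp add: emeasure_eq_measure ennreal_plus)
  finally show ?thesis .
qed

text \<open>For \<open>p < n\<close> the identity \<open>1/p* = 1/p - 1/n\<close> makes the claim equivalent to \<open>q < p*\<close>; for \<open>p \<ge> n\<close> it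
  holds for every \<open>q\<close>.\<close>

lemma subcritical_exponent:
  assumes "sobolev_exponent n p ps" "1 < p" "p < q" "q < ps" "0 < n"
  shows "real n * (1 / p - 1 / q) < 1"
proof (cases "p < real n")
  case True
  then have ps: "ps = real n * p / (real n - p)" using assms(1) by (simp add: sobolev_exponent_def)
  have "1 / ps = 1 / p - 1 / real n" using True assms unfolding ps by (simp add: field_simps)
  moreover have "1 / ps < 1 / q" using assms by (intro divide_strict_left_mono) auto
  ultimately have "1 / p - 1 / q < 1 / real n" by linarith
  then have "real n * (1 / p - 1 / q) < real n * (1 / real n)" using assms(5) by (intro mult_strict_left_mono) auto
  then show ?thesis using assms(5) by simp
next
  case False
  have "real n * (1 / p - 1 / q) = real n / p - real n / q" by (simp add: field_simps)
  also have "real n / p \<le> 1" using False assms by simp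
  also have "1 - real n / q < 1" using assms by simp
  finally show ?thesis by simp
qed

lemma sobolev_exponent_gt: "sobolev_exponent n p ps \<Longrightarrow> 1 < p \<Longrightarrow> p < ps"
  unfolding sobolev_exponent_def by (auto simp: less_divide_eq algebra_simps split: if_splits)

text \<open>The constants are fixed before the data \<open>f\<close>, \<open>a\<close>, \<open>b\<close>, \<open>u0\<close> and \<open>u\<close>. The a priori bound is used twice:
  with \<open>\<integral>\<bar>u\<bar>\<^sup>q\<close> merely finite it shows \<open>u \<in> L\<^sup>\<infinity>\<close>, hence \<open>u \<in> L\<^sup>p\<^sup>*\<close>, which is what makes \<open>Lp_norm ps \<Omega> u\<close>
  meaningful; with \<open>\<integral>\<bar>u\<bar>\<^sup>q \<le> \<bar>\<Omega>\<bar> + \<parallel>u\<parallel>\<^sup>p\<^sup>*\<close> it gives the estimate.\<close>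

theorem theorem2p2:
  fixes \<Omega> :: "(real^'n) set"
    and p ps m M s1 s3 \<epsilon> \<epsilon>1 c1 c2 c3 c4 c5 c6 c7 c8 c9 B1 B3 :: real
  assumes "2 \<le> CARD('n)" "open \<Omega>" "bounded \<Omega>"
    and "1 < p" "sobolev_exponent CARD('n) p ps"
    and "1 < m" "m \<le> M"
    and "0 < c1" "0 \<le> c2" "0 < c3" "0 \<le> c4" "0 < c5" "0 < c6" "0 < c7" "0 < c8" "0 \<le> c9"
    and "ps / (ps - p) < s1" "ps / (ps - p) < s3"
    and "0 < \<epsilon>1" "0 < \<epsilon>" "\<epsilon> < 1"
    and "0 \<le> ps - \<epsilon>1" "0 \<le> 1 - 1 / ps - \<epsilon>" "0 \<le> p * (1 - 1 / ps) - \<epsilon>" "0 \<le> ps - 1 - \<epsilon>"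
  shows "\<exists>c \<gamma>. 1 \<le> \<gamma> \<and>
    (\<forall>(f :: real^'n \<Rightarrow> real \<Rightarrow> real^'n \<Rightarrow> real)
      (a :: real^'n \<Rightarrow> real \<Rightarrow> real^'n \<Rightarrow> real^'n)
      (b :: real^'n \<Rightarrow> real \<Rightarrow> real^'n \<Rightarrow> real)
      (b1 :: real^'n \<Rightarrow> real) (b2 :: real^'n \<Rightarrow> real) (b3 :: real^'n \<Rightarrow> real)
      (u0 :: real^'n \<Rightarrow> real) (u :: real^'n \<Rightarrow> real).
      (\<forall>x\<in>\<Omega>. \<forall>v \<xi>. 0 \<le> f x v \<xi>) \<and>
      caratheodory \<Omega> f \<and>
      (AE x in lebesgue_on \<Omega>. \<forall>v. convex_on UNIV (f x v)) \<and>
      (\<forall>x\<in>\<Omega>. \<forall>v \<xi>. has_partials (f x v) \<xi>) \<and>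
      caratheodory \<Omega> (D_xi f) \<and>
      (\<forall>x\<in>\<Omega>. \<forall>v \<xi>. m * f x v \<xi> \<le> f x v (2 *\<^sub>R \<xi>) \<and> f x v (2 *\<^sub>R \<xi>) \<le> M * f x v \<xi>) \<and>
      (AE x in lebesgue_on \<Omega>. \<forall>v \<xi>. c5 * norm \<xi> powr p \<le> f x v \<xi>) \<and>
      (AE x in lebesgue_on \<Omega>. \<forall>v w \<xi>. \<bar>v\<bar> \<le> \<bar>w\<bar> \<longrightarrow> f x v \<xi> \<le> c6 * f x w \<xi>) \<and>
      (\<lambda>x. f x 0 0) \<in> Lp_space 1 \<Omega> \<and>
      caratheodory \<Omega> a \<and>
      b1 \<in> Lp_space s1 \<Omega> \<and> (AE x in lebesgue_on \<Omega>. 0 \<le> b1 x) \<and> Lp_norm s1 \<Omega> b1 = B1 \<and>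
      b2 \<in> Lp_space 1 \<Omega> \<and> (AE x in lebesgue_on \<Omega>. 0 \<le> b2 x) \<and>
      (AE x in lebesgue_on \<Omega>. \<forall>v \<xi>.
         a x v \<xi> \<bullet> \<xi> \<ge> c1 * (D_xi f x v \<xi> \<bullet> \<xi>) - c2 * rpow \<bar>v\<bar> (ps - \<epsilon>1) - b1 x \<and>
         a x v \<xi> \<bullet> \<xi> \<le> c3 * (D_xi f x v \<xi> \<bullet> \<xi>) + c4 * rpow \<bar>v\<bar> ps + b2 x) \<and>
      caratheodory \<Omega> b \<and>
      b3 \<in> Lp_space s3 \<Omega> \<and> (AE x in lebesgue_on \<Omega>. 0 \<le> b3 x) \<and> Lp_norm s3 \<Omega> b3 = B3 \<and>
      ((\<exists>b4 \<in> Lp_space 1 \<Omega>. (AE x in lebesgue_on \<Omega>. 0 \<le> b4 x) \<and>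
          (AE x in lebesgue_on \<Omega>. \<forall>v \<xi>.
             sgn v * b x v \<xi> \<ge> - c7 * (rpow (f x v \<xi>) (1 - 1 / ps - \<epsilon>)
                 + rpow (norm \<xi>) (p * (1 - 1 / ps) - \<epsilon>) + rpow \<bar>v\<bar> (ps - 1 - \<epsilon>)) - b3 x \<and>
             v * b x v \<xi> \<le> c8 * (f x v \<xi> + rpow \<bar>v\<bar> ps) + b4 x)) \<or>
       (AE x in lebesgue_on \<Omega>. \<forall>v \<xi>.
          \<bar>b x v \<xi>\<bar> \<le> c9 * (rpow (f x v \<xi>) (1 - 1 / ps - \<epsilon>) + rpow \<bar>v\<bar> (ps - 1 - \<epsilon>)) + b3 x)) \<and>
      u0 \<in> Linf_space \<Omega> \<inter> W1F \<Omega> f \<and>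
      u \<in> W1F \<Omega> f \<and>
      (\<lambda>x. u x - u0 x) \<in> W1F_0 p \<Omega> f \<and>
      weak_solution p \<Omega> f a b u
      \<longrightarrow>
      u \<in> Linf_space \<Omega> \<and>
      Linf_norm \<Omega> u \<le> c * (1 + Linf_norm \<Omega> u0) * (1 + Lp_norm ps \<Omega> u) powr \<gamma>)"
proof -
  note as = assms
  have n2: "0 < CARD('n)" by simp
  have p1: "1 \<le> p" "p > 0" using as(4) by auto
  have pps: "p < ps" by (rule sobolev_exponent_gt[OF as(5,4)])
  have ps0: "ps > 0" "1 / ps > 0" "1 / ps < 1" using pps p1 as(4) by auto
  define s where "s = min s1 s3"
  have s: "s > ps / (ps - p)" "s \<le> s1" "s \<le> s3" using as(17,18) by (auto simp: s_def)
  have s1: "s > 1"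
  proof -
    have "ps / (ps - p) > 1" using pps p1 by (simp add: less_divide_eq)
    then show ?thesis using s(1) by linarith
  qed
  have sps: "p * (s / (s - 1)) < ps"
  proof -
    have "ps < s * (ps - p)" using s(1) pps by (simp add: divide_less_eq)
    then show ?thesis using s1 by (simp add: divide_less_eq algebra_simps)
  qed
  define \<theta>1 where "\<theta>1 = 1 - 1 / ps - \<epsilon>"
  \<comment> \<open>\<open>\<theta>2\<close> is the exponent of \<open>\<bar>Du\<bar>\<close> divided by \<open>p\<close>\<close>
  define \<theta>2 where "\<theta>2 = 1 - 1 / ps - \<epsilon> / p"
  define e3 where "e3 = ps - 1 - \<epsilon>"
  define r where "r = ps - \<epsilon>1"
  have p\<theta>2: "p * (1 - 1 / ps) - \<epsilon> = p * \<theta>2" using p1 by (simp add: \<theta>2_def right_diff_distrib)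
  have \<theta>: "0 \<le> \<theta>1" "\<theta>1 < 1" "0 \<le> \<theta>2" "\<theta>2 < 1"
  proof -
    show "0 \<le> \<theta>1" using as(23) by (simp add: \<theta>1_def)
    show "\<theta>1 < 1" using ps0(2) as(20) unfolding \<theta>1_def by linarith
    have "0 \<le> p * \<theta>2" using as(24) p\<theta>2 by simp
    then show "0 \<le> \<theta>2" using p1(2) by (simp add: zero_le_mult_iff)
    have "\<epsilon> / p > 0" using p1 as(20) by simp
    then show "\<theta>2 < 1" using ps0(2) unfolding \<theta>2_def by linarith
  qed
  \<comment> \<open>the largest power of \<open>w\<close> produced by Young's inequality; each of the four is below \<open>ps\<close>\<close>
  define \<tau> where "\<tau> = max (max r (1 / (1 - \<theta>1))) (max (1 / (1 - \<theta>2)) (e3 + 1))"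
  have \<tau>: "r \<le> \<tau>" "1 / (1 - \<theta>1) \<le> \<tau>" "1 / (1 - \<theta>2) \<le> \<tau>" "e3 + 1 \<le> \<tau>" by (auto simp: \<tau>_def)
  have \<tau>0: "0 \<le> \<tau>" using as(22) \<tau>(1) by (simp add: r_def)
  have "\<tau> < ps"
  proof -
    have inv: "1 / (1 / ps + d) < ps" if "d > 0" for d
    proof -
      have "0 < 1 / ps + d" using that ps0(2) by linarith
      moreover have "1 < ps * (1 / ps + d)" using that ps0(1) by (simp add: distrib_left)
      ultimately show ?thesis by (simp add: pos_divide_less_eq)
    qed
    have "1 / (1 - \<theta>1) < ps" using inv[OF as(20)] by (simp add: \<theta>1_def)
    moreover have "1 / (1 - \<theta>2) < ps" using inv[of "\<epsilon> / p"] as(20) p1 by (simp add: \<theta>2_def)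
    moreover have "r < ps" "e3 + 1 < ps" using as(19,20) by (auto simp: r_def e3_def)
    ultimately show ?thesis by (simp add: \<tau>_def)
  qed
  \<comment> \<open>strictly between \<open>ps\<close> and the two exponents that the iteration has to exceed\<close>
  define q where "q = (max \<tau> (p * (s / (s - 1))) + ps) / 2"
  have q: "\<tau> < q" "p * (s / (s - 1)) < q" "q < ps"
  proof -
    have "A < (max A X + P) / 2 \<and> X < (max A X + P) / 2 \<and> (max A X + P) / 2 < P" if "A < P" "X < P" for A X P :: real
      using that by (auto simp: max_def)
    from this[OF \<open>\<tau> < ps\<close> sps] show "\<tau> < q" "p * (s / (s - 1)) < q" "q < ps" unfolding q_def by blast+
  qed
  have pq: "p < q"
  proof -
    have "p * 1 < p * (s / (s - 1))" using p1 s1 by (intro mult_strict_left_mono) (auto simp: less_divide_eq)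
    then show ?thesis using q(2) by simp
  qed
  have sub: "real CARD('n) * (1 / p - 1 / q) < 1" by (rule subcritical_exponent[OF as(5,4) pq q(3) n2])
  \<comment> \<open>one constant for both alternatives; the second is weakened by adding the term in \<open>\<bar>Du\<bar>\<close>\<close>
  define \<kappa> where "\<kappa> = max c7 c9"
  have \<kappa>: "\<kappa> > 0" "c7 \<le> \<kappa>" "c9 \<le> \<kappa>" using as(14) by (auto simp: \<kappa>_def)
  obtain C where C: "C > 0" and PW: "\<And>t \<xi> w y A B \<beta>1 \<beta>3. 0 \<le> t \<Longrightarrow> 0 \<le> \<xi> \<Longrightarrow> c5 * \<xi> powr p \<le> t \<Longrightarrow> 1 \<le> w \<Longrightarrow> 0 \<le> y \<Longrightarrow> y \<le> w \<Longrightarrow> 0 \<le> \<beta>1 \<Longrightarrow> 0 \<le> \<beta>3 \<Longrightarrow>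
     c1 * t - c2 * w powr r - \<beta>1 \<le> A \<Longrightarrow> - \<kappa> * (rpow t \<theta>1 + rpow \<xi> (p * \<theta>2) + w powr e3) - \<beta>3 \<le> B \<Longrightarrow>
     (c1 / 2) * t - C * (w powr \<tau> + (\<beta>1 + \<beta>3) * w) \<le> A + B * y"
    using pointwise_energy[OF as(8,9,12) \<kappa>(1) as(4) \<theta> \<tau>] by blast
  obtain Cs where Cs: "Cs > 0" and SOB: "\<And>u v X. u \<in> W1p_0 p \<Omega> \<Longrightarrow> is_weak_grad \<Omega> u v \<Longrightarrow> X \<ge> 0 \<Longrightarrow> Lp_int p \<Omega> v \<le> ennreal X \<Longrightarrow> Lp_int q \<Omega> u \<le> ennreal (Cs * X powr (q / p))"
    using sobolev_W1p_0[OF as(2,3) p1(1) pq sub] by blast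
  define C2 where "C2 = 2 * C / (c1 * c5)"
  have C2: "C2 > 0" using C as(8,12) by (simp add: C2_def)
  define C3 where "C3 = Cs * C2 powr (q / p)"
  have C3: "C3 > 0" using Cs C2 by (simp add: C3_def)
  define V where "V = measure (lebesgue_on \<Omega>) \<Omega>"
  have V: "V \<ge> 0" by (simp add: V_def)
  \<comment> \<open>bounds the \<open>s\<close>-th power integral of \<open>\<bar>b1\<bar> + \<bar>b3\<bar>\<close> through the norms \<open>B1\<close> and \<open>B3\<close> alone, since \<open>s \<le> s1, s3\<close>\<close>
  define Hs where "Hs = 2 powr s * ((V + B1 powr s1) + (V + B3 powr s3))"
  have Hs: "Hs \<ge> 0" using V by (simp add: Hs_def)
  from de_giorgi[OF p1(1) \<tau>0 q(1) s1 q(2) C3 Hs, where 'a="real^'n"]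
  obtain c \<gamma> where c: "c > 0" and \<gamma>: "\<gamma> > 0" and DG0: "\<forall>(M :: (real^'n) measure) w h K0 Y.
     w \<in> borel_measurable M \<longrightarrow> h \<in> borel_measurable M \<longrightarrow> (\<forall>x. 0 \<le> h x) \<longrightarrow> 1 \<le> K0 \<longrightarrow> 0 \<le> Y \<longrightarrow>
     (\<integral>\<^sup>+x. ennreal (h x powr s) \<partial>M) \<le> ennreal Hs \<longrightarrow> (\<integral>\<^sup>+x. ennreal (\<bar>w x\<bar> powr q) \<partial>M) \<le> ennreal Y \<longrightarrow>
     (\<forall>k X. K0 \<le> k \<longrightarrow> 0 \<le> X \<longrightarrow> (\<integral>\<^sup>+x. ennreal (of_bool (w x > k) * (w x powr \<tau> + h x * w x)) \<partial>M) \<le> ennreal X \<longrightarrow>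
        (\<integral>\<^sup>+x. ennreal ((max (w x - k) 0) powr q) \<partial>M) \<le> ennreal (C3 * X powr (q / p))) \<longrightarrow>
     (AE x in M. w x \<le> c * K0 * (1 + Y) powr \<gamma>)"
    by (elim exE conjE)
  note DG = DG0[rule_format]
  define c' where "c' = c * (2 * (1 + V)) powr \<gamma>"
  define \<gamma>' where "\<gamma>' = max 1 (ps * \<gamma>)"
  show ?thesis
  proof (rule exI[of _ c'], rule exI[of _ \<gamma>'], rule conjI, goal_cases)
    case 1
    show ?case by (simp add: \<gamma>'_def)
  next
    case 2
    show ?case
    proof (intro allI impI, elim conjE, goal_cases)
      case (1 f a b b1 b2 b3 u0 u)
      let ?M = "lebesgue_on \<Omega>"
      let ?D = "weak_grad \<Omega> u"
      note cf = 1(2) and conv = 1(3) and part = 1(4) and dbl = 1(6) and grow = 1(7) and mono = 1(8) and f0 = 1(9)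
      have sp: "AE x in ?M. x \<in> \<Omega>" by (rule AE_I2) (simp add: space_restrict_space)
      have u0L: "u0 \<in> Linf_space \<Omega>" and u0F: "u0 \<in> W1F \<Omega> f"
        using \<open>u0 \<in> Linf_space \<Omega> \<inter> W1F \<Omega> f\<close> by auto
      note uF = \<open>u \<in> W1F \<Omega> f\<close> and du = \<open>(\<lambda>x. u x - u0 x) \<in> W1F_0 p \<Omega> f\<close> and ws = \<open>weak_solution p \<Omega> f a b u\<close>
      have uW: "u \<in> W1p 1 \<Omega>" using uF by (simp add: W1F_def)
      have wg: "is_weak_grad \<Omega> u ?D" by (rule W1p_weak_grad(1)[OF uW as(2)])
      have mu[measurable]: "u \<in> borel_measurable ?M" by (rule is_weak_grad_measurable(1)[OF wg as(2)])
      define K where "K = Linf_norm \<Omega> u0"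
      have K: "AE x in ?M. \<bar>u0 x\<bar> \<le> K" "0 \<le> K" "u0 \<in> borel_measurable ?M"
        unfolding K_def by (rule Linf_space_bound[OF u0L])+
      define h where "h x = \<bar>b1 x\<bar> + \<bar>b3 x\<bar>" for x
      have b1L: "b1 \<in> Lp_space s1 \<Omega>" and b3L: "b3 \<in> Lp_space s3 \<Omega>" and b1n: "Lp_norm s1 \<Omega> b1 = B1" and b3n: "Lp_norm s3 \<Omega> b3 = B3"
        by fact+
      have mb[measurable]: "b1 \<in> borel_measurable ?M" "b3 \<in> borel_measurable ?M" using b1L b3L by (auto simp: Lp_space_iff)
      have mh[measurable]: "h \<in> borel_measurable ?M" unfolding h_def by measurable
      have hs: "(\<integral>\<^sup>+x. ennreal (h x powr s) \<partial>?M) \<le> ennreal Hs"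
      proof -
        have a1: "Lp_int s \<Omega> (\<lambda>x. \<bar>b1 x\<bar>) \<le> ennreal (V + B1 powr s1)"
          using Lp_int_le_of_larger_exponent[OF as(2,3) b1L, of s] s s1 by (simp add: b1n V_def Lp_int_def)
        have a3: "Lp_int s \<Omega> (\<lambda>x. \<bar>b3 x\<bar>) \<le> ennreal (V + B3 powr s3)"
          using Lp_int_le_of_larger_exponent[OF as(2,3) b3L, of s] s s1 by (simp add: b3n V_def Lp_int_def)
        have "Lp_int s \<Omega> (\<lambda>x. \<bar>b1 x\<bar> + \<bar>b3 x\<bar>) \<le> ennreal Hs"
          unfolding Hs_def by (rule Lp_int_add_le[OF _ _ _ a1 a3]) (use s1 V in auto)
        then show ?thesis by (simp add: Lp_int_def h_def)
      qed
      have low: "AE x in ?M. \<forall>\<xi>. f x (u x) \<xi> \<le> D_xi f x (u x) \<xi> \<bullet> \<xi>"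
        using conv sp
      proof eventually_elim
        case (elim x)
        \<comment> \<open>doubling at \<open>\<xi> = 0\<close> with \<open>m > 1\<close>\<close>
        have z: "f x (u x) 0 \<le> 0"
        proof -
          have "m * f x (u x) 0 \<le> f x (u x) (2 *\<^sub>R 0)" using dbl elim(2) by blast
          then have "(m - 1) * f x (u x) 0 \<le> 0" by (simp add: algebra_simps)
          then show ?thesis using as(6) by (simp add: mult_le_0_iff)
        qed
        show ?case
        proof
          fix \<xi>
          have "has_partials (f x (u x)) \<xi>" using part elim(2) by blast
          from convex_grad_inner_ge[OF _ this] show "f x (u x) \<xi> \<le> D_xi f x (u x) \<xi> \<bullet> \<xi>"
            using elim(1) z by (simp add: D_xi_def)
        qed
      qed
      have step: "(\<integral>\<^sup>+x. ennreal ((max (\<sigma> * u x - k) 0) powr q) \<partial>?M) \<le> ennreal (C3 * X powr (q / p))"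
        if \<sigma>: "\<sigma> = 1 \<or> \<sigma> = -1" and k: "1 + K \<le> k" and X: "0 \<le> X"
          and b: "(\<integral>\<^sup>+x. ennreal (of_bool (\<sigma> * u x > k) * ((\<sigma> * u x) powr \<tau> + h x * (\<sigma> * u x))) \<partial>?M) \<le> ennreal X" for \<sigma> k X
      proof -
        have k': "0 \<le> k" "K \<le> k" "1 \<le> k" using k K(2) by auto
        note adm = truncation_admissible[OF as(2,3,4) 1(1) cf as(12) grow as(13) mono f0 u0F K(3,1) uF du \<sigma> k'(1,2)]
        have PT: "AE x in ?M. \<sigma> * u x > k \<longrightarrow> (c1 / 2) * f x (u x) (?D x) - C * ((\<sigma> * u x) powr \<tau> + h x * (\<sigma> * u x))
           \<le> a x (u x) (?D x) \<bullet> ?D x + (\<sigma> * b x (u x) (?D x)) * (\<sigma> * u x - k)"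
        proof -
          have B: "AE x in ?M. \<sigma> * u x > k \<longrightarrow> - \<kappa> * (rpow (f x (u x) (?D x)) \<theta>1 + rpow (norm (?D x)) (p * \<theta>2) + (\<sigma> * u x) powr e3) - \<bar>b3 x\<bar> \<le> \<sigma> * b x (u x) (?D x)"
          proof -
            have comm: "- \<kappa> * S - \<bar>\<beta>\<bar> \<le> y" if "- c * S - \<beta> \<le> y" "c \<le> \<kappa>" "0 \<le> S" for c S \<beta> y :: real
              using that mult_right_mono[OF that(2,3)] by (simp add: abs_if split: if_splits)
            from 1(21) show ?thesis
            proof
              assume "\<exists>b4\<in>Lp_space 1 \<Omega>. (AE x in ?M. 0 \<le> b4 x) \<and> (AE x in ?M. \<forall>v \<xi>.
                 sgn v * b x v \<xi> \<ge> - c7 * (rpow (f x v \<xi>) (1 - 1 / ps - \<epsilon>) + rpow (norm \<xi>) (p * (1 - 1 / ps) - \<epsilon>) + rpow \<bar>v\<bar> (ps - 1 - \<epsilon>)) - b3 x \<and>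
                 v * b x v \<xi> \<le> c8 * (f x v \<xi> + rpow \<bar>v\<bar> ps) + b4 x)"
              then obtain b4 where A: "AE x in ?M. \<forall>v \<xi>.
                 sgn v * b x v \<xi> \<ge> - c7 * (rpow (f x v \<xi>) (1 - 1 / ps - \<epsilon>) + rpow (norm \<xi>) (p * (1 - 1 / ps) - \<epsilon>) + rpow \<bar>v\<bar> (ps - 1 - \<epsilon>)) - b3 x \<and>
                 v * b x v \<xi> \<le> c8 * (f x v \<xi> + rpow \<bar>v\<bar> ps) + b4 x" by blast
              then show ?thesis
              proof eventually_elim
                case (elim x)
                show ?case
                proof
                  assume w: "\<sigma> * u x > k"
                  have sg: "sgn (u x) = \<sigma>" "\<bar>u x\<bar> = \<sigma> * u x" using \<sigma> w k' by (auto simp: sgn_if)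
                  have "- c7 * (rpow (f x (u x) (?D x)) \<theta>1 + rpow (norm (?D x)) (p * \<theta>2) + rpow \<bar>u x\<bar> e3) - b3 x \<le> sgn (u x) * b x (u x) (?D x)"
                    using elim unfolding p\<theta>2 \<theta>1_def e3_def by blast
                  then have "- c7 * (rpow (f x (u x) (?D x)) \<theta>1 + rpow (norm (?D x)) (p * \<theta>2) + (\<sigma> * u x) powr e3) - b3 x \<le> \<sigma> * b x (u x) (?D x)"
                    unfolding sg using w k' by (simp add: rpow_pos)
                  then show "- \<kappa> * (rpow (f x (u x) (?D x)) \<theta>1 + rpow (norm (?D x)) (p * \<theta>2) + (\<sigma> * u x) powr e3) - \<bar>b3 x\<bar> \<le> \<sigma> * b x (u x) (?D x)"
                    by (rule comm[OF _ \<kappa>(2)]) (simp add: rpow_nonneg)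
                qed
              qed
            next
              assume "AE x in ?M. \<forall>v \<xi>. \<bar>b x v \<xi>\<bar> \<le> c9 * (rpow (f x v \<xi>) (1 - 1 / ps - \<epsilon>) + rpow \<bar>v\<bar> (ps - 1 - \<epsilon>)) + b3 x"
              then show ?thesis
              proof eventually_elim
                case (elim x)
                show ?case
                proof
                  assume w: "\<sigma> * u x > k"
                  have sg: "\<bar>u x\<bar> = \<sigma> * u x" using \<sigma> w k' by auto
                  have "\<bar>b x (u x) (?D x)\<bar> \<le> c9 * (rpow (f x (u x) (?D x)) \<theta>1 + rpow \<bar>u x\<bar> e3) + b3 x"
                    using elim unfolding \<theta>1_def e3_def by blast
                  then have "\<bar>b x (u x) (?D x)\<bar> \<le> c9 * (rpow (f x (u x) (?D x)) \<theta>1 + (\<sigma> * u x) powr e3) + b3 x"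
                    unfolding sg using w k' by (simp add: rpow_pos)
                  moreover have "- \<bar>b x (u x) (?D x)\<bar> \<le> \<sigma> * b x (u x) (?D x)" using \<sigma> by auto
                  moreover have "c9 * (rpow (f x (u x) (?D x)) \<theta>1 + (\<sigma> * u x) powr e3) \<le> c9 * (rpow (f x (u x) (?D x)) \<theta>1 + rpow (norm (?D x)) (p * \<theta>2) + (\<sigma> * u x) powr e3)"
                    using as(16) by (intro mult_left_mono) (auto simp: rpow_nonneg)
                  ultimately have "- c9 * (rpow (f x (u x) (?D x)) \<theta>1 + rpow (norm (?D x)) (p * \<theta>2) + (\<sigma> * u x) powr e3) - b3 x \<le> \<sigma> * b x (u x) (?D x)" by linarith
                  then show "- \<kappa> * (rpow (f x (u x) (?D x)) \<theta>1 + rpow (norm (?D x)) (p * \<theta>2) + (\<sigma> * u x) powr e3) - \<bar>b3 x\<bar> \<le> \<sigma> * b x (u x) (?D x)"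
                    by (rule comm[OF _ \<kappa>(3)]) (simp add: rpow_nonneg)
                qed
              qed
            qed
          qed
          have A: "AE x in ?M. \<forall>v \<xi>. a x v \<xi> \<bullet> \<xi> \<ge> c1 * (D_xi f x v \<xi> \<bullet> \<xi>) - c2 * rpow \<bar>v\<bar> (ps - \<epsilon>1) - b1 x \<and>
             a x v \<xi> \<bullet> \<xi> \<le> c3 * (D_xi f x v \<xi> \<bullet> \<xi>) + c4 * rpow \<bar>v\<bar> ps + b2 x" by fact
          show ?thesis
            using A B low grow sp
          proof eventually_elim
            case (elim x)
            show ?case
            proof
              assume w: "\<sigma> * u x > k"
              have sg: "\<bar>u x\<bar> = \<sigma> * u x" using \<sigma> w k' by auto
              have "c1 * f x (u x) (?D x) \<le> c1 * (D_xi f x (u x) (?D x) \<bullet> ?D x)" using elim(3) as(8) by (intro mult_left_mono) auto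
              moreover have "c1 * (D_xi f x (u x) (?D x) \<bullet> ?D x) - c2 * rpow \<bar>u x\<bar> (ps - \<epsilon>1) - b1 x \<le> a x (u x) (?D x) \<bullet> ?D x" using elim(1) by blast
              moreover have "rpow \<bar>u x\<bar> (ps - \<epsilon>1) = (\<sigma> * u x) powr r" unfolding sg r_def using w k' by (simp add: rpow_pos)
              moreover have "b1 x \<le> \<bar>b1 x\<bar>" by simp
              ultimately have A': "c1 * f x (u x) (?D x) - c2 * (\<sigma> * u x) powr r - \<bar>b1 x\<bar> \<le> a x (u x) (?D x) \<bullet> ?D x" by simp
              have B': "- \<kappa> * (rpow (f x (u x) (?D x)) \<theta>1 + rpow (norm (?D x)) (p * \<theta>2) + (\<sigma> * u x) powr e3) - \<bar>b3 x\<bar> \<le> \<sigma> * b x (u x) (?D x)"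
                using elim(2) w by blast
              show "(c1 / 2) * f x (u x) (?D x) - C * ((\<sigma> * u x) powr \<tau> + h x * (\<sigma> * u x))
                 \<le> a x (u x) (?D x) \<bullet> ?D x + (\<sigma> * b x (u x) (?D x)) * (\<sigma> * u x - k)"
                unfolding h_def
                by (rule PW[OF _ norm_ge_zero _ _ _ _ abs_ge_zero abs_ge_zero A' B']) (use 1(1) elim(4,5) w k' in auto)
            qed
          qed
        qed
        have "Lp_int p \<Omega> (\<lambda>x. of_bool (\<sigma> * u x > k) *\<^sub>R ?D x) \<le> ennreal (C2 * X)"
          unfolding C2_def
          by (rule caccioppoli[OF as(2) 1(1) cf uF ws \<sigma> adm as(8) C _ _ PT as(12) grow X b])
            (use k' in \<open>auto simp: h_def intro!: add_nonneg_nonneg mult_nonneg_nonneg\<close>)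
        from SOB[OF _ adm(2) _ this] have "Lp_int q \<Omega> (\<lambda>x. \<sigma> * max (\<sigma> * u x - k) 0) \<le> ennreal (Cs * (C2 * X) powr (q / p))"
          using adm(1) C2 X by (simp add: W1F_0_def)
        also have "Cs * (C2 * X) powr (q / p) = C3 * X powr (q / p)" using C2 X by (simp add: C3_def powr_mult)
        also have "Lp_int q \<Omega> (\<lambda>x. \<sigma> * max (\<sigma> * u x - k) 0) = (\<integral>\<^sup>+x. ennreal ((max (\<sigma> * u x - k) 0) powr q) \<partial>?M)"
          unfolding Lp_int_def by (rule nn_integral_cong) (use \<sigma> in auto)
        finally show ?thesis .
      qed
      have bound: "AE x in ?M. \<bar>u x\<bar> \<le> c * (1 + K) * (1 + Y) powr \<gamma>" if Y: "0 \<le> Y" "Lp_int q \<Omega> u \<le> ennreal Y" for Y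
      proof -
        have "AE x in ?M. \<sigma> * u x \<le> c * (1 + K) * (1 + Y) powr \<gamma>" if \<sigma>: "\<sigma> = 1 \<or> \<sigma> = -1" for \<sigma>
        proof (rule DG[OF _ mh _ _ Y(1) hs])
          show "(\<lambda>x. \<sigma> * u x) \<in> borel_measurable ?M" by measurable
          show "0 \<le> h x" for x by (simp add: h_def)
          show "1 \<le> 1 + K" using K(2) by simp
          show "(\<integral>\<^sup>+x. ennreal (\<bar>\<sigma> * u x\<bar> powr q) \<partial>?M) \<le> ennreal Y" using Y(2) \<sigma> by (auto simp: Lp_int_def abs_mult)
          show "(\<integral>\<^sup>+x. ennreal ((max (\<sigma> * u x - k) 0) powr q) \<partial>?M) \<le> ennreal (C3 * X powr (q / p))"
            if "1 + K \<le> k" "0 \<le> X" "(\<integral>\<^sup>+x. ennreal (of_bool (\<sigma> * u x > k) * ((\<sigma> * u x) powr \<tau> + h x * (\<sigma> * u x))) \<partial>?M) \<le> ennreal X" for k X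
            using step[OF \<sigma> that] .
        qed
        then have "AE x in ?M. 1 * u x \<le> c * (1 + K) * (1 + Y) powr \<gamma>" "AE x in ?M. - 1 * u x \<le> c * (1 + K) * (1 + Y) powr \<gamma>"
          by blast+
        then show ?thesis by eventually_elim (simp add: abs_le_iff)
      qed
      have q0: "q > 0" using pq p1 by simp
      have uq: "Lp_int q \<Omega> u < \<infinity>"
      proof -
        let ?w = "\<lambda>x. u x - u0 x"
        have w0: "?w \<in> W1p_0 p \<Omega>" using du by (simp add: W1F_0_def)
        then have wW: "?w \<in> W1p p \<Omega>" by (simp add: W1p_0_def)
        note wgw = W1p_weak_grad[OF wW as(2)]
        have "Lp_int q \<Omega> ?w \<le> ennreal (Cs * (Lp_norm p \<Omega> (weak_grad \<Omega> ?w) powr p) powr (q / p))"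
          by (rule SOB[OF w0 wgw(1)]) (use Lp_int_eq_norm[OF wgw(2) p1(2)] in auto)
        then have "Lp_int q \<Omega> ?w < \<infinity>" by (rule le_less_trans) simp
        then have "?w \<in> Lp_space q \<Omega>" using mu K(3) by (simp add: Lp_space_iff)
        moreover have "u0 \<in> Lp_space q \<Omega>"
          by (rule Lp_space_bounded[OF as(2,3) K(3) _ less_imp_le[OF q0], of K]) (use K(1) in simp)
        ultimately have "(\<lambda>x. ?w x + u0 x) \<in> Lp_space q \<Omega>" using q0 by (intro Lp_space_add) auto
        then show ?thesis by (simp add: Lp_space_iff)
      qed
      then obtain Y0 where Y0: "0 \<le> Y0" "Lp_int q \<Omega> u = ennreal Y0" by (cases "Lp_int q \<Omega> u") auto
      have uL: "u \<in> Lp_space ps \<Omega>"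
        by (rule Lp_space_bounded[OF as(2,3) mu _ less_imp_le[OF ps0(1)]]) (use bound[of Y0] Y0 in simp)
      define N where "N = Lp_norm ps \<Omega> u"
      have N: "N \<ge> 0" unfolding N_def by (rule Lp_norm_nonneg)
      have "Lp_int q \<Omega> u \<le> ennreal (V + N powr ps)"
        unfolding V_def N_def by (rule Lp_int_le_of_larger_exponent[OF as(2,3) uL]) (use q q0 ps0 in auto)
      from bound[OF _ this] have B1: "AE x in ?M. \<bar>u x\<bar> \<le> c * (1 + K) * (1 + (V + N powr ps)) powr \<gamma>" using V by simp
      have le: "c * (1 + K) * (1 + (V + N powr ps)) powr \<gamma> \<le> c' * (1 + K) * (1 + N) powr \<gamma>'"
      proof -
        have "N powr ps \<le> (1 + N) powr ps" "1 \<le> (1 + N) powr ps"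
          using N ps0 by (auto intro: powr_mono2 ge_one_powr_ge_zero)
        then have "1 + (V + N powr ps) \<le> 2 * (1 + V) * (1 + N) powr ps"
          using V mult_left_mono[of 1 "(1 + N) powr ps" V] by (simp add: algebra_simps)
        then have "(1 + (V + N powr ps)) powr \<gamma> \<le> (2 * (1 + V) * (1 + N) powr ps) powr \<gamma>"
          using V \<gamma> by (intro powr_mono2) auto
        also have "\<dots> = (2 * (1 + V)) powr \<gamma> * (1 + N) powr (ps * \<gamma>)" using V N by (simp add: powr_mult powr_powr)
        also have "\<dots> \<le> (2 * (1 + V)) powr \<gamma> * (1 + N) powr \<gamma>'" using N by (intro mult_left_mono powr_mono) (auto simp: \<gamma>'_def)
        finally have "c * (1 + K) * (1 + (V + N powr ps)) powr \<gamma> \<le> c * (1 + K) * ((2 * (1 + V)) powr \<gamma> * (1 + N) powr \<gamma>')"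
          using c K(2) by (intro mult_left_mono) auto
        then show ?thesis by (simp add: c'_def mult_ac)
      qed
      have B2: "AE x in ?M. \<bar>u x\<bar> \<le> c' * (1 + K) * (1 + N) powr \<gamma>'"
        using B1 by (rule eventually_mono) (use le in linarith)
      have B0: "0 \<le> c' * (1 + K) * (1 + N) powr \<gamma>'" using c K(2) by (simp add: c'_def)
      show ?case
        using Linf_spaceI[OF mu B2 B0] unfolding K_def N_def by blast
    qed
  qed
qed

end
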